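(* Let $\mathcal T$ be a gaussian quantum Markov semigroup on $\mathcal B(\Gamma(\mathbb C^d))$ with $\zeta=0$ and with a faithful invariant state $\rho$, and suppose that it has a spectral gap $g>0$ (for the GNS embedding determined by $\rho$). Then $Z$ is stable and $\mathbf{C_Z}>0$.
   Context: Scalar products are linear in the second argument. $\mathsf h=\Gamma(\mathbb C^d)$ is the boson Fock space with canonical orthonormal basis $e(n_1,\dots,n_d)$, $n_j\ge 0$, whose linear span is $D$; $a_j,a_j^\dagger$ are the usual annihilation and creation operators ($[a_j,a_k^\dagger]=\delta_{jk}$). Weyl operators: $W(z)=\exp\big(\sum_j(z_ja_j^\dagger-\overline{z_j}a_j)\big)$, $z\in\mathbb C^d$, unitary, with $W(z)W(z')=e^{-\mathrm i\Im\langle z,z'\rangle}W(z+z')$. Gaussian QMS. Let $1\le m\le 2d$, $\Omega=\Omega^*$, $\kappa=\kappa^T\in M_d(\mathbb C)$, $U=(u_{\ell k}),V=(v_{\ell k})\in M_{m\times d}(\mathbb C)$ with $\ker V^*\cap\ker U^T=\{0\}$, $\zeta\in\mathbb C^d$. On $D$ put $H=\sum_{j,k}(\Omega_{jk}a_j^\dagger a_k+\frac{\kappa_{jk}}2a_j^\dagger a_k^\dagger+\frac{\overline{\kappa_{jk}}}2a_ja_k)+\sum_j(\frac{\zeta_j}2a_j^\dagger+\frac{\overline{\zeta_j}}2a_j)$ and $L_\ell=\sum_k(\overline{v_{\ell k}}a_k+u_{\ell k}a_k^\dagger)$, $1\le\ell\le m$. The gaussian QMS $\mathcal T=(\mathcal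 T_t)_{t\ge0}$ is the unique weak$^*$-continuous semigroup of completely positive, identity preserving, weak$^*$-continuous maps on $\mathcal B(\mathsf h)$ such that for all $x\in\mathcal B(\mathsf h)$, $\xi,\xi'\in D$ the function $t\mapsto\langle\xi',\mathcal T_t(x)\xi\rangle$ is differentiable with derivative $\mathcal L(\mathcal T_t(x))[\xi',\xi]$, where $\mathcal L(x)[\xi',\xi]=\mathrm i\langle H\xi',x\xi\rangle-\mathrm i\langle\xi',xH\xi\rangle-\frac12\sum_{\ell}(\langle\xi',xL_\ell^*L_\ell\xi\rangle-2\langle L_\ell\xi',xL_\ell\xi\rangle+\langle L_\ell^*L_\ell\xi',x\xi\rangle)$. It satisfies $\mathcal T_t(W(z))=\exp\big(-\frac12\int_0^t\Re\langle e^{sZ}z,Ce^{sZ}z\rangle ds+\mathrm i\int_0^t\Re\langle\zeta,e^{sZ}z\rangle ds\big)W(e^{tZ}z)$, where $Z,C$ are the real linear operators on $\mathbb C^d$: $Zz=[(U^T\overline U-V^T\overline V)/2+\mathrm i\Omega]z+[(U^TV-V^TU)/2+\mathrm i\kappa]\overline z$, $Cz=(U^T\overline U+V^T\overline V)z+(U^TV+V^TU)\overline z$. Complexification. For a real linear operator $Az=A_1z+A_2\overline z$ on $\mathbb C^d$, $\mathbf A=\begin{bmatrix}\Re A_1+\Re A_2&\Im A_2-\Im A_1\\ \Im A_1+\Im A_2&\Re A_1-\Re A_2\end{bmatrix}$ acting on $\mathbb C^{2d}$. $\mathbf J=\begin{bmatrix}0&\mathbb 1\\-\mathbb 1&0\end{bmatrix}$.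 $\mathbf{C_Z}=\mathbf C-\mathrm i(\mathbf Z^*\mathbf J+\mathbf J\mathbf Z)$. $Z$ is stable if all eigenvalues of $\mathbf Z$ have strictly negative real part. A state is a positive trace-one operator; it is faithful if it has trivial kernel, and invariant if $\operatorname{tr}(\rho\mathcal T_t(x))=\operatorname{tr}(\rho x)$ for all $t\ge0$, $x\in\mathcal B(\mathsf h)$. Spectral gap (GNS embedding). $\mathfrak I_2(\mathsf h)$ is the space of Hilbert–Schmidt operators with $\langle x,y\rangle_2=\operatorname{tr}(x^*y)$ and norm $\|\cdot\|_2$. $(T_t)_{t\ge0}$ is the strongly continuous contraction semigroup on $\mathfrak I_2(\mathsf h)$ extending $T_t(x\rho^{1/2})=\mathcal T_t(x)\rho^{1/2}$, $x\in\mathcal B(\mathsf h)$. The semigroup has a spectral gap if there is $g>0$ such that $\|T_t(x)-\langle\rho^{1/2},x\rangle_2\rho^{1/2}\|_2\le e^{-gt}\|x-\langle\rho^{1/2},x\rangle_2\rho^{1/2}\|_2$ for all $x\in\mathfrak I_2(\mathsf h)$, $t>0$; the spectral gap is then the biggest such $g$. *)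

theory Defs
  imports "HOL-Analysis.Analysis" "HOL-Library.Nonpos_Ints"
begin

text \<open>
  The Fock space over \<open>\<complex>\<^sup>d\<close> is identified with \<open>\<ell>\<^sup>2\<close> over the occupation numbers
  \<open>n :: 'd \<Rightarrow> nat\<close>, where \<open>CARD('d) = d\<close>, through the canonical orthonormal basis.
\<close>

lemma square_summable_add:
  fixes f g :: "'a \<Rightarrow> complex"
  assumes f: "(\<lambda>n. (cmod (f n))\<^sup>2) summable_on A" and g: "(\<lambda>n. (cmod (g n))\<^sup>2) summable_on A"
  shows "(\<lambda>n. (cmod (f n + g n))\<^sup>2) summable_on A"
proof (rule summable_on_comparison_test)
  show "(\<lambda>n. 2 * (cmod (f n))\<^sup>2 + 2 * (cmod (g n))\<^sup>2) summable_on A"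
    by (intro summable_on_add summable_on_cmult_right f g)
  fix n
  have "(cmod (f n + g n))\<^sup>2 \<le> (cmod (f n) + cmod (g n))\<^sup>2"
    by (intro power_mono norm_triangle_ineq) auto
  also have "\<dots> \<le> 2 * (cmod (f n))\<^sup>2 + 2 * (cmod (g n))\<^sup>2"
    using sum_squares_bound[of "cmod (f n)" "cmod (g n)"] by (simp add: power2_sum)
  finally show "(cmod (f n + g n))\<^sup>2 \<le> 2 * (cmod (f n))\<^sup>2 + 2 * (cmod (g n))\<^sup>2" .
qed auto

lemma square_summable_mult:
  fixes f :: "'a \<Rightarrow> complex"
  assumes "(\<lambda>n. (cmod (f n))\<^sup>2) summable_on A"
  shows "(\<lambda>n. (cmod (c * f n))\<^sup>2) summable_on A"
  using summable_on_cmult_right[OF assms, of "(cmod c)\<^sup>2"]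
  by (simp add: norm_mult power_mult_distrib)

lemma square_summable_inner:
  fixes f g :: "'a \<Rightarrow> complex"
  assumes f: "(\<lambda>n. (cmod (f n))\<^sup>2) summable_on A" and g: "(\<lambda>n. (cmod (g n))\<^sup>2) summable_on A"
  shows "(\<lambda>n. cnj (f n) * g n) summable_on A"
proof -
  have "(\<lambda>n. norm (cnj (f n) * g n)) summable_on A"
  proof (rule summable_on_comparison_test)
    show "(\<lambda>n. (cmod (f n))\<^sup>2 + (cmod (g n))\<^sup>2) summable_on A"
      by (intro summable_on_add f g)
    fix n
    show "norm (cnj (f n) * g n) \<le> (cmod (f n))\<^sup>2 + (cmod (g n))\<^sup>2"
      using sum_squares_bound[of "cmod (f n)" "cmod (g n)"]
        mult_nonneg_nonneg[OF norm_ge_zero[of "f n"] norm_ge_zero[of "g n"]]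
      unfolding norm_mult complex_mod_cnj by linarith
  qed auto
  then show ?thesis
    by (rule abs_summable_summable)
qed

typedef ('d :: finite) fock =
  "{f :: ('d \<Rightarrow> nat) \<Rightarrow> complex. (\<lambda>n. (cmod (f n))\<^sup>2) summable_on UNIV}"
  morphisms fock_coeff Abs_fock
  by (rule exI[of _ "\<lambda>_. 0"]) simp

setup_lifting type_definition_fock

lift_definition scaleC :: "complex \<Rightarrow> 'd::finite fock \<Rightarrow> 'd fock"  (infixr "*\<^sub>C" 75)
  is "\<lambda>c f n. c * f n"
  by (rule square_summable_mult)

definition cinner :: "'d::finite fock \<Rightarrow> 'd fock \<Rightarrow> complex"
  where "cinner \<xi> \<eta> = (\<Sum>\<^sub>\<infinity>n. cnj (fock_coeff \<xi> n) * fock_coeff \<eta> n)"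

instantiation fock :: (finite) real_vector
begin

lift_definition zero_fock :: "'a fock" is "\<lambda>_. 0" by simp

lift_definition plus_fock :: "'a fock \<Rightarrow> 'a fock \<Rightarrow> 'a fock" is "\<lambda>f g n. f n + g n"
  by (rule square_summable_add)

lift_definition uminus_fock :: "'a fock \<Rightarrow> 'a fock" is "\<lambda>f n. - f n" by simp

definition minus_fock :: "'a fock \<Rightarrow> 'a fock \<Rightarrow> 'a fock"
  where "minus_fock \<xi> \<eta> = \<xi> + (- \<eta>)"

definition scaleR_fock :: "real \<Rightarrow> 'a fock \<Rightarrow> 'a fock"
  where "scaleR_fock r \<xi> = complex_of_real r *\<^sub>C \<xi>"

instance
proof
  fix \<xi> \<eta> \<theta> :: "'a fock" and r s :: real
  show "\<xi> + \<eta> + \<theta> = \<xi> + (\<eta> + \<theta>)" by transfer (simp add: add.assoc)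
  show "\<xi> + \<eta> = \<eta> + \<xi>" by transfer (simp add: add.commute)
  show "0 + \<xi> = \<xi>" by transfer simp
  show "- \<xi> + \<xi> = 0" by transfer simp
  show "\<xi> - \<eta> = \<xi> + - \<eta>" by (rule minus_fock_def)
  show "r *\<^sub>R (\<xi> + \<eta>) = r *\<^sub>R \<xi> + r *\<^sub>R \<eta>"
    unfolding scaleR_fock_def by transfer (simp add: algebra_simps)
  show "(r + s) *\<^sub>R \<xi> = r *\<^sub>R \<xi> + s *\<^sub>R \<xi>"
    unfolding scaleR_fock_def by transfer (simp add: algebra_simps)
  show "r *\<^sub>R s *\<^sub>R \<xi> = (r * s) *\<^sub>R \<xi>"
    unfolding scaleR_fock_def by transfer (simp add: algebra_simps)
  show "1 *\<^sub>R \<xi> = \<xi>"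
    unfolding scaleR_fock_def by transfer simp
qed

end

instantiation fock :: (finite) real_inner
begin

definition inner_fock :: "'a fock \<Rightarrow> 'a fock \<Rightarrow> real"
  where "inner_fock \<xi> \<eta> = Re (cinner \<xi> \<eta>)"

definition norm_fock :: "'a fock \<Rightarrow> real"
  where "norm_fock \<xi> = sqrt (inner \<xi> \<xi>)"

definition dist_fock :: "'a fock \<Rightarrow> 'a fock \<Rightarrow> real"
  where "dist_fock \<xi> \<eta> = norm (\<xi> - \<eta>)"

definition sgn_fock :: "'a fock \<Rightarrow> 'a fock"
  where "sgn_fock \<xi> = \<xi> /\<^sub>R norm \<xi>"

definition uniformity_fock :: "('a fock \<times> 'a fock) filter"
  where "uniformity_fock = (INF e\<in>{0 <..}. principal {(\<xi>, \<eta>). dist \<xi> \<eta> < e})"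

definition open_fock :: "'a fock set \<Rightarrow> bool"
  where "open_fock S \<longleftrightarrow> (\<forall>\<xi>\<in>S. \<forall>\<^sub>F (\<xi>', \<eta>) in uniformity. \<xi>' = \<xi> \<longrightarrow> \<eta> \<in> S)"

instance
proof
  fix \<xi> \<eta> \<theta> :: "'a fock" and r :: real
  have ss: "(\<lambda>n. (cmod (fock_coeff x n))\<^sup>2) summable_on UNIV" for x :: "'a fock"
    using fock_coeff[of x] by simp
  have summ: "(\<lambda>n. cnj (fock_coeff x n) * fock_coeff y n) summable_on UNIV" for x y :: "'a fock"
    by (rule square_summable_inner[OF ss ss])
  show "dist \<xi> \<eta> = norm (\<xi> - \<eta>)" by (rule dist_fock_def)
  show "sgn \<xi> = \<xi> /\<^sub>R norm \<xi>" by (rule sgn_fock_def)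
  show "(uniformity :: ('a fock \<times> 'a fock) filter)
      = (INF e\<in>{0 <..}. principal {(\<xi>, \<eta>). dist \<xi> \<eta> < e})" by (rule uniformity_fock_def)
  show "open S \<longleftrightarrow> (\<forall>\<xi>\<in>S. \<forall>\<^sub>F (\<xi>', \<eta>) in uniformity. \<xi>' = \<xi> \<longrightarrow> \<eta> \<in> S)"
    for S :: "'a fock set" by (rule open_fock_def)
  have "cinner \<xi> \<eta> = cnj (cinner \<eta> \<xi>)"
    unfolding cinner_def infsum_cnj[symmetric] by (simp add: mult.commute)
  then show "inner \<xi> \<eta> = inner \<eta> \<xi>" by (simp add: inner_fock_def)
  have "cinner (\<xi> + \<eta>) \<theta> = cinner \<xi> \<theta> + cinner \<eta> \<theta>"
    unfolding cinner_def plus_fock.rep_eq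
    by (simp add: distrib_right infsum_add[OF summ summ])
  then show "inner (\<xi> + \<eta>) \<theta> = inner \<xi> \<theta> + inner \<eta> \<theta>" by (simp add: inner_fock_def)
  have "cinner (r *\<^sub>R \<xi>) \<eta> = r * cinner \<xi> \<eta>"
    unfolding cinner_def scaleR_fock_def scaleC.rep_eq
    by (simp add: mult.assoc infsum_cmult_right')
  then show "inner (r *\<^sub>R \<xi>) \<eta> = r * inner \<xi> \<eta>" by (simp add: inner_fock_def)
  have inner_self: "inner x x = (\<Sum>\<^sub>\<infinity>n. (cmod (fock_coeff x n))\<^sup>2)" for x :: "'a fock"
    unfolding inner_fock_def cinner_def infsum_Re[OF summ, symmetric]
    by (rule infsum_cong) (simp add: cmod_power2, simp add: power2_eq_square)
  show "0 \<le> inner \<xi> \<xi>"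
    unfolding inner_self by (rule infsum_nonneg) simp
  show "inner \<xi> \<xi> = 0 \<longleftrightarrow> \<xi> = 0"
  proof
    assume "inner \<xi> \<xi> = 0"
    then have "(cmod (fock_coeff \<xi> n))\<^sup>2 = 0" for n
      unfolding inner_self by (intro nonneg_infsum_le_0D[where A = UNIV, OF _ ss]) auto
    then show "\<xi> = 0"
      by transfer (auto simp: fun_eq_iff)
  next
    assume "\<xi> = 0"
    then show "inner \<xi> \<xi> = 0"
      unfolding inner_self by (simp add: zero_fock.rep_eq)
  qed
  show "norm \<xi> = sqrt (inner \<xi> \<xi>)" by (rule norm_fock_def)
qed

end

lift_definition fock_e :: "('d::finite \<Rightarrow> nat) \<Rightarrow> 'd fock"
  is "\<lambda>n k. if k = n then 1 else 0"
proof -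
  fix n :: "'d \<Rightarrow> nat"
  show "(\<lambda>k. (cmod (if k = n then 1 else 0))\<^sup>2) summable_on UNIV"
    by (rule finite_nonzero_values_imp_summable_on) simp
qed

definition fock_D :: "'d::finite fock set"
  where "fock_D = {\<Sum>n\<in>F. c n *\<^sub>C fock_e n | F c. finite F}"

text \<open>
  On \<open>fock_D\<close> these are the linear extensions of \<open>a\<^sub>j e(n) = \<surd>n\<^sub>j e(n - \<epsilon>\<^sub>j)\<close> and
  \<open>a\<^sub>j\<^sup>\<dagger> e(n) = \<surd>(n\<^sub>j + 1) e(n + \<epsilon>\<^sub>j)\<close>, where \<open>\<epsilon>\<^sub>j\<close> is the multi-index with a single
  1 at position \<open>j\<close>. They are only used on \<open>fock_D\<close>; outside \<open>fock_D\<close> the index set of the sum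
  is infinite and the value is 0.
\<close>

definition annih :: "'d::finite \<Rightarrow> 'd fock \<Rightarrow> 'd fock"
  where "annih j \<xi> = (\<Sum>n | fock_coeff \<xi> n \<noteq> 0. (fock_coeff \<xi> n * sqrt (n j)) *\<^sub>C fock_e (n(j := n j - 1)))"

definition creat :: "'d::finite \<Rightarrow> 'd fock \<Rightarrow> 'd fock"
  where "creat j \<xi> = (\<Sum>n | fock_coeff \<xi> n \<noteq> 0. (fock_coeff \<xi> n * sqrt (n j + 1)) *\<^sub>C fock_e (n(j := n j + 1)))"

definition hamiltonian ::
  "complex^'d^'d \<Rightarrow> complex^'d^'d \<Rightarrow> complex^'d \<Rightarrow> 'd::finite fock \<Rightarrow> 'd fock"
  where "hamiltonian \<Omega> \<kappa> \<zeta> \<xi> =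
    (\<Sum>j\<in>UNIV. \<Sum>k\<in>UNIV.
        (\<Omega> $ j $ k) *\<^sub>C creat j (annih k \<xi>)
      + (\<kappa> $ j $ k / 2) *\<^sub>C creat j (creat k \<xi>)
      + (cnj (\<kappa> $ j $ k) / 2) *\<^sub>C annih j (annih k \<xi>))
    + (\<Sum>j\<in>UNIV. (\<zeta> $ j / 2) *\<^sub>C creat j \<xi> + (cnj (\<zeta> $ j) / 2) *\<^sub>C annih j \<xi>)"

definition kraus ::
  "complex^'d^'m \<Rightarrow> complex^'d^'m \<Rightarrow> 'm::finite \<Rightarrow> 'd::finite fock \<Rightarrow> 'd fock"
  where "kraus U V l \<xi> =
    (\<Sum>k\<in>UNIV. cnj (V $ l $ k) *\<^sub>C annih k \<xi> + (U $ l $ k) *\<^sub>C creat k \<xi>)"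

text \<open>The Hilbert space adjoint, on its domain, of an operator with dense domain \<open>fock_D\<close>.\<close>

definition adjoint_on_D :: "('d::finite fock \<Rightarrow> 'd fock) \<Rightarrow> 'd fock \<Rightarrow> 'd fock"
  where "adjoint_on_D A \<eta> = (THE \<phi>. \<forall>\<xi>\<in>fock_D. cinner \<phi> \<xi> = cinner \<eta> (A \<xi>))"

text \<open>
  The library type of bounded real linear maps, cut down to the complex linear ones.
\<close>

type_synonym 'd op = "'d fock \<Rightarrow>\<^sub>L 'd fock"

definition BH :: "'d::finite op set"
  where "BH = {x :: 'd op. \<forall>c \<xi>. x (c *\<^sub>C \<xi>) = c *\<^sub>C x \<xi>}"

definition scaleC_op :: "complex \<Rightarrow> 'd::finite op \<Rightarrow> 'd op"
  where "scaleC_op c x = Blinfun (\<lambda>\<xi>. c *\<^sub>C x \<xi>)"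

definition adj :: "'d::finite op \<Rightarrow> 'd op"
  where "adj x = (THE y. y \<in> BH \<and> (\<forall>\<xi> \<eta>. cinner (y \<xi>) \<eta> = cinner \<xi> (x \<eta>)))"

definition positive_op :: "'d::finite op \<Rightarrow> bool"
  where "positive_op x \<longleftrightarrow> x \<in> BH \<and> (\<forall>\<xi>. cinner \<xi> (x \<xi>) \<in> \<real>\<^sub>\<ge>\<^sub>0)"

definition sqrt_op :: "'d::finite op \<Rightarrow> 'd op"
  where "sqrt_op x = (THE y. positive_op y \<and> y o\<^sub>L y = x)"

definition tr :: "'d::finite op \<Rightarrow> complex"
  where "tr x = (\<Sum>\<^sub>\<infinity>n. cinner (fock_e n) (x (fock_e n)))"

definition trace_class :: "'d::finite op set"
  where "trace_class =
    {x \<in> BH. (\<lambda>n. cinner (fock_e n) (sqrt_op (adj x o\<^sub>L x) (fock_e n))) summable_on UNIV}"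

text \<open>
  The weak* topology that \<open>\<B>(h)\<close> carries as the dual of the trace class operators: the
  coarsest one making all functionals \<open>x \<mapsto> tr (a x)\<close> with \<open>a\<close> trace class continuous.
\<close>

definition weak_star :: "'d::finite op topology"
  where "weak_star = pullback_topology BH (\<lambda>x. \<lambda>a\<in>trace_class. tr (a o\<^sub>L x))
    (product_topology (\<lambda>_. euclidean) trace_class)"

definition linear_on_ops :: "'d::finite op set \<Rightarrow> ('d op \<Rightarrow> 'd op) \<Rightarrow> bool"
  where "linear_on_ops X \<Phi> \<longleftrightarrow> \<Phi> ` X \<subseteq> X
    \<and> (\<forall>x\<in>X. \<forall>y\<in>X. \<Phi> (x + y) = \<Phi> x + \<Phi> y)
    \<and> (\<forall>c. \<forall>x\<in>X. \<Phi> (scaleC_op c x) = scaleC_op c (\<Phi> x))"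

text \<open>Positivity of an operator matrix on the direct sum of \<open>N\<close> copies of the Fock space.\<close>

definition positive_matrix :: "nat \<Rightarrow> (nat \<Rightarrow> nat \<Rightarrow> 'd::finite op) \<Rightarrow> bool"
  where "positive_matrix N X \<longleftrightarrow> (\<forall>i<N. \<forall>j<N. X i j \<in> BH)
    \<and> (\<forall>\<xi>. (\<Sum>i<N. \<Sum>j<N. cinner (\<xi> i) (X i j (\<xi> j))) \<in> \<real>\<^sub>\<ge>\<^sub>0)"

definition completely_positive :: "('d::finite op \<Rightarrow> 'd op) \<Rightarrow> bool"
  where "completely_positive \<Phi> \<longleftrightarrow>
    (\<forall>N X. positive_matrix N X \<longrightarrow> positive_matrix N (\<lambda>i j. \<Phi> (X i j)))"

definition weak_star_semigroup :: "(real \<Rightarrow> 'd::finite op \<Rightarrow> 'd op) \<Rightarrow> bool"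
  where "weak_star_semigroup T \<longleftrightarrow>
    (\<forall>x\<in>BH. T 0 x = x)
    \<and> (\<forall>s\<ge>0. \<forall>t\<ge>0. \<forall>x\<in>BH. T (s + t) x = T s (T t x))
    \<and> (\<forall>x\<in>BH. continuous_map (top_of_set {0..}) weak_star (\<lambda>t. T t x))"

definition quantum_markov_semigroup :: "(real \<Rightarrow> 'd::finite op \<Rightarrow> 'd op) \<Rightarrow> bool"
  where "quantum_markov_semigroup T \<longleftrightarrow> weak_star_semigroup T
    \<and> (\<forall>t\<ge>0. linear_on_ops BH (T t) \<and> completely_positive (T t)
        \<and> T t id_blinfun = id_blinfun \<and> continuous_map weak_star weak_star (T t))"

definition generator_form ::
  "complex^'d^'d \<Rightarrow> complex^'d^'d \<Rightarrow> complex^'d^'m \<Rightarrow> complex^'d^'m \<Rightarrow> complex^'d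
    \<Rightarrow> 'd::finite op \<Rightarrow> 'd fock \<Rightarrow> 'd fock \<Rightarrow> complex"
  where "generator_form \<Omega> \<kappa> U V \<zeta> x \<xi>' \<xi> =
    (let H = hamiltonian \<Omega> \<kappa> \<zeta>; L = kraus U V; Ls = (\<lambda>l. adjoint_on_D (L l)) in
      \<i> * cinner (H \<xi>') (x \<xi>) - \<i> * cinner \<xi>' (x (H \<xi>))
      - 1/2 * (\<Sum>l\<in>UNIV. cinner \<xi>' (x (Ls l (L l \<xi>))) - 2 * cinner (L l \<xi>') (x (L l \<xi>))
                 + cinner (Ls l (L l \<xi>')) (x \<xi>)))"

text \<open>
  For \<open>\<Omega>\<close> self-adjoint and \<open>\<kappa>\<close> symmetric there is exactly one such \<open>T\<close>, up to its
  irrelevant values at negative times and outside \<open>BH\<close>.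
\<close>

definition gaussian_qms ::
  "complex^'d^'d \<Rightarrow> complex^'d^'d \<Rightarrow> complex^'d^'m \<Rightarrow> complex^'d^'m \<Rightarrow> complex^'d
    \<Rightarrow> (real \<Rightarrow> 'd::finite op \<Rightarrow> 'd op) \<Rightarrow> bool"
  where "gaussian_qms \<Omega> \<kappa> U V \<zeta> T \<longleftrightarrow> quantum_markov_semigroup T
    \<and> (\<forall>x\<in>BH. \<forall>\<xi>'\<in>fock_D. \<forall>\<xi>\<in>fock_D. \<forall>t\<ge>0.
        ((\<lambda>s. cinner \<xi>' (T s x \<xi>)) has_vector_derivative
            generator_form \<Omega> \<kappa> U V \<zeta> (T t x) \<xi>' \<xi>) (at t within {0..}))"

definition state :: "'d::finite op \<Rightarrow> bool"
  where "state \<rho> \<longleftrightarrow> positive_op \<rho> \<and> \<rho> \<in> trace_class \<and> tr \<rho> = 1"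

definition faithful :: "'d::finite op \<Rightarrow> bool"
  where "faithful \<rho> \<longleftrightarrow> (\<forall>\<xi>. \<rho> \<xi> = 0 \<longrightarrow> \<xi> = 0)"

definition invariant_state :: "(real \<Rightarrow> 'd::finite op \<Rightarrow> 'd op) \<Rightarrow> 'd op \<Rightarrow> bool"
  where "invariant_state T \<rho> \<longleftrightarrow> state \<rho>
    \<and> (\<forall>t\<ge>0. \<forall>x\<in>BH. tr (\<rho> o\<^sub>L T t x) = tr (\<rho> o\<^sub>L x))"

definition hilbert_schmidt :: "'d::finite op set"
  where "hilbert_schmidt = {x \<in> BH. (\<lambda>n. (norm (x (fock_e n)))\<^sup>2) summable_on UNIV}"

definition hs_inner :: "'d::finite op \<Rightarrow> 'd op \<Rightarrow> complex"
  where "hs_inner x y = tr (adj x o\<^sub>L y)"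

definition hs_norm :: "'d::finite op \<Rightarrow> real"
  where "hs_norm x = sqrt (Re (hs_inner x x))"

definition gns_semigroup ::
  "(real \<Rightarrow> 'd::finite op \<Rightarrow> 'd op) \<Rightarrow> 'd op \<Rightarrow> (real \<Rightarrow> 'd op \<Rightarrow> 'd op) \<Rightarrow> bool"
  where "gns_semigroup T \<rho> S \<longleftrightarrow>
    (\<forall>t\<ge>0. linear_on_ops hilbert_schmidt (S t)
        \<and> (\<forall>x\<in>hilbert_schmidt. hs_norm (S t x) \<le> hs_norm x))
    \<and> (\<forall>x\<in>hilbert_schmidt. S 0 x = x)
    \<and> (\<forall>s\<ge>0. \<forall>t\<ge>0. \<forall>x\<in>hilbert_schmidt. S (s + t) x = S s (S t x))
    \<and> (\<forall>x\<in>hilbert_schmidt. \<forall>t\<ge>0. ((\<lambda>s. hs_norm (S s x - S t x)) \<longlongrightarrow> 0) (at t within {0..}))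
    \<and> (\<forall>t\<ge>0. \<forall>x\<in>BH. S t (x o\<^sub>L sqrt_op \<rho>) = T t x o\<^sub>L sqrt_op \<rho>)"

definition gap_inequality :: "'d::finite op \<Rightarrow> (real \<Rightarrow> 'd op \<Rightarrow> 'd op) \<Rightarrow> real \<Rightarrow> bool"
  where "gap_inequality \<rho> S g \<longleftrightarrow> (\<forall>x\<in>hilbert_schmidt. \<forall>t>0.
    hs_norm (S t x - scaleC_op (hs_inner (sqrt_op \<rho>) x) (sqrt_op \<rho>))
      \<le> exp (- g * t) * hs_norm (x - scaleC_op (hs_inner (sqrt_op \<rho>) x) (sqrt_op \<rho>)))"

definition has_spectral_gap :: "'d::finite op \<Rightarrow> (real \<Rightarrow> 'd op \<Rightarrow> 'd op) \<Rightarrow> bool"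
  where "has_spectral_gap \<rho> S \<longleftrightarrow> (\<exists>g>0. gap_inequality \<rho> S g)"

text \<open>
  A real linear operator \<open>z \<mapsto> A\<^sub>1 z + A\<^sub>2 cnj z\<close> on \<open>\<complex>\<^sup>d\<close> is represented by the pair of its
  (uniquely determined) matrices \<open>A\<^sub>1\<close>, \<open>A\<^sub>2\<close>.
\<close>

abbreviation cnj_mat :: "complex^'n^'m \<Rightarrow> complex^'n^'m"
  where "cnj_mat \<equiv> map_matrix cnj"

definition adj_mat :: "complex^'n^'m \<Rightarrow> complex^'m^'n"
  where "adj_mat A = cnj_mat (transpose A)"

definition scale_mat :: "complex \<Rightarrow> complex^'n^'m \<Rightarrow> complex^'n^'m"
  where "scale_mat c = map_matrix ((*) c)"

definition Z1 :: "complex^'d^'d \<Rightarrow> complex^'d^'m \<Rightarrow> complex^'d^'m \<Rightarrow> complex^'d^'d"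
  where "Z1 \<Omega> U V =
    scale_mat (1/2) (transpose U ** cnj_mat U - transpose V ** cnj_mat V) + scale_mat \<i> \<Omega>"

definition Z2 :: "complex^'d^'d \<Rightarrow> complex^'d^'m \<Rightarrow> complex^'d^'m \<Rightarrow> complex^'d^'d"
  where "Z2 \<kappa> U V =
    scale_mat (1/2) (transpose U ** V - transpose V ** U) + scale_mat \<i> \<kappa>"

definition C1 :: "complex^'d^'m \<Rightarrow> complex^'d^'m \<Rightarrow> complex^'d^'d"
  where "C1 U V = transpose U ** cnj_mat U + transpose V ** cnj_mat V"

definition C2 :: "complex^'d^'m \<Rightarrow> complex^'d^'m \<Rightarrow> complex^'d^'d"
  where "C2 U V = transpose U ** V + transpose V ** U"

definition block_mat ::
  "'a^'d^'d \<Rightarrow> 'a^'d^'d \<Rightarrow> 'a^'d^'d \<Rightarrow> 'a^'d^'d \<Rightarrow> 'a^('d + 'd)^('d + 'd)"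
  where "block_mat A B C E = (\<chi> i j. case i of
      Inl p \<Rightarrow> (case j of Inl q \<Rightarrow> A $ p $ q | Inr q \<Rightarrow> B $ p $ q)
    | Inr p \<Rightarrow> (case j of Inl q \<Rightarrow> C $ p $ q | Inr q \<Rightarrow> E $ p $ q))"

abbreviation Re_mat :: "complex^'n^'m \<Rightarrow> complex^'n^'m"
  where "Re_mat \<equiv> map_matrix (\<lambda>c. complex_of_real (Re c))"

abbreviation Im_mat :: "complex^'n^'m \<Rightarrow> complex^'n^'m"
  where "Im_mat \<equiv> map_matrix (\<lambda>c. complex_of_real (Im c))"

definition complexification ::
  "complex^'d^'d \<Rightarrow> complex^'d^'d \<Rightarrow> complex^('d + 'd)^('d + 'd)"
  where "complexification A1 A2 = block_mat
    (Re_mat A1 + Re_mat A2) (Im_mat A2 - Im_mat A1)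
    (Im_mat A1 + Im_mat A2) (Re_mat A1 - Re_mat A2)"

definition J_mat :: "complex^('d::finite + 'd)^('d + 'd)"
  where "J_mat = block_mat 0 (mat 1) (- mat 1) 0"

abbreviation Z_mat ::
  "complex^'d^'d \<Rightarrow> complex^'d^'d \<Rightarrow> complex^'d^'m \<Rightarrow> complex^'d^'m
    \<Rightarrow> complex^('d + 'd)^('d + 'd)"
  where "Z_mat \<Omega> \<kappa> U V \<equiv> complexification (Z1 \<Omega> U V) (Z2 \<kappa> U V)"

abbreviation C_mat :: "complex^'d^'m \<Rightarrow> complex^'d^'m \<Rightarrow> complex^('d + 'd)^('d + 'd)"
  where "C_mat U V \<equiv> complexification (C1 U V) (C2 U V)"

definition CZ_mat ::
  "complex^'d^'d \<Rightarrow> complex^'d^'d \<Rightarrow> complex^'d^'m \<Rightarrow> complex^'d^'m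
    \<Rightarrow> complex^('d::finite + 'd)^('d + 'd)"
  where "CZ_mat \<Omega> \<kappa> U V = C_mat U V
    - scale_mat \<i> (adj_mat (Z_mat \<Omega> \<kappa> U V) ** J_mat + J_mat ** Z_mat \<Omega> \<kappa> U V)"

definition eigenvalue :: "complex^'n^'n \<Rightarrow> complex \<Rightarrow> bool"
  where "eigenvalue A \<mu> \<longleftrightarrow> (\<exists>v. v \<noteq> 0 \<and> A *v v = \<mu> *s v)"

definition stable_mat :: "complex^'n^'n \<Rightarrow> bool"
  where "stable_mat A \<longleftrightarrow> (\<forall>\<mu>. eigenvalue A \<mu> \<longrightarrow> Re \<mu> < 0)"

definition positive_definite :: "complex^'n^'n \<Rightarrow> bool"
  where "positive_definite A \<longleftrightarrow> adj_mat A = A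
    \<and> (\<forall>v. v \<noteq> 0 \<longrightarrow> Re (\<Sum>i\<in>UNIV. cnj (v $ i) * (A *v v) $ i) > 0)"

end

(*
  A Weyl operator W(z) evolves into phi_t(z) W(e^{tZ} z); this is derived from the weak master equation by
  a maximum principle, which shows that bounded solutions are determined by their initial value.
  Applied to a single W(z), the gap inequality shows that the characteristic function chi of rho has modulus
  exp(-Q/2) with Q(z) = int_0^infinity Re <e^{sZ} z, C e^{sZ} z> ds < infinity. As rho is faithful, Q is
  positive definite, hence e^{tZ} z -> 0 and chi = exp(-Q/2). The operators W(z) / chi(z) are then permuted by
  the semigroup and have Gram matrix exp S(z, z'), where S = Q + i J. Applying the gap inequality to their
  linear combinations at z = eps z_i and letting eps -> 0 gives S(e^{tZ} w) <= e^{-2gt} S(w) on C^{2d}, whose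
  derivative at t = 0 is C_Z = -(S Z + Z^* S) >= 2 g S. Finally S > 0, because a null vector of S would be
  a combination of annihilation and creation operators that vanishes on the dense range of rho^{1/2}.
*)

theory Submission
  imports Defs
begin

subsection \<open>Hilbert space structure of the Fock space\<close>

text \<open>The semigroup is specified only through matrix elements between vectors of
  \<open>fock_D\<close>, and in general neither T_t(x) nor W(z) maps \<open>fock_D\<close> into
  itself. Hence all commutation rules with W(z) are identities of sesquilinear forms, and W(z) is
  built from the exponential series on finite particle vectors. The generator is unbounded, so no
  Gronwall estimate in operator norm is available. The number operator N serves as a Lyapunov
  function instead: the generator is quadratic in the a_j and their adjoints, so its effect on N is
  again of order N. Subtracting a small multiple of N + 1 makes the supremum in the maximum
  principle attained, by compactness. A single Weyl operator only sees the real form Q. The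
  symplectic part J enters through products of different Weyl operators, which is why complex linear
  combinations are needed. Dividing by chi gives every summand mean 1, so the variance of a
  combination is the sum of conj(c_i) c_j (exp S(z_i, z_j) - 1), and its leading order is the
  hermitian form of S. With the z_i running through a real basis of C^d this form lives on
  C^{2d}.\<close>

lemma fock_eqI: "(\<And>n. fock_coeff \<xi> n = fock_coeff \<eta> n) \<Longrightarrow> \<xi> = \<eta>"
  by (simp add: fock_coeff_inject[symmetric] fun_eq_iff)

lemma fock_coeff_minus [simp]: "fock_coeff (\<xi> - \<eta>) n = fock_coeff \<xi> n - fock_coeff \<eta> n"
  unfolding minus_fock_def plus_fock.rep_eq uminus_fock.rep_eq by simp

lemma fock_coeff_scaleR [simp]: "fock_coeff (r *\<^sub>R \<xi>) n = complex_of_real r * fock_coeff \<xi> n"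
  by (simp add: scaleR_fock_def scaleC.rep_eq)

declare plus_fock.rep_eq [simp] uminus_fock.rep_eq [simp] zero_fock.rep_eq [simp]
  scaleC.rep_eq [simp] fock_e.rep_eq [simp]

lemma fock_coeff_sum [simp]: "fock_coeff (sum f A) n = (\<Sum>a\<in>A. fock_coeff (f a) n)"
  by (induction A rule: infinite_finite_induct) auto

lemma scaleC_add_right: "c *\<^sub>C (\<xi> + \<eta>) = c *\<^sub>C \<xi> + c *\<^sub>C \<eta>"
  and scaleC_add_left: "(c + d) *\<^sub>C \<xi> = c *\<^sub>C \<xi> + d *\<^sub>C \<xi>"
  and scaleC_diff_right: "c *\<^sub>C (\<xi> - \<eta>) = c *\<^sub>C \<xi> - c *\<^sub>C \<eta>"
  and scaleC_diff_left: "(c - d) *\<^sub>C \<xi> = c *\<^sub>C \<xi> - d *\<^sub>C \<xi>"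
  and scaleC_minus_left: "(- c) *\<^sub>C \<xi> = - (c *\<^sub>C \<xi>)"
  and scaleC_scaleC [simp]: "c *\<^sub>C d *\<^sub>C \<xi> = (c * d) *\<^sub>C \<xi>"
  and scaleC_one [simp]: "1 *\<^sub>C \<xi> = \<xi>"
  and scaleC_zero [simp]: "0 *\<^sub>C \<xi> = 0" "c *\<^sub>C 0 = 0"
  and scaleR_scaleC: "r *\<^sub>R \<xi> = complex_of_real r *\<^sub>C \<xi>"
  and scaleR_scaleC_commute: "c *\<^sub>C r *\<^sub>R \<xi> = r *\<^sub>R c *\<^sub>C \<xi>"
  by (rule fock_eqI; simp add: algebra_simps)+

lemma scaleC_sum_right: "c *\<^sub>C sum f A = (\<Sum>a\<in>A. c *\<^sub>C f a)"
  by (rule fock_eqI) (simp add: sum_distrib_left)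

lemma square_summable_fock_coeff: "(\<lambda>n. (cmod (fock_coeff \<xi> n))\<^sup>2) summable_on UNIV"
  using fock_coeff[of \<xi>] by simp

lemma summable_cinner: "(\<lambda>n. cnj (fock_coeff \<xi> n) * fock_coeff \<eta> n) summable_on UNIV"
  by (rule square_summable_inner) (rule square_summable_fock_coeff)+

lemma cinner_add_left: "cinner (\<xi> + \<eta>) \<theta> = cinner \<xi> \<theta> + cinner \<eta> \<theta>"
  unfolding cinner_def by (simp add: distrib_right infsum_add summable_cinner)

lemma cinner_add_right: "cinner \<theta> (\<xi> + \<eta>) = cinner \<theta> \<xi> + cinner \<theta> \<eta>"
  unfolding cinner_def by (simp add: distrib_left infsum_add summable_cinner)

lemma cinner_scaleC_left [simp]: "cinner (c *\<^sub>C \<xi>) \<eta> = cnj c * cinner \<xi> \<eta>"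
  unfolding cinner_def by (simp add: mult.assoc infsum_cmult_right')

lemma cinner_scaleC_right [simp]: "cinner \<xi> (c *\<^sub>C \<eta>) = c * cinner \<xi> \<eta>"
  unfolding cinner_def by (simp add: mult.left_commute infsum_cmult_right')

lemma cinner_commute: "cinner \<xi> \<eta> = cnj (cinner \<eta> \<xi>)"
  unfolding cinner_def infsum_cnj[symmetric] by (simp add: mult.commute)

lemma cinner_scaleR_left [simp]: "cinner (r *\<^sub>R \<xi>) \<eta> = r * cinner \<xi> \<eta>"
  and cinner_scaleR_right [simp]: "cinner \<xi> (r *\<^sub>R \<eta>) = r * cinner \<xi> \<eta>"
  by (simp_all add: scaleR_scaleC)

lemma cinner_zero [simp]: "cinner 0 \<xi> = 0" "cinner \<xi> 0 = 0"
  by (simp_all add: cinner_def)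

lemma cinner_minus_left [simp]: "cinner (- \<xi>) \<eta> = - cinner \<xi> \<eta>"
  and cinner_minus_right [simp]: "cinner \<xi> (- \<eta>) = - cinner \<xi> \<eta>"
  using cinner_scaleC_left[of "-1" \<xi> \<eta>] cinner_scaleC_right[of \<xi> "-1" \<eta>]
  by (simp_all add: scaleC_minus_left)

lemma cinner_diff_left: "cinner (\<xi> - \<eta>) \<theta> = cinner \<xi> \<theta> - cinner \<eta> \<theta>"
  and cinner_diff_right: "cinner \<theta> (\<xi> - \<eta>) = cinner \<theta> \<xi> - cinner \<theta> \<eta>"
  using cinner_add_left[of \<xi> "- \<eta>" \<theta>] cinner_add_right[of \<theta> \<xi> "- \<eta>"] by simp_all

lemma cinner_sum_left: "cinner (sum f A) \<eta> = (\<Sum>a\<in>A. cinner (f a) \<eta>)"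
  by (induction A rule: infinite_finite_induct) (auto simp: cinner_add_left)

lemma cinner_sum_right: "cinner \<eta> (sum f A) = (\<Sum>a\<in>A. cinner \<eta> (f a))"
  by (induction A rule: infinite_finite_induct) (auto simp: cinner_add_right)

lemma Re_cinner: "Re (cinner \<xi> \<eta>) = inner \<xi> \<eta>"
  by (simp add: inner_fock_def)

lemma cinner_self: "cinner \<xi> \<xi> = complex_of_real ((norm \<xi>)\<^sup>2)"
proof -
  have "Im (cinner \<xi> \<xi>) = 0"
    using arg_cong[OF cinner_commute[of \<xi> \<xi>], of Im] by simp
  then show ?thesis
    by (simp add: complex_eq_iff Re_cinner power2_norm_eq_inner)
qed

lemma norm_fock_sq: "(norm \<xi>)\<^sup>2 = (\<Sum>\<^sub>\<infinity>n. (cmod (fock_coeff \<xi> n))\<^sup>2)"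
  unfolding power2_norm_eq_inner[of \<xi>] Re_cinner[symmetric] cinner_def infsum_Re[OF summable_cinner, symmetric]
  by (rule infsum_cong) (simp add: cmod_power2, simp add: power2_eq_square)

lemma norm_scaleC [simp]: "norm (c *\<^sub>C \<xi>) = cmod c * norm \<xi>"
proof -
  have "complex_of_real ((norm (c *\<^sub>C \<xi>))\<^sup>2) = (cnj c * c) * complex_of_real ((norm \<xi>)\<^sup>2)"
    unfolding cinner_self[symmetric] by simp
  also have "cnj c * c = complex_of_real ((cmod c)\<^sup>2)"
    using complex_norm_square[of c] by (simp add: mult.commute)
  finally have "(norm (c *\<^sub>C \<xi>))\<^sup>2 = (cmod c * norm \<xi>)\<^sup>2"
    unfolding of_real_mult[symmetric] of_real_eq_iff by (simp add: power_mult_distrib)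
  then show ?thesis by (simp add: power2_eq_iff_nonneg)
qed

text \<open>The Cauchy-Schwarz inequality of the class \<open>real_inner\<close> controls only the
  real part; multiplying \<eta> by the unit phase \<open>c\<close> makes the complex product real
  and nonnegative.\<close>

lemma cmod_cinner_le: "cmod (cinner \<xi> \<eta>) \<le> norm \<xi> * norm \<eta>"
proof (cases "cinner \<xi> \<eta> = 0")
  case False
  define c where "c = cnj (cinner \<xi> \<eta>) / cmod (cinner \<xi> \<eta>)"
  have c: "cmod c = 1" using False by (simp add: c_def norm_divide)
  have "c * cinner \<xi> \<eta> = complex_of_real (cmod (cinner \<xi> \<eta>))"
    using False complex_norm_square[of "cinner \<xi> \<eta>"] by (simp add: c_def field_simps power2_eq_square)
  then have "cmod (cinner \<xi> \<eta>) = inner \<xi> (c *\<^sub>C \<eta>)"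
    by (metis Re_cinner Re_complex_of_real cinner_scaleC_right)
  also have "\<dots> \<le> norm \<xi> * norm (c *\<^sub>C \<eta>)" by (rule norm_cauchy_schwarz)
  finally show ?thesis using c by simp
qed simp

lemma bounded_bilinear_cinner: "bounded_bilinear cinner"
proof
  show "\<exists>K. \<forall>a b. norm (cinner a b) \<le> norm a * norm b * K"
    by (rule exI[of _ 1]) (simp add: cmod_cinner_le)
qed (simp_all add: cinner_add_left cinner_add_right scaleR_conv_of_real)

lemma bounded_linear_scaleC: "bounded_linear (\<lambda>\<xi>. c *\<^sub>C \<xi>)"
  by (rule bounded_linear_intro[where K = "cmod c"])
    (simp_all add: scaleC_add_right scaleR_scaleC_commute mult.commute)

lemmas tendsto_cinner [tendsto_intros] = bounded_bilinear.tendsto[OF bounded_bilinear_cinner]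
lemmas continuous_on_cinner [continuous_intros] =
  bounded_bilinear.continuous_on[OF bounded_bilinear_cinner]

lemma cinner_fock_e [simp]: "cinner (fock_e n) \<xi> = fock_coeff \<xi> n"
proof -
  have "cinner (fock_e n) \<xi> = (\<Sum>\<^sub>\<infinity>k\<in>{n}. cnj (fock_coeff (fock_e n) k) * fock_coeff \<xi> k)"
    unfolding cinner_def by (rule infsum_cong_neutral) auto
  then show ?thesis by simp
qed

lemma cinner_fock_e_right [simp]: "cinner \<xi> (fock_e n) = cnj (fock_coeff \<xi> n)"
  by (metis cinner_commute cinner_fock_e)

lemma norm_fock_e [simp]: "norm (fock_e n) = 1"
proof -
  have "complex_of_real ((norm (fock_e n))\<^sup>2) = complex_of_real 1"
    unfolding cinner_self[symmetric] by simp
  then have "(norm (fock_e n :: 'a fock))\<^sup>2 = 1\<^sup>2" by (simp only: of_real_eq_iff) simp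
  then show ?thesis using power2_eq_imp_eq[of "norm (fock_e n :: 'a fock)" 1] by simp
qed

lemma cmod_fock_coeff_le: "cmod (fock_coeff \<xi> n) \<le> norm \<xi>"
  using cmod_cinner_le[of "fock_e n" \<xi>] by simp

lemma sum_fock_coeff_sq_le: "finite F \<Longrightarrow> (\<Sum>n\<in>F. (cmod (fock_coeff \<xi> n))\<^sup>2) \<le> (norm \<xi>)\<^sup>2"
  unfolding norm_fock_sq by (intro finite_sum_le_infsum square_summable_fock_coeff) auto

lemma square_summable_bddI:
  fixes f :: "'a \<Rightarrow> complex"
  assumes "\<And>F. finite F \<Longrightarrow> (\<Sum>n\<in>F. (cmod (f n))\<^sup>2) \<le> C"
  shows "(\<lambda>n. (cmod (f n))\<^sup>2) summable_on UNIV" "(\<Sum>\<^sub>\<infinity>n. (cmod (f n))\<^sup>2) \<le> C"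
proof -
  show s: "(\<lambda>n. (cmod (f n))\<^sup>2) summable_on UNIV"
    by (rule nonneg_bdd_above_summable_on) (auto intro!: bdd_aboveI2 assms)
  show "(\<Sum>\<^sub>\<infinity>n. (cmod (f n))\<^sup>2) \<le> C"
    by (rule infsum_le_finite_sums[OF s]) (auto intro: assms)
qed

text \<open>The tool for constructing vectors from coefficient functions: one bound on finite
  partial sums gives square summability and the norm estimate together.\<close>

lemma Abs_fock_bdd:
  fixes f :: "('d::finite \<Rightarrow> nat) \<Rightarrow> complex"
  assumes "\<And>F. finite F \<Longrightarrow> (\<Sum>n\<in>F. (cmod (f n))\<^sup>2) \<le> C\<^sup>2" "C \<ge> 0"
  shows "fock_coeff (Abs_fock f) = f" "norm (Abs_fock f) \<le> C"
proof -
  show c: "fock_coeff (Abs_fock f) = f"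
    by (rule Abs_fock_inverse) (use square_summable_bddI(1)[OF assms(1)] in auto)
  have "(norm (Abs_fock f))\<^sup>2 \<le> C\<^sup>2"
    unfolding norm_fock_sq c by (rule square_summable_bddI(2)[OF assms(1)])
  then show "norm (Abs_fock f) \<le> C" using assms(2) by (rule power2_le_imp_le)
qed

instance fock :: (finite) banach
proof
  fix X :: "nat \<Rightarrow> 'a fock"
  assume X: "Cauchy X"
  have "Cauchy (\<lambda>i. fock_coeff (X i) n)" for n
  proof (rule metric_CauchyI)
    fix e :: real assume "0 < e"
    then obtain M where M: "\<And>i j. i \<ge> M \<Longrightarrow> j \<ge> M \<Longrightarrow> dist (X i) (X j) < e"
      using metric_CauchyD[OF X] by blast
    show "\<exists>M. \<forall>i\<ge>M. \<forall>j\<ge>M. dist (fock_coeff (X i) n) (fock_coeff (X j) n) < e"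
    proof (intro exI[of _ M] allI impI)
      fix i j assume "i \<ge> M" "j \<ge> M"
      then show "dist (fock_coeff (X i) n) (fock_coeff (X j) n) < e"
        using M[of i j] cmod_fock_coeff_le[of "X i - X j" n] by (simp add: dist_norm)
    qed
  qed
  then have "\<exists>l. (\<lambda>i. fock_coeff (X i) n) \<longlonglongrightarrow> l" for n
    by (simp add: Cauchy_convergent_iff convergent_def)
  then obtain l where l: "\<And>n. (\<lambda>i. fock_coeff (X i) n) \<longlonglongrightarrow> l n" by metis
  \<comment> \<open>The Cauchy estimate passes to the coordinatewise limit on finite sets of
    coordinates, with a bound independent of the set.\<close>
  have tail: "(\<Sum>n\<in>F. (cmod (fock_coeff (X i) n - l n))\<^sup>2) \<le> e\<^sup>2"
    if "finite F" and "\<forall>j\<ge>i. norm (X i - X j) \<le> e" for F i e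
  proof (rule LIMSEQ_le_const2)
    show "(\<lambda>j. \<Sum>n\<in>F. (cmod (fock_coeff (X i) n - fock_coeff (X j) n))\<^sup>2)
      \<longlonglongrightarrow> (\<Sum>n\<in>F. (cmod (fock_coeff (X i) n - l n))\<^sup>2)"
      by (intro tendsto_intros l)
    have "(\<Sum>n\<in>F. (cmod (fock_coeff (X i) n - fock_coeff (X j) n))\<^sup>2) \<le> e\<^sup>2" if "j \<ge> i" for j
      using sum_fock_coeff_sq_le[OF \<open>finite F\<close>, of "X i - X j"] that
        \<open>\<forall>j\<ge>i. norm (X i - X j) \<le> e\<close> power_mono[of "norm (X i - X j)" e 2] by fastforce
    then show "\<exists>N. \<forall>j\<ge>N. (\<Sum>n\<in>F. (cmod (fock_coeff (X i) n - fock_coeff (X j) n))\<^sup>2) \<le> e\<^sup>2"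
      by blast
  qed
  have ex: "\<exists>M. \<forall>i\<ge>M. \<forall>j\<ge>i. norm (X i - X j) \<le> e" if "e > 0" for e
  proof -
    obtain M where M: "\<And>i j. i \<ge> M \<Longrightarrow> j \<ge> M \<Longrightarrow> dist (X i) (X j) < e"
      using metric_CauchyD[OF X \<open>e > 0\<close>] by blast
    show ?thesis
    proof (intro exI[of _ M] allI impI)
      fix i j assume "i \<ge> M" "j \<ge> i"
      then show "norm (X i - X j) \<le> e" using M[of i j] by (simp add: dist_norm)
    qed
  qed
  obtain M where M: "\<And>j. j \<ge> M \<Longrightarrow> norm (X M - X j) \<le> 1" using ex[of 1] by auto
  \<comment> \<open>What the tail estimate controls is the difference of \<open>X M\<close> and the
    coordinatewise limit, so this difference is made a vector and subtracted from
    \<open>X M\<close>.\<close>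
  define D1 where "D1 = Abs_fock (\<lambda>n. fock_coeff (X M) n - l n)"
  define L where "L = X M - D1"
  have D1: "fock_coeff D1 = (\<lambda>n. fock_coeff (X M) n - l n)"
    unfolding D1_def by (rule Abs_fock_bdd(1)[where C = 1]) (use tail[of _ M 1] M in simp_all)
  have L: "fock_coeff L = l" by (auto simp: L_def D1)
  have "X \<longlonglongrightarrow> L"
  proof (rule metric_LIMSEQ_I)
    fix e :: real assume e: "0 < e"
    then obtain M where M: "\<And>i j. i \<ge> M \<Longrightarrow> j \<ge> i \<Longrightarrow> norm (X i - X j) \<le> e/2"
      using ex[of "e/2"] by auto
    have "dist (X i) L < e" if i: "i \<ge> M" for i
    proof -
      have "(norm (X i - L))\<^sup>2 \<le> (e/2)\<^sup>2"
        unfolding norm_fock_sq by (rule square_summable_bddI(2)) (use tail M[OF i] L in auto)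
      then have "norm (X i - L) \<le> e/2" by (rule power2_le_imp_le) (use e in simp)
      then show ?thesis using e by (simp add: dist_norm)
    qed
    then show "\<exists>no. \<forall>n\<ge>no. dist (X n) L < e" by blast
  qed
  then show "convergent X" by (auto simp: convergent_def)
qed

subsection \<open>Finite particle vectors\<close>

lemma cnj_mult_self: "cnj z * z = complex_of_real ((cmod z)\<^sup>2)" "z * cnj z = complex_of_real ((cmod z)\<^sup>2)"
  using complex_norm_square[of z] by (simp_all add: mult.commute)

lemma fock_D_iff: "\<xi> \<in> fock_D \<longleftrightarrow> finite {n. fock_coeff \<xi> n \<noteq> 0}"
proof
  assume "\<xi> \<in> fock_D"
  then obtain F c where F: "finite F" and \<xi>: "\<xi> = (\<Sum>n\<in>F. c n *\<^sub>C fock_e n)"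
    by (auto simp: fock_D_def)
  have "fock_coeff \<xi> n = 0" if "n \<notin> F" for n
    using that by (auto simp: \<xi> intro!: sum.neutral)
  then have "{n. fock_coeff \<xi> n \<noteq> 0} \<subseteq> F" by auto
  then show "finite {n. fock_coeff \<xi> n \<noteq> 0}" using F finite_subset by blast
next
  assume fin: "finite {n. fock_coeff \<xi> n \<noteq> 0}"
  have "\<xi> = (\<Sum>n\<in>{n. fock_coeff \<xi> n \<noteq> 0}. fock_coeff \<xi> n *\<^sub>C fock_e n)"
    by (rule fock_eqI) (simp add: fin if_distrib[of "\<lambda>x. _ * x"] cong: if_cong)
  then show "\<xi> \<in> fock_D" unfolding fock_D_def using fin by blast
qed

lemma fock_D_expand:
  assumes "finite F" "{n. fock_coeff \<xi> n \<noteq> 0} \<subseteq> F"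
  shows "\<xi> = (\<Sum>n\<in>F. fock_coeff \<xi> n *\<^sub>C fock_e n)"
  by (rule fock_eqI) (use assms in \<open>auto simp: if_distrib[of "\<lambda>x. _ * x"] cong: if_cong\<close>)

lemma fock_D_0 [simp]: "0 \<in> fock_D"
  and fock_D_e [simp]: "fock_e n \<in> fock_D"
  by (simp_all add: fock_D_iff)

lemma fock_D_add [simp]: "\<xi> \<in> fock_D \<Longrightarrow> \<eta> \<in> fock_D \<Longrightarrow> \<xi> + \<eta> \<in> fock_D"
  unfolding fock_D_iff
  by (rule finite_subset[of _ "{n. fock_coeff \<xi> n \<noteq> 0} \<union> {n. fock_coeff \<eta> n \<noteq> 0}"]) auto

lemma fock_D_scaleC [simp]: "\<xi> \<in> fock_D \<Longrightarrow> c *\<^sub>C \<xi> \<in> fock_D"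
  unfolding fock_D_iff by (rule finite_subset[of _ "{n. fock_coeff \<xi> n \<noteq> 0}"]) auto

lemma fock_D_scaleR [simp]: "\<xi> \<in> fock_D \<Longrightarrow> r *\<^sub>R \<xi> \<in> fock_D"
  by (simp add: scaleR_scaleC)

lemma fock_D_minus [simp]: "\<xi> \<in> fock_D \<Longrightarrow> - \<xi> \<in> fock_D"
  using fock_D_scaleC[of \<xi> "-1"] by (simp add: scaleC_minus_left)

lemma fock_D_diff [simp]: "\<xi> \<in> fock_D \<Longrightarrow> \<eta> \<in> fock_D \<Longrightarrow> \<xi> - \<eta> \<in> fock_D"
  using fock_D_add[of \<xi> "- \<eta>"] by simp

lemma fock_D_sum [simp]: "(\<And>a. a \<in> A \<Longrightarrow> f a \<in> fock_D) \<Longrightarrow> sum f A \<in> fock_D"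
  by (induction A rule: infinite_finite_induct) auto

lemma fock_D_induct [consumes 1, case_names zero add]:
  assumes "\<xi> \<in> fock_D" "P 0"
    "\<And>c n \<xi>. \<xi> \<in> fock_D \<Longrightarrow> P \<xi> \<Longrightarrow> P (c *\<^sub>C fock_e n + \<xi>)"
  shows "P \<xi>"
proof -
  obtain F c where F: "finite F" and \<xi>: "\<xi> = (\<Sum>n\<in>F. c n *\<^sub>C fock_e n)"
    using assms(1) by (auto simp: fock_D_def)
  show ?thesis unfolding \<xi> using F
    by (induction F rule: finite_induct) (auto intro!: assms(2,3))
qed

text \<open>Total particle number, the eigenvalue of N at \<open>fock_e n\<close>.\<close>

definition level :: "('d::finite \<Rightarrow> nat) \<Rightarrow> nat"
  where "level n = (\<Sum>j\<in>UNIV. n j)"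

text \<open>The finite rank projection onto at most k particles. It gives an explicit approximating
  sequence in \<open>fock_D\<close> for every vector.\<close>

definition trunc :: "nat \<Rightarrow> 'd::finite fock \<Rightarrow> 'd fock"
  where "trunc k \<xi> = (\<Sum>n | level n \<le> k. fock_coeff \<xi> n *\<^sub>C fock_e n)"

lemma finite_level: "finite {n :: 'd::finite \<Rightarrow> nat. level n \<le> k}"
proof -
  have "n j \<le> k" if "level n \<le> k" for n :: "'d \<Rightarrow> nat" and j
    using member_le_sum[of j UNIV n] that by (simp add: level_def)
  then have "{n :: 'd \<Rightarrow> nat. level n \<le> k} \<subseteq> (\<Pi>\<^sub>E j\<in>UNIV. {..k})" by auto
  then show ?thesis by (rule finite_subset) (simp add: finite_PiE)
qed

lemma trunc_in_D [simp]: "trunc k \<xi> \<in> fock_D"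
  by (simp add: trunc_def)

lemma fock_coeff_trunc [simp]: "fock_coeff (trunc k \<xi>) n = (if level n \<le> k then fock_coeff \<xi> n else 0)"
  by (simp add: trunc_def finite_level if_distrib[of "\<lambda>x. _ * x"] cong: if_cong)

lemma finite_subset_level: "finite F \<Longrightarrow> \<exists>k. F \<subseteq> {n. level n \<le> k}"
  by (rule exI[of _ "Max (level ` F)"]) auto

lemma trunc_tendsto: "(\<lambda>k. trunc k \<xi>) \<longlonglongrightarrow> \<xi>"
proof -
  let ?f = "\<lambda>n. (cmod (fock_coeff \<xi> n))\<^sup>2"
  have lim: "filterlim (\<lambda>k. {n :: 'a \<Rightarrow> nat. level n \<le> k}) (finite_subsets_at_top UNIV) sequentially"
    unfolding filterlim_finite_subsets_at_top
  proof (intro allI impI, elim conjE)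
    fix X :: "('a \<Rightarrow> nat) set" assume "finite X"
    then obtain k where "X \<subseteq> {n. level n \<le> k}" using finite_subset_level by blast
    then show "\<forall>\<^sub>F k in sequentially. finite {n :: 'a \<Rightarrow> nat. level n \<le> k} \<and> X \<subseteq> {n. level n \<le> k} \<and> {n. level n \<le> k} \<subseteq> UNIV"
      unfolding eventually_sequentially
      by (intro exI[of _ k] allI impI) (auto simp: finite_level intro: order_trans)
  qed
  have "(?f has_sum (norm \<xi>)\<^sup>2) UNIV"
    unfolding norm_fock_sq by (rule has_sum_infsum[OF square_summable_fock_coeff])
  then have "(\<lambda>k. \<Sum>n | level n \<le> k. ?f n) \<longlonglongrightarrow> (norm \<xi>)\<^sup>2"
    unfolding has_sum_def by (rule filterlim_compose[OF _ lim])
  then have "(\<lambda>k. (norm \<xi>)\<^sup>2 - (\<Sum>n | level n \<le> k. ?f n)) \<longlonglongrightarrow> (norm \<xi>)\<^sup>2 - (norm \<xi>)\<^sup>2"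
    by (intro tendsto_intros)
  \<comment> \<open>Pythagoras for the orthogonal projection \<open>trunc k\<close>.\<close>
  moreover have "(norm \<xi>)\<^sup>2 - (\<Sum>n | level n \<le> k. ?f n) = (norm (trunc k \<xi> - \<xi>))\<^sup>2" for k
  proof -
    have "complex_of_real ((norm (trunc k \<xi> - \<xi>))\<^sup>2) =
      cinner (trunc k \<xi>) (trunc k \<xi>) - cinner (trunc k \<xi>) \<xi> - cinner \<xi> (trunc k \<xi>) + cinner \<xi> \<xi>"
      unfolding cinner_self[symmetric] by (simp add: cinner_diff_left cinner_diff_right)
    also have "cinner (trunc k \<xi>) (trunc k \<xi>) = (\<Sum>n | level n \<le> k. ?f n)"
      unfolding of_real_sum
      by (subst trunc_def) (unfold cinner_sum_left, rule sum.cong, auto simp: cnj_mult_self simp del: of_real_power)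
    also have "cinner (trunc k \<xi>) \<xi> = (\<Sum>n | level n \<le> k. ?f n)"
      unfolding of_real_sum
      by (subst trunc_def) (unfold cinner_sum_left, rule sum.cong, auto simp: cnj_mult_self simp del: of_real_power)
    also have "cinner \<xi> (trunc k \<xi>) = (\<Sum>n | level n \<le> k. ?f n)"
      unfolding of_real_sum
      by (subst trunc_def) (unfold cinner_sum_right, rule sum.cong, auto simp: cnj_mult_self simp del: of_real_power)
    finally show ?thesis
      unfolding cinner_self of_real_diff[symmetric] of_real_add[symmetric] of_real_eq_iff by simp
  qed
  ultimately have "(\<lambda>k. (norm (trunc k \<xi> - \<xi>))\<^sup>2) \<longlonglongrightarrow> 0" by simp
  then have "(\<lambda>k. sqrt ((norm (trunc k \<xi> - \<xi>))\<^sup>2)) \<longlonglongrightarrow> sqrt 0" by (intro tendsto_intros)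
  then have "(\<lambda>k. norm (trunc k \<xi> - \<xi>)) \<longlonglongrightarrow> 0" by simp
  then have "(\<lambda>k. trunc k \<xi> - \<xi>) \<longlonglongrightarrow> 0" by (rule tendsto_norm_zero_cancel)
  then show ?thesis by (rule LIM_zero_cancel)
qed

lemma norm_trunc_le: "norm (trunc k \<xi>) \<le> norm \<xi>"
proof -
  have "(norm (trunc k \<xi>))\<^sup>2 \<le> (norm \<xi>)\<^sup>2"
    unfolding norm_fock_sq
    by (rule infsum_mono[OF square_summable_fock_coeff square_summable_fock_coeff]) auto
  then show ?thesis by (rule power2_le_imp_le) simp
qed

lemma fock_D_dense_eqI:
  fixes f g :: "'d::finite fock \<Rightarrow> 'b::t2_space"
  assumes "continuous_on UNIV f" "continuous_on UNIV g" "\<And>\<xi>. \<xi> \<in> fock_D \<Longrightarrow> f \<xi> = g \<xi>"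
  shows "f \<xi> = g \<xi>"
proof -
  have "isCont f \<xi>" "isCont g \<xi>" using assms(1,2) by (auto simp: continuous_on_eq_continuous_at)
  then have "(\<lambda>k. f (trunc k \<xi>)) \<longlonglongrightarrow> f \<xi>" "(\<lambda>k. g (trunc k \<xi>)) \<longlonglongrightarrow> g \<xi>"
    using trunc_tendsto isCont_tendsto_compose by blast+
  then show ?thesis using assms(3) by (simp add: LIMSEQ_unique)
qed

lemma cinner_eqI_D:
  assumes "\<And>v. v \<in> fock_D \<Longrightarrow> cinner v \<xi> = cinner v \<eta>"
  shows "\<xi> = \<eta>"
  by (rule fock_eqI) (use assms[OF fock_D_e] in simp)

subsection \<open>Bounded operators\<close>

lemma BH_scaleC: "x \<in> BH \<Longrightarrow> x (c *\<^sub>C \<xi>) = c *\<^sub>C x \<xi>"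
  by (simp add: BH_def)

lemma BH_add [simp]: "x \<in> BH \<Longrightarrow> y \<in> BH \<Longrightarrow> x + y \<in> BH"
  and BH_diff [simp]: "x \<in> BH \<Longrightarrow> y \<in> BH \<Longrightarrow> x - y \<in> BH"
  and BH_0 [simp]: "0 \<in> BH"
  and BH_id [simp]: "id_blinfun \<in> BH"
  by (auto simp: BH_def plus_blinfun.rep_eq minus_blinfun.rep_eq scaleC_add_right scaleC_diff_right)

lemma BH_comp [simp]: "x \<in> BH \<Longrightarrow> y \<in> BH \<Longrightarrow> x o\<^sub>L y \<in> BH"
  by (simp add: BH_def)

lemma scaleC_op_apply [simp]: "scaleC_op c x \<xi> = c *\<^sub>C x \<xi>"
  unfolding scaleC_op_def
  by (subst bounded_linear_Blinfun_apply)
    (auto intro: bounded_linear_compose[OF bounded_linear_scaleC] blinfun.bounded_linear_right)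

lemma BH_scaleC_op [simp]: "x \<in> BH \<Longrightarrow> scaleC_op c x \<in> BH"
  by (simp add: BH_def mult.commute)

lemma blinfun_sum_apply [simp]: "blinfun_apply (sum f A) \<xi> = (\<Sum>a\<in>A. f a \<xi>)"
  by (rule blinfun.sum_left)

lemma BH_sum [simp]: "(\<And>a. a \<in> A \<Longrightarrow> f a \<in> BH) \<Longrightarrow> sum f A \<in> BH"
  by (induction A rule: infinite_finite_induct) auto

lemma blinfun_eqI_D:
  fixes x y :: "'d::finite op"
  assumes "\<And>u v. u \<in> fock_D \<Longrightarrow> v \<in> fock_D \<Longrightarrow> cinner u (x v) = cinner u (y v)"
  shows "x = y"
proof (rule blinfun_eqI)
  fix \<xi>
  show "x \<xi> = y \<xi>"
    by (rule fock_D_dense_eqI[of "blinfun_apply x"])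
      (auto intro!: cinner_eqI_D assms blinfun.continuous_on continuous_intros)
qed

text \<open>The n-th coefficient of y \<xi> must be <f e_n, \<xi>>, so the adjoint can be written
  down without a representation theorem. It is defined everywhere although f is controlled on
  \<open>fock_D\<close> only; both \<open>adj\<close> and the Weyl operators are obtained from
  it.\<close>

lemma ex_adjoint:
  fixes f :: "'d::finite fock \<Rightarrow> 'd fock"
  assumes add: "\<And>u v. u \<in> fock_D \<Longrightarrow> v \<in> fock_D \<Longrightarrow> f (u + v) = f u + f v"
    and scale: "\<And>c u. u \<in> fock_D \<Longrightarrow> f (c *\<^sub>C u) = c *\<^sub>C f u"
    and bound: "\<And>u. u \<in> fock_D \<Longrightarrow> norm (f u) \<le> C * norm u" and C: "C \<ge> 0"
  shows "\<exists>y\<in>BH. norm y \<le> C \<and> (\<forall>\<xi>. \<forall>v\<in>fock_D. cinner (blinfun_apply y \<xi>) v = cinner \<xi> (f v))"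
proof -
  have f0: "f 0 = 0" using scale[of 0 0] by simp
  have fsum: "f (\<Sum>n\<in>F. a n *\<^sub>C fock_e n) = (\<Sum>n\<in>F. a n *\<^sub>C f (fock_e n))" for F a
    by (induction F rule: infinite_finite_induct) (auto simp: f0 add scale)
  let ?c = "\<lambda>\<xi> n. cinner (f (fock_e n)) \<xi>"
  have bd: "(\<Sum>n\<in>F. (cmod (?c \<xi> n))\<^sup>2) \<le> (C * norm \<xi>)\<^sup>2" if F: "finite F" for F \<xi>
  proof -
    \<comment> \<open>Duality: for this \<eta> the squared norm equals <f \<eta>, \<xi>>, which is
      at most C times the norms of \<eta> and \<xi>; cancelling one factor bounds the coefficients
      on F.\<close>
    define \<eta> where "\<eta> = (\<Sum>n\<in>F. ?c \<xi> n *\<^sub>C fock_e n)"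
    have \<eta>D: "\<eta> \<in> fock_D" by (simp add: \<eta>_def)
    have co: "fock_coeff \<eta> n = ?c \<xi> n" if "n \<in> F" for n
      using F that by (simp add: \<eta>_def if_distrib[of "\<lambda>x. _ * x"] cong: if_cong)
    have n1: "complex_of_real ((norm \<eta>)\<^sup>2) = (\<Sum>n\<in>F. complex_of_real ((cmod (?c \<xi> n))\<^sup>2))"
      unfolding cinner_self[symmetric]
      by (subst \<eta>_def) (unfold cinner_sum_left, rule sum.cong, auto simp: co cnj_mult_self simp del: of_real_power)
    have "cinner (f \<eta>) \<xi> = (\<Sum>n\<in>F. complex_of_real ((cmod (?c \<xi> n))\<^sup>2))"
      by (subst \<eta>_def, subst fsum) (unfold cinner_sum_left, rule sum.cong, auto simp: cnj_mult_self simp del: of_real_power)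
    then have "(norm \<eta>)\<^sup>2 = cmod (cinner (f \<eta>) \<xi>)"
      unfolding n1[symmetric] by (simp add: norm_power)
    also have "\<dots> \<le> norm (f \<eta>) * norm \<xi>" by (rule cmod_cinner_le)
    also have "\<dots> \<le> (C * norm \<eta>) * norm \<xi>" by (intro mult_right_mono bound \<eta>D) simp
    finally have "norm \<eta> \<le> C * norm \<xi>"
      using C by (cases "norm \<eta> = 0") (auto simp: power2_eq_square mult.commute mult.left_commute)
    then have "(norm \<eta>)\<^sup>2 \<le> (C * norm \<xi>)\<^sup>2" by (intro power_mono) auto
    then show ?thesis using n1 unfolding of_real_sum[symmetric] of_real_eq_iff by simp
  qed
  define g where "g \<xi> = Abs_fock (?c \<xi>)" for \<xi>
  have g: "fock_coeff (g \<xi>) = ?c \<xi>" "norm (g \<xi>) \<le> C * norm \<xi>" for \<xi>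
    unfolding g_def by (rule Abs_fock_bdd[OF bd]; use C in simp)+
  have bl: "bounded_linear g"
    by (rule bounded_linear_intro[where K = C])
      (auto intro!: fock_eqI simp: g cinner_add_right mult.commute)
  define y where "y = Blinfun g"
  have y: "blinfun_apply y = g" unfolding y_def by (rule bounded_linear_Blinfun_apply[OF bl])
  have "y \<in> BH" by (auto simp: BH_def y intro!: fock_eqI simp: g)
  moreover have "norm y \<le> C" by (rule norm_blinfun_bound) (use C g y in auto)
  moreover have "cinner (y \<xi>) v = cinner \<xi> (f v)" if "v \<in> fock_D" for \<xi> v
    using that
  proof (induction v rule: fock_D_induct)
    case (add c n v)
    have "cinner (y \<xi>) (fock_e n) = cinner \<xi> (f (fock_e n))"
      unfolding y by (simp add: g) (metis cinner_commute)
    then show ?case using add by (simp add: cinner_add_right assms(1) scale)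
  qed (simp add: f0)
  ultimately show ?thesis by blast
qed

lemma adj_exists:
  assumes x: "x \<in> BH"
  shows "adj x \<in> BH" "cinner (adj x \<xi>) \<eta> = cinner \<xi> (x \<eta>)"
proof -
  obtain y where y: "y \<in> BH" "\<forall>\<xi>. \<forall>v\<in>fock_D. cinner (blinfun_apply y \<xi>) v = cinner \<xi> (x v)"
    using ex_adjoint[of "blinfun_apply x" "norm x"] BH_scaleC[OF x]
    by (auto simp: blinfun.add_right norm_blinfun)
  have y': "\<forall>\<xi> \<eta>. cinner (y \<xi>) \<eta> = cinner \<xi> (x \<eta>)"
  proof (intro allI)
    fix \<xi> \<eta>
    show "cinner (y \<xi>) \<eta> = cinner \<xi> (x \<eta>)"
      by (rule fock_D_dense_eqI[of "\<lambda>\<eta>. cinner (y \<xi>) \<eta>"]) (use y in \<open>auto intro!: continuous_intros\<close>)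
  qed
  have "adj x = y" unfolding adj_def
  proof (rule the_equality)
    fix w assume w: "w \<in> BH \<and> (\<forall>\<xi> \<eta>. cinner (w \<xi>) \<eta> = cinner \<xi> (x \<eta>))"
    show "w = y"
      by (rule blinfun_eqI_D) (metis w y' cinner_commute)
  qed (use y y' in auto)
  then show "adj x \<in> BH" "cinner (adj x \<xi>) \<eta> = cinner \<xi> (x \<eta>)" using y y' by auto
qed

lemma adj_exists_right: "x \<in> BH \<Longrightarrow> cinner \<eta> (adj x \<xi>) = cinner (x \<eta>) \<xi>"
  by (metis adj_exists(2) cinner_commute)

subsection \<open>Annihilation and creation operators\<close>

lemma fock_coeff_annih:
  assumes "\<xi> \<in> fock_D"
  shows "fock_coeff (annih j \<xi>) n = sqrt (n j + 1) * fock_coeff \<xi> (n(j := n j + 1))"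
proof -
  let ?S = "{n. fock_coeff \<xi> n \<noteq> 0}" and ?m = "n(j := n j + 1)"
  have fin: "finite ?S" using assms by (simp add: fock_D_iff)
  have eq: "fock_coeff \<xi> k * sqrt (k j) * (if n = k(j := k j - 1) then 1 else 0) =
      (if k = ?m then fock_coeff \<xi> k * sqrt (k j) else 0)" for k
    by (cases "k j") (auto simp: fun_eq_iff)
  have "fock_coeff (annih j \<xi>) n = (\<Sum>k\<in>?S. if k = ?m then fock_coeff \<xi> k * sqrt (k j) else 0)"
    unfolding annih_def fock_coeff_sum scaleC.rep_eq fock_e.rep_eq eq ..
  also have "\<dots> = sqrt (n j + 1) * fock_coeff \<xi> ?m"
    using fin by simp
  finally show ?thesis by (simp add: add.commute)
qed

text \<open>For n j = 0 the truncated subtraction returns n itself, but then the factor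
  \<open>sqrt (n j)\<close> vanishes.\<close>

lemma fock_coeff_creat:
  assumes "\<xi> \<in> fock_D"
  shows "fock_coeff (creat j \<xi>) n = sqrt (n j) * fock_coeff \<xi> (n(j := n j - 1))"
proof -
  let ?S = "{n. fock_coeff \<xi> n \<noteq> 0}" and ?m = "n(j := n j - 1)"
  have fin: "finite ?S" using assms by (simp add: fock_D_iff)
  have eq: "fock_coeff \<xi> k * sqrt (k j + 1) * (if n = k(j := k j + 1) then 1 else 0) =
      (if k = ?m then fock_coeff \<xi> k * sqrt (n j) else 0)" for k
    by (cases "n j") (auto simp: fun_eq_iff add.commute)
  have "fock_coeff (creat j \<xi>) n = (\<Sum>k\<in>?S. if k = ?m then fock_coeff \<xi> k * sqrt (n j) else 0)"
    unfolding creat_def fock_coeff_sum scaleC.rep_eq fock_e.rep_eq eq ..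
  also have "\<dots> = sqrt (n j) * fock_coeff \<xi> ?m"
    using fin by simp
  finally show ?thesis .
qed

lemma annih_in_D [simp]: "annih j \<xi> \<in> fock_D"
  and creat_in_D [simp]: "creat j \<xi> \<in> fock_D"
  by (simp_all add: annih_def creat_def)

lemma annih_add: "\<xi> \<in> fock_D \<Longrightarrow> \<eta> \<in> fock_D \<Longrightarrow> annih j (\<xi> + \<eta>) = annih j \<xi> + annih j \<eta>"
  and creat_add: "\<xi> \<in> fock_D \<Longrightarrow> \<eta> \<in> fock_D \<Longrightarrow> creat j (\<xi> + \<eta>) = creat j \<xi> + creat j \<eta>"
  and annih_scaleC: "\<xi> \<in> fock_D \<Longrightarrow> annih j (c *\<^sub>C \<xi>) = c *\<^sub>C annih j \<xi>"
  and creat_scaleC: "\<xi> \<in> fock_D \<Longrightarrow> creat j (c *\<^sub>C \<xi>) = c *\<^sub>C creat j \<xi>"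
  by (rule fock_eqI; simp add: fock_coeff_annih fock_coeff_creat distrib_left)+

lemma annih_0 [simp]: "annih j 0 = 0" and creat_0 [simp]: "creat j 0 = 0"
  using annih_scaleC[of 0 j 0] creat_scaleC[of 0 j 0] by simp_all

lemma annih_diff: "\<xi> \<in> fock_D \<Longrightarrow> \<eta> \<in> fock_D \<Longrightarrow> annih j (\<xi> - \<eta>) = annih j \<xi> - annih j \<eta>"
  and creat_diff: "\<xi> \<in> fock_D \<Longrightarrow> \<eta> \<in> fock_D \<Longrightarrow> creat j (\<xi> - \<eta>) = creat j \<xi> - creat j \<eta>"
  by (rule fock_eqI; simp add: fock_coeff_annih fock_coeff_creat right_diff_distrib)+

lemma annih_sum: "(\<And>a. a \<in> A \<Longrightarrow> f a \<in> fock_D) \<Longrightarrow> annih j (sum f A) = (\<Sum>a\<in>A. annih j (f a))"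
  by (induction A rule: infinite_finite_induct) (auto simp: annih_add)

lemma creat_sum: "(\<And>a. a \<in> A \<Longrightarrow> f a \<in> fock_D) \<Longrightarrow> creat j (sum f A) = (\<Sum>a\<in>A. creat j (f a))"
  by (induction A rule: infinite_finite_induct) (auto simp: creat_add)

lemma annih_creat:
  assumes "\<xi> \<in> fock_D"
  shows "annih j (creat k \<xi>) = creat k (annih j \<xi>) + (if j = k then \<xi> else 0)"
proof (rule fock_eqI)
  fix n
  have sq: "complex_of_real (sqrt (real m)) * complex_of_real (sqrt (real m)) = of_nat m" for m
    unfolding of_real_mult[symmetric] by simp
  show "fock_coeff (annih j (creat k \<xi>)) n = fock_coeff (creat k (annih j \<xi>) + (if j = k then \<xi> else 0)) n"
  proof (cases "j = k")
    case True
    show ?thesis using sq[of "n k"] sq[of "Suc (n k)"]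
      by (cases "n k") (simp_all add: True fock_coeff_annih fock_coeff_creat assms mult.assoc[symmetric] distrib_right add.commute fun_upd_idem)
  next
    case False
    then show ?thesis
      by (simp add: fock_coeff_annih fock_coeff_creat assms fun_upd_twist)
  qed
qed

lemma annih_annih: "\<xi> \<in> fock_D \<Longrightarrow> annih j (annih k \<xi>) = annih k (annih j \<xi>)"
  by (rule fock_eqI, cases "j = k") (auto simp: fock_coeff_annih fun_upd_twist)

lemma creat_creat: "\<xi> \<in> fock_D \<Longrightarrow> creat j (creat k \<xi>) = creat k (creat j \<xi>)"
  by (rule fock_eqI, cases "j = k") (auto simp: fock_coeff_creat fun_upd_twist)

lemma cinner_creat_left:
  assumes "\<xi> \<in> fock_D" "\<eta> \<in> fock_D"
  shows "cinner (creat j \<xi>) \<eta> = cinner \<xi> (annih j \<eta>)"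
proof -
  have "finite {n. fock_coeff \<xi> n \<noteq> 0}" using assms by (simp add: fock_D_iff)
  then have \<xi>: "\<xi> = (\<Sum>n | fock_coeff \<xi> n \<noteq> 0. fock_coeff \<xi> n *\<^sub>C fock_e n)"
    by (rule fock_D_expand) simp
  have "cinner (creat j \<xi>) \<eta> = (\<Sum>n | fock_coeff \<xi> n \<noteq> 0. cnj (fock_coeff \<xi> n) * fock_coeff (annih j \<eta>) n)"
    unfolding creat_def cinner_sum_left
    by (rule sum.cong) (simp_all add: fock_coeff_annih assms)
  also have "\<dots> = cinner (\<Sum>n | fock_coeff \<xi> n \<noteq> 0. fock_coeff \<xi> n *\<^sub>C fock_e n) (annih j \<eta>)"
    by (simp add: cinner_sum_left)
  finally show ?thesis using \<xi> by simp
qed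

lemma cinner_annih_left:
  assumes "\<xi> \<in> fock_D" "\<eta> \<in> fock_D"
  shows "cinner (annih j \<xi>) \<eta> = cinner \<xi> (creat j \<eta>)"
  by (metis assms cinner_creat_left cinner_commute)

section \<open>Powers of the number operator and weighted norms\<close>

text \<open>The operator (N + 1)^{s/2} on \<open>fock_D\<close>: \<open>wt 2\<close> is N + 1, and
  the squared norm of \<open>wt 1 \<xi>\<close> is the form <\<xi>, (N + 1) \<xi>>.\<close>

definition wt :: "nat \<Rightarrow> 'd::finite fock \<Rightarrow> 'd fock"
  where "wt s \<xi> = (\<Sum>n | fock_coeff \<xi> n \<noteq> 0. (sqrt (level n + 1) ^ s * fock_coeff \<xi> n) *\<^sub>C fock_e n)"

lemma wt_in_D [simp]: "wt s \<xi> \<in> fock_D"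
  by (simp add: wt_def)

lemma fock_coeff_wt:
  assumes "\<xi> \<in> fock_D"
  shows "fock_coeff (wt s \<xi>) n = sqrt (level n + 1) ^ s * fock_coeff \<xi> n"
  using assms by (simp add: wt_def fock_D_iff if_distrib[of "\<lambda>x. _ * x"] cong: if_cong)

lemma wt_add: "\<xi> \<in> fock_D \<Longrightarrow> \<eta> \<in> fock_D \<Longrightarrow> wt s (\<xi> + \<eta>) = wt s \<xi> + wt s \<eta>"
  and wt_diff: "\<xi> \<in> fock_D \<Longrightarrow> \<eta> \<in> fock_D \<Longrightarrow> wt s (\<xi> - \<eta>) = wt s \<xi> - wt s \<eta>"
  and wt_scaleC: "\<xi> \<in> fock_D \<Longrightarrow> wt s (c *\<^sub>C \<xi>) = c *\<^sub>C wt s \<xi>"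
  and wt_zero: "\<xi> \<in> fock_D \<Longrightarrow> wt 0 \<xi> = \<xi>"
  and wt_wt: "\<xi> \<in> fock_D \<Longrightarrow> wt s (wt t \<xi>) = wt (s + t) \<xi>"
  by (rule fock_eqI; simp add: fock_coeff_wt algebra_simps power_add)+

lemma cinner_wt_left: "\<xi> \<in> fock_D \<Longrightarrow> \<eta> \<in> fock_D \<Longrightarrow> cinner (wt s \<xi>) \<eta> = cinner \<xi> (wt s \<eta>)"
  unfolding cinner_def by (simp add: fock_coeff_wt mult_ac)

text \<open>Comparison principle for weighted shifts: annihilation and creation move coefficients
  along index maps that are injective where the coefficients do not vanish.\<close>

lemma norm_le_reindex:
  assumes inj: "inj_on f {n. fock_coeff \<xi> n \<noteq> 0}"
    and le: "\<And>n. fock_coeff \<xi> n \<noteq> 0 \<Longrightarrow> cmod (fock_coeff \<xi> n) \<le> C * cmod (fock_coeff \<eta> (f n))"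
    and C: "C \<ge> 0"
  shows "norm \<xi> \<le> C * norm \<eta>"
proof -
  have "(norm \<xi>)\<^sup>2 \<le> (C * norm \<eta>)\<^sup>2" unfolding norm_fock_sq[of \<xi>]
  proof (rule square_summable_bddI(2))
    fix F :: "('a \<Rightarrow> nat) set" assume F: "finite F"
    let ?G = "F \<inter> {n. fock_coeff \<xi> n \<noteq> 0}"
    have "(\<Sum>n\<in>F. (cmod (fock_coeff \<xi> n))\<^sup>2) = (\<Sum>n\<in>?G. (cmod (fock_coeff \<xi> n))\<^sup>2)"
      using F by (intro sum.mono_neutral_right) auto
    also have "\<dots> \<le> (\<Sum>n\<in>?G. (C * cmod (fock_coeff \<eta> (f n)))\<^sup>2)"
      by (intro sum_mono power_mono le) auto
    also have "\<dots> = C\<^sup>2 * (\<Sum>n\<in>?G. (cmod (fock_coeff \<eta> (f n)))\<^sup>2)"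
      by (simp add: power_mult_distrib sum_distrib_left)
    also have "(\<Sum>n\<in>?G. (cmod (fock_coeff \<eta> (f n)))\<^sup>2) = (\<Sum>m\<in>f ` ?G. (cmod (fock_coeff \<eta> m))\<^sup>2)"
      using inj by (subst sum.reindex) (auto intro: inj_on_subset)
    also have "C\<^sup>2 * \<dots> \<le> C\<^sup>2 * (norm \<eta>)\<^sup>2"
      using F by (intro mult_left_mono sum_fock_coeff_sq_le) auto
    finally show "(\<Sum>n\<in>F. (cmod (fock_coeff \<xi> n))\<^sup>2) \<le> (C * norm \<eta>)\<^sup>2"
      by (simp add: power_mult_distrib)
  qed
  then show ?thesis by (rule power2_le_imp_le) (use C in simp)
qed

lemma level_upd: "level (n(j := m)) + n j = level n + m"
proof -
  have "level (n(j := m)) = m + (\<Sum>i\<in>UNIV - {j}. n i)" "level n = n j + (\<Sum>i\<in>UNIV - {j}. n i)"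
    unfolding level_def by (subst sum.remove[of _ j]; simp)+
  then show ?thesis by simp
qed

lemma le_level: "n j \<le> level n"
  unfolding level_def by (rule member_le_sum) auto

lemma norm_wt_annih_le:
  assumes "\<xi> \<in> fock_D"
  shows "norm (wt s (annih j \<xi>)) \<le> norm (wt (Suc s) \<xi>)"
proof -
  have "norm (wt s (annih j \<xi>)) \<le> 1 * norm (wt (Suc s) \<xi>)"
  proof (rule norm_le_reindex[where f = "\<lambda>n. n(j := n j + 1)"])
    show "inj_on (\<lambda>n. n(j := n j + 1)) {n. fock_coeff (wt s (annih j \<xi>)) n \<noteq> 0}"
    proof (rule inj_onI)
      fix m n :: "'a \<Rightarrow> nat"
      assume "m(j := m j + 1) = n(j := n j + 1)"
      then show "m = n" by (metis add_right_cancel fun_upd_eqD fun_upd_triv fun_upd_upd)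
    qed
    fix n :: "'a \<Rightarrow> nat"
    have l: "level (n(j := n j + 1)) = level n + 1" using level_upd[of n j "n j + 1"] by simp
    have "sqrt (real (level n) + 1) ^ s \<le> sqrt (real (level n) + 2) ^ s"
      by (intro power_mono) auto
    moreover have "sqrt (real (n j) + 1) \<le> sqrt (real (level n) + 2)"
      using le_level[of n j] by simp
    ultimately have "sqrt (real (level n) + 1) ^ s * sqrt (real (n j) + 1)
        \<le> sqrt (real (level n) + 2) ^ s * sqrt (real (level n) + 2)"
      by (intro mult_mono) auto
    then have "sqrt (real (level n) + 1) ^ s * sqrt (real (n j) + 1) * cmod (fock_coeff \<xi> (n(j := n j + 1)))
        \<le> sqrt (real (level n) + 2) ^ s * sqrt (real (level n) + 2) * cmod (fock_coeff \<xi> (n(j := n j + 1)))"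
      by (rule mult_right_mono) simp
    then show "cmod (fock_coeff (wt s (annih j \<xi>)) n) \<le> 1 * cmod (fock_coeff (wt (Suc s) \<xi>) (n(j := n j + 1)))"
      using l by (simp add: fock_coeff_wt fock_coeff_annih assms norm_mult norm_power mult_ac add.commute)
  qed simp
  then show ?thesis by simp
qed

text \<open>Creation raises the particle number by one, and level + 2 <= 2 (level + 1) costs a
  factor sqrt 2 for each power of the weight.\<close>

lemma norm_wt_creat_le:
  assumes "\<xi> \<in> fock_D"
  shows "norm (wt s (creat j \<xi>)) \<le> sqrt 2 ^ s * norm (wt (Suc s) \<xi>)"
proof (rule norm_le_reindex[where f = "\<lambda>n. n(j := n j - 1)"])
  \<comment> \<open>Lowering n j is injective only where n j > 0, because subtraction is
    truncated.\<close>
  have nz: "n j \<noteq> 0" if "fock_coeff (wt s (creat j \<xi>)) n \<noteq> 0" for n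
    using that assms by (auto simp: fock_coeff_wt fock_coeff_creat)
  show "inj_on (\<lambda>n. n(j := n j - 1)) {n. fock_coeff (wt s (creat j \<xi>)) n \<noteq> 0}"
  proof (rule inj_onI)
    fix m n :: "'a \<Rightarrow> nat"
    assume *: "m(j := m j - 1) = n(j := n j - 1)"
      and "m \<in> {n. fock_coeff (wt s (creat j \<xi>)) n \<noteq> 0}" "n \<in> {n. fock_coeff (wt s (creat j \<xi>)) n \<noteq> 0}"
    then have "m j \<noteq> 0" "n j \<noteq> 0" using nz by auto
    moreover have "m j - 1 = n j - 1" using fun_cong[OF *, of j] by simp
    ultimately have "m j = n j" by simp
    then show "m = n" using * by (metis fun_upd_triv fun_upd_upd)
  qed
  fix n :: "'a \<Rightarrow> nat" assume "fock_coeff (wt s (creat j \<xi>)) n \<noteq> 0"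
  then have n: "n j \<noteq> 0" by (rule nz)
  let ?m = "n(j := n j - 1)"
  have l: "level n = level ?m + 1" using level_upd[of n j "n j - 1"] n by simp
  have "sqrt (real (level n) + 1) ^ s \<le> (sqrt 2 * sqrt (real (level ?m) + 1)) ^ s"
    unfolding real_sqrt_mult[symmetric] using l by (intro power_mono) auto
  moreover have "sqrt (real (n j)) \<le> sqrt (real (level ?m) + 1)"
    using le_level[of n j] l by simp
  ultimately have "sqrt (real (level n) + 1) ^ s * sqrt (real (n j))
      \<le> (sqrt 2 * sqrt (real (level ?m) + 1)) ^ s * sqrt (real (level ?m) + 1)"
    by (intro mult_mono) auto
  then have "sqrt (real (level n) + 1) ^ s * sqrt (real (n j)) * cmod (fock_coeff \<xi> ?m)
      \<le> (sqrt 2 * sqrt (real (level ?m) + 1)) ^ s * sqrt (real (level ?m) + 1) * cmod (fock_coeff \<xi> ?m)"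
    by (rule mult_right_mono) simp
  then show "cmod (fock_coeff (wt s (creat j \<xi>)) n) \<le> sqrt 2 ^ s * cmod (fock_coeff (wt (Suc s) \<xi>) ?m)"
    by (simp add: fock_coeff_wt fock_coeff_creat assms norm_mult norm_power power_mult_distrib mult_ac add.commute)
qed simp

section \<open>Field operators and the canonical commutation relations\<close>

text \<open>The skew-symmetric exponent B(z) of W(z). It is only real linear in z.\<close>

definition fieldop :: "complex^'d \<Rightarrow> 'd::finite fock \<Rightarrow> 'd fock"
  where "fieldop z \<xi> = (\<Sum>j\<in>UNIV. (z $ j) *\<^sub>C creat j \<xi> - cnj (z $ j) *\<^sub>C annih j \<xi>)"

lemma fieldop_in_D [simp]: "fieldop z \<xi> \<in> fock_D"
  by (simp add: fieldop_def)

lemma fieldop_add: "\<xi> \<in> fock_D \<Longrightarrow> \<eta> \<in> fock_D \<Longrightarrow> fieldop z (\<xi> + \<eta>) = fieldop z \<xi> + fieldop z \<eta>"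
  by (simp add: fieldop_def annih_add creat_add scaleC_add_right sum.distrib[symmetric] algebra_simps)

lemma fieldop_scaleC: "\<xi> \<in> fock_D \<Longrightarrow> fieldop z (c *\<^sub>C \<xi>) = c *\<^sub>C fieldop z \<xi>"
  by (simp add: fieldop_def annih_scaleC creat_scaleC scaleC_diff_right scaleC_sum_right mult.commute)

lemma fieldop_plus: "fieldop (z + w) \<xi> = fieldop z \<xi> + fieldop w \<xi>"
  by (simp add: fieldop_def sum.distrib[symmetric] scaleC_add_left algebra_simps)

lemma fieldop_minus: "fieldop (- z) \<xi> = - fieldop z \<xi>"
  by (simp add: fieldop_def scaleC_minus_left sum_negf[symmetric])

lemma fieldop_scaleR: "fieldop (r *\<^sub>R z) \<xi> = r *\<^sub>R fieldop z \<xi>"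
  by (simp add: fieldop_def scaleC_sum_right scaleC_diff_right scaleR_scaleC scaleR_conv_of_real[where 'a=complex])

lemma fieldop_0 [simp]: "fieldop 0 \<xi> = 0" "fieldop z 0 = 0"
  by (simp_all add: fieldop_def)

lemma cinner_fieldop_left:
  assumes "\<xi> \<in> fock_D" "\<eta> \<in> fock_D"
  shows "cinner (fieldop z \<xi>) \<eta> = - cinner \<xi> (fieldop z \<eta>)"
  using assms by (simp add: fieldop_def cinner_sum_left cinner_sum_right cinner_diff_left cinner_diff_right
    cinner_creat_left cinner_annih_left sum_negf[symmetric])

definition hip :: "complex^'d \<Rightarrow> complex^'d \<Rightarrow> complex"
  where "hip z w = (\<Sum>j\<in>UNIV. cnj (z $ j) * w $ j)"

text \<open>After exchanging the two summation indices the products cancel in pairs up to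
  [a_j, a_k^dagger] = delta_{jk}; the diagonal leaves conj <z, w> - <z, w> = -2 i Im <z, w>.\<close>

lemma fieldop_commute:
  assumes \<xi>: "\<xi> \<in> fock_D"
  shows "fieldop z (fieldop w \<xi>) = fieldop w (fieldop z \<xi>) + (- 2 * \<i> * Im (hip z w)) *\<^sub>C \<xi>"
proof -
  have exp: "fieldop z (fieldop w \<xi>) =
     (\<Sum>j\<in>UNIV. \<Sum>k\<in>UNIV. (z $ j * w $ k) *\<^sub>C creat j (creat k \<xi>) - (z $ j * cnj (w $ k)) *\<^sub>C creat j (annih k \<xi>)
        - (cnj (z $ j) * w $ k) *\<^sub>C annih j (creat k \<xi>) + (cnj (z $ j) * cnj (w $ k)) *\<^sub>C annih j (annih k \<xi>))" for z w
    unfolding fieldop_def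
    by (simp add: creat_sum annih_sum creat_diff annih_diff creat_scaleC annih_scaleC
        scaleC_sum_right scaleC_diff_right sum_subtractf sum.distrib algebra_simps)
  have swap: "fieldop w (fieldop z \<xi>) =
     (\<Sum>j\<in>UNIV. \<Sum>k\<in>UNIV. (w $ k * z $ j) *\<^sub>C creat k (creat j \<xi>) - (w $ k * cnj (z $ j)) *\<^sub>C creat k (annih j \<xi>)
        - (cnj (w $ k) * z $ j) *\<^sub>C annih k (creat j \<xi>) + (cnj (w $ k) * cnj (z $ j)) *\<^sub>C annih k (annih j \<xi>))"
    unfolding exp by (rule sum.swap)
  have "fieldop z (fieldop w \<xi>) - fieldop w (fieldop z \<xi>) =
     (\<Sum>j\<in>UNIV. \<Sum>k\<in>UNIV. (if j = k then (z $ j * cnj (w $ k) - cnj (z $ j) * w $ k) *\<^sub>C \<xi> else 0))"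
    unfolding exp[of z w] swap sum_subtractf[symmetric]
    by (intro sum.cong refl)
      (auto simp: annih_creat[OF \<xi>] annih_annih[OF \<xi>] creat_creat[OF \<xi>] scaleC_add_right scaleC_diff_left algebra_simps)
  also have "\<dots> = (\<Sum>j\<in>UNIV. (z $ j * cnj (w $ j) - cnj (z $ j) * w $ j) *\<^sub>C \<xi>)"
    by simp
  also have "\<dots> = (\<Sum>j\<in>UNIV. z $ j * cnj (w $ j) - cnj (z $ j) * w $ j) *\<^sub>C \<xi>"
    by (rule fock_eqI) (simp add: sum_distrib_right)
  also have "(\<Sum>j\<in>UNIV. z $ j * cnj (w $ j) - cnj (z $ j) * w $ j) = cnj (hip z w) - hip z w"
    by (simp add: hip_def sum_subtractf)
  also have "\<dots> = - 2 * \<i> * Im (hip z w)"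
    by (simp add: complex_eq_iff)
  finally show ?thesis by (simp add: algebra_simps)
qed

subsection \<open>Weyl operators\<close>

lemma fieldop_sum: "(\<And>a. a \<in> A \<Longrightarrow> f a \<in> fock_D) \<Longrightarrow> fieldop z (sum f A) = (\<Sum>a\<in>A. fieldop z (f a))"
  by (induction A rule: infinite_finite_induct) (auto simp: fieldop_add)

lemma fieldop_scaleR_vec: "\<xi> \<in> fock_D \<Longrightarrow> fieldop z (r *\<^sub>R \<xi>) = r *\<^sub>R fieldop z \<xi>"
  by (simp add: scaleR_scaleC fieldop_scaleC)

lemma fieldop_power_in_D [simp]: "v \<in> fock_D \<Longrightarrow> (fieldop z ^^ k) v \<in> fock_D"
  by (induction k) auto

lemma fieldop_power_add:
  "u \<in> fock_D \<Longrightarrow> v \<in> fock_D \<Longrightarrow> (fieldop z ^^ k) (u + v) = (fieldop z ^^ k) u + (fieldop z ^^ k) v"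
  by (induction k) (auto simp: fieldop_add)

lemma fieldop_power_scaleC:
  "u \<in> fock_D \<Longrightarrow> (fieldop z ^^ k) (c *\<^sub>C u) = c *\<^sub>C (fieldop z ^^ k) u"
  by (induction k) (auto simp: fieldop_scaleC)

section \<open>Exponential series on finite particle vectors\<close>

text \<open>Filtration by particle number: a field operator raises the degree by at most one and, on
  degree K, is bounded by a multiple of sqrt (K + 1).\<close>

definition lev :: "nat \<Rightarrow> 'd::finite fock set"
  where "lev K = {\<xi>. \<forall>n. fock_coeff \<xi> n \<noteq> 0 \<longrightarrow> level n \<le> K}"

lemma lev_in_D: "\<xi> \<in> lev K \<Longrightarrow> \<xi> \<in> fock_D"
  unfolding fock_D_iff lev_def by (rule finite_subset[OF _ finite_level[of K]]) auto

lemma fock_D_lev: "\<xi> \<in> fock_D \<Longrightarrow> \<exists>K. \<xi> \<in> lev K"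
  using finite_subset_level[of "{n. fock_coeff \<xi> n \<noteq> 0}"] by (auto simp: fock_D_iff lev_def)

lemma fieldop_lev:
  assumes "\<xi> \<in> lev K" shows "fieldop z \<xi> \<in> lev (Suc K)"
  unfolding lev_def
proof (intro CollectI allI impI)
  fix n assume "fock_coeff (fieldop z \<xi>) n \<noteq> 0"
  then have "(\<Sum>j\<in>UNIV. z $ j * fock_coeff (creat j \<xi>) n - cnj (z $ j) * fock_coeff (annih j \<xi>) n) \<noteq> 0"
    by (simp add: fieldop_def)
  then obtain j where "z $ j * fock_coeff (creat j \<xi>) n - cnj (z $ j) * fock_coeff (annih j \<xi>) n \<noteq> 0"
    by (meson sum.not_neutral_contains_not_neutral)
  then have "fock_coeff (creat j \<xi>) n \<noteq> 0 \<or> fock_coeff (annih j \<xi>) n \<noteq> 0" by auto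
  then have "(n j \<noteq> 0 \<and> fock_coeff \<xi> (n(j := n j - 1)) \<noteq> 0) \<or> fock_coeff \<xi> (n(j := n j + 1)) \<noteq> 0"
    using lev_in_D[OF assms] by (auto simp: fock_coeff_creat fock_coeff_annih)
  then have "(n j \<noteq> 0 \<and> level (n(j := n j - 1)) \<le> K) \<or> level (n(j := n j + 1)) \<le> K"
    using assms by (auto simp: lev_def)
  then show "level n \<le> Suc K"
    using level_upd[of n j "n j - 1"] level_upd[of n j "n j + 1"] by auto
qed

lemma fieldop_power_lev: "\<xi> \<in> lev K \<Longrightarrow> (fieldop z ^^ k) \<xi> \<in> lev (K + k)"
  by (induction k) (auto intro: fieldop_lev)

lemma norm_wt_lev:
  assumes "\<xi> \<in> lev K" shows "norm (wt 1 \<xi>) \<le> sqrt (K + 1) * norm \<xi>"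
proof (rule norm_le_reindex[where f = "\<lambda>n. n"])
  fix n assume "fock_coeff (wt 1 \<xi>) n \<noteq> 0"
  then have "fock_coeff \<xi> n \<noteq> 0" using lev_in_D[OF assms] by (auto simp: fock_coeff_wt)
  then have "level n \<le> K" using assms by (auto simp: lev_def)
  then show "cmod (fock_coeff (wt 1 \<xi>) n) \<le> sqrt (K + 1) * cmod (fock_coeff \<xi> n)"
    using lev_in_D[OF assms] by (auto simp: fock_coeff_wt norm_mult intro!: mult_right_mono)
qed auto

abbreviation dimc :: "'d::finite itself \<Rightarrow> real"
  where "dimc t \<equiv> 2 * real CARD('d)"

lemma norm_fieldop_le:
  fixes \<xi> :: "'d::finite fock"
  assumes "\<xi> \<in> fock_D"
  shows "norm (fieldop z \<xi>) \<le> dimc TYPE('d) * norm z * norm (wt 1 \<xi>)"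
proof -
  have c: "norm (creat j \<xi>) \<le> norm (wt 1 \<xi>)" for j
    using norm_wt_creat_le[OF assms, of 0 j] by (simp add: wt_zero)
  have a: "norm (annih j \<xi>) \<le> norm (wt 1 \<xi>)" for j
    using norm_wt_annih_le[OF assms, of 0 j] by (simp add: wt_zero)
  have "norm (fieldop z \<xi>) \<le> (\<Sum>j\<in>(UNIV :: 'd set). 2 * (norm z * norm (wt 1 \<xi>)))"
    unfolding fieldop_def
  proof (rule sum_norm_le)
    fix j
    have "norm ((z $ j) *\<^sub>C creat j \<xi> - cnj (z $ j) *\<^sub>C annih j \<xi>)
      \<le> cmod (z $ j) * norm (creat j \<xi>) + cmod (z $ j) * norm (annih j \<xi>)"
      by (rule order_trans[OF norm_triangle_ineq4]) simp
    also have "\<dots> \<le> norm z * norm (wt 1 \<xi>) + norm z * norm (wt 1 \<xi>)"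
      by (intro add_mono mult_mono c a Finite_Cartesian_Product.norm_nth_le) auto
    finally show "norm ((z $ j) *\<^sub>C creat j \<xi> - cnj (z $ j) *\<^sub>C annih j \<xi>) \<le> 2 * (norm z * norm (wt 1 \<xi>))"
      by simp
  qed
  then show ?thesis by (simp add: mult_ac)
qed

text \<open>Each application meets at most one particle more than the one before. For fixed K the
  product of the square roots is of the order of sqrt (k!) up to a power of k, slower than the k! in
  the exponential series: finite particle vectors are analytic.\<close>

lemma norm_fieldop_power_le:
  fixes v :: "'d::finite fock"
  assumes "v \<in> lev K"
  shows "norm ((fieldop z ^^ k) v) \<le> (dimc TYPE('d) * norm z) ^ k * (\<Prod>i<k. sqrt (K + i + 1)) * norm v"
proof (induction k)
  case (Suc k)
  have l: "(fieldop z ^^ k) v \<in> lev (K + k)" by (rule fieldop_power_lev[OF assms])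
  have "norm ((fieldop z ^^ Suc k) v) \<le> dimc TYPE('d) * norm z * norm (wt 1 ((fieldop z ^^ k) v))"
    using norm_fieldop_le[OF lev_in_D[OF l], of z] by simp
  also have "\<dots> \<le> dimc TYPE('d) * norm z * (sqrt (K + k + 1) * norm ((fieldop z ^^ k) v))"
    using norm_wt_lev[OF l] by (intro mult_left_mono) auto
  also have "\<dots> \<le> dimc TYPE('d) * norm z * (sqrt (K + k + 1) *
      ((dimc TYPE('d) * norm z) ^ k * (\<Prod>i<k. sqrt (K + i + 1)) * norm v))"
    by (intro mult_left_mono Suc.IH) auto
  finally show ?case by (simp add: mult_ac)
qed simp

lemma summable_weyl_bound:
  fixes x :: real
  assumes "x \<ge> 0"
  shows "summable (\<lambda>k. x ^ k * (\<Prod>i<k. sqrt (real K + real i + 1)) / fact k)"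
proof -
  \<comment> \<open>Since K + k + 1 <= (K + 1) (k + 1), this N makes the ratio x sqrt (K + k + 1) /
    (k + 1) at most 1/2 for k >= N.\<close>
  obtain N :: nat where N: "4 * x\<^sup>2 * (real K + 1) \<le> real N" using real_arch_simple by blast
  show ?thesis
  proof (rule summable_ratio_test[where c = "1/2" and N = N])
    fix k assume "k \<ge> N"
    then have "4 * x\<^sup>2 * (real K + 1) * (real k + 1) \<le> (real k + 1) * (real k + 1)"
      using N by (intro mult_right_mono) auto
    moreover have "real K + real k + 1 \<le> (real K + 1) * (real k + 1)"
      by (simp add: algebra_simps)
    then have "4 * x\<^sup>2 * (real K + real k + 1) \<le> 4 * x\<^sup>2 * ((real K + 1) * (real k + 1))"
      by (intro mult_left_mono) auto
    ultimately have "4 * x\<^sup>2 * (real K + real k + 1) \<le> (real k + 1) * (real k + 1)"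
      by (simp only: mult.assoc)
    then have "(2 * x)\<^sup>2 * (real K + real k + 1) \<le> (real k + 1)\<^sup>2"
      by (simp add: power2_eq_square mult_ac)
    then have "sqrt ((2 * x)\<^sup>2 * (real K + real k + 1)) \<le> sqrt ((real k + 1)\<^sup>2)"
      by (rule real_sqrt_le_mono)
    then have *: "x * sqrt (real K + real k + 1) \<le> 1/2 * (real k + 1)"
      using assms by (simp add: real_sqrt_mult)
    let ?p = "x ^ k * (\<Prod>i<k. sqrt (real K + real i + 1)) / fact k"
    have p: "?p \<ge> 0" using assms by (intro divide_nonneg_nonneg mult_nonneg_nonneg prod_nonneg) auto
    define A where "A = x ^ Suc k * (\<Prod>i<Suc k. sqrt (real K + real i + 1)) / fact (Suc k)"
    have "A = ?p * (x * sqrt (real K + real k + 1) / (real k + 1))"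
      by (simp add: A_def field_simps)
    also have "\<dots> \<le> ?p * (1/2)"
      using * by (intro mult_left_mono p) (simp add: field_simps)
    finally have "A \<le> 1/2 * ?p" by (simp only: mult.commute)
    moreover have "A \<ge> 0" unfolding A_def
      using assms by (intro divide_nonneg_nonneg mult_nonneg_nonneg prod_nonneg) auto
    ultimately show "norm (x ^ Suc k * (\<Prod>i<Suc k. sqrt (real K + real i + 1)) / fact (Suc k))
      \<le> 1/2 * norm ?p"
      unfolding real_norm_def abs_of_nonneg[OF p] A_def[symmetric] by simp
  qed simp
qed

definition weyl_term :: "complex^'d \<Rightarrow> 'd::finite fock \<Rightarrow> nat \<Rightarrow> 'd fock"
  where "weyl_term z v k = (1 / fact k) *\<^sub>R (fieldop z ^^ k) v"

definition weyl_vec :: "complex^'d \<Rightarrow> 'd::finite fock \<Rightarrow> 'd fock"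
  where "weyl_vec z v = (\<Sum>k. weyl_term z v k)"

lemma norm_weyl_term_le:
  fixes v :: "'d::finite fock"
  assumes "v \<in> lev K"
  shows "norm (weyl_term z v k) \<le> (dimc TYPE('d) * norm z) ^ k * (\<Prod>i<k. sqrt (real K + real i + 1)) / fact k * norm v"
proof -
  have "norm (weyl_term z v k) = norm ((fieldop z ^^ k) v) / fact k"
    by (simp add: weyl_term_def)
  also have "\<dots> \<le> ((dimc TYPE('d) * norm z) ^ k * (\<Prod>i<k. sqrt (real K + real i + 1)) * norm v) / fact k"
    using norm_fieldop_power_le[OF assms, where z = z and k = k] by (intro divide_right_mono) (auto simp: add_ac)
  finally show ?thesis by simp
qed

lemma summable_norm_weyl_term:
  fixes v :: "'d::finite fock"
  assumes "v \<in> fock_D"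
  shows "summable (\<lambda>k. norm (weyl_term z v k))"
proof -
  obtain K where "v \<in> lev K" using fock_D_lev[OF assms] by blast
  then show ?thesis
    by (intro summable_comparison_test[OF _ summable_mult2[OF summable_weyl_bound[of "dimc TYPE('d) * norm z" K]], of _ "norm v"]
        exI[of _ 0] allI impI) (use norm_weyl_term_le in auto)
qed

lemma summable_weyl_term: "v \<in> fock_D \<Longrightarrow> summable (weyl_term z v)"
  by (rule summable_norm_cancel) (rule summable_norm_weyl_term)

lemma weyl_vec_add: "u \<in> fock_D \<Longrightarrow> v \<in> fock_D \<Longrightarrow> weyl_vec z (u + v) = weyl_vec z u + weyl_vec z v"
  unfolding weyl_vec_def
  by (subst suminf_add[OF summable_weyl_term summable_weyl_term])
    (auto simp: weyl_term_def fieldop_power_add scaleR_add_right intro!: arg_cong[of _ _ suminf])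

lemma weyl_vec_scaleC: "u \<in> fock_D \<Longrightarrow> weyl_vec z (c *\<^sub>C u) = c *\<^sub>C weyl_vec z u"
  unfolding weyl_vec_def
  by (subst bounded_linear.suminf[OF bounded_linear_scaleC summable_weyl_term])
    (auto simp: weyl_term_def fieldop_power_scaleC scaleR_scaleC_commute intro!: arg_cong[of _ _ suminf])

lemma weyl_vec_0 [simp]: "weyl_vec 0 v = v"
proof -
  have "(fieldop 0 ^^ k) v = (if k = 0 then v else 0)" for k
    by (cases k) auto
  then have "weyl_term 0 v k = (if k = 0 then v else 0)" for k by (simp add: weyl_term_def)
  then have "(\<Sum>k. weyl_term 0 v k) = (\<Sum>k\<in>{0}. weyl_term 0 v k)" by (intro suminf_finite) auto
  then show ?thesis by (simp add: weyl_vec_def weyl_term_def)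
qed

text \<open>The dependence on z is split off as a power of its norm, with b independent of z, so
  that remainders of the series are uniform in z.\<close>

lemma weyl_term_bound:
  fixes v :: "'d::finite fock"
  assumes "v \<in> fock_D"
  obtains b :: "nat \<Rightarrow> real" where "summable b" "\<And>k. b k \<ge> 0"
    "\<And>z k. norm (weyl_term z v k) \<le> norm z ^ k * b k"
proof -
  obtain K where K: "v \<in> lev K" using fock_D_lev[OF assms] by blast
  define b where "b k = dimc TYPE('d) ^ k * (\<Prod>i<k. sqrt (real K + real i + 1)) / fact k * norm v" for k
  show ?thesis
  proof (rule that)
    show "summable b" unfolding b_def by (intro summable_mult2 summable_weyl_bound) simp
    show "b k \<ge> 0" for k unfolding b_def by (intro mult_nonneg_nonneg divide_nonneg_nonneg prod_nonneg) auto
    show "norm (weyl_term z v k) \<le> norm z ^ k * b k" for z k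
      using norm_weyl_term_le[OF K, where z = z and k = k] by (simp add: b_def power_mult_distrib mult_ac)
  qed
qed

text \<open>Removing the terms of order 0 and 1 leaves a common factor norm z squared as long as
  norm z <= 1. Differentiability of W at 0 rests on this.\<close>

lemma weyl_vec_approx:
  fixes v :: "'d::finite fock"
  assumes "v \<in> fock_D"
  shows "\<exists>C\<ge>0. \<forall>z. norm z \<le> 1 \<longrightarrow> norm (weyl_vec z v - v - fieldop z v) \<le> C * (norm z)\<^sup>2"
proof -
  obtain b where b: "summable b" "\<And>k. b k \<ge> 0"
    "\<And>z k. norm (weyl_term z v k) \<le> norm z ^ k * b k" using weyl_term_bound[OF assms] by blast
  have sb: "summable (\<lambda>k. b (k + 2))" using b(1) by (subst summable_iff_shift)
  show ?thesis
  proof (intro exI[of _ "\<Sum>k. b (k + 2)"] conjI allI impI)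
    show "0 \<le> (\<Sum>k. b (k + 2))" by (rule suminf_nonneg[OF sb b(2)])
    fix z :: "complex^'d" assume z: "norm z \<le> 1"
    have "weyl_vec z v - v - fieldop z v = (\<Sum>k. weyl_term z v (k + 2))"
      unfolding weyl_vec_def suminf_split_initial_segment[OF summable_weyl_term[OF assms], of z 2]
      by (simp add: numeral_2_eq_2 weyl_term_def)
    also have "norm \<dots> \<le> (\<Sum>k. (norm z)\<^sup>2 * b (k + 2))"
    proof (rule norm_suminf_le[OF _ summable_mult[OF sb]])
      fix k
      have "norm (weyl_term z v (k + 2)) \<le> norm z ^ (k + 2) * b (k + 2)" by (rule b(3))
      also have "\<dots> \<le> (norm z)\<^sup>2 * b (k + 2)"
        using power_decreasing[of 2 "k + 2" "norm z"] z by (intro mult_right_mono b) auto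
      finally show "norm (weyl_term z v (k + 2)) \<le> (norm z)\<^sup>2 * b (k + 2)" .
    qed
    also have "\<dots> = (norm z)\<^sup>2 * (\<Sum>k. b (k + 2))" by (rule suminf_mult[OF sb])
    finally show "norm (weyl_vec z v - v - fieldop z v) \<le> (\<Sum>k. b (k + 2)) * (norm z)\<^sup>2"
      by (simp add: mult.commute)
  qed
qed

section \<open>Weyl relations from the exponential series\<close>

text \<open>The sum of an exponential series leaves \<open>fock_D\<close>, so a second exponential
  series cannot be applied to it. Pairing two series and sorting by total degree replaces the
  product of the exponentials.\<close>

lemma cinner_suminf_Cauchy:
  fixes x y :: "nat \<Rightarrow> 'd::finite fock"
  assumes x: "summable (\<lambda>k. norm (x k))" and y: "summable (\<lambda>k. norm (y k))"
  shows "(\<lambda>n. \<Sum>i\<le>n. cinner (x i) (y (n - i))) sums cinner (suminf x) (suminf y)"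
proof -
  define f where "f = (\<lambda>(i, j). cinner (x i) (y j))"
  have hx: "(x has_sum suminf x) UNIV" and hy: "(y has_sum suminf y) UNIV"
    using norm_summable_imp_has_sum[OF x] norm_summable_imp_has_sum[OF y]
      summable_sums[OF summable_norm_cancel[OF x]] summable_sums[OF summable_norm_cancel[OF y]] by auto
  have nx: "(\<lambda>k. norm (x k)) summable_on UNIV" and ny: "(\<lambda>k. norm (y k)) summable_on UNIV"
    using summable_nonneg_imp_summable_on[OF x] summable_nonneg_imp_summable_on[OF y] by auto
  define g where "g p = norm (x (fst p)) * norm (y (snd p))" for p
  have "(\<lambda>p. norm (g p)) summable_on (SIGMA i:UNIV. UNIV)"
    unfolding Infinite_Sum.abs_summable_on_Sigma_iff
    by (auto simp: g_def norm_mult abs_mult infsum_cmult_right' infsum_nonneg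
        intro!: summable_on_cmult_right summable_on_cmult_left nx ny)
  then have "(\<lambda>p. norm (f p)) summable_on (SIGMA i:UNIV. UNIV)"
    by (rule Infinite_Sum.abs_summable_on_comparison_test') (auto simp: f_def g_def cmod_cinner_le)
  then have "f summable_on (SIGMA i:UNIV. UNIV)" by (rule abs_summable_summable)
  then obtain S where S: "(f has_sum S) (SIGMA i:UNIV. UNIV)" by (auto simp: summable_on_def)
  have "((\<lambda>i. cinner (x i) (suminf y)) has_sum S) UNIV"
    by (rule has_sum_SigmaD[OF S])
      (use has_sum_bounded_linear[OF bounded_bilinear.bounded_linear_right[OF bounded_bilinear_cinner] hy] in \<open>simp add: f_def\<close>)
  moreover have "((\<lambda>i. cinner (x i) (suminf y)) has_sum cinner (suminf x) (suminf y)) UNIV"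
    using has_sum_bounded_linear[OF bounded_bilinear.bounded_linear_left[OF bounded_bilinear_cinner] hx] by simp
  ultimately have Seq: "S = cinner (suminf x) (suminf y)" by (rule has_sum_unique)
  have "((\<lambda>(n, i). f (i, n - i)) has_sum S) (SIGMA n:UNIV. {..n})"
    using S by (subst has_sum_reindex_bij_witness[of _ "\<lambda>(i, j). (i + j, i)" "\<lambda>(n, i). (i, n - i)"]) auto
  then have "((\<lambda>n. \<Sum>i\<le>n. cinner (x i) (y (n - i))) has_sum S) UNIV"
    by (rule has_sum_SigmaD) (simp add: f_def has_sum_finite)
  then show ?thesis unfolding Seq by (rule has_sum_imp_sums)
qed

text \<open>
  The homogeneous parts of \<open>e\<^sup>X e\<^sup>Y\<close> and of \<open>e\<^sup>c\<^sup>/\<^sup>2 e\<^sup>X\<^sup>+\<^sup>Y\<close>, where \<open>[X, Y] = c\<close>, obey the same recursion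
  \<open>(n + 1) P\<^sub>n\<^sub>+\<^sub>1 = (X + Y) P\<^sub>n + c P\<^sub>n\<^sub>-\<^sub>1\<close>.
\<close>

lemma fieldop_power_commute:
  assumes v: "v \<in> fock_D" and c: "c = - 2 * \<i> * Im (hip x y)"
  shows "(fieldop x ^^ j) (fieldop y v) = fieldop y ((fieldop x ^^ j) v) + (of_nat j * c) *\<^sub>C (fieldop x ^^ (j - 1)) v"
proof (induction j)
  case (Suc j)
  have "(fieldop x ^^ Suc j) (fieldop y v)
    = fieldop x (fieldop y ((fieldop x ^^ j) v)) + (of_nat j * c) *\<^sub>C fieldop x ((fieldop x ^^ (j - 1)) v)"
    using v by (simp add: Suc fieldop_add fieldop_scaleC)
  also have "fieldop x (fieldop y ((fieldop x ^^ j) v)) = fieldop y ((fieldop x ^^ Suc j) v) + c *\<^sub>C (fieldop x ^^ j) v"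
    using fieldop_commute[of "(fieldop x ^^ j) v" x y] v c by simp
  also have "(of_nat j * c) *\<^sub>C fieldop x ((fieldop x ^^ (j - 1)) v) = (of_nat j * c) *\<^sub>C (fieldop x ^^ j) v"
    by (cases j) auto
  finally show ?case by (simp add: scaleC_add_left[symmetric] algebra_simps)
qed simp

definition bch_left :: "complex^'d \<Rightarrow> complex^'d \<Rightarrow> 'd::finite fock \<Rightarrow> nat \<Rightarrow> 'd fock"
  where "bch_left x y v n = (\<Sum>j\<le>n. (1 / (fact j * fact (n - j))) *\<^sub>R (fieldop x ^^ j) ((fieldop y ^^ (n - j)) v))"

text \<open>Coefficient of s^m in exp (c s^2 / 2): a commutator counts with degree two.\<close>

definition bch_coeff :: "complex \<Rightarrow> nat \<Rightarrow> complex"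
  where "bch_coeff c m = (if even m then (c/2) ^ (m div 2) / fact (m div 2) else 0)"

definition bch_right :: "complex \<Rightarrow> complex^'d \<Rightarrow> 'd::finite fock \<Rightarrow> nat \<Rightarrow> 'd fock"
  where "bch_right c z v n = (\<Sum>m\<le>n. bch_coeff c m *\<^sub>C weyl_term z v (n - m))"

lemma bch_left_rec:
  assumes v: "v \<in> fock_D" and c: "c = - 2 * \<i> * Im (hip x y)"
  shows "real (Suc n) *\<^sub>R bch_left x y v (Suc n) =
    fieldop (x + y) (bch_left x y v n) + (if n = 0 then 0 else c *\<^sub>C bch_left x y v (n - 1))"
proof -
  define q where "q j k = (fieldop x ^^ j) ((fieldop y ^^ k) v)" for j k
  define w where "w j k = 1 / (fact j * fact k :: real)" for j k
  have qD: "q j k \<in> fock_D" for j k using v by (simp add: q_def)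
  have wS: "real (Suc j) * w (Suc j) k = w j k" "real (Suc k) * w j (Suc k) = w j k" for j k
    by (simp_all add: w_def field_simps del: of_nat_Suc) 
  have L: "bch_left x y v n = (\<Sum>j\<le>n. w j (n - j) *\<^sub>R q j (n - j))" for n
    by (simp add: bch_left_def q_def w_def)
  have qx: "fieldop x (q j k) = q (Suc j) k" for j k by (simp add: q_def)
  have qy: "fieldop y (q j k) = q j (Suc k) - (of_nat j * c) *\<^sub>C q (j - 1) k" for j k
    using fieldop_power_commute[of "(fieldop y ^^ k) v" c x y j] v c by (simp add: q_def)
  \<comment> \<open>The factor n + 1 is split as j + (n + 1 - j). The first share strips one x off
    the left; the second strips one y, which has to be moved to the left through x^j and thereby
    produces the commutator term.\<close>
  have "real (Suc n) *\<^sub>R bch_left x y v (Suc n)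
    = (\<Sum>j\<le>Suc n. (real j * w j (Suc n - j)) *\<^sub>R q j (Suc n - j))
      + (\<Sum>j\<le>Suc n. (real (Suc n - j) * w j (Suc n - j)) *\<^sub>R q j (Suc n - j))"
    unfolding L scaleR_sum_right sum.distrib[symmetric]
    by (intro sum.cong refl) (simp add: scaleR_add_left[symmetric] distrib_right[symmetric] of_nat_diff)
  also have "(\<Sum>j\<le>Suc n. (real j * w j (Suc n - j)) *\<^sub>R q j (Suc n - j))
    = (\<Sum>j\<le>n. w j (n - j) *\<^sub>R q (Suc j) (n - j))"
    by (subst sum.atMost_Suc_shift) (simp add: wS del: of_nat_Suc)
  also have "(\<Sum>j\<le>Suc n. (real (Suc n - j) * w j (Suc n - j)) *\<^sub>R q j (Suc n - j))
    = (\<Sum>j\<le>n. w j (n - j) *\<^sub>R q j (Suc (n - j)))"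
    by (subst sum.atMost_Suc) (auto intro!: sum.cong simp: Suc_diff_le wS simp del: of_nat_Suc)
  also have "(\<Sum>j\<le>n. w j (n - j) *\<^sub>R q (Suc j) (n - j)) = fieldop x (bch_left x y v n)"
    by (simp add: L fieldop_sum fieldop_scaleR_vec qD qx)
  also have "(\<Sum>j\<le>n. w j (n - j) *\<^sub>R q j (Suc (n - j)))
    = fieldop y (bch_left x y v n) + (\<Sum>j\<le>n. (real j * w j (n - j)) *\<^sub>R (c *\<^sub>C q (j - 1) (n - j)))"
  proof -
    have "w j (n - j) *\<^sub>R q j (Suc (n - j)) = fieldop y (w j (n - j) *\<^sub>R q j (n - j))
      + (real j * w j (n - j)) *\<^sub>R (c *\<^sub>C q (j - 1) (n - j))" for j
      unfolding fieldop_scaleR_vec[OF qD] qy by (simp add: scaleC_diff_right scaleR_scaleC mult_ac)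
    then show ?thesis by (simp add: L fieldop_sum qD sum.distrib[symmetric])
  qed
  also have "(\<Sum>j\<le>n. (real j * w j (n - j)) *\<^sub>R (c *\<^sub>C q (j - 1) (n - j)))
    = (if n = 0 then 0 else c *\<^sub>C bch_left x y v (n - 1))"
  proof (cases n)
    case (Suc m)
    show ?thesis unfolding Suc
      by (subst sum.atMost_Suc_shift)
        (simp add: L scaleC_sum_right scaleR_scaleC_commute wS del: of_nat_Suc)
  qed simp
  finally show ?thesis by (simp add: fieldop_plus algebra_simps)
qed

lemma bch_coeff_rec:
  "bch_coeff c 0 = 1" "bch_coeff c (Suc 0) = 0"
  "of_nat (Suc (Suc m)) * bch_coeff c (Suc (Suc m)) = c * bch_coeff c m"
proof -
  show "of_nat (Suc (Suc m)) * bch_coeff c (Suc (Suc m)) = c * bch_coeff c m"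
  proof (cases "even m")
    case True
    then obtain k where k: "m = 2 * k" by blast
    have "2 * a * ((c/2) * p / (a * f)) = c * (p / f)" if "a \<noteq> 0" for a p f :: complex
      using that by simp
    from this[OF of_nat_neq_0, of k "(c/2) ^ k" "fact k"]
    have "of_nat (2 * Suc k) * ((c/2) ^ Suc k / fact (Suc k)) = c * ((c/2) ^ k / fact k)"
      by (simp only: of_nat_mult of_nat_numeral power_Suc fact_Suc)
    then show ?thesis by (simp add: bch_coeff_def k)
  qed (simp add: bch_coeff_def)
qed (simp_all add: bch_coeff_def)

lemma weyl_term_in_D [simp]: "v \<in> fock_D \<Longrightarrow> weyl_term z v k \<in> fock_D"
  by (simp add: weyl_term_def)

lemma weyl_term_rec:
  assumes "v \<in> fock_D"
  shows "real k *\<^sub>R weyl_term z v k = (if k = 0 then 0 else fieldop z (weyl_term z v (k - 1)))"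
proof (cases k)
  case (Suc m)
  have "real (Suc m) * (1 / fact (Suc m)) = 1 / fact m" by (simp add: field_simps del: of_nat_Suc)
  then show ?thesis using assms unfolding Suc by (simp add: weyl_term_def fieldop_scaleR_vec del: of_nat_Suc fact_Suc)
qed simp

lemma bch_right_rec:
  assumes v: "v \<in> fock_D"
  shows "real (Suc n) *\<^sub>R bch_right c z v (Suc n) =
    fieldop z (bch_right c z v n) + (if n = 0 then 0 else c *\<^sub>C bch_right c z v (n - 1))"
proof -
  have "real (Suc n) *\<^sub>R bch_right c z v (Suc n)
    = (\<Sum>m\<le>Suc n. (of_nat m * bch_coeff c m) *\<^sub>C weyl_term z v (Suc n - m))
      + (\<Sum>m\<le>Suc n. bch_coeff c m *\<^sub>C (real (Suc n - m) *\<^sub>R weyl_term z v (Suc n - m)))"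
    unfolding bch_right_def scaleR_sum_right sum.distrib[symmetric]
    by (intro sum.cong refl)
      (simp add: scaleR_scaleC scaleC_add_left[symmetric] of_nat_diff algebra_simps)
  also have "(\<Sum>m\<le>Suc n. bch_coeff c m *\<^sub>C (real (Suc n - m) *\<^sub>R weyl_term z v (Suc n - m)))
    = (\<Sum>m\<le>n. bch_coeff c m *\<^sub>C fieldop z (weyl_term z v (n - m)))"
    using v by (subst sum.atMost_Suc) (auto intro!: sum.cong simp: weyl_term_rec Suc_diff_le simp del: of_nat_Suc)
  also have "\<dots> = fieldop z (bch_right c z v n)"
    using v by (simp add: bch_right_def fieldop_sum fieldop_scaleC)
  also have "(\<Sum>m\<le>Suc n. (of_nat m * bch_coeff c m) *\<^sub>C weyl_term z v (Suc n - m))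
    = (if n = 0 then 0 else c *\<^sub>C bch_right c z v (n - 1))"
  proof (cases n)
    case (Suc k)
    show ?thesis unfolding Suc
      by (subst sum.atMost_Suc_shift, subst sum.atMost_Suc_shift)
        (simp add: bch_coeff_rec bch_right_def scaleC_sum_right del: of_nat_Suc)
  qed (simp add: bch_coeff_rec)
  finally show ?thesis by (simp add: add.commute)
qed

lemma bch_left_eq_right:
  assumes v: "v \<in> fock_D" and c: "c = - 2 * \<i> * Im (hip x y)"
  shows "bch_left x y v n = bch_right c (x + y) v n"
proof (induction n rule: less_induct)
  case (less n)
  show ?case
  proof (cases n)
    case 0
    then show ?thesis by (simp add: bch_left_def bch_right_def bch_coeff_rec weyl_term_def)
  next
    case (Suc m)
    have "real (Suc m) *\<^sub>R bch_left x y v (Suc m) = real (Suc m) *\<^sub>R bch_right c (x + y) v (Suc m)"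
      unfolding bch_left_rec[OF v c] bch_right_rec[OF v]
      using less[of m] less[of "m - 1"] Suc by auto
    then show ?thesis using Suc by simp
  qed
qed

lemma cinner_fieldop_power_left:
  assumes "u \<in> fock_D" "v \<in> fock_D"
  shows "cinner ((fieldop z ^^ j) u) v = cinner u ((fieldop (- z) ^^ j) v)"
  using assms(2)
proof (induction j arbitrary: v)
  case (Suc j)
  have "cinner ((fieldop z ^^ Suc j) u) v = cinner ((fieldop z ^^ j) u) (fieldop (- z) v)"
    using assms(1) Suc.prems by (simp add: cinner_fieldop_left fieldop_minus)
  also have "\<dots> = cinner u ((fieldop (- z) ^^ j) (fieldop (- z) v))"
    by (rule Suc.IH) simp
  finally show ?case by (simp add: funpow_swap1)
qed simp

lemma sums_bch_coeff: "bch_coeff c sums exp (c / 2)"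
proof -
  have "(\<lambda>n. (c/2) ^ n /\<^sub>R fact n) sums exp (c/2)" by (rule exp_converges)
  moreover have "(c/2) ^ n /\<^sub>R fact n = bch_coeff c (2 * n)" for n
    by (simp add: bch_coeff_def scaleR_conv_of_real field_simps)
  ultimately have "(\<lambda>n. bch_coeff c (2 * n)) sums exp (c/2)"
    by simp
  moreover have "(\<lambda>n. bch_coeff c (2 * n)) sums exp (c/2) \<longleftrightarrow> bch_coeff c sums exp (c/2)"
  proof (rule sums_mono_reindex)
    fix n :: nat assume "n \<notin> range ((*) 2)"
    then have "odd n" by (metis evenE rangeI)
    then show "bch_coeff c n = 0" by (simp add: bch_coeff_def)
  qed (simp add: strict_mono_def)
  ultimately show ?thesis by simp
qed

lemma summable_norm_bch_coeff: "summable (\<lambda>m. norm (bch_coeff c m))"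
proof -
  have "norm (bch_coeff c m) = Re (bch_coeff (of_real (cmod c)) m)" for m
  proof -
    have "(complex_of_real (cmod c) / 2) ^ k / fact k = complex_of_real ((cmod c / 2) ^ k / fact k)" for k
      by simp
    then show ?thesis
      unfolding bch_coeff_def by (simp only: Re_complex_of_real norm_divide norm_power split: if_split) simp
  qed
  then show ?thesis using sums_summable[OF sums_Re[OF sums_bch_coeff[of "of_real (cmod c)"]]] by simp
qed

lemma hip_add_left: "hip (x + y) z = hip x z + hip y z"
  and hip_add_right: "hip z (x + y) = hip z x + hip z y"
  and hip_minus_left [simp]: "hip (- x) z = - hip x z"
  and hip_minus_right [simp]: "hip z (- x) = - hip z x"
  and hip_scaleR_left [simp]: "hip (r *\<^sub>R x) z = r * hip x z"
  and hip_scaleR_right [simp]: "hip z (r *\<^sub>R x) = r * hip z x"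
  and hip_0 [simp]: "hip 0 z = 0" "hip z 0 = 0"
  by (simp_all add: hip_def sum.distrib[symmetric] sum_negf[symmetric] sum_distrib_left algebra_simps scaleR_conv_of_real[where 'a = complex])

lemma hip_commute: "hip z w = cnj (hip w z)"
  by (simp add: hip_def mult.commute)

lemma Im_hip_self [simp]: "Im (hip z z) = 0"
  by (simp add: hip_def)

text \<open>By skew symmetry the powers of B(x) move to the right as powers of B(-x), so the part of
  degree n is the n-th homogeneous part of e^{-B(x)} e^{B(y)}. Resummation gives the Weyl relation
  in weak form; x = y gives isometry.\<close>

lemma cinner_weyl_vec:
  assumes u: "u \<in> fock_D" and v: "v \<in> fock_D"
  shows "cinner (weyl_vec x u) (weyl_vec y v) = exp (\<i> * Im (hip x y)) * cinner u (weyl_vec (y - x) v)"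
proof -
  define c where "c = - 2 * \<i> * Im (hip (- x) y)"
  have c2: "c / 2 = \<i> * Im (hip x y)" by (simp add: c_def)
  have "(\<lambda>n. \<Sum>i\<le>n. cinner (weyl_term x u i) (weyl_term y v (n - i))) sums cinner (weyl_vec x u) (weyl_vec y v)"
    unfolding weyl_vec_def by (intro cinner_suminf_Cauchy summable_norm_weyl_term u v)
  also have "(\<lambda>n. \<Sum>i\<le>n. cinner (weyl_term x u i) (weyl_term y v (n - i))) = (\<lambda>n. cinner u (bch_left (- x) y v n))"
    by (rule ext) (simp add: weyl_term_def bch_left_def cinner_sum_right cinner_fieldop_power_left u v mult.commute)
  also have "\<dots> = (\<lambda>n. \<Sum>m\<le>n. bch_coeff c m * cinner u (weyl_term (y - x) v (n - m)))"
    by (rule ext) (simp add: bch_left_eq_right[OF v c_def] bch_right_def cinner_sum_right)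
  finally have s1: "(\<lambda>n. \<Sum>m\<le>n. bch_coeff c m * cinner u (weyl_term (y - x) v (n - m)))
    sums cinner (weyl_vec x u) (weyl_vec y v)" .
  have sn: "summable (\<lambda>k. norm (cinner u (weyl_term (y - x) v k)))"
    by (rule summable_comparison_test[OF _ summable_mult[OF summable_norm_weyl_term[OF v, of "y - x"], of "norm u"]])
      (auto intro!: exI[of _ 0] cmod_cinner_le)
  have "(\<lambda>n. \<Sum>m\<le>n. bch_coeff c m * cinner u (weyl_term (y - x) v (n - m))) sums
     ((\<Sum>m. bch_coeff c m) * (\<Sum>k. cinner u (weyl_term (y - x) v k)))"
    by (rule Cauchy_product_sums[OF summable_norm_bch_coeff sn])
  also have "(\<Sum>m. bch_coeff c m) = exp (c / 2)" using sums_bch_coeff by (rule sums_unique[symmetric])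
  also have "(\<Sum>k. cinner u (weyl_term (y - x) v k)) = cinner u (weyl_vec (y - x) v)"
    unfolding weyl_vec_def
    by (rule bounded_linear.suminf[OF bounded_bilinear.bounded_linear_right[OF bounded_bilinear_cinner] summable_weyl_term[OF v], symmetric])
  finally show ?thesis using s1 unfolding c2 by (rule sums_unique2[rotated])
qed

lemma norm_weyl_vec: "v \<in> fock_D \<Longrightarrow> norm (weyl_vec z v) = norm v"
  using cinner_weyl_vec[of v v z z]
  by (simp add: cinner_self power2_eq_iff_nonneg del: of_real_power)

text \<open>W(z) is taken as the adjoint of the isometry \<open>weyl_vec (- z)\<close> on
  \<open>fock_D\<close>; this yields a bounded operator on the whole space, which agrees with the
  exponential series on \<open>fock_D\<close>.\<close>

definition weyl :: "complex^'d \<Rightarrow> 'd::finite op"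
  where "weyl z = (SOME y. y \<in> BH \<and> norm y \<le> 1 \<and> (\<forall>\<xi>. \<forall>v\<in>fock_D. cinner (y \<xi>) v = cinner \<xi> (weyl_vec (- z) v)))"

lemma weyl_props:
  shows weyl_BH [simp]: "weyl z \<in> BH" and norm_weyl: "norm (weyl z) \<le> 1"
    and cinner_weyl_D: "v \<in> fock_D \<Longrightarrow> cinner (weyl z \<xi>) v = cinner \<xi> (weyl_vec (- z) v)"
proof -
  have "\<exists>y. y \<in> BH \<and> norm y \<le> 1 \<and> (\<forall>\<xi>. \<forall>v\<in>fock_D. cinner (y \<xi>) v = cinner \<xi> (weyl_vec (- z) v))"
    using ex_adjoint[of "weyl_vec (- z)" 1] by (auto simp: weyl_vec_add weyl_vec_scaleC norm_weyl_vec)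
  from someI_ex[OF this] show "weyl z \<in> BH" "norm (weyl z) \<le> 1"
    "v \<in> fock_D \<Longrightarrow> cinner (weyl z \<xi>) v = cinner \<xi> (weyl_vec (- z) v)"
    unfolding weyl_def[symmetric] by auto
qed

lemma weyl_vec:
  assumes "v \<in> fock_D" shows "weyl z v = weyl_vec z v"
proof (rule cinner_eqI_D)
  fix u :: "'a fock" assume u: "u \<in> fock_D"
  have "cinner u (weyl z v) = cnj (cinner (weyl z v) u)" by (rule cinner_commute)
  also have "\<dots> = cnj (cinner v (weyl_vec (- z) u))" using cinner_weyl_D[OF u] by simp
  also have "\<dots> = cinner (weyl_vec (- z) u) v" by (rule cinner_commute[symmetric])
  also have "\<dots> = cinner u (weyl_vec z v)" using cinner_weyl_vec[OF u assms, of "- z" 0] by simp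
  finally show "cinner u (weyl z v) = cinner u (weyl_vec z v)" .
qed

lemma cinner_weyl_left: "cinner (weyl z \<xi>) \<eta> = cinner \<xi> (weyl (- z) \<eta>)"
  by (rule fock_D_dense_eqI[of "\<lambda>\<eta>. cinner (weyl z \<xi>) \<eta>"])
    (auto intro!: continuous_intros simp: cinner_weyl_D weyl_vec)

lemma weyl_weyl_D:
  assumes "v \<in> fock_D"
  shows "weyl x (weyl y v) = exp (- \<i> * Im (hip x y)) *\<^sub>C weyl (x + y) v"
proof (rule cinner_eqI_D)
  fix u :: "'a fock" assume u: "u \<in> fock_D"
  have "cinner u (weyl x (weyl y v)) = cinner (weyl (- x) u) (weyl y v)"
    using cinner_weyl_left[of "- x" u "weyl y v"] by simp
  also have "\<dots> = exp (- \<i> * Im (hip x y)) * cinner u (weyl (x + y) v)"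
    using u assms by (simp add: weyl_vec cinner_weyl_vec add.commute)
  finally show "cinner u (weyl x (weyl y v)) = cinner u (exp (- \<i> * Im (hip x y)) *\<^sub>C weyl (x + y) v)" by simp
qed

lemma weyl_weyl: "weyl x (weyl y \<xi>) = exp (- \<i> * Im (hip x y)) *\<^sub>C weyl (x + y) \<xi>"
  by (rule fock_D_dense_eqI[of "\<lambda>\<xi>. weyl x (weyl y \<xi>)"])
    (auto intro!: continuous_intros bounded_linear.continuous_on[OF bounded_linear_scaleC] simp: weyl_weyl_D)

lemma weyl_0 [simp]: "weyl 0 \<xi> = \<xi>"
  by (rule fock_D_dense_eqI[of "\<lambda>\<xi>. weyl 0 \<xi>"])
    (auto intro!: continuous_intros simp: weyl_vec)

lemma weyl_inverse: "weyl (- z) (weyl z \<xi>) = \<xi>" "weyl z (weyl (- z) \<xi>) = \<xi>"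
  by (simp_all add: weyl_weyl)

lemma norm_weyl_apply [simp]: "norm (weyl z \<xi>) = norm \<xi>"
proof -
  have "cinner (weyl z \<xi>) (weyl z \<xi>) = cinner \<xi> \<xi>"
    by (simp add: cinner_weyl_left weyl_inverse)
  then show ?thesis by (simp add: cinner_self power2_eq_iff_nonneg del: of_real_power)
qed

subsection \<open>Differentiation of Weyl operators\<close>

lemma has_derivative_quadratic:
  fixes f :: "'a::real_normed_vector \<Rightarrow> 'b::real_normed_vector"
  assumes bl: "bounded_linear D" and C: "C \<ge> 0"
    and le: "\<And>h. norm h \<le> 1 \<Longrightarrow> norm (f (x + h) - f x - D h) \<le> C * (norm h)\<^sup>2"
  shows "(f has_derivative D) (at x)"
  unfolding has_derivative_at
proof (intro conjI bl)
  have "((\<lambda>h. norm (f (x + h) - f x - D h) / norm h) \<longlongrightarrow> 0) (at 0)"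
  proof (rule tendsto_sandwich[OF _ _ tendsto_const, where h = "\<lambda>h. C * norm h"])
    show "\<forall>\<^sub>F h in at 0. norm (f (x + h) - f x - D h) / norm h \<le> C * norm h"
      unfolding eventually_at
    proof (intro exI[of _ 1] conjI ballI impI)
      fix h :: 'a assume "h \<noteq> 0 \<and> dist h 0 < 1"
      then show "norm (f (x + h) - f x - D h) / norm h \<le> C * norm h"
        using le[of h] by (simp add: divide_le_eq power2_eq_square mult.assoc)
    qed simp
    show "((\<lambda>h. C * norm h) \<longlongrightarrow> 0) (at (0::'a))"
      by (intro tendsto_mult_right_zero tendsto_norm_zero tendsto_ident_at)
  qed (simp add: eventually_at_filter)
  then show "(\<lambda>h. norm (f (x + h) - f x - D h) / norm h) \<midarrow>0\<rightarrow> 0" .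
qed

lemma bounded_linear_fieldop: "bounded_linear (\<lambda>z. fieldop z v)"
  by (rule linear_conv_bounded_linear[THEN iffD1], rule linearI) (simp_all add: fieldop_plus fieldop_scaleR)

lemma weyl_has_derivative_0:
  assumes v: "v \<in> fock_D"
  shows "((\<lambda>h. weyl h v) has_derivative (\<lambda>h. fieldop h v)) (at 0)"
proof -
  obtain C where C: "C \<ge> 0" "\<forall>z. norm z \<le> 1 \<longrightarrow> norm (weyl_vec z v - v - fieldop z v) \<le> C * (norm z)\<^sup>2"
    using weyl_vec_approx[OF v] by blast
  show ?thesis
    by (rule has_derivative_quadratic[OF bounded_linear_fieldop C(1)]) (use C(2) v in \<open>simp add: weyl_vec\<close>)
qed

text \<open>Differentiability is available only at 0 and on \<open>fock_D\<close>. Writing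
  W(\<gamma> s) as a phase times W(z) W(\<gamma> s - z), with z = \<gamma> t, reduces the general
  point to that case; the phase contributes the term with Im <z, y>.\<close>

lemma weyl_has_vector_derivative:
  assumes u: "u \<in> fock_D" and v: "v \<in> fock_D"
    and g: "(\<gamma> has_vector_derivative y) (at t within S)"
  shows "((\<lambda>s. cinner u (weyl (\<gamma> s) v)) has_vector_derivative
    cinner u (weyl (\<gamma> t) (fieldop y v)) + \<i> * Im (hip (\<gamma> t) y) * cinner u (weyl (\<gamma> t) v)) (at t within S)"
proof -
  define z where "z = \<gamma> t"
  have eq: "cinner u (weyl (\<gamma> s) v) = exp (\<i> * Im (hip z (\<gamma> s - z))) * cinner u (weyl z (weyl (\<gamma> s - z) v))" for s
    by (simp add: weyl_weyl exp_add[symmetric])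
  have g': "((\<lambda>s. \<gamma> s - z) has_vector_derivative y) (at t within S)"
    using has_vector_derivative_diff[OF g has_vector_derivative_const[of z]] by simp
  have "((\<lambda>s. weyl (\<gamma> s - z) v) has_derivative (\<lambda>r. fieldop (r *\<^sub>R y) v)) (at t within S)"
    using has_derivative_compose[OF g'[unfolded has_vector_derivative_def], of "\<lambda>h. weyl h v" "\<lambda>h. fieldop h v"]
      weyl_has_derivative_0[OF v] by (simp add: z_def)
  then have 1: "((\<lambda>s. weyl (\<gamma> s - z) v) has_vector_derivative fieldop y v) (at t within S)"
    by (simp add: has_vector_derivative_def fieldop_scaleR)
  have bl: "bounded_linear (\<lambda>x. cinner u (weyl z x))"
    by (intro bounded_linear_compose[OF bounded_bilinear.bounded_linear_right[OF bounded_bilinear_cinner]]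
        blinfun.bounded_linear_right)
  have 2: "((\<lambda>s. cinner u (weyl z (weyl (\<gamma> s - z) v))) has_vector_derivative cinner u (weyl z (fieldop y v))) (at t within S)"
    by (rule bounded_linear.has_vector_derivative[OF bl 1])
  have "bounded_linear (\<lambda>h. \<i> * complex_of_real (Im (hip z h)))"
    by (rule linear_conv_bounded_linear[THEN iffD1], rule linearI) (simp_all add: hip_add_right algebra_simps scaleR_conv_of_real[where 'a = complex])
  from bounded_linear.has_vector_derivative[OF this g']
  have 3: "((\<lambda>s. \<i> * complex_of_real (Im (hip z (\<gamma> s - z)))) has_vector_derivative \<i> * Im (hip z y)) (at t within S)" .
  have 4: "((\<lambda>s. exp (\<i> * complex_of_real (Im (hip z (\<gamma> s - z))))) has_vector_derivative \<i> * Im (hip z y)) (at t within S)"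
    using field_vector_diff_chain_within[OF 3 has_field_derivative_at_within[OF DERIV_exp]]
    by (simp add: o_def z_def)
  show ?thesis
    unfolding eq using has_vector_derivative_mult[OF 4 2] by (simp add: z_def)
qed

text \<open>The inner product of W(r h) u and W(z) v is differentiated at r = 0 twice: directly, and
  after moving W(r h) through W(z) by the Weyl relation. The field operator itself is never applied
  to W(z) v.\<close>

lemma cinner_fieldop_weyl:
  assumes u: "u \<in> fock_D" and v: "v \<in> fock_D"
  shows "cinner (fieldop h u) (weyl z v)
    = 2 * \<i> * Im (hip h z) * cinner u (weyl z v) - cinner u (weyl z (fieldop h v))"
proof -
  let ?g = "\<lambda>r::real. r *\<^sub>R h"
  have g: "(?g has_vector_derivative h) (at 0)" "((\<lambda>r. - ?g r) has_vector_derivative - h) (at 0)"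
    by (auto intro!: derivative_eq_intros)
  have eq: "cinner (weyl (?g r) u) (weyl z v) = exp (complex_of_real r * (2 * \<i> * Im (hip h z))) * cinner u (weyl z (weyl (- ?g r) v))" for r
    unfolding cinner_weyl_left using hip_commute[of z h]
    by (simp add: weyl_weyl exp_add[symmetric])
  have d: "((\<lambda>r. weyl (?g r) w) has_vector_derivative fieldop h w) (at 0)" 
    "((\<lambda>r. weyl (- ?g r) w) has_vector_derivative - fieldop h w) (at 0)" if w: "w \<in> fock_D" for w
    using has_derivative_compose[OF g(1)[unfolded has_vector_derivative_def], of "\<lambda>h. weyl h w" "\<lambda>h. fieldop h w"]
      has_derivative_compose[OF g(2)[unfolded has_vector_derivative_def], of "\<lambda>h. weyl h w" "\<lambda>h. fieldop h w"]
      weyl_has_derivative_0[OF w] by (simp_all add: has_vector_derivative_def fieldop_scaleR fieldop_minus)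
  have l: "((\<lambda>r. cinner (weyl (?g r) u) (weyl z v)) has_vector_derivative cinner (fieldop h u) (weyl z v)) (at 0)"
    by (rule bounded_linear.has_vector_derivative[OF bounded_bilinear.bounded_linear_left[OF bounded_bilinear_cinner] d(1)[OF u]])
  have bl: "bounded_linear (\<lambda>x. cinner u (weyl z x))"
    by (intro bounded_linear_compose[OF bounded_bilinear.bounded_linear_right[OF bounded_bilinear_cinner]]
        blinfun.bounded_linear_right)
  have r: "((\<lambda>r. cinner u (weyl z (weyl (- ?g r) v))) has_vector_derivative cinner u (weyl z (- fieldop h v))) (at 0)"
    by (rule bounded_linear.has_vector_derivative[OF bl d(2)[OF v]])
  have e: "((\<lambda>r. exp (complex_of_real r * (2 * \<i> * Im (hip h z)))) has_vector_derivative 2 * \<i> * Im (hip h z)) (at 0)"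
  proof -
    have "((\<lambda>r. complex_of_real r * (2 * \<i> * Im (hip h z))) has_vector_derivative 1 * (2 * \<i> * Im (hip h z))) (at 0)"
      using bounded_linear.has_vector_derivative[OF bounded_linear_of_real has_vector_derivative_id]
      by (intro has_vector_derivative_mult_left) simp
    from field_vector_diff_chain_within[OF this has_field_derivative_at_within[OF DERIV_exp]]
    show ?thesis by (simp add: o_def)
  qed
  have "((\<lambda>r. cinner (weyl (?g r) u) (weyl z v)) has_vector_derivative
    2 * \<i> * Im (hip h z) * cinner u (weyl z v) - cinner u (weyl z (fieldop h v))) (at 0)"
    unfolding eq using has_vector_derivative_mult[OF e r] by (simp add: blinfun.minus_right)
  from vector_derivative_unique_at[OF l this] show ?thesis .
qed

lemma fieldop_axis:
  "fieldop (axis j c) \<xi> = c *\<^sub>C creat j \<xi> - cnj c *\<^sub>C annih j \<xi>"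
proof -
  have "fieldop (axis j c) \<xi> = (\<Sum>k\<in>UNIV. if k = j then c *\<^sub>C creat j \<xi> - cnj c *\<^sub>C annih j \<xi> else 0)"
    unfolding fieldop_def by (rule sum.cong) (auto simp: axis_def)
  then show ?thesis by simp
qed

lemma creat_fieldop: "creat j \<xi> = (1/2) *\<^sub>C fieldop (axis j 1) \<xi> - (\<i>/2) *\<^sub>C fieldop (axis j \<i>) \<xi>"
  and annih_fieldop: "annih j \<xi> = (-1/2) *\<^sub>C fieldop (axis j 1) \<xi> - (\<i>/2) *\<^sub>C fieldop (axis j \<i>) \<xi>"
  by (rule fock_eqI; simp add: fieldop_axis algebra_simps)+

lemma hip_axis: "hip (axis j c) z = cnj c * z $ j"
proof -
  have "hip (axis j c) z = (\<Sum>k\<in>UNIV. if k = j then cnj c * z $ j else 0)"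
    unfolding hip_def by (rule sum.cong) (auto simp: axis_def)
  then show ?thesis by simp
qed

lemma weyl_scaleC: "weyl z (c *\<^sub>C v) = c *\<^sub>C weyl z v"
  by (rule BH_scaleC) simp

text \<open>Weak form of the shift a_j W(z) = W(z) (a_j + z_j).\<close>

lemma cinner_creat_weyl:
  assumes u: "u \<in> fock_D" and v: "v \<in> fock_D"
  shows "cinner (creat j u) (weyl z v) = z $ j * cinner u (weyl z v) + cinner u (weyl z (annih j v))"
proof -
  have 1: "complex_of_real (Im (z $ j)) * \<i> + Re (z $ j) = z $ j"
    by (simp add: complex_eq_iff)
  show ?thesis
    unfolding creat_fieldop[of j u] annih_fieldop[of j v]
    using arg_cong[OF 1, of "\<lambda>x. x * cinner u (weyl z v)"]
    by (simp add: cinner_diff_left cinner_diff_right cinner_fieldop_weyl[OF u v] hip_axis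
      blinfun.diff_right blinfun.minus_right weyl_scaleC algebra_simps)
qed

lemma cinner_annih_weyl:
  assumes u: "u \<in> fock_D" and v: "v \<in> fock_D"
  shows "cinner (annih j u) (weyl z v) = cnj (z $ j) * cinner u (weyl z v) + cinner u (weyl z (creat j v))"
proof -
  have 1: "Re (z $ j) - complex_of_real (Im (z $ j)) * \<i> = cnj (z $ j)"
    by (simp add: complex_eq_iff)
  show ?thesis
    unfolding creat_fieldop[of j v] annih_fieldop[of j u]
    using arg_cong[OF 1, of "\<lambda>x. x * cinner u (weyl z v)"]
    by (simp add: cinner_diff_left cinner_diff_right cinner_fieldop_weyl[OF u v] hip_axis
      blinfun.diff_right blinfun.minus_right weyl_scaleC algebra_simps)
qed

subsection \<open>The generator on Weyl operators\<close>

definition kraus_adj ::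
  "complex^'d^'m \<Rightarrow> complex^'d^'m \<Rightarrow> 'm::finite \<Rightarrow> 'd::finite fock \<Rightarrow> 'd fock"
  where "kraus_adj U V l \<xi> =
    (\<Sum>k\<in>UNIV. (V $ l $ k) *\<^sub>C creat k \<xi> + cnj (U $ l $ k) *\<^sub>C annih k \<xi>)"

lemma kraus_in_D [simp]: "kraus U V l \<xi> \<in> fock_D"
  and kraus_adj_in_D [simp]: "kraus_adj U V l \<xi> \<in> fock_D"
  and hamiltonian_in_D [simp]: "hamiltonian \<Omega> \<kappa> \<zeta> \<xi> \<in> fock_D"
  by (simp_all add: kraus_def kraus_adj_def hamiltonian_def)

lemma cinner_kraus:
  assumes "\<xi> \<in> fock_D" "\<eta> \<in> fock_D"
  shows "cinner (kraus U V l \<xi>) \<eta> = cinner \<xi> (kraus_adj U V l \<eta>)"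
    and "cinner (kraus_adj U V l \<xi>) \<eta> = cinner \<xi> (kraus U V l \<eta>)"
  using assms by (simp_all add: kraus_def kraus_adj_def cinner_sum_left cinner_sum_right cinner_add_left
    cinner_add_right cinner_creat_left cinner_annih_left add.commute)

lemma adjoint_on_D_kraus:
  assumes "\<eta> \<in> fock_D"
  shows "adjoint_on_D (kraus U V l) \<eta> = kraus_adj U V l \<eta>"
  unfolding adjoint_on_D_def
proof (rule the_equality)
  show "\<forall>\<xi>\<in>fock_D. cinner (kraus_adj U V l \<eta>) \<xi> = cinner \<eta> (kraus U V l \<xi>)"
    using assms by (simp add: cinner_kraus)
  fix \<phi> assume "\<forall>\<xi>\<in>fock_D. cinner \<phi> \<xi> = cinner \<eta> (kraus U V l \<xi>)"
  then have "cinner \<phi> \<xi> = cinner (kraus_adj U V l \<eta>) \<xi>" if "\<xi> \<in> fock_D" for \<xi>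
    using assms that by (simp add: cinner_kraus)
  then show "\<phi> = kraus_adj U V l \<eta>"
    by (intro cinner_eqI_D) (metis cinner_commute)
qed

lemma generator_form_D:
  assumes "\<xi> \<in> fock_D" "\<xi>' \<in> fock_D"
  shows "generator_form \<Omega> \<kappa> U V \<zeta> x \<xi>' \<xi> =
    \<i> * cinner (hamiltonian \<Omega> \<kappa> \<zeta> \<xi>') (x \<xi>) - \<i> * cinner \<xi>' (x (hamiltonian \<Omega> \<kappa> \<zeta> \<xi>))
      - 1/2 * (\<Sum>l\<in>UNIV. cinner \<xi>' (x (kraus_adj U V l (kraus U V l \<xi>)))
          - 2 * cinner (kraus U V l \<xi>') (x (kraus U V l \<xi>))
          + cinner (kraus_adj U V l (kraus U V l \<xi>')) (x \<xi>))"
  by (simp add: generator_form_def Let_def adjoint_on_D_kraus)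

text \<open>The scalar by which conjugation with W(z) shifts the operator
  \<open>kraus U V l\<close>.\<close>

definition lam :: "complex^'d^'m \<Rightarrow> complex^'d^'m \<Rightarrow> 'm::finite \<Rightarrow> complex^'d::finite \<Rightarrow> complex"
  where "lam U V l z = (\<Sum>k\<in>UNIV. cnj (V $ l $ k) * z $ k + U $ l $ k * cnj (z $ k))"

lemma cinner_kraus_weyl:
  assumes u: "u \<in> fock_D" and v: "v \<in> fock_D"
  shows "cinner (kraus U V l u) (weyl z v) = cnj (lam U V l z) * cinner u (weyl z v) + cinner u (weyl z (kraus_adj U V l v))"
    and "cinner (kraus_adj U V l u) (weyl z v) = lam U V l z * cinner u (weyl z v) + cinner u (weyl z (kraus U V l v))"
  by (simp_all add: kraus_def kraus_adj_def cinner_sum_left cinner_sum_right cinner_add_left cinner_add_right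
    cinner_creat_weyl[OF u v] cinner_annih_weyl[OF u v] blinfun.sum_right blinfun.add_right weyl_scaleC lam_def
    sum_distrib_right sum_distrib_left sum.distrib algebra_simps)

definition cnj_vec :: "complex^'d \<Rightarrow> complex^'d"
  where "cnj_vec z = (\<chi> j. cnj (z $ j))"

definition drift :: "complex^'d^'d \<Rightarrow> complex^'d^'d \<Rightarrow> complex^'d^'m \<Rightarrow> complex^'d^'m \<Rightarrow> complex^'d \<Rightarrow> complex^'d"
  where "drift \<Omega> \<kappa> U V z = Z1 \<Omega> U V *v z + Z2 \<kappa> U V *v cnj_vec z"

text \<open>This is the shape in which the generator produces Z: a dissipative half expressed by the
  shifts \<open>lam\<close> and a hamiltonian half i (\<Omega> z + \<kappa> conj z).\<close>

lemma drift_nth: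
  fixes U V :: "complex^'d^'m::finite"
  shows "drift \<Omega> \<kappa> U V z $ k =
    (\<Sum>l\<in>UNIV. cnj (lam U V l z) * U $ l $ k - lam U V l z * V $ l $ k) / 2
    + \<i> * (\<Sum>j\<in>UNIV. \<Omega> $ k $ j * z $ j + \<kappa> $ k $ j * cnj (z $ j))"
proof -
  have "(\<Sum>l\<in>UNIV. cnj (lam U V l z) * U $ l $ k - lam U V l z * V $ l $ k) =
    (\<Sum>l\<in>UNIV. \<Sum>j\<in>UNIV. (V $ l $ j * cnj (z $ j) + cnj (U $ l $ j) * z $ j) * U $ l $ k
        - (cnj (V $ l $ j) * z $ j + U $ l $ j * cnj (z $ j)) * V $ l $ k)"
    by (simp add: lam_def sum_distrib_right sum_subtractf)
  also have "\<dots> = (\<Sum>j\<in>UNIV. \<Sum>l\<in>UNIV. (V $ l $ j * cnj (z $ j) + cnj (U $ l $ j) * z $ j) * U $ l $ k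
        - (cnj (V $ l $ j) * z $ j + U $ l $ j * cnj (z $ j)) * V $ l $ k)"
    by (rule sum.swap)
  finally have eq: "(\<Sum>l\<in>UNIV. cnj (lam U V l z) * U $ l $ k - lam U V l z * V $ l $ k) / 2 = (\<Sum>j\<in>UNIV. \<Sum>l\<in>UNIV. ((V $ l $ j * cnj (z $ j) + cnj (U $ l $ j) * z $ j) * U $ l $ k
        - (cnj (V $ l $ j) * z $ j + U $ l $ j * cnj (z $ j)) * V $ l $ k) / 2)"
    by (simp add: sum_divide_distrib)
  show ?thesis unfolding eq
    by (simp add: drift_def Z1_def Z2_def matrix_vector_mult_def cnj_vec_def scale_mat_def matrix_matrix_mult_def
      map_matrix_def transpose_def sum_distrib_left sum_distrib_right sum.distrib[symmetric] sum_subtractf[symmetric]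
      algebra_simps diff_divide_distrib add_divide_distrib)
qed

text \<open>The real bilinear form Re <z, C w>, as \<open>diffu_hip\<close> confirms. Written
  through \<open>lam\<close> it is visibly symmetric and nonnegative.\<close>

definition diffu :: "complex^'d^'m \<Rightarrow> complex^'d^'m \<Rightarrow> complex^'d \<Rightarrow> complex^'d \<Rightarrow> real"
  where "diffu U V z w = (\<Sum>l\<in>UNIV. Re (cnj (lam U V l z) * lam U V l w))"

text \<open>Conjugation with W(z) shifts every a_j by z_j. In a quadratic hamiltonian the quadratic
  part cancels, the linear part has coefficients h = \<Omega> z + \<kappa> conj z, and the constant
  is real because \<Omega> is self-adjoint.\<close>

lemma cinner_hamiltonian_weyl:
  fixes h :: "'d::finite \<Rightarrow> complex" and z :: "complex^'d"
  assumes u: "u \<in> fock_D" and v: "v \<in> fock_D" and \<Omega>: "adj_mat \<Omega> = \<Omega>" and \<kappa>: "transpose \<kappa> = \<kappa>"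
    and h_def: "\<And>k. h k = (\<Sum>j\<in>UNIV. \<Omega> $ k $ j * z $ j + \<kappa> $ k $ j * cnj (z $ j))"
  shows "cinner (hamiltonian \<Omega> \<kappa> 0 u) (weyl z v) - cinner u (weyl z (hamiltonian \<Omega> \<kappa> 0 v)) =
    (\<Sum>k\<in>UNIV. h k * cinner u (weyl z (creat k v)) + cnj (h k) * cinner u (weyl z (annih k v)))
    + complex_of_real (Re (\<Sum>k\<in>UNIV. cnj (z $ k) * h k)) * cinner u (weyl z v)"
proof -
  have \<Omega>': "cnj (\<Omega> $ j $ k) = \<Omega> $ k $ j" for j k
    using arg_cong[OF \<Omega>, of "\<lambda>A. A $ k $ j"] by (simp add: adj_mat_def map_matrix_def transpose_def)
  have \<kappa>': "\<kappa> $ j $ k = \<kappa> $ k $ j" for j k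
    using arg_cong[OF \<kappa>, of "\<lambda>A. A $ j $ k"] by (simp add: transpose_def)
  define w where "w = cinner u (weyl z v)"
  define A where "A k = cinner u (weyl z (annih k v))" for k
  define C where "C k = cinner u (weyl z (creat k v))" for k
  define CA where "CA j k = cinner u (weyl z (creat j (annih k v)))" for j k
  define CC where "CC j k = cinner u (weyl z (creat j (creat k v)))" for j k
  define AA where "AA j k = cinner u (weyl z (annih j (annih k v)))" for j k
  note defs = w_def[symmetric] A_def[symmetric] C_def[symmetric] CA_def[symmetric] CC_def[symmetric] AA_def[symmetric]
  have L: "cinner (hamiltonian \<Omega> \<kappa> 0 u) (weyl z v) =
    (\<Sum>j\<in>UNIV. \<Sum>k\<in>UNIV. \<Omega> $ k $ j * (z $ j * (cnj (z $ k) * w + C k) + cnj (z $ k) * A j + CA k j)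
      + cnj (\<kappa> $ j $ k) / 2 * (z $ j * (z $ k * w + A k) + z $ k * A j + AA k j)
      + \<kappa> $ j $ k / 2 * (cnj (z $ j) * (cnj (z $ k) * w + C k) + cnj (z $ k) * C j + CC k j))"
    unfolding hamiltonian_def
    by (simp add: cinner_sum_left cinner_add_left cinner_creat_weyl cinner_annih_weyl u v defs \<Omega>' algebra_simps)
  have R: "cinner u (weyl z (hamiltonian \<Omega> \<kappa> 0 v)) =
    (\<Sum>j\<in>UNIV. \<Sum>k\<in>UNIV. \<Omega> $ j $ k * CA j k + \<kappa> $ j $ k / 2 * CC j k + cnj (\<kappa> $ j $ k) / 2 * AA j k)"
    unfolding hamiltonian_def
    by (simp add: cinner_sum_right cinner_add_right blinfun.sum_right blinfun.add_right weyl_scaleC defs)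
  \<comment> \<open>The indices are relabelled, using that \<kappa> is symmetric, so that the
    quadratic terms have the same form as in \<open>L\<close> and cancel.\<close>
  have R': "cinner u (weyl z (hamiltonian \<Omega> \<kappa> 0 v)) =
    (\<Sum>j\<in>UNIV. \<Sum>k\<in>UNIV. \<Omega> $ k $ j * CA k j + \<kappa> $ j $ k / 2 * CC k j + cnj (\<kappa> $ j $ k) / 2 * AA k j)"
    unfolding R by (subst sum.swap) (simp add: \<kappa>')
  let ?s = "\<lambda>f :: 'd \<Rightarrow> 'd \<Rightarrow> complex. \<Sum>j\<in>UNIV. \<Sum>k\<in>UNIV. f j k"
  have sw: "?s f = ?s (\<lambda>j k. f k j)" for f by (rule sum.swap)
  have "cinner (hamiltonian \<Omega> \<kappa> 0 u) (weyl z v) - cinner u (weyl z (hamiltonian \<Omega> \<kappa> 0 v)) =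
    ?s (\<lambda>j k. \<Omega> $ k $ j * z $ j * cnj (z $ k) * w) + ?s (\<lambda>j k. \<Omega> $ k $ j * z $ j * C k) + ?s (\<lambda>j k. \<Omega> $ k $ j * cnj (z $ k) * A j)
    + ?s (\<lambda>j k. cnj (\<kappa> $ j $ k) / 2 * z $ j * z $ k * w) + ?s (\<lambda>j k. cnj (\<kappa> $ j $ k) / 2 * z $ j * A k) + ?s (\<lambda>j k. cnj (\<kappa> $ j $ k) / 2 * z $ k * A j)
    + ?s (\<lambda>j k. \<kappa> $ j $ k / 2 * cnj (z $ j) * cnj (z $ k) * w) + ?s (\<lambda>j k. \<kappa> $ j $ k / 2 * cnj (z $ j) * C k) + ?s (\<lambda>j k. \<kappa> $ j $ k / 2 * cnj (z $ k) * C j)"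
    unfolding L R' sum_subtractf[symmetric] sum.distrib[symmetric]
    by (intro sum.cong refl) (simp add: algebra_simps)
  also have "?s (\<lambda>j k. \<Omega> $ k $ j * z $ j * C k) = ?s (\<lambda>k j. \<Omega> $ k $ j * z $ j * C k)" by (rule sw)
  also have "?s (\<lambda>j k. \<Omega> $ k $ j * cnj (z $ k) * A j) = ?s (\<lambda>j k. cnj (\<Omega> $ j $ k * z $ k) * A j)" by (simp add: \<Omega>')
  also have "?s (\<lambda>j k. cnj (\<kappa> $ j $ k) / 2 * z $ j * A k) = ?s (\<lambda>k j. cnj (\<kappa> $ k $ j) / 2 * z $ j * A k)"
    by (subst sw) (simp add: \<kappa>')
  also have "?s (\<lambda>j k. \<kappa> $ j $ k / 2 * cnj (z $ j) * C k) = ?s (\<lambda>k j. \<kappa> $ k $ j / 2 * cnj (z $ j) * C k)"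
    by (subst sw) (simp add: \<kappa>')
  also have "?s (\<lambda>j k. \<Omega> $ k $ j * z $ j * cnj (z $ k) * w) = ?s (\<lambda>k j. cnj (z $ k) * (\<Omega> $ k $ j * z $ j)) * w"
    by (subst sw) (simp add: sum_distrib_right sum_distrib_left mult_ac)
  also have "?s (\<lambda>j k. cnj (\<kappa> $ j $ k) / 2 * z $ j * z $ k * w) = cnj (?s (\<lambda>k j. cnj (z $ k) * (\<kappa> $ k $ j * cnj (z $ j)))) / 2 * w"
    by (simp add: sum_distrib_right sum_distrib_left sum_divide_distrib mult_ac)
  also have "?s (\<lambda>j k. \<kappa> $ j $ k / 2 * cnj (z $ j) * cnj (z $ k) * w) = ?s (\<lambda>k j. cnj (z $ k) * (\<kappa> $ k $ j * cnj (z $ j))) / 2 * w"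
    by (simp add: sum_distrib_right sum_distrib_left sum_divide_distrib mult_ac)
  finally have eq: "cinner (hamiltonian \<Omega> \<kappa> 0 u) (weyl z v) - cinner u (weyl z (hamiltonian \<Omega> \<kappa> 0 v)) =
     (?s (\<lambda>k j. \<Omega> $ k $ j * z $ j * C k) + ?s (\<lambda>k j. \<kappa> $ k $ j / 2 * cnj (z $ j) * C k) + ?s (\<lambda>j k. \<kappa> $ j $ k / 2 * cnj (z $ k) * C j))
     + (?s (\<lambda>j k. cnj (\<Omega> $ j $ k * z $ k) * A j) + ?s (\<lambda>k j. cnj (\<kappa> $ k $ j) / 2 * z $ j * A k) + ?s (\<lambda>j k. cnj (\<kappa> $ j $ k) / 2 * z $ k * A j))
     + (?s (\<lambda>k j. cnj (z $ k) * (\<Omega> $ k $ j * z $ j)) + cnj (?s (\<lambda>k j. cnj (z $ k) * (\<kappa> $ k $ j * cnj (z $ j)))) / 2 + ?s (\<lambda>k j. cnj (z $ k) * (\<kappa> $ k $ j * cnj (z $ j))) / 2) * w"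
    by (simp add: algebra_simps)
  have c: "(?s (\<lambda>k j. \<Omega> $ k $ j * z $ j * C k) + ?s (\<lambda>k j. \<kappa> $ k $ j / 2 * cnj (z $ j) * C k) + ?s (\<lambda>j k. \<kappa> $ j $ k / 2 * cnj (z $ k) * C j))
    = (\<Sum>k\<in>UNIV. h k * C k)"
    by (simp add: h_def sum_distrib_right sum_distrib_left sum.distrib[symmetric] algebra_simps)
  have a: "(?s (\<lambda>j k. cnj (\<Omega> $ j $ k * z $ k) * A j) + ?s (\<lambda>k j. cnj (\<kappa> $ k $ j) / 2 * z $ j * A k) + ?s (\<lambda>j k. cnj (\<kappa> $ j $ k) / 2 * z $ k * A j))
    = (\<Sum>k\<in>UNIV. cnj (h k) * A k)"
    by (simp add: h_def sum_distrib_right sum_distrib_left sum.distrib[symmetric] algebra_simps)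
  have cr: "cnj (?s (\<lambda>k j. cnj (z $ k) * (\<Omega> $ k $ j * z $ j))) = ?s (\<lambda>k j. cnj (z $ k) * (\<Omega> $ k $ j * z $ j))"
    by (subst sw) (simp add: \<Omega>' mult_ac)
  have r: "?s (\<lambda>k j. cnj (z $ k) * (\<Omega> $ k $ j * z $ j)) = Re (?s (\<lambda>k j. cnj (z $ k) * (\<Omega> $ k $ j * z $ j)))"
  proof -
    have "x = complex_of_real (Re x)" if "cnj x = x" for x
      using arg_cong[OF that, of Im] by (simp add: complex_eq_iff)
    from this[OF cr] show ?thesis .
  qed
  have "cnj x / 2 + x / 2 = of_real (Re x)" for x by (simp add: complex_eq_iff)
  then have w: "?s (\<lambda>k j. cnj (z $ k) * (\<Omega> $ k $ j * z $ j)) + cnj (?s (\<lambda>k j. cnj (z $ k) * (\<kappa> $ k $ j * cnj (z $ j)))) / 2 + ?s (\<lambda>k j. cnj (z $ k) * (\<kappa> $ k $ j * cnj (z $ j))) / 2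
    = of_real (Re (?s (\<lambda>k j. cnj (z $ k) * (\<Omega> $ k $ j * z $ j)) + ?s (\<lambda>k j. cnj (z $ k) * (\<kappa> $ k $ j * cnj (z $ j)))))"
    using r by (simp only: add.assoc plus_complex.sel of_real_add)
  have "?s (\<lambda>k j. cnj (z $ k) * (\<Omega> $ k $ j * z $ j)) + ?s (\<lambda>k j. cnj (z $ k) * (\<kappa> $ k $ j * cnj (z $ j))) = (\<Sum>k\<in>UNIV. cnj (z $ k) * h k)"
    by (simp add: h_def sum_distrib_left sum.distrib[symmetric] distrib_left)
  then show ?thesis unfolding eq c a w by (simp only: sum.distrib C_def A_def w_def)
qed

text \<open>The bracket is the derivative from \<open>weyl_has_vector_derivative\<close> along a
  curve through z with velocity Z z. Hence the ansatz f(t) W(e^{tZ} z) turns the master equation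
  into a scalar linear equation for f.\<close>

lemma generator_form_weyl:
  fixes U V :: "complex^'d::finite^'m::finite"
  assumes u: "u \<in> fock_D" and v: "v \<in> fock_D" and \<Omega>: "adj_mat \<Omega> = \<Omega>" and \<kappa>: "transpose \<kappa> = \<kappa>"
  shows "generator_form \<Omega> \<kappa> U V 0 (weyl z) u v =
    - (complex_of_real (diffu U V z z) / 2) * cinner u (weyl z v)
    + (cinner u (weyl z (fieldop (drift \<Omega> \<kappa> U V z) v)) + \<i> * Im (hip z (drift \<Omega> \<kappa> U V z)) * cinner u (weyl z v))"
proof -
  define w where "w = cinner u (weyl z v)"
  define A where "A k = cinner u (weyl z (annih k v))" for k
  define C where "C k = cinner u (weyl z (creat k v))" for k
  define h where "h k = (\<Sum>j\<in>UNIV. \<Omega> $ k $ j * z $ j + \<kappa> $ k $ j * cnj (z $ j))" for k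
  define p where "p k = (\<Sum>l\<in>UNIV. cnj (lam U V l z) * U $ l $ k - lam U V l z * V $ l $ k) / 2" for k
  let ?l = "\<lambda>l. lam U V l z"
  \<comment> \<open>Moving each Kraus operator past W(z) costs a shift by \<open>lam\<close> or its
    conjugate. The quadratic terms cancel, and the squared modulus of the shift and first order
    terms remain.\<close>
  have kr: "cinner u (weyl z (kraus_adj U V l (kraus U V l v))) - 2 * cinner (kraus U V l u) (weyl z (kraus U V l v))
          + cinner (kraus_adj U V l (kraus U V l u)) (weyl z v)
      = cnj (?l l) * ?l l * w + (\<Sum>k\<in>UNIV. (?l l * V $ l $ k - cnj (?l l) * U $ l $ k) * C k
          - (cnj (?l l) * cnj (V $ l $ k) - ?l l * cnj (U $ l $ k)) * A k)" for l
  proof -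
    have "cinner u (weyl z (kraus_adj U V l (kraus U V l v))) - 2 * cinner (kraus U V l u) (weyl z (kraus U V l v))
          + cinner (kraus_adj U V l (kraus U V l u)) (weyl z v)
      = cnj (?l l) * ?l l * w + ?l l * cinner u (weyl z (kraus_adj U V l v)) - cnj (?l l) * cinner u (weyl z (kraus U V l v))"
      by (simp add: cinner_kraus_weyl u v w_def algebra_simps)
    also have "cinner u (weyl z (kraus_adj U V l v)) = (\<Sum>k\<in>UNIV. V $ l $ k * C k + cnj (U $ l $ k) * A k)"
      by (simp add: kraus_adj_def cinner_sum_right cinner_add_right blinfun.sum_right blinfun.add_right weyl_scaleC C_def A_def)
    also have "cinner u (weyl z (kraus U V l v)) = (\<Sum>k\<in>UNIV. cnj (V $ l $ k) * A k + U $ l $ k * C k)"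
      by (simp add: kraus_def cinner_sum_right cinner_add_right blinfun.sum_right blinfun.add_right weyl_scaleC C_def A_def)
    finally show ?thesis
      by (simp add: sum_distrib_left sum.distrib sum_subtractf algebra_simps)
  qed
  have S: "(\<Sum>l\<in>UNIV. cnj (?l l) * ?l l * w + (\<Sum>k\<in>UNIV. (?l l * V $ l $ k - cnj (?l l) * U $ l $ k) * C k
          - (cnj (?l l) * cnj (V $ l $ k) - ?l l * cnj (U $ l $ k)) * A k))
    = complex_of_real (diffu U V z z) * w - 2 * (\<Sum>k\<in>UNIV. p k * C k - cnj (p k) * A k)"
  proof -
    have "(\<Sum>l\<in>UNIV. cnj (?l l) * ?l l * w) = complex_of_real (diffu U V z z) * w"
      by (simp add: diffu_def sum_distrib_right cnj_mult_self del: of_real_power)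
    moreover have "(\<Sum>l\<in>UNIV. \<Sum>k\<in>UNIV. (?l l * V $ l $ k - cnj (?l l) * U $ l $ k) * C k
          - (cnj (?l l) * cnj (V $ l $ k) - ?l l * cnj (U $ l $ k)) * A k)
      = - 2 * (\<Sum>k\<in>UNIV. p k * C k - cnj (p k) * A k)"
      by (subst sum.swap)
        (simp add: p_def sum_distrib_left sum_distrib_right sum_subtractf[symmetric] sum_negf[symmetric] algebra_simps
          sum_divide_distrib diff_divide_distrib add_divide_distrib)
    ultimately show ?thesis by (simp add: sum.distrib)
  qed
  have dr: "drift \<Omega> \<kappa> U V z $ k = p k + \<i> * h k" for k by (simp add: drift_nth p_def h_def)
  have F: "cinner u (weyl z (fieldop (drift \<Omega> \<kappa> U V z) v)) = (\<Sum>k\<in>UNIV. p k * C k - cnj (p k) * A k) + \<i> * (\<Sum>k\<in>UNIV. h k * C k + cnj (h k) * A k)"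
    by (simp add: fieldop_def dr cinner_sum_right cinner_diff_right blinfun.sum_right blinfun.diff_right weyl_scaleC C_def A_def
        sum_distrib_left sum.distrib[symmetric] sum_subtractf[symmetric] algebra_simps)
  \<comment> \<open>The dissipative half p does not contribute: with \<open>lam\<close> = \<alpha> +
    \<beta> the cross terms cancel and leave the difference of the squared moduli of \<beta> and
    \<alpha>, which is real.\<close>
  have hp: "Im (hip z (drift \<Omega> \<kappa> U V z)) = Re (\<Sum>k\<in>UNIV. cnj (z $ k) * h k)"
  proof -
    define \<alpha> where "\<alpha> l = (\<Sum>k\<in>UNIV. cnj (V $ l $ k) * z $ k)" for l
    define \<beta> where "\<beta> l = (\<Sum>k\<in>UNIV. U $ l $ k * cnj (z $ k))" for l
    have l: "?l l = \<alpha> l + \<beta> l" for l by (simp add: lam_def \<alpha>_def \<beta>_def sum.distrib)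
    have "hip z (drift \<Omega> \<kappa> U V z) = (\<Sum>k\<in>UNIV. cnj (z $ k) * p k) + \<i> * (\<Sum>k\<in>UNIV. cnj (z $ k) * h k)"
      by (simp add: hip_def dr distrib_left sum.distrib sum_distrib_left mult_ac)
    moreover have "(\<Sum>k\<in>UNIV. cnj (z $ k) * p k) = (\<Sum>l\<in>UNIV. cnj (?l l) * \<beta> l - ?l l * cnj (\<alpha> l)) / 2"
    proof -
      have "(\<Sum>k\<in>UNIV. cnj (z $ k) * p k) = (\<Sum>k\<in>UNIV. \<Sum>l\<in>UNIV. cnj (z $ k) * (cnj (?l l) * U $ l $ k - ?l l * V $ l $ k)) / 2"
        by (simp add: p_def sum_distrib_left sum_divide_distrib)
      also have "\<dots> = (\<Sum>l\<in>UNIV. \<Sum>k\<in>UNIV. cnj (z $ k) * (cnj (?l l) * U $ l $ k - ?l l * V $ l $ k)) / 2"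
        by (subst sum.swap) (rule refl)
      also have "\<dots> = (\<Sum>l\<in>UNIV. cnj (?l l) * \<beta> l - ?l l * cnj (\<alpha> l)) / 2"
        by (simp add: \<alpha>_def \<beta>_def sum_distrib_left sum_subtractf[symmetric] algebra_simps)
      finally show ?thesis .
    qed
    moreover have "Im (cnj (?l l) * \<beta> l - ?l l * cnj (\<alpha> l)) = 0" for l
      by (simp add: l algebra_simps)
    ultimately show ?thesis by simp
  qed
  have "generator_form \<Omega> \<kappa> U V 0 (weyl z) u v = \<i> * (cinner (hamiltonian \<Omega> \<kappa> 0 u) (weyl z v) - cinner u (weyl z (hamiltonian \<Omega> \<kappa> 0 v)))
    - 1/2 * (\<Sum>l\<in>UNIV. cnj (?l l) * ?l l * w + (\<Sum>k\<in>UNIV. (?l l * V $ l $ k - cnj (?l l) * U $ l $ k) * C k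
          - (cnj (?l l) * cnj (V $ l $ k) - ?l l * cnj (U $ l $ k)) * A k))"
    unfolding generator_form_D[OF v u] kr by (simp add: algebra_simps)
  also have "\<dots> = \<i> * ((\<Sum>k\<in>UNIV. h k * C k + cnj (h k) * A k) + complex_of_real (Re (\<Sum>k\<in>UNIV. cnj (z $ k) * h k)) * w)
     - 1/2 * (complex_of_real (diffu U V z z) * w - 2 * (\<Sum>k\<in>UNIV. p k * C k - cnj (p k) * A k))"
    by (simp only: S cinner_hamiltonian_weyl[OF u v \<Omega> \<kappa> h_def] C_def[symmetric] A_def[symmetric] w_def[symmetric])
  finally show ?thesis unfolding F hp w_def[symmetric] by (simp add: algebra_simps)
qed

subsection \<open>Uniqueness for the master equation\<close>

lemma wt_sum: "(\<And>a. a \<in> A \<Longrightarrow> f a \<in> fock_D) \<Longrightarrow> wt s (sum f A) = (\<Sum>a\<in>A. wt s (f a))"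
proof (induction A rule: infinite_finite_induct)
  case (insert a A)
  then show ?case by (simp add: wt_add)
qed (simp_all add: wt_def)

lemma annih_wt2:
  assumes "\<xi> \<in> fock_D"
  shows "annih j (wt 2 \<xi>) = wt 2 (annih j \<xi>) + annih j \<xi>"
proof (rule fock_eqI)
  fix n :: "'a \<Rightarrow> nat"
  have "level (n(j := n j + 1)) = level n + 1" using level_upd[of n j "n j + 1"] by simp
  then show "fock_coeff (annih j (wt 2 \<xi>)) n = fock_coeff (wt 2 (annih j \<xi>) + annih j \<xi>) n"
    using assms by (simp add: fock_coeff_annih fock_coeff_wt algebra_simps del: of_real_power flip: of_real_power)
qed

lemma creat_wt2:
  assumes "\<xi> \<in> fock_D"
  shows "creat j (wt 2 \<xi>) = wt 2 (creat j \<xi>) - creat j \<xi>"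
proof (rule fock_eqI)
  fix n :: "'a \<Rightarrow> nat"
  show "fock_coeff (creat j (wt 2 \<xi>)) n = fock_coeff (wt 2 (creat j \<xi>) - creat j \<xi>) n"
  proof (cases "n j = 0")
    case False
    then have "level n = level (n(j := n j - 1)) + 1" using level_upd[of n j "n j - 1"] by simp
    then show ?thesis
      using assms by (simp add: fock_coeff_creat fock_coeff_wt algebra_simps del: of_real_power flip: of_real_power)
  qed (use assms in \<open>simp add: fock_coeff_creat fock_coeff_wt\<close>)
qed

lemma wt_scaleR: "\<xi> \<in> fock_D \<Longrightarrow> wt s (r *\<^sub>R \<xi>) = r *\<^sub>R wt s \<xi>"
  by (simp add: scaleR_scaleC wt_scaleC)

lemma cinner_wt2: "\<xi> \<in> fock_D \<Longrightarrow> cinner \<xi> (wt 2 \<xi>) = complex_of_real ((norm (wt 1 \<xi>))\<^sup>2)"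
  using cinner_wt_left[of \<xi> "wt 1 \<xi>" 1] by (simp add: cinner_self wt_wt numeral_2_eq_2 del: of_real_power)

lemma norm_wt_mono:
  assumes "\<xi> \<in> fock_D" "s \<le> t"
  shows "norm (wt s \<xi>) \<le> norm (wt t \<xi>)"
proof -
  have "norm (wt s \<xi>) \<le> 1 * norm (wt t \<xi>)"
  proof (rule norm_le_reindex[where f = "\<lambda>n. n"])
    fix n :: "'a \<Rightarrow> nat"
    have "sqrt (real (level n) + 1) ^ s \<le> sqrt (real (level n) + 1) ^ t"
      by (rule power_increasing) (use assms in auto)
    then show "cmod (fock_coeff (wt s \<xi>) n) \<le> 1 * cmod (fock_coeff (wt t \<xi>) n)"
      using assms by (simp add: fock_coeff_wt norm_mult norm_power mult_right_mono add.commute)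
  qed auto
  then show ?thesis by simp
qed

lemma norm_le_wt: "\<xi> \<in> fock_D \<Longrightarrow> norm \<xi> \<le> norm (wt s \<xi>)"
  using norm_wt_mono[of \<xi> 0 s] by (simp add: wt_zero)

lemma norm_creat_le: "\<xi> \<in> fock_D \<Longrightarrow> norm (creat j \<xi>) \<le> norm (wt 1 \<xi>)"
  and norm_annih_le: "\<xi> \<in> fock_D \<Longrightarrow> norm (annih j \<xi>) \<le> norm (wt 1 \<xi>)"
  using norm_wt_creat_le[of \<xi> 0 j] norm_wt_annih_le[of \<xi> 0 j] by (simp_all add: wt_zero)

lemma norm_creat2_le:
  assumes "\<xi> \<in> fock_D"
  shows "norm (creat j (creat k \<xi>)) \<le> 2 * norm (wt 2 \<xi>)" "norm (creat j (annih k \<xi>)) \<le> 2 * norm (wt 2 \<xi>)"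
    "norm (annih j (creat k \<xi>)) \<le> 2 * norm (wt 2 \<xi>)" "norm (annih j (annih k \<xi>)) \<le> 2 * norm (wt 2 \<xi>)"
proof -
  have s: "sqrt 2 \<le> 2" using real_sqrt_le_mono[of 2 4] by simp
  have c: "norm (wt 1 (creat k \<xi>)) \<le> 2 * norm (wt 2 \<xi>)"
    using norm_wt_creat_le[OF assms, of 1 k] mult_right_mono[OF s norm_ge_zero[of "wt 2 \<xi>"]]
    by (simp add: numeral_2_eq_2)
  have a: "norm (wt 1 (annih k \<xi>)) \<le> 2 * norm (wt 2 \<xi>)"
  proof -
    have "norm (wt 1 (annih k \<xi>)) \<le> norm (wt 2 \<xi>)"
      using norm_wt_annih_le[OF assms, of 1 k] by (simp add: numeral_2_eq_2)
    then show ?thesis using norm_ge_zero[of "wt 2 \<xi>"] by linarith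
  qed
  show "norm (creat j (creat k \<xi>)) \<le> 2 * norm (wt 2 \<xi>)" "norm (annih j (creat k \<xi>)) \<le> 2 * norm (wt 2 \<xi>)"
    using order_trans[OF norm_creat_le c] order_trans[OF norm_annih_le c] by auto
  show "norm (creat j (annih k \<xi>)) \<le> 2 * norm (wt 2 \<xi>)" "norm (annih j (annih k \<xi>)) \<le> 2 * norm (wt 2 \<xi>)"
    using order_trans[OF norm_creat_le a] order_trans[OF norm_annih_le a] by auto
qed

lemma kraus_add: "\<xi> \<in> fock_D \<Longrightarrow> \<eta> \<in> fock_D \<Longrightarrow> kraus U V l (\<xi> + \<eta>) = kraus U V l \<xi> + kraus U V l \<eta>"
  by (simp add: kraus_def annih_add creat_add scaleC_add_right sum.distrib algebra_simps)

lemma kraus_adj_add: "\<xi> \<in> fock_D \<Longrightarrow> \<eta> \<in> fock_D \<Longrightarrow> kraus_adj U V l (\<xi> + \<eta>) = kraus_adj U V l \<xi> + kraus_adj U V l \<eta>"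
  by (simp add: kraus_adj_def annih_add creat_add scaleC_add_right sum.distrib algebra_simps)

lemma hamiltonian_add:
  "\<xi> \<in> fock_D \<Longrightarrow> \<eta> \<in> fock_D \<Longrightarrow> hamiltonian \<Omega> \<kappa> \<zeta> (\<xi> + \<eta>) = hamiltonian \<Omega> \<kappa> \<zeta> \<xi> + hamiltonian \<Omega> \<kappa> \<zeta> \<eta>"
  by (simp add: hamiltonian_def annih_add creat_add scaleC_add_right sum.distrib algebra_simps)

text \<open>The commutators of N with creation and annihilation have opposite signs, so commuting L
  with N amounts to flipping the sign of V. The result is still of first order.\<close>

lemma kraus_wt2:
  assumes "\<xi> \<in> fock_D"
  shows "kraus U V l (wt 2 \<xi>) = wt 2 (kraus U V l \<xi>) - kraus U (- V) l \<xi>"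
  using assms by (simp add: kraus_def annih_wt2 creat_wt2 wt_sum wt_add wt_scaleC scaleC_add_right scaleC_diff_right
    scaleC_minus_left sum.distrib sum_subtractf sum_negf)

lemma norm_kraus_le: "\<exists>c\<ge>0. \<forall>\<xi>\<in>fock_D. norm (kraus U V l \<xi>) \<le> c * norm (wt 1 \<xi>)"
proof (intro exI[of _ "\<Sum>k\<in>UNIV. cmod (V $ l $ k) + cmod (U $ l $ k)"] conjI ballI)
  fix \<xi> :: "'a fock" assume \<xi>: "\<xi> \<in> fock_D"
  show "norm (kraus U V l \<xi>) \<le> (\<Sum>k\<in>UNIV. cmod (V $ l $ k) + cmod (U $ l $ k)) * norm (wt 1 \<xi>)"
    unfolding kraus_def sum_distrib_right
  proof (rule sum_norm_le)
    fix k
    have "norm (cnj (V $ l $ k) *\<^sub>C annih k \<xi> + U $ l $ k *\<^sub>C creat k \<xi>)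
      \<le> cmod (V $ l $ k) * norm (annih k \<xi>) + cmod (U $ l $ k) * norm (creat k \<xi>)"
      by (rule order_trans[OF norm_triangle_ineq]) simp
    also have "\<dots> \<le> cmod (V $ l $ k) * norm (wt 1 \<xi>) + cmod (U $ l $ k) * norm (wt 1 \<xi>)"
      by (intro add_mono mult_left_mono norm_annih_le norm_creat_le \<xi>) auto
    finally show "norm (cnj (V $ l $ k) *\<^sub>C annih k \<xi> + U $ l $ k *\<^sub>C creat k \<xi>)
      \<le> (cmod (V $ l $ k) + cmod (U $ l $ k)) * norm (wt 1 \<xi>)" by (simp add: distrib_right)
  qed
qed (simp add: sum_nonneg)

lemma norm_kraus_adj_kraus_le: "\<exists>c\<ge>0. \<forall>\<xi>\<in>fock_D. norm (kraus_adj U V l (kraus U V l \<xi>)) \<le> c * norm (wt 2 \<xi>)"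
proof -
  define b where "b j k = 2 * ((cmod (V $ l $ j) + cmod (U $ l $ j)) * (cmod (V $ l $ k) + cmod (U $ l $ k)))" for j k
  show ?thesis
  proof (intro exI[of _ "\<Sum>j\<in>UNIV. \<Sum>k\<in>UNIV. b j k"] conjI ballI)
    fix \<xi> :: "'a fock" assume \<xi>: "\<xi> \<in> fock_D"
    have "kraus_adj U V l (kraus U V l \<xi>) = (\<Sum>j\<in>UNIV. \<Sum>k\<in>UNIV.
        (V $ l $ j * cnj (V $ l $ k)) *\<^sub>C creat j (annih k \<xi>) + (V $ l $ j * U $ l $ k) *\<^sub>C creat j (creat k \<xi>)
        + (cnj (U $ l $ j) * cnj (V $ l $ k)) *\<^sub>C annih j (annih k \<xi>) + (cnj (U $ l $ j) * U $ l $ k) *\<^sub>C annih j (creat k \<xi>))"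
      by (simp add: kraus_adj_def kraus_def creat_sum annih_sum creat_add annih_add creat_scaleC annih_scaleC
         scaleC_sum_right scaleC_add_right sum.distrib algebra_simps)
    also have "norm \<dots> \<le> (\<Sum>j\<in>UNIV. \<Sum>k\<in>UNIV. b j k * norm (wt 2 \<xi>))"
    proof (intro sum_norm_le)
      fix j k
      have "norm ((V $ l $ j * cnj (V $ l $ k)) *\<^sub>C creat j (annih k \<xi>) + (V $ l $ j * U $ l $ k) *\<^sub>C creat j (creat k \<xi>)
        + (cnj (U $ l $ j) * cnj (V $ l $ k)) *\<^sub>C annih j (annih k \<xi>) + (cnj (U $ l $ j) * U $ l $ k) *\<^sub>C annih j (creat k \<xi>))
        \<le> cmod (V $ l $ j) * cmod (V $ l $ k) * norm (creat j (annih k \<xi>)) + cmod (V $ l $ j) * cmod (U $ l $ k) * norm (creat j (creat k \<xi>))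
        + cmod (U $ l $ j) * cmod (V $ l $ k) * norm (annih j (annih k \<xi>)) + cmod (U $ l $ j) * cmod (U $ l $ k) * norm (annih j (creat k \<xi>))"
        by (intro norm_triangle_le add_mono) (simp_all add: norm_mult)
      also have "\<dots> \<le> cmod (V $ l $ j) * cmod (V $ l $ k) * (2 * norm (wt 2 \<xi>)) + cmod (V $ l $ j) * cmod (U $ l $ k) * (2 * norm (wt 2 \<xi>))
        + cmod (U $ l $ j) * cmod (V $ l $ k) * (2 * norm (wt 2 \<xi>)) + cmod (U $ l $ j) * cmod (U $ l $ k) * (2 * norm (wt 2 \<xi>))"
        by (intro add_mono mult_left_mono norm_creat2_le \<xi>) auto
      also have "\<dots> = b j k * norm (wt 2 \<xi>)" by (simp add: b_def algebra_simps)
      finally show "norm ((V $ l $ j * cnj (V $ l $ k)) *\<^sub>C creat j (annih k \<xi>) + (V $ l $ j * U $ l $ k) *\<^sub>C creat j (creat k \<xi>)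
        + (cnj (U $ l $ j) * cnj (V $ l $ k)) *\<^sub>C annih j (annih k \<xi>) + (cnj (U $ l $ j) * U $ l $ k) *\<^sub>C annih j (creat k \<xi>))
        \<le> b j k * norm (wt 2 \<xi>)" .
    qed
    finally show "norm (kraus_adj U V l (kraus U V l \<xi>)) \<le> (\<Sum>j\<in>UNIV. \<Sum>k\<in>UNIV. b j k) * norm (wt 2 \<xi>)"
      by (simp add: sum_distrib_right)
  qed (simp add: b_def sum_nonneg)
qed

lemma norm_hamiltonian_le: "\<exists>c\<ge>0. \<forall>\<xi>\<in>fock_D. norm (hamiltonian \<Omega> \<kappa> 0 \<xi>) \<le> c * norm (wt 2 \<xi>)"
proof -
  define b where "b j k = 2 * (cmod (\<Omega> $ j $ k) + cmod (\<kappa> $ j $ k))" for j k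
  show ?thesis
  proof (intro exI[of _ "\<Sum>j\<in>UNIV. \<Sum>k\<in>UNIV. b j k"] conjI ballI)
    fix \<xi> :: "'a fock" assume \<xi>: "\<xi> \<in> fock_D"
    have "norm (hamiltonian \<Omega> \<kappa> 0 \<xi>) \<le> (\<Sum>j\<in>UNIV. \<Sum>k\<in>UNIV. b j k * norm (wt 2 \<xi>))"
      unfolding hamiltonian_def
    proof (simp, intro sum_norm_le)
      fix j k
      have "norm ((\<Omega> $ j $ k) *\<^sub>C creat j (annih k \<xi>) + (\<kappa> $ j $ k / 2) *\<^sub>C creat j (creat k \<xi>)
        + (cnj (\<kappa> $ j $ k) / 2) *\<^sub>C annih j (annih k \<xi>))
        \<le> cmod (\<Omega> $ j $ k) * norm (creat j (annih k \<xi>)) + cmod (\<kappa> $ j $ k) / 2 * norm (creat j (creat k \<xi>))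
        + cmod (\<kappa> $ j $ k) / 2 * norm (annih j (annih k \<xi>))"
        by (intro norm_triangle_le add_mono) (simp_all add: norm_divide)
      also have "\<dots> \<le> cmod (\<Omega> $ j $ k) * (2 * norm (wt 2 \<xi>)) + cmod (\<kappa> $ j $ k) / 2 * (2 * norm (wt 2 \<xi>))
        + cmod (\<kappa> $ j $ k) / 2 * (2 * norm (wt 2 \<xi>))"
        by (intro add_mono mult_left_mono norm_creat2_le \<xi>) auto
      also have "\<dots> = b j k * norm (wt 2 \<xi>)" by (simp add: b_def algebra_simps)
      finally show "norm ((\<Omega> $ j $ k) *\<^sub>C creat j (annih k \<xi>) + (\<kappa> $ j $ k / 2) *\<^sub>C creat j (creat k \<xi>)
        + (cnj (\<kappa> $ j $ k) / 2) *\<^sub>C annih j (annih k \<xi>)) \<le> b j k * norm (wt 2 \<xi>)" .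
    qed
    then show "norm (hamiltonian \<Omega> \<kappa> 0 \<xi>) \<le> (\<Sum>j\<in>UNIV. \<Sum>k\<in>UNIV. b j k) * norm (wt 2 \<xi>)"
      by (simp add: sum_distrib_right)
  qed (simp add: b_def sum_nonneg)
qed

lemma hamiltonian_symmetric:
  assumes \<Omega>: "adj_mat \<Omega> = \<Omega>" and D: "\<xi> \<in> fock_D" "\<eta> \<in> fock_D"
  shows "cinner (hamiltonian \<Omega> \<kappa> 0 \<xi>) \<eta> = cinner \<xi> (hamiltonian \<Omega> \<kappa> 0 \<eta>)"
proof -
  have \<Omega>': "cnj (\<Omega> $ j $ k) = \<Omega> $ k $ j" for j k
    using arg_cong[OF \<Omega>, of "\<lambda>A. A $ k $ j"] by (simp add: adj_mat_def map_matrix_def transpose_def)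
  have "cinner (hamiltonian \<Omega> \<kappa> 0 \<xi>) \<eta> = (\<Sum>j\<in>UNIV. \<Sum>k\<in>UNIV. \<Omega> $ k $ j * cinner \<xi> (creat k (annih j \<eta>))
    + cnj (\<kappa> $ j $ k) / 2 * cinner \<xi> (annih k (annih j \<eta>)) + \<kappa> $ j $ k / 2 * cinner \<xi> (creat k (creat j \<eta>)))"
    unfolding hamiltonian_def
    by (simp add: cinner_sum_left cinner_add_left cinner_creat_left cinner_annih_left D \<Omega>')
  also have "\<dots> = (\<Sum>j\<in>UNIV. \<Sum>k\<in>UNIV. \<Omega> $ k $ j * cinner \<xi> (creat k (annih j \<eta>)))
    + (\<Sum>j\<in>UNIV. \<Sum>k\<in>UNIV. cnj (\<kappa> $ j $ k) / 2 * cinner \<xi> (annih j (annih k \<eta>)) + \<kappa> $ j $ k / 2 * cinner \<xi> (creat j (creat k \<eta>)))"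
    using D by (simp add: sum.distrib annih_annih creat_creat add.assoc)
  also have "(\<Sum>j\<in>UNIV. \<Sum>k\<in>UNIV. \<Omega> $ k $ j * cinner \<xi> (creat k (annih j \<eta>)))
    = (\<Sum>j\<in>UNIV. \<Sum>k\<in>UNIV. \<Omega> $ j $ k * cinner \<xi> (creat j (annih k \<eta>)))" by (rule sum.swap)
  finally show ?thesis
    unfolding hamiltonian_def
    by (simp add: cinner_sum_right cinner_add_right sum.distrib algebra_simps)
qed

text \<open>The commutator [N, H]: the terms with \<Omega> conserve particles and drop out, the
  others change N by two, which cancels the 1/2.\<close>

definition ham_comm :: "complex^'d^'d \<Rightarrow> 'd::finite fock \<Rightarrow> 'd fock"
  where "ham_comm \<kappa> \<xi> = (\<Sum>j\<in>UNIV. \<Sum>k\<in>UNIV. (\<kappa> $ j $ k) *\<^sub>C creat j (creat k \<xi>) - cnj (\<kappa> $ j $ k) *\<^sub>C annih j (annih k \<xi>))"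

lemma ham_comm_in_D [simp]: "ham_comm \<kappa> \<xi> \<in> fock_D"
  by (simp add: ham_comm_def)

lemma hamiltonian_wt2:
  assumes \<xi>: "\<xi> \<in> fock_D"
  shows "hamiltonian \<Omega> \<kappa> 0 (wt 2 \<xi>) = wt 2 (hamiltonian \<Omega> \<kappa> 0 \<xi>) - ham_comm \<kappa> \<xi>"
proof -
  have ca: "creat j (annih k (wt 2 \<xi>)) = wt 2 (creat j (annih k \<xi>))" for j k
    using \<xi> by (simp add: annih_wt2 creat_wt2 creat_add)
  have cc: "creat j (creat k (wt 2 \<xi>)) = wt 2 (creat j (creat k \<xi>)) - 2 *\<^sub>C creat j (creat k \<xi>)" for j k
    using \<xi> by (simp add: creat_wt2 creat_diff) (rule fock_eqI, simp)
  have aa: "annih j (annih k (wt 2 \<xi>)) = wt 2 (annih j (annih k \<xi>)) + 2 *\<^sub>C annih j (annih k \<xi>)" for j k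
    using \<xi> by (simp add: annih_wt2 annih_add) (rule fock_eqI, simp)
  show ?thesis
    unfolding hamiltonian_def ham_comm_def ca cc aa
    by (simp add: wt_sum wt_add wt_scaleC scaleC_diff_right scaleC_add_right sum.distrib sum_subtractf)
qed

text \<open>Moving one of the two factors to the left side of the inner product leaves first order
  operators on both sides, so the form of N + 1 is enough and no graph norm is required.\<close>

lemma cmod_cinner_ham_comm_le:
  "\<exists>c\<ge>0. \<forall>\<xi>\<in>fock_D. cmod (cinner \<xi> (ham_comm \<kappa> \<xi>)) \<le> c * (norm (wt 1 \<xi>))\<^sup>2"
proof (intro exI[of _ "\<Sum>j\<in>UNIV. \<Sum>k\<in>UNIV. 2 * cmod (\<kappa> $ j $ k)"] conjI ballI)
  fix \<xi> :: "'a fock" assume \<xi>: "\<xi> \<in> fock_D"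
  have "cinner \<xi> (ham_comm \<kappa> \<xi>) = (\<Sum>j\<in>UNIV. \<Sum>k\<in>UNIV. \<kappa> $ j $ k * cinner (annih j \<xi>) (creat k \<xi>) - cnj (\<kappa> $ j $ k) * cinner (creat j \<xi>) (annih k \<xi>))"
    unfolding ham_comm_def
    by (simp add: cinner_sum_right cinner_diff_right cinner_annih_left cinner_creat_left \<xi>)
  also have "cmod \<dots> \<le> (\<Sum>j\<in>UNIV. \<Sum>k\<in>UNIV. 2 * cmod (\<kappa> $ j $ k) * (norm (wt 1 \<xi>))\<^sup>2)"
  proof (intro sum_norm_le)
    fix j k
    have "cmod (cinner (annih j \<xi>) (creat k \<xi>)) \<le> norm (wt 1 \<xi>) * norm (wt 1 \<xi>)"
      by (rule order_trans[OF cmod_cinner_le mult_mono[OF norm_annih_le[OF \<xi>] norm_creat_le[OF \<xi>]]]) auto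
    moreover have "cmod (cinner (creat j \<xi>) (annih k \<xi>)) \<le> norm (wt 1 \<xi>) * norm (wt 1 \<xi>)"
      by (rule order_trans[OF cmod_cinner_le mult_mono[OF norm_creat_le[OF \<xi>] norm_annih_le[OF \<xi>]]]) auto
    ultimately have "cmod (\<kappa> $ j $ k) * cmod (cinner (annih j \<xi>) (creat k \<xi>)) + cmod (\<kappa> $ j $ k) * cmod (cinner (creat j \<xi>) (annih k \<xi>))
       \<le> cmod (\<kappa> $ j $ k) * (norm (wt 1 \<xi>) * norm (wt 1 \<xi>)) + cmod (\<kappa> $ j $ k) * (norm (wt 1 \<xi>) * norm (wt 1 \<xi>))"
      by (intro add_mono mult_left_mono) auto
    moreover have "cmod (\<kappa> $ j $ k * cinner (annih j \<xi>) (creat k \<xi>) - cnj (\<kappa> $ j $ k) * cinner (creat j \<xi>) (annih k \<xi>))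
      \<le> cmod (\<kappa> $ j $ k) * cmod (cinner (annih j \<xi>) (creat k \<xi>)) + cmod (\<kappa> $ j $ k) * cmod (cinner (creat j \<xi>) (annih k \<xi>))"
      by (rule order_trans[OF norm_triangle_ineq4]) (simp add: norm_mult)
    ultimately show "cmod (\<kappa> $ j $ k * cinner (annih j \<xi>) (creat k \<xi>) - cnj (\<kappa> $ j $ k) * cinner (creat j \<xi>) (annih k \<xi>))
      \<le> 2 * cmod (\<kappa> $ j $ k) * (norm (wt 1 \<xi>))\<^sup>2"
      by (simp add: power2_eq_square mult_ac)
  qed
  finally show "cmod (cinner \<xi> (ham_comm \<kappa> \<xi>)) \<le> (\<Sum>j\<in>UNIV. \<Sum>k\<in>UNIV. 2 * cmod (\<kappa> $ j $ k)) * (norm (wt 1 \<xi>))\<^sup>2"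
    by (simp add: sum_distrib_right)
qed (simp add: sum_nonneg)

text \<open>The drift operator \<open>G\<close> in \<open>\<L>(x) = G\<^sup>* x + \<Sum>\<^sub>l L\<^sub>l\<^sup>* x L\<^sub>l + x G\<close>.\<close>

definition gdrift :: "complex^'d^'d \<Rightarrow> complex^'d^'d \<Rightarrow> complex^'d^'m \<Rightarrow> complex^'d^'m::finite \<Rightarrow> 'd::finite fock \<Rightarrow> 'd fock"
  where "gdrift \<Omega> \<kappa> U V \<xi> = (- \<i>) *\<^sub>C hamiltonian \<Omega> \<kappa> 0 \<xi> - (1/2) *\<^sub>C (\<Sum>l\<in>UNIV. kraus_adj U V l (kraus U V l \<xi>))"

lemma gdrift_in_D [simp]: "gdrift \<Omega> \<kappa> U V \<xi> \<in> fock_D"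
  by (simp add: gdrift_def)

lemma gdrift_add: "\<xi> \<in> fock_D \<Longrightarrow> \<eta> \<in> fock_D \<Longrightarrow> gdrift \<Omega> \<kappa> U V (\<xi> + \<eta>) = gdrift \<Omega> \<kappa> U V \<xi> + gdrift \<Omega> \<kappa> U V \<eta>"
  by (simp add: gdrift_def hamiltonian_add kraus_add kraus_adj_add sum.distrib scaleC_add_right algebra_simps)

lemma generator_form_gdrift:
  assumes "u \<in> fock_D" "v \<in> fock_D" "x \<in> BH"
  shows "generator_form \<Omega> \<kappa> U V 0 x u v =
    cinner (gdrift \<Omega> \<kappa> U V u) (x v) + cinner u (x (gdrift \<Omega> \<kappa> U V v))
    + (\<Sum>l\<in>UNIV. cinner (kraus U V l u) (x (kraus U V l v)))"
  unfolding generator_form_D[OF assms(2,1)] gdrift_def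
  by (simp add: cinner_diff_left cinner_diff_right blinfun.diff_right BH_scaleC[OF assms(3)] blinfun.sum_right
     cinner_sum_left cinner_sum_right sum.distrib sum_subtractf sum_distrib_left algebra_simps)

lemma norm_gdrift_le:
  fixes U V :: "complex^'d::finite^'m::finite"
  shows "\<exists>c\<ge>0. \<forall>\<xi>\<in>fock_D. norm (gdrift \<Omega> \<kappa> U V \<xi>) \<le> c * norm (wt 2 \<xi>)"
proof -
  obtain a where a: "a \<ge> 0" "\<And>\<xi>. \<xi> \<in> fock_D \<Longrightarrow> norm (hamiltonian \<Omega> \<kappa> 0 \<xi>) \<le> a * norm (wt 2 \<xi>)"
    using norm_hamiltonian_le by blast
  have "\<forall>l. \<exists>b\<ge>0. \<forall>\<xi>\<in>fock_D. norm (kraus_adj U V l (kraus U V l \<xi>)) \<le> b * norm (wt 2 \<xi>)"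
    using norm_kraus_adj_kraus_le by blast
  then obtain b where b: "\<And>l. b l \<ge> 0" "\<And>l \<xi>. \<xi> \<in> fock_D \<Longrightarrow> norm (kraus_adj U V l (kraus U V l \<xi>)) \<le> b l * norm (wt 2 \<xi>)"
    by metis
  show ?thesis
  proof (intro exI[of _ "a + (\<Sum>l\<in>UNIV. b l)"] conjI ballI)
    show "0 \<le> a + (\<Sum>l\<in>UNIV. b l)" using a b by (simp add: sum_nonneg)
    fix \<xi> :: "'d fock" assume \<xi>: "\<xi> \<in> fock_D"
    have "norm (\<Sum>l\<in>UNIV. kraus_adj U V l (kraus U V l \<xi>)) \<le> (\<Sum>l\<in>UNIV. b l * norm (wt 2 \<xi>))"
      by (intro sum_norm_le b(2) \<xi>)
    then have "norm ((1/2) *\<^sub>C (\<Sum>l\<in>UNIV. kraus_adj U V l (kraus U V l \<xi>))) \<le> (\<Sum>l\<in>UNIV. b l * norm (wt 2 \<xi>))"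
      using norm_ge_zero[of "\<Sum>l\<in>UNIV. kraus_adj U V l (kraus U V l \<xi>)"]
        norm_scaleC[of "1/2" "\<Sum>l\<in>UNIV. kraus_adj U V l (kraus U V l \<xi>)"] by (simp only: norm_divide norm_one norm_numeral)
    moreover have "norm ((- \<i>) *\<^sub>C hamiltonian \<Omega> \<kappa> 0 \<xi>) \<le> a * norm (wt 2 \<xi>)" using a(2)[OF \<xi>] by simp
    moreover have "norm (gdrift \<Omega> \<kappa> U V \<xi>) \<le> norm ((- \<i>) *\<^sub>C hamiltonian \<Omega> \<kappa> 0 \<xi>) + norm ((1/2) *\<^sub>C (\<Sum>l\<in>UNIV. kraus_adj U V l (kraus U V l \<xi>)))"
      unfolding gdrift_def by (rule norm_triangle_ineq4)
    ultimately show "norm (gdrift \<Omega> \<kappa> U V \<xi>) \<le> (a + (\<Sum>l\<in>UNIV. b l)) * norm (wt 2 \<xi>)"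
      unfolding distrib_right sum_distrib_right by linarith
  qed
qed

text \<open>The form of L(1) = 0 at \<xi>: H is symmetric and contributes nothing to the real
  part.\<close>

lemma gdrift_conservative:
  assumes \<Omega>: "adj_mat \<Omega> = \<Omega>" and \<xi>: "\<xi> \<in> fock_D"
  shows "2 * Re (cinner (gdrift \<Omega> \<kappa> U V \<xi>) \<xi>) + (\<Sum>l\<in>UNIV. (norm (kraus U V l \<xi>))\<^sup>2) = 0"
proof -
  have "Im (cinner (hamiltonian \<Omega> \<kappa> 0 \<xi>) \<xi>) = 0"
    using arg_cong[OF cinner_commute[of "hamiltonian \<Omega> \<kappa> 0 \<xi>" \<xi>], of Im] hamiltonian_symmetric[OF \<Omega> \<xi> \<xi>, of \<kappa>] by simp
  moreover have "Re (cinner (kraus_adj U V l (kraus U V l \<xi>)) \<xi>) = (norm (kraus U V l \<xi>))\<^sup>2" for l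
    using \<xi> by (simp add: cinner_kraus cinner_self del: of_real_power)
  ultimately show ?thesis
    by (simp add: gdrift_def cinner_diff_left cinner_sum_left)
qed

text \<open>The Lyapunov bound L(N + 1) <= c (N + 1) as a quadratic form. Apparent terms of order
  N^2 cancel, and only commutators with N survive: [N, H] and, for each l, a product of two first
  order operators.\<close>

lemma gdrift_number_bound:
  fixes U V :: "complex^'d::finite^'m::finite"
  assumes \<Omega>: "adj_mat \<Omega> = \<Omega>"
  shows "\<exists>c\<ge>0. \<forall>\<xi>\<in>fock_D. 2 * Re (cinner (gdrift \<Omega> \<kappa> U V \<xi>) (wt 2 \<xi>))
    + (\<Sum>l\<in>UNIV. Re (cinner (kraus U V l \<xi>) (wt 2 (kraus U V l \<xi>)))) \<le> c * (norm (wt 1 \<xi>))\<^sup>2"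
proof -
  obtain a where a: "a \<ge> 0" "\<And>\<xi>. \<xi> \<in> fock_D \<Longrightarrow> cmod (cinner \<xi> (ham_comm \<kappa> \<xi>)) \<le> a * (norm (wt 1 \<xi>))\<^sup>2"
    using cmod_cinner_ham_comm_le by blast
  have "\<forall>l. \<exists>b\<ge>0. \<forall>\<xi>\<in>fock_D. norm (kraus U V l \<xi>) \<le> b * norm (wt 1 \<xi>)" using norm_kraus_le by blast
  then obtain b where b: "\<And>l. b l \<ge> 0" "\<And>l \<xi>. \<xi> \<in> fock_D \<Longrightarrow> norm (kraus U V l \<xi>) \<le> b l * norm (wt 1 \<xi>)" by metis
  have "\<forall>l. \<exists>b\<ge>0. \<forall>\<xi>\<in>fock_D. norm (kraus U (- V) l \<xi>) \<le> b * norm (wt 1 \<xi>)" using norm_kraus_le by blast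
  then obtain b' where b': "\<And>l. b' l \<ge> 0" "\<And>l \<xi>. \<xi> \<in> fock_D \<Longrightarrow> norm (kraus U (- V) l \<xi>) \<le> b' l * norm (wt 1 \<xi>)" by metis
  show ?thesis
  proof (intro exI[of _ "a + (\<Sum>l\<in>UNIV. b l * b' l)"] conjI ballI)
    show "0 \<le> a + (\<Sum>l\<in>UNIV. b l * b' l)" using a b b' by (simp add: sum_nonneg)
    fix \<xi> :: "'d fock" assume \<xi>: "\<xi> \<in> fock_D"
    let ?H = "hamiltonian \<Omega> \<kappa> 0 \<xi>" and ?L = "\<lambda>l. kraus U V l \<xi>"
    have "cinner ?H (wt 2 \<xi>) = cinner \<xi> (wt 2 ?H) - cinner \<xi> (ham_comm \<kappa> \<xi>)"
      using \<xi> by (simp add: hamiltonian_symmetric[OF \<Omega>] hamiltonian_wt2 cinner_diff_right)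
    also have "cinner \<xi> (wt 2 ?H) = cnj (cinner ?H (wt 2 \<xi>))"
      using \<xi> by (subst cinner_wt_left[symmetric]) (auto intro: cinner_commute)
    finally have hc: "cinner ?H (wt 2 \<xi>) = cnj (cinner ?H (wt 2 \<xi>)) - cinner \<xi> (ham_comm \<kappa> \<xi>)" .
    \<comment> \<open>H being symmetric, the imaginary part sees only the commutator with N.\<close>
    have "2 * Im (cinner ?H (wt 2 \<xi>)) = - Im (cinner \<xi> (ham_comm \<kappa> \<xi>))"
      using arg_cong[OF hc, of Im] by simp
    then have H: "- 2 * Im (cinner ?H (wt 2 \<xi>)) \<le> a * (norm (wt 1 \<xi>))\<^sup>2"
      using abs_Im_le_cmod[of "cinner \<xi> (ham_comm \<kappa> \<xi>)"] a(2)[OF \<xi>] by linarith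
    have L: "Re (cinner (?L l) (wt 2 (?L l))) - Re (cinner (kraus_adj U V l (?L l)) (wt 2 \<xi>)) \<le> b l * b' l * (norm (wt 1 \<xi>))\<^sup>2" for l
    proof -
      have "Re (cinner (?L l) (wt 2 (?L l))) - Re (cinner (kraus_adj U V l (?L l)) (wt 2 \<xi>)) = Re (cinner (?L l) (kraus U (- V) l \<xi>))"
        using \<xi> by (simp add: cinner_kraus kraus_wt2 cinner_diff_right)
      also have "\<dots> \<le> norm (?L l) * norm (kraus U (- V) l \<xi>)"
        by (rule order_trans[OF complex_Re_le_cmod cmod_cinner_le])
      also have "\<dots> \<le> (b l * norm (wt 1 \<xi>)) * (b' l * norm (wt 1 \<xi>))"
        using b b' \<xi> by (intro mult_mono mult_nonneg_nonneg) auto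
      finally show ?thesis by (simp add: power2_eq_square mult_ac)
    qed
    have "2 * Re (cinner (gdrift \<Omega> \<kappa> U V \<xi>) (wt 2 \<xi>)) + (\<Sum>l\<in>UNIV. Re (cinner (?L l) (wt 2 (?L l))))
      = - 2 * Im (cinner ?H (wt 2 \<xi>)) + (\<Sum>l\<in>UNIV. Re (cinner (?L l) (wt 2 (?L l))) - Re (cinner (kraus_adj U V l (?L l)) (wt 2 \<xi>)))"
      by (simp add: gdrift_def cinner_diff_left cinner_sum_left sum_subtractf)
    also have "\<dots> \<le> a * (norm (wt 1 \<xi>))\<^sup>2 + (\<Sum>l\<in>UNIV. b l * b' l * (norm (wt 1 \<xi>))\<^sup>2)"
      by (intro add_mono H sum_mono L)
    finally show "2 * Re (cinner (gdrift \<Omega> \<kappa> U V \<xi>) (wt 2 \<xi>)) + (\<Sum>l\<in>UNIV. Re (cinner (?L l) (wt 2 (?L l))))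
      \<le> (a + (\<Sum>l\<in>UNIV. b l * b' l)) * (norm (wt 1 \<xi>))\<^sup>2"
      by (simp add: distrib_right sum_distrib_right)
  qed
qed

section \<open>Compactness of the number-weighted unit ball\<close>

text \<open>The constraint <\<xi>, (N + 1) \<xi>> <= B is imposed on finite partial sums, because
  limits of vectors in \<open>fock_D\<close> need not stay in \<open>fock_D\<close>, where
  \<open>wt\<close> is meaningful.\<close>

definition weighted_ball :: "real \<Rightarrow> 'd::finite fock set"
  where "weighted_ball B = {\<xi>. norm \<xi> \<le> 1 \<and>
    (\<forall>F. finite F \<longrightarrow> (\<Sum>n\<in>F. (real (level n) + 1) * (cmod (fock_coeff \<xi> n))\<^sup>2) \<le> B)}"

lemma weighted_sum_le_norm_wt:
  assumes "\<xi> \<in> fock_D" "finite F"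
  shows "(\<Sum>n\<in>F. (real (level n) + 1) * (cmod (fock_coeff \<xi> n))\<^sup>2) \<le> (norm (wt 1 \<xi>))\<^sup>2"
  using sum_fock_coeff_sq_le[OF assms(2), of "wt 1 \<xi>"] assms(1)
  by (simp add: fock_coeff_wt norm_mult power_mult_distrib add.commute)

lemma norm_wt_trunc_sq:
  "(norm (wt 1 (trunc k \<xi>)))\<^sup>2 = (\<Sum>n | level n \<le> k. (real (level n) + 1) * (cmod (fock_coeff \<xi> n))\<^sup>2)"
proof -
  have "(norm (wt 1 (trunc k \<xi>)))\<^sup>2 = (\<Sum>\<^sub>\<infinity>n\<in>{n. level n \<le> k}. (real (level n) + 1) * (cmod (fock_coeff \<xi> n))\<^sup>2)"
    unfolding norm_fock_sq
    by (rule infsum_cong_neutral) (auto simp: fock_coeff_wt norm_mult power_mult_distrib add.commute)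
  then show ?thesis by (simp add: finite_level)
qed

lemma tail_le:
  fixes \<xi> :: "'d::finite fock"
  assumes B: "\<And>F. finite F \<Longrightarrow> (\<Sum>n\<in>F. (real (level n) + 1) * (cmod (fock_coeff \<xi> n))\<^sup>2) \<le> B"
  shows "(norm (\<xi> - trunc k \<xi>))\<^sup>2 \<le> B / (real k + 1)"
  unfolding norm_fock_sq
proof (rule square_summable_bddI(2))
  fix F :: "('d \<Rightarrow> nat) set" assume F: "finite F"
  have "(\<Sum>n\<in>F. (cmod (fock_coeff (\<xi> - trunc k \<xi>) n))\<^sup>2) * (real k + 1)
    \<le> (\<Sum>n\<in>F. (real (level n) + 1) * (cmod (fock_coeff \<xi> n))\<^sup>2)"
    unfolding sum_distrib_right by (intro sum_mono) (auto simp: mult.commute mult_right_mono)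
  also have "\<dots> \<le> B" by (rule B[OF F])
  finally show "(\<Sum>n\<in>F. (cmod (fock_coeff (\<xi> - trunc k \<xi>) n))\<^sup>2) \<le> B / (real k + 1)"
    by (simp add: pos_le_divide_eq)
qed

text \<open>The form domain of the number operator embeds compactly.\<close>

lemma weighted_ball_seq_compact:
  fixes f :: "nat \<Rightarrow> 'd::finite fock"
  assumes f: "\<And>k. f k \<in> weighted_ball B"
  shows "\<exists>\<xi>\<in>weighted_ball B. \<exists>r. strict_mono r \<and> (\<lambda>k. f (r k)) \<longlonglongrightarrow> \<xi>"
proof -
  \<comment> \<open>Tychonoff for closed discs gives a subsequence converging in each coordinate;
    the uniform bound \<open>tail_le\<close> later upgrades this to norm convergence.\<close>
  have cp: "compact (PiE (UNIV :: ('d \<Rightarrow> nat) set) (\<lambda>_. cball (0::complex) 1))"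
  proof -
    have "compactin (product_topology (\<lambda>_. euclidean) UNIV) (PiE (UNIV :: ('d \<Rightarrow> nat) set) (\<lambda>_. cball (0::complex) 1))"
      by (subst compactin_PiE) auto
    then show ?thesis by (simp add: euclidean_product_topology)
  qed
  have "fock_coeff (f k) \<in> PiE UNIV (\<lambda>_. cball 0 1)" for k
    using order_trans[OF cmod_fock_coeff_le] f[of k] by (auto simp: weighted_ball_def)
  then obtain x r where r: "strict_mono r" and lim: "((\<lambda>k. fock_coeff (f k)) \<circ> r) \<longlonglongrightarrow> x"
    using cp unfolding compact_def by metis
  have co: "(\<lambda>k. fock_coeff (f (r k)) n) \<longlonglongrightarrow> x n" for n
  proof -
    have "isCont (\<lambda>g :: ('d \<Rightarrow> nat) \<Rightarrow> complex. g n) x"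
    proof -
      have "continuous_on UNIV (\<lambda>g :: ('d \<Rightarrow> nat) \<Rightarrow> complex. g n)" by (rule continuous_on_product_coordinates)
      then show ?thesis using continuous_on_eq_continuous_at[OF open_UNIV] by blast
    qed
    from isCont_tendsto_compose[OF this lim] show ?thesis by (simp add: o_def)
  qed
  have wB: "(\<Sum>n\<in>F. (real (level n) + 1) * (cmod (x n))\<^sup>2) \<le> B" if "finite F" for F
  proof (rule LIMSEQ_le_const2)
    show "(\<lambda>k. \<Sum>n\<in>F. (real (level n) + 1) * (cmod (fock_coeff (f (r k)) n))\<^sup>2)
      \<longlonglongrightarrow> (\<Sum>n\<in>F. (real (level n) + 1) * (cmod (x n))\<^sup>2)"
      by (intro tendsto_intros co)
  qed (use f that in \<open>auto simp: weighted_ball_def\<close>)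
  have w1: "(\<Sum>n\<in>F. (cmod (x n))\<^sup>2) \<le> 1\<^sup>2" if "finite F" for F
  proof (rule LIMSEQ_le_const2)
    show "(\<lambda>k. \<Sum>n\<in>F. (cmod (fock_coeff (f (r k)) n))\<^sup>2) \<longlonglongrightarrow> (\<Sum>n\<in>F. (cmod (x n))\<^sup>2)"
      by (intro tendsto_intros co)
    have "(\<Sum>n\<in>F. (cmod (fock_coeff (f (r k)) n))\<^sup>2) \<le> 1\<^sup>2" for k
      using sum_fock_coeff_sq_le[OF that, of "f (r k)"] power_mono[of "norm (f (r k))" 1 2] f[of "r k"]
      by (simp add: weighted_ball_def)
    then show "\<exists>N. \<forall>k\<ge>N. (\<Sum>n\<in>F. (cmod (fock_coeff (f (r k)) n))\<^sup>2) \<le> 1\<^sup>2" by blast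
  qed
  define \<xi> where "\<xi> = Abs_fock x"
  have \<xi>: "fock_coeff \<xi> = x" "norm \<xi> \<le> 1" unfolding \<xi>_def by (rule Abs_fock_bdd[OF w1]; simp)+
  have \<xi>B: "\<xi> \<in> weighted_ball B" using \<xi> wB by (simp add: weighted_ball_def)
  have B0: "B \<ge> 0" using wB[of "{}"] by simp
  have "(\<lambda>k. f (r k)) \<longlonglongrightarrow> \<xi>"
  proof (rule metric_LIMSEQ_I)
    fix e :: real assume e: "0 < e"
    \<comment> \<open>Chosen so that the tail beyond K particles has norm below e/3 on the whole
      weighted ball.\<close>
    obtain K :: nat where K: "B * (9 / e\<^sup>2) < real K" using reals_Archimedean2 by blast
    have "B / (real K + 1) < (e/3)\<^sup>2"
    proof -
      have "B * 9 < real K * e\<^sup>2" using K e by (simp add: field_simps)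
      also have "\<dots> \<le> (real K + 1) * e\<^sup>2" by (simp add: mult_right_mono)
      finally show ?thesis using e by (simp add: field_simps)
    qed
    then have tl: "norm (\<eta> - trunc K \<eta>) < e/3" if "\<eta> \<in> weighted_ball B" for \<eta> :: "'d fock"
    proof -
      have "(norm (\<eta> - trunc K \<eta>))\<^sup>2 \<le> B / (real K + 1)" by (rule tail_le) (use that in \<open>auto simp: weighted_ball_def\<close>)
      then have "(norm (\<eta> - trunc K \<eta>))\<^sup>2 < (e/3)\<^sup>2" using \<open>B / (real K + 1) < (e/3)\<^sup>2\<close> by linarith
      then show ?thesis by (rule power2_less_imp_less) (use e in simp)
    qed
    have "(\<lambda>k. trunc K (f (r k))) \<longlonglongrightarrow> trunc K \<xi>"
      unfolding trunc_def \<xi>(1)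
    proof (intro tendsto_sum)
      fix n
      have "((\<lambda>k. fock_coeff (f (r k)) n *\<^sub>C fock_e n) \<longlonglongrightarrow> x n *\<^sub>C fock_e n)"
      proof (rule LIM_zero_cancel, rule tendsto_norm_zero_cancel)
        have "(\<lambda>k. norm (fock_coeff (f (r k)) n - x n)) \<longlonglongrightarrow> 0"
          using co[of n] by (intro tendsto_norm_zero LIM_zero)
        then show "(\<lambda>k. norm (fock_coeff (f (r k)) n *\<^sub>C fock_e n - x n *\<^sub>C fock_e n)) \<longlonglongrightarrow> 0"
          by (simp add: scaleC_diff_left[symmetric])
      qed
      then show "((\<lambda>k. fock_coeff (f (r k)) n *\<^sub>C fock_e n) \<longlonglongrightarrow> x n *\<^sub>C fock_e n)" .
    qed
    from metric_LIMSEQ_D[OF this, of "e/3"] e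
    obtain N where N: "\<And>k. k \<ge> N \<Longrightarrow> norm (trunc K (f (r k)) - trunc K \<xi>) < e/3" by (auto simp: dist_norm)
    have "dist (f (r k)) \<xi> < e" if "k \<ge> N" for k
    proof -
      have "f (r k) - \<xi> = (f (r k) - trunc K (f (r k))) + (trunc K (f (r k)) - trunc K \<xi>) - (\<xi> - trunc K \<xi>)" by simp
      then have "norm (f (r k) - \<xi>) \<le> norm (f (r k) - trunc K (f (r k))) + norm (trunc K (f (r k)) - trunc K \<xi>) + norm (\<xi> - trunc K \<xi>)"
        by (metis (no_types) norm_triangle_ineq4 norm_triangle_ineq add_right_mono order_trans)
      then show ?thesis using N[OF that] tl[OF f[of "r k"]] tl[OF \<xi>B] by (simp add: dist_norm)
    qed
    then show "\<exists>no. \<forall>k\<ge>no. dist (f (r k)) \<xi> < e" by blast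
  qed
  then show ?thesis using \<xi>B r by blast
qed

lemma quadratic_nonneg_discriminant:
  fixes a b c :: real
  assumes "\<And>r. a + 2 * r * b + r\<^sup>2 * c \<ge> 0" "c \<ge> 0"
  shows "b\<^sup>2 \<le> a * c"
proof (cases "c = 0")
  case True
  have "b = 0"
  proof (rule ccontr)
    assume b: "b \<noteq> 0"
    have "a + 2 * (- (a + 1) / (2 * b)) * b \<ge> 0" using assms(1)[of "- (a + 1) / (2 * b)"] True by simp
    then show False using b by (simp add: field_simps)
  qed
  then show ?thesis using True by simp
next
  case False
  have "a + 2 * (- b / c) * b + (- b / c)\<^sup>2 * c = (a * c - b\<^sup>2) / c"
    using False by (simp add: field_simps power2_eq_square)
  then show ?thesis using assms(1)[of "- b / c"] False assms(2) by (simp add: zero_le_divide_iff)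
qed

section \<open>The maximum principle\<close>

text \<open>Real part of the form of y - w (N + 1). The penalty makes maximising sequences bounded
  in the form norm, hence relatively compact.\<close>

definition number_form :: "'d::finite op \<Rightarrow> real \<Rightarrow> 'd fock \<Rightarrow> real"
  where "number_form y w \<xi> = Re (cinner \<xi> (y \<xi>)) - w * (norm (wt 1 \<xi>))\<^sup>2"

definition hpart :: "'d::finite op \<Rightarrow> 'd op"
  where "hpart y = (1/2) *\<^sub>R (y + adj y)"

lemma hpart:
  assumes "y \<in> BH"
  shows "hpart y \<in> BH" "cinner u (hpart y v) = (cinner u (y v) + cinner (y u) v) / 2"
proof -
  show "cinner u (hpart y v) = (cinner u (y v) + cinner (y u) v) / 2"
    by (simp add: hpart_def scaleR_blinfun.rep_eq plus_blinfun.rep_eq cinner_add_right adj_exists_right[OF assms] add_divide_distrib)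
  have "y + adj y \<in> BH" using adj_exists(1)[OF assms] assms by simp
  then show "hpart y \<in> BH"
    by (simp add: hpart_def BH_def scaleR_blinfun.rep_eq scaleR_scaleC_commute)
qed

lemma Re_hpart_form:
  assumes y: "y \<in> BH"
  shows "Re (cinner u (y v) + cinner v (y u)) = 2 * Re (cinner u (hpart y v))"
proof -
  have "Re (cinner u (hpart y v)) = (Re (cinner u (y v)) + Re (cinner (y u) v)) / 2"
    unfolding hpart(2)[OF y] by simp
  then show ?thesis using arg_cong[OF cinner_commute[of "y u" v], of Re] by simp
qed

text \<open>Euler-Lagrange equation at a maximiser, tested against the basis vectors.\<close>

lemma number_form_maximiser:
  fixes \<xi> :: "'d::finite fock"
  assumes y: "y \<in> BH" and w: "w > 0"
    and le: "\<And>\<eta>. \<eta> \<in> fock_D \<Longrightarrow> number_form y w \<eta> \<le> \<mu> * (norm \<eta>)\<^sup>2"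
    and lim: "(\<lambda>K. \<mu> * (norm (trunc K \<xi>))\<^sup>2 - number_form y w (trunc K \<xi>)) \<longlonglongrightarrow> 0"
  shows "fock_coeff (hpart y \<xi> - complex_of_real \<mu> *\<^sub>C \<xi>) n = of_real (w * (real (level n) + 1)) * fock_coeff \<xi> n"
proof -
  let ?d = "fock_coeff (hpart y \<xi> - complex_of_real \<mu> *\<^sub>C \<xi>) n - of_real (w * (real (level n) + 1)) * fock_coeff \<xi> n"
  let ?q = "\<lambda>\<eta>. \<mu> * (norm \<eta>)\<^sup>2 - number_form y w \<eta>"
  have q0: "?q \<eta> \<ge> 0" if "\<eta> \<in> fock_D" for \<eta> using le[OF that] by simp
  have nf: "number_form y w \<eta> = Re (cinner \<eta> (hpart y \<eta>)) - w * Re (cinner \<eta> (wt 2 \<eta>))" if "\<eta> \<in> fock_D" for \<eta>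
    using that Re_hpart_form[OF y, of \<eta> \<eta>] by (simp add: number_form_def cinner_wt2 del: of_real_power)
  have expand: "?q (\<eta> + r *\<^sub>R e) = ?q \<eta> + 2 * r * (\<mu> * Re (cinner e \<eta>) - Re (cinner e (hpart y \<eta>)) + w * Re (cinner e (wt 2 \<eta>))) + r\<^sup>2 * ?q e"
    if "\<eta> \<in> fock_D" "e \<in> fock_D" for \<eta> e r
  proof -
    have s: "Re (cinner \<eta> e) = Re (cinner e \<eta>)" using arg_cong[OF cinner_commute[of \<eta> e], of Re] by simp
    have "cinner \<eta> (hpart y e) = cnj (cinner e (hpart y \<eta>))"
      unfolding hpart(2)[OF y] using cinner_commute[of \<eta> "y e"] cinner_commute[of "y \<eta>" e] by simp
    then have h: "Re (cinner \<eta> (hpart y e)) = Re (cinner e (hpart y \<eta>))" by simp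
    have "cinner \<eta> (wt 2 e) = cnj (cinner e (wt 2 \<eta>))"
      using that cinner_wt_left[of \<eta> e 2] cinner_commute[of "wt 2 \<eta>" e] by simp
    then have n: "Re (cinner \<eta> (wt 2 e)) = Re (cinner e (wt 2 \<eta>))" by simp
    have nn: "(norm x)\<^sup>2 = Re (cinner x x)" for x :: "'d fock" by (simp add: cinner_self del: of_real_power)
    show ?thesis
      using that s h n unfolding nn nf[OF that(1)] nf[OF that(2)]
      by (subst nf) (simp_all add: cinner_add_left cinner_add_right blinfun.add_right blinfun.scaleR_right
        wt_add wt_scaleR power2_eq_square algebra_simps)
  qed
  have key: "Re (cnj c * ?d) = 0" for c
  proof -
    let ?e = "c *\<^sub>C fock_e n"
    \<comment> \<open>The maximiser need not lie in \<open>fock_D\<close>, so its truncations are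
      perturbed. Their deficit tends to 0, which removes the constant term of the nonnegative
      quadratic in r and forces the linear coefficient to vanish.\<close>
    have "2 * r * (- Re (cnj c * ?d)) + r\<^sup>2 * ?q ?e \<ge> 0" for r
    proof (rule LIMSEQ_le_const)
      have lt: "(\<lambda>K. trunc K \<xi>) \<longlonglongrightarrow> \<xi>" by (rule trunc_tendsto)
      have lh: "(\<lambda>K. hpart y (trunc K \<xi>)) \<longlonglongrightarrow> hpart y \<xi>"
        by (intro bounded_linear.tendsto[OF blinfun.bounded_linear_right] lt)
      have lc: "(\<lambda>K. fock_coeff (trunc K \<xi>) n) \<longlonglongrightarrow> fock_coeff \<xi> n"
        using tendsto_cinner[OF tendsto_const[of "fock_e n"] lt] by (simp del: fock_coeff_trunc)
      have eqK: "w * Re (cinner ?e (wt 2 (trunc K \<xi>))) = Re (cnj c * (of_real (w * (real (level n) + 1)) * fock_coeff (trunc K \<xi>) n))" for K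
        by (simp add: fock_coeff_wt add.commute algebra_simps del: fock_coeff_trunc of_real_power flip: of_real_power)
      have l2: "(\<lambda>K. w * Re (cinner ?e (wt 2 (trunc K \<xi>)))) \<longlonglongrightarrow> Re (cnj c * (of_real (w * (real (level n) + 1)) * fock_coeff \<xi> n))"
        unfolding eqK by (intro tendsto_intros lc)
      have "(\<lambda>K. ?q (trunc K \<xi>) + 2 * r * (\<mu> * Re (cinner ?e (trunc K \<xi>)) - Re (cinner ?e (hpart y (trunc K \<xi>))) + w * Re (cinner ?e (wt 2 (trunc K \<xi>)))) + r\<^sup>2 * ?q ?e)
        \<longlonglongrightarrow> 0 + 2 * r * (\<mu> * Re (cinner ?e \<xi>) - Re (cinner ?e (hpart y \<xi>)) + Re (cnj c * (of_real (w * (real (level n) + 1)) * fock_coeff \<xi> n))) + r\<^sup>2 * ?q ?e"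
        by (intro tendsto_intros lim l2 lt lh)
      moreover have "\<mu> * Re (cinner ?e \<xi>) - Re (cinner ?e (hpart y \<xi>)) + Re (cnj c * (of_real (w * (real (level n) + 1)) * fock_coeff \<xi> n)) = - Re (cnj c * ?d)"
        by (simp add: algebra_simps)
      ultimately show "(\<lambda>K. ?q (trunc K \<xi> + r *\<^sub>R ?e)) \<longlonglongrightarrow> 2 * r * (- Re (cnj c * ?d)) + r\<^sup>2 * ?q ?e"
        unfolding expand[OF trunc_in_D fock_D_scaleC[OF fock_D_e]] by simp
      show "\<exists>N. \<forall>K\<ge>N. 0 \<le> ?q (trunc K \<xi> + r *\<^sub>R ?e)" using q0 by simp
    qed
    then have "(- Re (cnj c * ?d))\<^sup>2 \<le> 0 * ?q ?e"
      by (intro quadratic_nonneg_discriminant q0) simp_all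
    then show ?thesis by simp
  qed
  have "Re ?d = 0" using key[of 1] by simp
  moreover have "Im ?d = 0" using key[of \<i>] by simp
  ultimately show ?thesis by (simp add: complex_eq_iff)
qed

text \<open>On the vectors L_l \<xi> the form of y is bounded by that of \<mu> + w (N + 1); the
  pairing with G is rewritten through the residual of the Euler-Lagrange equation. L(1) = 0 removes
  \<mu>, L(N + 1) <= c0 (N + 1) bounds the penalty, and the residual is small near a
  maximiser.\<close>

lemma generator_form_le:
  fixes U V :: "complex^'d::finite^'m::finite"
  assumes \<Omega>: "adj_mat \<Omega> = \<Omega>" and y: "y \<in> BH" and \<xi>: "\<xi> \<in> fock_D" and w: "w \<ge> 0"
    and le: "\<And>\<eta>. \<eta> \<in> fock_D \<Longrightarrow> number_form y w \<eta> \<le> \<mu> * (norm \<eta>)\<^sup>2"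
    and G: "norm (gdrift \<Omega> \<kappa> U V \<xi>) \<le> cG * norm (wt 2 \<xi>)"
    and N: "2 * Re (cinner (gdrift \<Omega> \<kappa> U V \<xi>) (wt 2 \<xi>))
    + (\<Sum>l\<in>UNIV. Re (cinner (kraus U V l \<xi>) (wt 2 (kraus U V l \<xi>)))) \<le> c0 * (norm (wt 1 \<xi>))\<^sup>2"
  shows "Re (generator_form \<Omega> \<kappa> U V 0 y \<xi> \<xi>) \<le>
    2 * cG * norm (wt 2 \<xi>) * norm (hpart y \<xi> - w *\<^sub>R wt 2 \<xi> - \<mu> *\<^sub>R \<xi>) + w * c0 * (norm (wt 1 \<xi>))\<^sup>2"
proof -
  let ?G = "gdrift \<Omega> \<kappa> U V \<xi>" and ?L = "\<lambda>l. kraus U V l \<xi>"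
  let ?r = "hpart y \<xi> - w *\<^sub>R wt 2 \<xi> - \<mu> *\<^sub>R \<xi>"
  have L: "Re (cinner (?L l) (y (?L l))) \<le> \<mu> * (norm (?L l))\<^sup>2 + w * Re (cinner (?L l) (wt 2 (?L l)))" for l
    using le[of "?L l"] by (simp add: number_form_def cinner_wt2 del: of_real_power)
  have "cinner ?G (hpart y \<xi>) = cinner ?G ?r + complex_of_real w * cinner ?G (wt 2 \<xi>) + complex_of_real \<mu> * cinner ?G \<xi>"
    by (simp add: cinner_diff_right)
  then have h: "Re (cinner ?G (hpart y \<xi>)) = Re (cinner ?G ?r) + w * Re (cinner ?G (wt 2 \<xi>)) + \<mu> * Re (cinner ?G \<xi>)"
    by simp
  have g: "Re (generator_form \<Omega> \<kappa> U V 0 y \<xi> \<xi>) = 2 * Re (cinner ?G (hpart y \<xi>)) + (\<Sum>l\<in>UNIV. Re (cinner (?L l) (y (?L l))))"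
    unfolding generator_form_gdrift[OF \<xi> \<xi> y] Re_hpart_form[OF y, symmetric] by simp
  have "Re (generator_form \<Omega> \<kappa> U V 0 y \<xi> \<xi>) \<le> 2 * Re (cinner ?G (hpart y \<xi>))
      + (\<Sum>l\<in>UNIV. \<mu> * (norm (?L l))\<^sup>2 + w * Re (cinner (?L l) (wt 2 (?L l))))"
    unfolding g by (intro add_left_mono sum_mono L)
  also have "\<dots> = 2 * Re (cinner ?G ?r) + w * (2 * Re (cinner ?G (wt 2 \<xi>)) + (\<Sum>l\<in>UNIV. Re (cinner (?L l) (wt 2 (?L l)))))
      + \<mu> * (2 * Re (cinner ?G \<xi>) + (\<Sum>l\<in>UNIV. (norm (?L l))\<^sup>2))"
    unfolding h by (simp add: sum.distrib sum_distrib_left algebra_simps)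
  also have "\<dots> = 2 * Re (cinner ?G ?r) + w * (2 * Re (cinner ?G (wt 2 \<xi>)) + (\<Sum>l\<in>UNIV. Re (cinner (?L l) (wt 2 (?L l)))))"
    using gdrift_conservative[OF \<Omega> \<xi>, of \<kappa> U V] by simp
  also have "\<dots> \<le> 2 * (cG * norm (wt 2 \<xi>) * norm ?r) + w * (c0 * (norm (wt 1 \<xi>))\<^sup>2)"
  proof (intro add_mono mult_left_mono N w)
    have "Re (cinner ?G ?r) \<le> norm ?G * norm ?r" by (rule order_trans[OF complex_Re_le_cmod cmod_cinner_le])
    also have "\<dots> \<le> cG * norm (wt 2 \<xi>) * norm ?r" by (intro mult_right_mono G) simp
    finally show "Re (cinner ?G ?r) \<le> cG * norm (wt 2 \<xi>) * norm ?r" .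
  qed simp
  finally show ?thesis by (simp add: mult.assoc)
qed

text \<open>Continuity of the generator form in the graph norm of N, with a constant depending on x
  only through its norm. It makes the approximation of a maximiser by truncations uniform in
  time.\<close>

lemma generator_form_diff_le:
  fixes U V :: "complex^'d::finite^'m::finite"
  shows "\<exists>C\<ge>0. \<forall>x \<zeta> \<zeta>'. x \<in> BH \<longrightarrow> \<zeta> \<in> fock_D \<longrightarrow> \<zeta>' \<in> fock_D \<longrightarrow>
    cmod (generator_form \<Omega> \<kappa> U V 0 x \<zeta> \<zeta> - generator_form \<Omega> \<kappa> U V 0 x \<zeta>' \<zeta>')
      \<le> C * norm x * (norm (wt 2 \<zeta>) + norm (wt 2 \<zeta>')) * norm (wt 2 (\<zeta> - \<zeta>'))"
proof -
  obtain a where a: "a \<ge> 0" "\<And>\<xi>. \<xi> \<in> fock_D \<Longrightarrow> norm (gdrift \<Omega> \<kappa> U V \<xi>) \<le> a * norm (wt 2 \<xi>)"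
    using norm_gdrift_le by blast
  have "\<forall>l. \<exists>b\<ge>0. \<forall>\<xi>\<in>fock_D. norm (kraus U V l \<xi>) \<le> b * norm (wt 1 \<xi>)" using norm_kraus_le by blast
  then obtain b where b0: "\<And>l. b l \<ge> 0" "\<And>l \<xi>. \<xi> \<in> fock_D \<Longrightarrow> norm (kraus U V l \<xi>) \<le> b l * norm (wt 1 \<xi>)" by metis
  have b: "norm (kraus U V l \<xi>) \<le> b l * norm (wt 2 \<xi>)" if "\<xi> \<in> fock_D" for l \<xi>
    by (rule order_trans[OF b0(2)[OF that] mult_left_mono[OF norm_wt_mono[OF that]]]) (use b0 in auto)
  define C where "C = 2 * a + (\<Sum>l\<in>UNIV. b l * b l)"
  let ?g = "generator_form \<Omega> \<kappa> U V 0"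
  have bd: "cmod (?g x u v) \<le> C * norm x * norm (wt 2 u) * norm (wt 2 v)"
    if x: "x \<in> BH" and u: "u \<in> fock_D" and v: "v \<in> fock_D" for x u v
  proof -
    have A: "cmod (cinner p (x q)) \<le> s * t * norm x * norm (wt 2 u) * norm (wt 2 v)"
      if "norm p \<le> s * norm (wt 2 u)" "norm q \<le> t * norm (wt 2 v)" "s \<ge> 0" "t \<ge> 0" for p q s t
    proof -
      have "cmod (cinner p (x q)) \<le> norm p * (norm x * norm q)"
        by (rule order_trans[OF cmod_cinner_le mult_left_mono[OF norm_blinfun]]) simp
      also have "\<dots> \<le> (s * norm (wt 2 u)) * (norm x * (t * norm (wt 2 v)))"
        using that by (intro mult_mono mult_nonneg_nonneg) auto
      finally show ?thesis by (simp add: mult_ac)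
    qed
    have "cmod (?g x u v) \<le> cmod (cinner (gdrift \<Omega> \<kappa> U V u) (x v)) + cmod (cinner u (x (gdrift \<Omega> \<kappa> U V v)))
       + (\<Sum>l\<in>UNIV. cmod (cinner (kraus U V l u) (x (kraus U V l v))))"
      unfolding generator_form_gdrift[OF u v x] by (intro norm_triangle_le add_mono norm_sum order_refl)
    also have "\<dots> \<le> a * 1 * norm x * norm (wt 2 u) * norm (wt 2 v) + 1 * a * norm x * norm (wt 2 u) * norm (wt 2 v)
       + (\<Sum>l\<in>UNIV. b l * b l * norm x * norm (wt 2 u) * norm (wt 2 v))"
      using norm_le_wt[OF u, of 2] norm_le_wt[OF v, of 2] by (intro add_mono sum_mono A a b b0 u v) auto
    finally show ?thesis by (simp add: C_def distrib_right sum_distrib_right)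
  qed
  have add: "?g x (u + u') v = ?g x u v + ?g x u' v" "?g x v (u + u') = ?g x v u + ?g x v u'"
    if "x \<in> BH" "u \<in> fock_D" "u' \<in> fock_D" "v \<in> fock_D" for x u u' v
    using that by (simp_all add: generator_form_gdrift gdrift_add kraus_add cinner_add_left cinner_add_right
      blinfun.add_right sum.distrib)
  show ?thesis
  proof (intro exI[of _ C] conjI allI impI)
    show "C \<ge> 0" unfolding C_def using a(1) b0(1) by (intro add_nonneg_nonneg sum_nonneg) auto
    fix x :: "'d op" and \<zeta> \<zeta>' :: "'d fock" assume D: "x \<in> BH" "\<zeta> \<in> fock_D" "\<zeta>' \<in> fock_D"
    have "?g x \<zeta> \<zeta> - ?g x \<zeta>' \<zeta>' = ?g x (\<zeta> - \<zeta>') \<zeta> + ?g x \<zeta>' (\<zeta> - \<zeta>')"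
      using D add(1)[of x "\<zeta> - \<zeta>'" \<zeta>' \<zeta>] add(2)[of x "\<zeta> - \<zeta>'" \<zeta>' \<zeta>'] by simp
    then have "cmod (?g x \<zeta> \<zeta> - ?g x \<zeta>' \<zeta>') \<le> cmod (?g x (\<zeta> - \<zeta>') \<zeta>) + cmod (?g x \<zeta>' (\<zeta> - \<zeta>'))"
      using norm_triangle_ineq by simp
    also have "\<dots> \<le> C * norm x * norm (wt 2 (\<zeta> - \<zeta>')) * norm (wt 2 \<zeta>) + C * norm x * norm (wt 2 \<zeta>') * norm (wt 2 (\<zeta> - \<zeta>'))"
      using D by (intro add_mono bd) auto
    finally show "cmod (?g x \<zeta> \<zeta> - ?g x \<zeta>' \<zeta>') \<le> C * norm x * (norm (wt 2 \<zeta>) + norm (wt 2 \<zeta>')) * norm (wt 2 (\<zeta> - \<zeta>'))"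
      by (simp add: algebra_simps)
  qed
qed

lemma cmod_quadratic_diff_le:
  assumes "norm x \<le> M"
  shows "cmod (cinner a (blinfun_apply x a) - cinner b (x b)) \<le> M * (norm a + norm b) * norm (a - b)"
proof -
  have bd: "cmod (cinner u (x v)) \<le> M * norm u * norm v" for u v
  proof -
    have "cmod (cinner u (x v)) \<le> norm u * (norm x * norm v)"
      by (rule order_trans[OF cmod_cinner_le mult_left_mono[OF norm_blinfun]]) simp
    also have "\<dots> \<le> norm u * (M * norm v)" using assms by (intro mult_left_mono mult_right_mono) auto
    finally show ?thesis by (simp add: mult_ac)
  qed
  have "cinner a (x a) - cinner b (x b) = cinner (a - b) (x a) + cinner b (x (a - b))"
    by (simp add: cinner_diff_left cinner_diff_right blinfun.diff_right)
  then have "cmod (cinner a (x a) - cinner b (x b)) \<le> cmod (cinner (a - b) (x a)) + cmod (cinner b (x (a - b)))"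
    using norm_triangle_ineq by simp
  also have "\<dots> \<le> M * norm (a - b) * norm a + M * norm b * norm (a - b)" by (intro add_mono bd)
  finally show ?thesis by (simp add: algebra_simps)
qed

lemma number_form_scaleR:
  "\<xi> \<in> fock_D \<Longrightarrow> number_form y w (r *\<^sub>R \<xi>) = r\<^sup>2 * number_form y w \<xi>"
  by (simp add: number_form_def wt_scaleR blinfun.scaleR_right power_mult_distrib power2_eq_square algebra_simps)

text \<open>
  Maximum principle: a positive maximum \<open>\<mu>\<close> of \<open>Re \<langle>\<xi>, y\<^sub>t \<xi>\<rangle> - \<epsilon> e\<^sup>c\<^sup>t \<langle>\<xi>, (N + 1) \<xi>\<rangle>\<close> over \<open>t\<close> and the
  unit ball would be attained at some \<open>\<xi>\<close> in the domain of \<open>N\<close>, where the time derivative is negative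
  because \<open>\<L>(\<mu> - y) \<ge> - \<epsilon> \<L>(N)\<close> at \<open>\<xi>\<close> and \<open>\<L>(N) \<le> c\<^sub>0 (N + 1)\<close>.
\<close>

lemma master_nonpos:
  fixes U V :: "complex^'d::finite^'m::finite" and y :: "real \<Rightarrow> 'd op"
  assumes \<Omega>: "adj_mat \<Omega> = \<Omega>"
    and yB: "\<And>t. t \<ge> 0 \<Longrightarrow> y t \<in> BH" and yM: "\<And>t. t \<ge> 0 \<Longrightarrow> norm (y t) \<le> M" and y0: "y 0 = 0"
    and der: "\<And>t u v. t \<ge> 0 \<Longrightarrow> u \<in> fock_D \<Longrightarrow> v \<in> fock_D \<Longrightarrow>
      ((\<lambda>s. cinner u (y s v)) has_vector_derivative generator_form \<Omega> \<kappa> U V 0 (y t) u v) (at t within {0..})"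
    and \<tau>: "\<tau> \<ge> 0" and \<xi>0: "\<xi>0 \<in> fock_D"
  shows "Re (cinner \<xi>0 (y \<tau> \<xi>0)) \<le> 0"
proof -
  let ?g = "generator_form \<Omega> \<kappa> U V 0"
  have M0: "M \<ge> 0" using yM[of 0] norm_ge_zero[of "y 0"] by linarith
  obtain cG where cG: "cG \<ge> 0" "\<And>\<xi>. \<xi> \<in> fock_D \<Longrightarrow> norm (gdrift \<Omega> \<kappa> U V \<xi>) \<le> cG * norm (wt 2 \<xi>)"
    using norm_gdrift_le by blast
  obtain c0 where c0: "c0 \<ge> 0" "\<And>\<xi>. \<xi> \<in> fock_D \<Longrightarrow> 2 * Re (cinner (gdrift \<Omega> \<kappa> U V \<xi>) (wt 2 \<xi>))
    + (\<Sum>l\<in>UNIV. Re (cinner (kraus U V l \<xi>) (wt 2 (kraus U V l \<xi>)))) \<le> c0 * (norm (wt 1 \<xi>))\<^sup>2"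
    using gdrift_number_bound[OF \<Omega>] by blast
  obtain CC where CC: "CC \<ge> 0" "\<And>x \<zeta> \<zeta>'. x \<in> BH \<Longrightarrow> \<zeta> \<in> fock_D \<Longrightarrow> \<zeta>' \<in> fock_D \<Longrightarrow>
    cmod (?g x \<zeta> \<zeta> - ?g x \<zeta>' \<zeta>') \<le> CC * norm x * (norm (wt 2 \<zeta>) + norm (wt 2 \<zeta>')) * norm (wt 2 (\<zeta> - \<zeta>'))"
    using generator_form_diff_le[of \<Omega> \<kappa> U V] by metis
  \<comment> \<open>One more than the growth rate of N under the generator: the surplus leaves a
    strictly negative term in the time derivative at the maximum.\<close>
  define c where "c = c0 + 1"
  have cpos: "c > 0" using c0(1) by (simp add: c_def)
  have cont: "continuous_on {0..} (\<lambda>t. cinner u (y t v))" if "u \<in> fock_D" "v \<in> fock_D" for u v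
    unfolding continuous_on_eq_continuous_within
    using has_vector_derivative_continuous[OF der[OF _ that]] by auto
  \<comment> \<open>Weak continuity in time is given only on \<open>fock_D\<close>; the uniform
    bound M carries it over to all vectors.\<close>
  have cont2: "continuous_on {0..} (\<lambda>t. cinner \<eta> (y t \<eta>))" for \<eta>
  proof (rule uniform_limit_theorem[where f = "\<lambda>K t. cinner (trunc K \<eta>) (y t (trunc K \<eta>))" and F = sequentially])
    show "\<forall>\<^sub>F K in sequentially. continuous_on {0..} (\<lambda>t. cinner (trunc K \<eta>) (y t (trunc K \<eta>)))"
      using cont by simp
    show "uniform_limit {0..} (\<lambda>K t. cinner (trunc K \<eta>) (y t (trunc K \<eta>))) (\<lambda>t. cinner \<eta> (y t \<eta>)) sequentially"
    proof (rule uniform_limitI)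
      fix e :: real assume e: "e > 0"
      have "(\<lambda>K. M * (norm (trunc K \<eta>) + norm \<eta>) * norm (trunc K \<eta> - \<eta>)) \<longlonglongrightarrow> M * (norm \<eta> + norm \<eta>) * norm (\<eta> - \<eta>)"
        by (intro tendsto_intros trunc_tendsto)
      then have "\<forall>\<^sub>F K in sequentially. M * (norm (trunc K \<eta>) + norm \<eta>) * norm (trunc K \<eta> - \<eta>) < e"
        by (rule order_tendstoD) (use e in simp)
      then show "\<forall>\<^sub>F K in sequentially. \<forall>t\<in>{0..}. dist (cinner (trunc K \<eta>) (y t (trunc K \<eta>))) (cinner \<eta> (y t \<eta>)) < e"
      proof (rule eventually_mono, intro ballI)
        fix K t assume K: "M * (norm (trunc K \<eta>) + norm \<eta>) * norm (trunc K \<eta> - \<eta>) < e" and t: "t \<in> {0::real..}"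
        show "dist (cinner (trunc K \<eta>) (y t (trunc K \<eta>))) (cinner \<eta> (y t \<eta>)) < e"
          unfolding dist_norm by (rule le_less_trans[OF cmod_quadratic_diff_le[OF yM] K]) (use t in simp)
      qed
    qed
  qed simp
  have main: "Re (cinner \<xi>0 (y \<tau> \<xi>0)) \<le> \<epsilon> * (exp (c * \<tau>) * (norm (wt 1 \<xi>0))\<^sup>2)" if \<epsilon>: "\<epsilon> > 0" for \<epsilon>
  proof (rule ccontr)
    assume neg: "\<not> ?thesis"
    define w where "w t = \<epsilon> * exp (c * t)" for t
    have wpos: "w t > 0" for t using \<epsilon> by (simp add: w_def)
    have wge: "w t \<ge> \<epsilon>" if "t \<ge> 0" for t using \<epsilon> cpos that by (simp add: w_def)
    define P where "P t \<xi> = number_form (y t) (w t) \<xi>" for t \<xi>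
    have P\<xi>0: "P \<tau> \<xi>0 > 0" using neg by (simp add: P_def number_form_def w_def mult.assoc)
    define S where "S = {P t \<xi> | t \<xi>. 0 \<le> t \<and> t \<le> \<tau> \<and> \<xi> \<in> fock_D \<and> norm \<xi> \<le> 1}"
    have Pf: "P t \<xi> \<le> M - w t * (norm (wt 1 \<xi>))\<^sup>2" if "t \<ge> 0" "norm \<xi> \<le> 1" for t \<xi>
    proof -
      have "Re (cinner \<xi> (y t \<xi>)) \<le> norm \<xi> * (norm (y t) * norm \<xi>)"
        by (rule order_trans[OF complex_Re_le_cmod order_trans[OF cmod_cinner_le mult_left_mono[OF norm_blinfun]]]) simp
      also have "\<dots> \<le> 1 * (M * 1)" using that yM[OF that(1)] M0 by (intro mult_mono mult_nonneg_nonneg) auto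
      finally show ?thesis by (simp add: P_def number_form_def)
    qed
    have PM: "P t \<xi> \<le> M" if "t \<ge> 0" "norm \<xi> \<le> 1" for t \<xi>
    proof -
      have "w t * (norm (wt 1 \<xi>))\<^sup>2 \<ge> 0" using wpos[of t] by simp
      then show ?thesis using Pf[OF that] by linarith
    qed
    have bdd: "bdd_above S" unfolding S_def by (rule bdd_aboveI[of _ M]) (auto intro: PM)
    define \<mu> where "\<mu> = Sup S"
    have inS: "P t \<xi> \<le> \<mu>" if "0 \<le> t" "t \<le> \<tau>" "\<xi> \<in> fock_D" "norm \<xi> \<le> 1" for t \<xi>
      unfolding \<mu>_def by (rule cSup_upper[OF _ bdd]) (use that in \<open>auto simp: S_def\<close>)
    \<comment> \<open>Both sides are quadratic, so the bound on the unit ball scales to all of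
      \<open>fock_D\<close>. The vectors L_l \<xi>, which are not normalised, require this.\<close>
    have hom: "P t \<xi> \<le> \<mu> * (norm \<xi>)\<^sup>2" if "0 \<le> t" "t \<le> \<tau>" "\<xi> \<in> fock_D" for t \<xi>
    proof (cases "\<xi> = 0")
      case True
      have "wt 1 0 = (0 :: 'd fock)" using wt_scaleC[of 0 1 0] by simp
      then show ?thesis using True by (simp add: P_def number_form_def)
    next
      case False
      have "P t ((1 / norm \<xi>) *\<^sub>R \<xi>) \<le> \<mu>" by (rule inS) (use that False in auto)
      then show ?thesis using False that
        by (simp add: P_def number_form_scaleR power_divide pos_divide_le_eq)
    qed
    have \<mu>pos: "\<mu> > 0"
    proof -
      have "0 < \<mu> * (norm \<xi>0)\<^sup>2" using P\<xi>0 hom[OF \<tau> order_refl \<xi>0] by linarith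
      then show ?thesis by (simp add: zero_less_mult_iff)
    qed
    have Sne: "S \<noteq> {}" unfolding S_def using \<tau> by (auto intro!: exI[of _ \<tau>] exI[of _ "0 :: 'd fock"])
    have "\<exists>t \<xi>. 0 \<le> t \<and> t \<le> \<tau> \<and> \<xi> \<in> fock_D \<and> norm \<xi> \<le> 1 \<and> P t \<xi> > \<mu> - 1 / (real k + 1)" for k
    proof -
      have "\<mu> - 1 / (real k + 1) < Sup S" unfolding \<mu>_def by simp
      then obtain x where "x \<in> S" "\<mu> - 1 / (real k + 1) < x" using less_cSup_iff[OF Sne bdd] by blast
      then show ?thesis by (auto simp: S_def)
    qed
    then obtain tk \<xi>k where k: "\<And>k. 0 \<le> tk k" "\<And>k. tk k \<le> \<tau>" "\<And>k. \<xi>k k \<in> fock_D" "\<And>k. norm (\<xi>k k) \<le> 1"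
      "\<And>k. P (tk k) (\<xi>k k) > \<mu> - 1 / (real k + 1)" by metis
    define B where "B = (M + 1) / \<epsilon>"
    have "\<xi>k k \<in> weighted_ball B" for k
    proof -
      have "\<epsilon> * (norm (wt 1 (\<xi>k k)))\<^sup>2 \<le> w (tk k) * (norm (wt 1 (\<xi>k k)))\<^sup>2"
        using wge[OF k(1)] by (intro mult_right_mono) auto
      moreover have "1 / (real k + 1) \<le> 1" by simp
      ultimately have "\<epsilon> * (norm (wt 1 (\<xi>k k)))\<^sup>2 \<le> M + 1"
        using Pf[OF k(1,4)[of k]] k(5)[of k] \<mu>pos by linarith
      then have "(norm (wt 1 (\<xi>k k)))\<^sup>2 \<le> B" using \<epsilon> by (simp add: B_def pos_le_divide_eq mult.commute)
      then show ?thesis using k(4) weighted_sum_le_norm_wt[OF k(3)[of k]] order_trans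
        unfolding weighted_ball_def by blast
    qed
    then obtain \<xi> r1 where \<xi>: "\<xi> \<in> weighted_ball B" and r1: "strict_mono r1" "(\<lambda>k. \<xi>k (r1 k)) \<longlonglongrightarrow> \<xi>"
      using weighted_ball_seq_compact[of \<xi>k B] by blast
    have "\<forall>k. tk (r1 k) \<in> {0..\<tau>}" using k by simp
    then obtain ts r2 where ts: "ts \<in> {0..\<tau>}" and r2: "strict_mono r2" "((\<lambda>k. tk (r1 k)) \<circ> r2) \<longlonglongrightarrow> ts"
      using compact_Icc[of 0 \<tau>] unfolding compact_def by metis
    define r where "r k = r1 (r2 k)" for k
    have rk: "strict_mono r" using r1(1) r2(1) by (simp add: r_def strict_mono_def)
    have l\<xi>: "(\<lambda>k. \<xi>k (r k)) \<longlonglongrightarrow> \<xi>"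
      using LIMSEQ_subseq_LIMSEQ[OF r1(2) r2(1)] by (simp add: r_def o_def)
    have lt: "(\<lambda>k. tk (r k)) \<longlonglongrightarrow> ts" using r2(2) by (simp add: r_def o_def)
    have ts0: "0 \<le> ts" "ts \<le> \<tau>" using ts by auto
    define R where "R = Re (cinner \<xi> (y ts \<xi>))"
    have lR: "(\<lambda>k. Re (cinner (\<xi>k (r k)) (y (tk (r k)) (\<xi>k (r k))))) \<longlonglongrightarrow> R"
    proof -
      have "(\<lambda>k. cinner \<xi> (y (tk (r k)) \<xi>)) \<longlonglongrightarrow> cinner \<xi> (y ts \<xi>)"
        by (rule continuous_on_tendsto_compose[OF cont2 lt]) (use k(1) ts0 in auto)
      moreover have "(\<lambda>k. cinner (\<xi>k (r k)) (y (tk (r k)) (\<xi>k (r k))) - cinner \<xi> (y (tk (r k)) \<xi>)) \<longlonglongrightarrow> 0"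
      proof (rule Lim_null_comparison)
        show "\<forall>\<^sub>F k in sequentially. norm (cinner (\<xi>k (r k)) (y (tk (r k)) (\<xi>k (r k))) - cinner \<xi> (y (tk (r k)) \<xi>))
          \<le> M * (norm (\<xi>k (r k)) + norm \<xi>) * norm (\<xi>k (r k) - \<xi>)"
          using cmod_quadratic_diff_le[OF yM[OF k(1)]] by simp
        have "(\<lambda>k. M * (norm (\<xi>k (r k)) + norm \<xi>) * norm (\<xi>k (r k) - \<xi>)) \<longlonglongrightarrow> M * (norm \<xi> + norm \<xi>) * norm (\<xi> - \<xi>)"
          by (intro tendsto_intros l\<xi>)
        then show "(\<lambda>k. M * (norm (\<xi>k (r k)) + norm \<xi>) * norm (\<xi>k (r k) - \<xi>)) \<longlonglongrightarrow> 0" by simp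
      qed
      ultimately have "(\<lambda>k. (cinner (\<xi>k (r k)) (y (tk (r k)) (\<xi>k (r k))) - cinner \<xi> (y (tk (r k)) \<xi>)) + cinner \<xi> (y (tk (r k)) \<xi>)) \<longlonglongrightarrow> 0 + cinner \<xi> (y ts \<xi>)"
        by (intro tendsto_add)
      then show ?thesis unfolding R_def by (intro tendsto_Re) simp
    qed
    \<comment> \<open>Lower semicontinuity of the penalty along the maximising sequence, on finite
      sets of coordinates since the limit may leave \<open>fock_D\<close>. The empty set gives R >=
      \<mu>.\<close>
    have wsum: "w ts * (\<Sum>n\<in>F. (real (level n) + 1) * (cmod (fock_coeff \<xi> n))\<^sup>2) \<le> R - \<mu>" if F: "finite F" for F
    proof (rule LIMSEQ_le)
      have co: "(\<lambda>k. fock_coeff (\<xi>k (r k)) n) \<longlonglongrightarrow> fock_coeff \<xi> n" for n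
        using tendsto_cinner[OF tendsto_const[of "fock_e n"] l\<xi>] by simp
      show "(\<lambda>k. w (tk (r k)) * (\<Sum>n\<in>F. (real (level n) + 1) * (cmod (fock_coeff (\<xi>k (r k)) n))\<^sup>2))
        \<longlonglongrightarrow> w ts * (\<Sum>n\<in>F. (real (level n) + 1) * (cmod (fock_coeff \<xi> n))\<^sup>2)"
        unfolding w_def by (intro tendsto_intros co lt)
      have "(\<lambda>k. 1 / (real (r k) + 1)) \<longlonglongrightarrow> 0"
        using LIMSEQ_subseq_LIMSEQ[OF LIMSEQ_inverse_real_of_nat rk] by (simp add: o_def inverse_eq_divide add.commute)
      then have "(\<lambda>k. Re (cinner (\<xi>k (r k)) (y (tk (r k)) (\<xi>k (r k)))) - (\<mu> - 1 / (real (r k) + 1))) \<longlonglongrightarrow> R - (\<mu> - 0)"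
        by (intro tendsto_intros lR)
      then show "(\<lambda>k. Re (cinner (\<xi>k (r k)) (y (tk (r k)) (\<xi>k (r k)))) - (\<mu> - 1 / (real (r k) + 1))) \<longlonglongrightarrow> R - \<mu>" by simp
      have "w (tk (r k)) * (\<Sum>n\<in>F. (real (level n) + 1) * (cmod (fock_coeff (\<xi>k (r k)) n))\<^sup>2)
          \<le> Re (cinner (\<xi>k (r k)) (y (tk (r k)) (\<xi>k (r k)))) - (\<mu> - 1 / (real (r k) + 1))" for k
      proof -
        have "w (tk (r k)) * (\<Sum>n\<in>F. (real (level n) + 1) * (cmod (fock_coeff (\<xi>k (r k)) n))\<^sup>2)
          \<le> w (tk (r k)) * (norm (wt 1 (\<xi>k (r k))))\<^sup>2"
          using wpos by (intro mult_left_mono weighted_sum_le_norm_wt[OF k(3) F]) (simp add: less_imp_le)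
        also have "\<dots> = Re (cinner (\<xi>k (r k)) (y (tk (r k)) (\<xi>k (r k)))) - P (tk (r k)) (\<xi>k (r k))"
          by (simp add: P_def number_form_def)
        finally show ?thesis using k(5)[of "r k"] by linarith
      qed
      then show "\<exists>N. \<forall>k\<ge>N. w (tk (r k)) * (\<Sum>n\<in>F. (real (level n) + 1) * (cmod (fock_coeff (\<xi>k (r k)) n))\<^sup>2)
          \<le> Re (cinner (\<xi>k (r k)) (y (tk (r k)) (\<xi>k (r k)))) - (\<mu> - 1 / (real (r k) + 1))" by blast
    qed
    have Rmu: "R \<ge> \<mu>" using wsum[of "{}"] by simp
    have tspos: "ts > 0"
    proof (rule ccontr)
      assume "\<not> ts > 0"
      then have "ts = 0" using ts0 by simp
      then show False using Rmu \<mu>pos by (simp add: R_def y0)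
    qed
    define \<xi>K where "\<xi>K K = trunc K \<xi>" for K
    have \<xi>KD: "\<xi>K K \<in> fock_D" for K by (simp add: \<xi>K_def)
    have l\<xi>K: "\<xi>K \<longlonglongrightarrow> \<xi>" unfolding \<xi>K_def by (rule trunc_tendsto)
    define q where "q K = \<mu> * (norm (\<xi>K K))\<^sup>2 - P ts (\<xi>K K)" for K
    have q0: "q K \<ge> 0" for K using hom[OF ts0 \<xi>KD, of K] by (simp add: q_def)
    have n1: "norm \<xi> \<le> 1" using \<xi> by (simp add: weighted_ball_def)
    \<comment> \<open>An upper bound for the deficit q whose limit can be computed. As q >= 0, it
      forces \<xi> to have norm 1, and then q tends to 0.\<close>
    define b where "b K = \<mu> * (norm (\<xi>K K))\<^sup>2 - Re (cinner (\<xi>K K) (y ts (\<xi>K K))) + (R - \<mu>)" for K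
    have qb: "q K \<le> b K" for K
      using wsum[OF finite_level[of K]] unfolding q_def b_def P_def number_form_def \<xi>K_def norm_wt_trunc_sq by simp
    have "b \<longlonglongrightarrow> \<mu> * (norm \<xi>)\<^sup>2 - R + (R - \<mu>)"
      unfolding b_def R_def
      by (intro tendsto_intros l\<xi>K bounded_linear.tendsto[OF blinfun.bounded_linear_right])
    then have lb: "b \<longlonglongrightarrow> \<mu> * ((norm \<xi>)\<^sup>2 - 1)" by (simp add: algebra_simps)
    have "0 \<le> \<mu> * ((norm \<xi>)\<^sup>2 - 1)"
      by (rule LIMSEQ_le_const[OF lb]) (use q0 qb order_trans in blast)
    then have "(norm \<xi>)\<^sup>2 \<ge> 1" using \<mu>pos by (simp add: zero_le_mult_iff)
    moreover have "(norm \<xi>)\<^sup>2 \<le> 1" using n1 by (simp add: power_le_one)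
    ultimately have n\<xi>: "(norm \<xi>)\<^sup>2 = 1" by simp
    have lq: "q \<longlonglongrightarrow> 0"
      by (rule tendsto_sandwich[OF _ _ tendsto_const, of 0 q _ b]) (use q0 qb lb n\<xi> in simp_all)
    have le: "number_form (y ts) (w ts) \<eta> \<le> \<mu> * (norm \<eta>)\<^sup>2" if "\<eta> \<in> fock_D" for \<eta>
      using hom[OF ts0 that] by (simp add: P_def)
    have EL: "fock_coeff (hpart (y ts) \<xi> - complex_of_real \<mu> *\<^sub>C \<xi>) n = of_real (w ts * (real (level n) + 1)) * fock_coeff \<xi> n" for n
      by (rule number_form_maximiser[OF yB[OF ts0(1)] wpos le]) (use lq in \<open>simp_all add: q_def[abs_def] P_def \<xi>K_def\<close>)
    \<comment> \<open>By the Euler-Lagrange equation this vector is (N + 1) \<xi>, so the maximiser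
      lies in the domain of N and \<open>wt 2\<close> of its truncations converges.\<close>
    define kv where "kv = (1 / w ts) *\<^sub>R (hpart (y ts) \<xi> - \<mu> *\<^sub>R \<xi>)"
    have kvc: "fock_coeff kv n = of_real (real (level n) + 1) * fock_coeff \<xi> n" for n
      using EL[of n] wpos[of ts] unfolding kv_def scaleR_scaleC[of \<mu>] by (simp add: field_simps)
    have wtK: "wt 2 (\<xi>K K) = trunc K kv" for K
      by (rule fock_eqI) (simp add: \<xi>K_def fock_coeff_wt kvc add.commute del: of_real_power flip: of_real_power)
    define rK where "rK K = hpart (y ts) (\<xi>K K) - w ts *\<^sub>R wt 2 (\<xi>K K) - \<mu> *\<^sub>R \<xi>K K" for K
    have "rK \<longlonglongrightarrow> hpart (y ts) \<xi> - w ts *\<^sub>R kv - \<mu> *\<^sub>R \<xi>"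
      unfolding rK_def wtK by (intro tendsto_intros l\<xi>K trunc_tendsto bounded_linear.tendsto[OF blinfun.bounded_linear_right])
    moreover have "hpart (y ts) \<xi> - w ts *\<^sub>R kv - \<mu> *\<^sub>R \<xi> = 0" using wpos[of ts] by (simp add: kv_def)
    ultimately have lr: "rK \<longlonglongrightarrow> 0" by simp
    define g where "g t \<zeta> = Re (?g (y t) \<zeta> \<zeta>) - c * w t * (norm (wt 1 \<zeta>))\<^sup>2" for t \<zeta>
    have dP: "((\<lambda>t. P t \<zeta>) has_real_derivative g t \<zeta>) (at t)" if t: "t > 0" and \<zeta>: "\<zeta> \<in> fock_D" for t \<zeta>
    proof -
      have "((\<lambda>s. cinner \<zeta> (y s \<zeta>)) has_vector_derivative ?g (y t) \<zeta> \<zeta>) (at t within {0<..})"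
        by (rule has_vector_derivative_within_subset[OF der]) (use t \<zeta> in auto)
      then have "((\<lambda>s. cinner \<zeta> (y s \<zeta>)) has_vector_derivative ?g (y t) \<zeta> \<zeta>) (at t)"
        using t by (simp add: at_within_open[of t "{0<..}"])
      from bounded_linear.has_vector_derivative[OF bounded_linear_Re this]
      have 1: "((\<lambda>s. Re (cinner \<zeta> (y s \<zeta>))) has_real_derivative Re (?g (y t) \<zeta> \<zeta>)) (at t)"
        by (simp add: has_real_derivative_iff_has_vector_derivative)
      have 2: "((\<lambda>s. w s * (norm (wt 1 \<zeta>))\<^sup>2) has_real_derivative c * w t * (norm (wt 1 \<zeta>))\<^sup>2) (at t)"
        unfolding w_def by (auto intro!: derivative_eq_intros)
      show ?thesis unfolding P_def number_form_def g_def by (rule DERIV_diff[OF 1 2])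
    qed
    \<comment> \<open>The part c0 of c absorbs the growth of N + 1, and the remaining 1 produces the
      negative last term.\<close>
    have gts: "g ts (\<xi>K K) \<le> 2 * cG * norm kv * norm (rK K) - w ts * (norm (\<xi>K K))\<^sup>2" for K
    proof -
      have "Re (?g (y ts) (\<xi>K K) (\<xi>K K)) \<le> 2 * cG * norm (wt 2 (\<xi>K K)) * norm (rK K) + w ts * c0 * (norm (wt 1 (\<xi>K K)))\<^sup>2"
        unfolding rK_def
        by (rule generator_form_le[OF \<Omega> yB[OF ts0(1)] \<xi>KD less_imp_le[OF wpos] le cG(2)[OF \<xi>KD] c0(2)[OF \<xi>KD]])
      moreover have "2 * cG * norm (wt 2 (\<xi>K K)) * norm (rK K) \<le> 2 * cG * norm kv * norm (rK K)"
        unfolding wtK using cG(1) by (intro mult_right_mono mult_left_mono norm_trunc_le) auto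
      moreover have "w ts * (norm (\<xi>K K))\<^sup>2 \<le> w ts * (norm (wt 1 (\<xi>K K)))\<^sup>2"
        using wpos[of ts] by (intro mult_left_mono power_mono norm_le_wt \<xi>KD) auto
      moreover have "c * w ts * (norm (wt 1 (\<xi>K K)))\<^sup>2 = w ts * c0 * (norm (wt 1 (\<xi>K K)))\<^sup>2 + w ts * (norm (wt 1 (\<xi>K K)))\<^sup>2"
        by (simp add: c_def algebra_simps)
      ultimately show ?thesis unfolding g_def by linarith
    qed
    define Dc where "Dc = (CC * M + c * w \<tau>) * (2 * norm kv)"
    have Dc0: "Dc \<ge> 0" unfolding Dc_def using CC(1) M0 cpos wpos[of \<tau>] by (intro mult_nonneg_nonneg add_nonneg_nonneg) auto
    \<comment> \<open>The derivative must be controlled on a time interval with all K at once; hence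
      a comparison of truncations uniform in t.\<close>
    have gdiff: "\<bar>g t (\<xi>K K) - g t (\<xi>K J)\<bar> \<le> Dc * norm (trunc K kv - trunc J kv)" if t: "0 \<le> t" "t \<le> \<tau>" for t K J
    proof -
      let ?n = "norm (trunc K kv - trunc J kv)"
      have wtd: "wt 2 (\<xi>K K - \<xi>K J) = trunc K kv - trunc J kv" by (simp add: wt_diff \<xi>KD wtK)
      have s: "norm (wt 2 (\<xi>K K)) + norm (wt 2 (\<xi>K J)) \<le> 2 * norm kv"
        unfolding wtK using norm_trunc_le[of K kv] norm_trunc_le[of J kv] by linarith
      have "cmod (?g (y t) (\<xi>K K) (\<xi>K K) - ?g (y t) (\<xi>K J) (\<xi>K J))
        \<le> CC * norm (y t) * (norm (wt 2 (\<xi>K K)) + norm (wt 2 (\<xi>K J))) * norm (wt 2 (\<xi>K K - \<xi>K J))"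
        by (rule CC(2)) (use yB t \<xi>KD in auto)
      also have "\<dots> \<le> CC * M * (2 * norm kv) * ?n"
        unfolding wtd using CC(1) M0 yM t s by (intro mult_mono mult_nonneg_nonneg add_nonneg_nonneg) auto
      finally have 1: "\<bar>Re (?g (y t) (\<xi>K K) (\<xi>K K)) - Re (?g (y t) (\<xi>K J) (\<xi>K J))\<bar> \<le> CC * M * (2 * norm kv) * ?n"
        using abs_Re_le_cmod[of "?g (y t) (\<xi>K K) (\<xi>K K) - ?g (y t) (\<xi>K J) (\<xi>K J)"] by simp
      have "\<bar>(norm (wt 1 (\<xi>K K)))\<^sup>2 - (norm (wt 1 (\<xi>K J)))\<^sup>2\<bar>
        = (norm (wt 1 (\<xi>K K)) + norm (wt 1 (\<xi>K J))) * \<bar>norm (wt 1 (\<xi>K K)) - norm (wt 1 (\<xi>K J))\<bar>"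
        by (simp add: power2_eq_square square_diff_square_factored abs_mult)
      also have "\<dots> \<le> (2 * norm kv) * ?n"
      proof (intro mult_mono)
        show "norm (wt 1 (\<xi>K K)) + norm (wt 1 (\<xi>K J)) \<le> 2 * norm kv"
          using norm_wt_mono[OF \<xi>KD[of K], of 1 2] norm_wt_mono[OF \<xi>KD[of J], of 1 2] s by simp
        have "\<bar>norm (wt 1 (\<xi>K K)) - norm (wt 1 (\<xi>K J))\<bar> \<le> norm (wt 1 (\<xi>K K) - wt 1 (\<xi>K J))" by (rule norm_triangle_ineq3)
        also have "\<dots> = norm (wt 1 (\<xi>K K - \<xi>K J))" by (simp add: wt_diff \<xi>KD)
        also have "\<dots> \<le> norm (wt 2 (\<xi>K K - \<xi>K J))" by (rule norm_wt_mono) (simp_all add: \<xi>KD)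
        finally show "\<bar>norm (wt 1 (\<xi>K K)) - norm (wt 1 (\<xi>K J))\<bar> \<le> ?n" unfolding wtd .
      qed auto
      finally have "\<bar>(norm (wt 1 (\<xi>K K)))\<^sup>2 - (norm (wt 1 (\<xi>K J)))\<^sup>2\<bar> \<le> (2 * norm kv) * ?n" .
      moreover have "c * w t \<le> c * w \<tau>" unfolding w_def using \<epsilon> cpos t by simp
      ultimately have "c * w t * \<bar>(norm (wt 1 (\<xi>K K)))\<^sup>2 - (norm (wt 1 (\<xi>K J)))\<^sup>2\<bar> \<le> c * w \<tau> * ((2 * norm kv) * ?n)"
        using cpos wpos[of \<tau>] less_imp_le[OF wpos[of t]] by (intro mult_mono mult_nonneg_nonneg) auto
      then have 2: "\<bar>c * w t * (norm (wt 1 (\<xi>K K)))\<^sup>2 - c * w t * (norm (wt 1 (\<xi>K J)))\<^sup>2\<bar> \<le> c * w \<tau> * ((2 * norm kv) * ?n)"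
        using cpos wpos[of t] by (simp add: abs_mult right_diff_distrib[symmetric])
      have "\<bar>g t (\<xi>K K) - g t (\<xi>K J)\<bar> \<le> CC * M * (2 * norm kv) * ?n + c * w \<tau> * ((2 * norm kv) * ?n)"
        unfolding g_def using 1 2 by linarith
      also have "\<dots> = Dc * ?n" unfolding Dc_def by (simp only: distrib_right mult.assoc)
      finally show ?thesis .
    qed
    \<comment> \<open>The budget: the derivative is below -3/4 w at time ts for K = J, below -1/2 w
      near ts by continuity, and, since two errors of w/8 separate K from J, at most -1/4 w for
      every K >= J.\<close>
    have ev1: "\<forall>\<^sub>F K in sequentially. 2 * cG * norm kv * norm (rK K) - w ts * (norm (\<xi>K K))\<^sup>2 < - (3/4) * w ts"
    proof (rule order_tendstoD)
      show "(\<lambda>K. 2 * cG * norm kv * norm (rK K) - w ts * (norm (\<xi>K K))\<^sup>2) \<longlonglongrightarrow> 2 * cG * norm kv * norm (0 :: 'd fock) - w ts * (norm \<xi>)\<^sup>2"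
        by (intro tendsto_intros lr l\<xi>K)
    qed (use n\<xi> wpos[of ts] in simp)
    have ev2: "\<forall>\<^sub>F K in sequentially. Dc * norm (trunc K kv - kv) < w ts / 8"
    proof (rule order_tendstoD)
      show "(\<lambda>K. Dc * norm (trunc K kv - kv)) \<longlonglongrightarrow> Dc * norm (kv - kv)"
        by (intro tendsto_intros trunc_tendsto)
    qed (use wpos[of ts] in simp)
    from eventually_conj[OF ev1 ev2] obtain J where
      J1: "\<And>K. K \<ge> J \<Longrightarrow> 2 * cG * norm kv * norm (rK K) - w ts * (norm (\<xi>K K))\<^sup>2 < - (3/4) * w ts"
      and J2: "\<And>K. K \<ge> J \<Longrightarrow> Dc * norm (trunc K kv - kv) < w ts / 8"
      unfolding eventually_sequentially by blast
    have gJ: "g ts (\<xi>K J) < - (3/4) * w ts" using gts[of J] J1[of J] by simp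
    have gKJ: "g t (\<xi>K K) \<le> g t (\<xi>K J) + w ts / 4" if "0 \<le> t" "t \<le> \<tau>" "K \<ge> J" for t K
    proof -
      have "norm (trunc K kv - trunc J kv) \<le> norm (trunc K kv - kv) + norm (trunc J kv - kv)"
        using norm_triangle_ineq4[of "trunc K kv - kv" "trunc J kv - kv"] by simp
      then have "Dc * norm (trunc K kv - trunc J kv) \<le> Dc * norm (trunc K kv - kv) + Dc * norm (trunc J kv - kv)"
        using Dc0 by (simp add: distrib_left[symmetric] mult_left_mono)
      then show ?thesis using gdiff[OF that(1,2), of K J] J2[OF that(3)] J2[of J] by simp
    qed
    have "continuous_on {0..} (\<lambda>t. g t (\<xi>K J))"
      unfolding g_def w_def
      by (intro continuous_intros)
        (subst continuous_on_cong[OF refl generator_form_gdrift[OF \<xi>KD \<xi>KD yB]], simp,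
          intro continuous_intros cont, auto simp: \<xi>KD)
    then have "((\<lambda>t. g t (\<xi>K J)) \<longlongrightarrow> g ts (\<xi>K J)) (at ts within {0..})"
      using ts0 by (simp add: continuous_on_def)
    then have "\<forall>\<^sub>F t in at ts within {0..}. g t (\<xi>K J) < - (1/2) * w ts"
      by (rule order_tendstoD) (use gJ wpos[of ts] in linarith)
    then obtain d where d: "d > 0" "\<And>t. t \<ge> 0 \<Longrightarrow> t \<noteq> ts \<Longrightarrow> dist t ts < d \<Longrightarrow> g t (\<xi>K J) < - (1/2) * w ts"
      unfolding eventually_at by auto
    \<comment> \<open>A positive time strictly before ts and within d of it. Only times up to \<tau>
      are admissible, so the contradiction is sought to the left of ts.\<close>
    define s where "s = max (ts / 2) (ts - d / 2)"
    have s: "0 < s" "s < ts" "ts - s < d" using tspos d(1) by (auto simp: s_def)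
    have gneg: "g t (\<xi>K K) \<le> - (w ts / 4)" if "s \<le> t" "t \<le> ts" "K \<ge> J" for t K
    proof -
      have "g t (\<xi>K J) < - (1/2) * w ts"
      proof (cases "t = ts")
        case True show ?thesis using gJ wpos[of ts] unfolding True by linarith
      next
        case False then show ?thesis using d(2)[of t] that s by (simp add: dist_real_def)
      qed
      then show ?thesis using gKJ[of t K] that s ts0 by linarith
    qed
    \<comment> \<open>Following the form backwards from ts to s increases it by a fixed amount,
      while it stays below \<mu> times the squared norm; hence the deficit at ts cannot tend to
      0.\<close>
    have "q K \<ge> w ts / 4 * (ts - s)" if K: "K \<ge> J" for K
    proof -
      have "P ts (\<xi>K K) + w ts / 4 * ts \<le> P s (\<xi>K K) + w ts / 4 * s"
      proof (rule DERIV_nonpos_imp_nonincreasing[of s ts "\<lambda>t. P t (\<xi>K K) + w ts / 4 * t"])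
        show "s \<le> ts" using s by simp
        fix t assume t: "s \<le> t" "t \<le> ts"
        have "((\<lambda>t. P t (\<xi>K K) + w ts / 4 * t) has_real_derivative g t (\<xi>K K) + w ts / 4 * 1) (at t)"
          by (intro DERIV_add DERIV_cmult DERIV_ident dP) (use t s \<xi>KD in auto)
        then show "\<exists>z. ((\<lambda>t. P t (\<xi>K K) + w ts / 4 * t) has_real_derivative z) (at t) \<and> z \<le> 0"
          using gneg[OF t K] by (intro exI conjI) auto
      qed
      moreover have "P s (\<xi>K K) \<le> \<mu> * (norm (\<xi>K K))\<^sup>2" by (rule hom) (use s ts0 \<xi>KD in auto)
      ultimately show ?thesis by (simp add: q_def right_diff_distrib)
    qed
    then have "w ts / 4 * (ts - s) \<le> 0" by (intro LIMSEQ_le_const[OF lq]) blast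
    moreover have "w ts / 4 * (ts - s) > 0" using s wpos[of ts] by simp
    ultimately show False by linarith
  qed
  show ?thesis
  proof (rule tendsto_lowerbound[of "\<lambda>\<epsilon>. \<epsilon> * (exp (c * \<tau>) * (norm (wt 1 \<xi>0))\<^sup>2)" 0 "at_right 0"])
    show "((\<lambda>\<epsilon>. \<epsilon> * (exp (c * \<tau>) * (norm (wt 1 \<xi>0))\<^sup>2)) \<longlongrightarrow> 0) (at_right 0)"
      by (auto intro!: tendsto_eq_intros)
    show "\<forall>\<^sub>F \<epsilon> in at_right 0. Re (cinner \<xi>0 (y \<tau> \<xi>0)) \<le> \<epsilon> * (exp (c * \<tau>) * (norm (wt 1 \<xi>0))\<^sup>2)"
      unfolding eventually_at_right_field using main by (intro exI[of _ 1]) auto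
  qed simp
qed

text \<open>The equation is complex linear, so \<open>master_nonpos\<close> applies to a y(t) for a
  = 1, -1, i, -i and makes the quadratic form of y vanish on \<open>fock_D\<close>; polarisation
  does the rest.\<close>

lemma master_unique:
  fixes U V :: "complex^'d::finite^'m::finite" and y :: "real \<Rightarrow> 'd op"
  assumes \<Omega>: "adj_mat \<Omega> = \<Omega>"
    and yB: "\<And>t. t \<ge> 0 \<Longrightarrow> y t \<in> BH" and yM: "\<And>t. t \<ge> 0 \<Longrightarrow> norm (y t) \<le> M" and y0: "y 0 = 0"
    and der: "\<And>t u v. t \<ge> 0 \<Longrightarrow> u \<in> fock_D \<Longrightarrow> v \<in> fock_D \<Longrightarrow>
      ((\<lambda>s. cinner u (y s v)) has_vector_derivative generator_form \<Omega> \<kappa> U V 0 (y t) u v) (at t within {0..})"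
    and \<tau>: "\<tau> \<ge> 0"
  shows "y \<tau> = 0"
proof -
  have gs: "generator_form \<Omega> \<kappa> U V 0 (scaleC_op a x) u v = a * generator_form \<Omega> \<kappa> U V 0 x u v"
    if "u \<in> fock_D" "v \<in> fock_D" "x \<in> BH" for a x u v
    using that by (simp add: generator_form_gdrift sum_distrib_left algebra_simps)
  have ns: "norm (scaleC_op a x) \<le> cmod a * norm x" for a and x :: "'d op"
    by (rule norm_blinfun_bound) (auto simp: mult.assoc intro!: mult_left_mono norm_blinfun)
  have "Re (cinner \<xi> (scaleC_op a (y \<tau>) \<xi>)) \<le> 0" if "\<xi> \<in> fock_D" for a \<xi>
  proof (rule master_nonpos[OF \<Omega>, where y = "\<lambda>t. scaleC_op a (y t)" and M = "cmod a * M" and \<tau> = \<tau> and \<kappa> = \<kappa> and U = U and V = V])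
    fix t :: real assume t: "t \<ge> 0"
    show "scaleC_op a (y t) \<in> BH" using yB[OF t] by simp
    show "norm (scaleC_op a (y t)) \<le> cmod a * M"
      by (rule order_trans[OF ns mult_left_mono[OF yM[OF t]]]) simp
    fix u v :: "'d fock" assume uv: "u \<in> fock_D" "v \<in> fock_D"
    show "((\<lambda>s. cinner u (scaleC_op a (y s) v)) has_vector_derivative
            generator_form \<Omega> \<kappa> U V 0 (scaleC_op a (y t)) u v) (at t within {0..})"
      using has_vector_derivative_mult_right[OF der[OF t uv], of a] by (simp add: gs uv yB[OF t])
  next
    show "scaleC_op a (y 0) = 0" by (rule blinfun_eqI) (simp add: y0)
  qed (use \<tau> that in auto)
  then have Re0: "Re (a * cinner \<xi> (y \<tau> \<xi>)) \<le> 0" if "\<xi> \<in> fock_D" for a \<xi> using that by simp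
  have z: "cinner \<xi> (y \<tau> \<xi>) = 0" if "\<xi> \<in> fock_D" for \<xi>
    using Re0[OF that, of 1] Re0[OF that, of "-1"] Re0[OF that, of \<i>] Re0[OF that, of "- \<i>"]
    by (simp add: complex_eq_iff)
  show ?thesis
  proof (rule blinfun_eqI_D)
    fix u v :: "'d fock" assume u: "u \<in> fock_D" and v: "v \<in> fock_D"
    let ?x = "y \<tau>"
    have 1: "cinner u (?x v) + cinner v (?x u) = 0"
      using z[of "u + v"] z[OF u] z[OF v] u v by (simp add: cinner_add_left cinner_add_right blinfun.add_right add.commute)
    have 2: "\<i> * cinner u (?x v) - \<i> * cinner v (?x u) = 0"
      using z[of "u + \<i> *\<^sub>C v"] z[OF u] z[OF v] u v
      by (simp add: cinner_add_left cinner_add_right blinfun.add_right BH_scaleC[OF yB[OF \<tau>]])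
    have "cinner u (?x v) = cinner v (?x u)" using 2 by (simp add: right_diff_distrib[symmetric])
    then show "cinner u (?x v) = cinner u (blinfun_apply 0 v)" using 1 by simp
  qed
qed

subsection \<open>The semigroup on Weyl operators\<close>

definition flow :: "('a::euclidean_space \<Rightarrow> 'a) \<Rightarrow> real \<Rightarrow> 'a \<Rightarrow> 'a"
  where "flow A t z = (\<Sum>k. (t ^ k / fact k) *\<^sub>R (A ^^ k) z)"

context
  fixes A :: "'a::euclidean_space \<Rightarrow> 'a"
  assumes A: "bounded_linear A"
begin

lemma summable_flow: "summable (\<lambda>k. norm ((t ^ k / fact k) *\<^sub>R (A ^^ k) z))"
proof -
  obtain K where K: "K > 0" "\<And>x. norm (A x) \<le> norm x * K" using bounded_linear.pos_bounded[OF A] by blast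
  have p: "norm ((A ^^ k) z) \<le> K ^ k * norm z" for k
  proof (induction k)
    case (Suc k)
    have "norm ((A ^^ Suc k) z) \<le> norm ((A ^^ k) z) * K" using K(2) by simp
    also have "\<dots> \<le> (K ^ k * norm z) * K" using Suc K by (intro mult_right_mono) auto
    finally show ?case by (simp add: mult_ac)
  qed simp
  have s: "summable (\<lambda>k. ((\<bar>t\<bar> * K) ^ k /\<^sub>R fact k) * norm z)"
    by (intro summable_mult2 summable_exp_generic)
  show ?thesis
  proof (rule summable_comparison_test[OF _ s], intro exI[of _ 0] allI impI)
    fix k
    have "\<bar>t\<bar> ^ k / fact k * norm ((A ^^ k) z) \<le> \<bar>t\<bar> ^ k / fact k * (K ^ k * norm z)"
      by (intro mult_left_mono p) simp
    moreover have "norm (norm ((t ^ k / fact k) *\<^sub>R (A ^^ k) z)) = \<bar>t\<bar> ^ k / fact k * norm ((A ^^ k) z)"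
      by (simp add: power_abs)
    moreover have "((\<bar>t\<bar> * K) ^ k /\<^sub>R fact k) * norm z = \<bar>t\<bar> ^ k / fact k * (K ^ k * norm z)"
      by (simp add: power_mult_distrib divide_inverse mult_ac)
    ultimately show "norm (norm ((t ^ k / fact k) *\<^sub>R (A ^^ k) z)) \<le> ((\<bar>t\<bar> * K) ^ k /\<^sub>R fact k) * norm z"
      by (simp only:)
  qed
qed

lemma flow_sums: "(\<lambda>k. (t ^ k / fact k) *\<^sub>R (A ^^ k) z) sums flow A t z"
  unfolding flow_def by (rule summable_sums[OF summable_norm_cancel[OF summable_flow]])

lemma flow_0 [simp]: "flow A 0 z = z"
proof -
  have "(\<lambda>k. (0 ^ k / fact k) *\<^sub>R (A ^^ k) z) sums (\<Sum>k\<in>{0}. (0 ^ k / fact k) *\<^sub>R (A ^^ k) z)"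
    by (rule sums_finite) auto
  from sums_unique2[OF flow_sums this] show ?thesis by simp
qed

lemma funpow_linear: "linear (A ^^ k)"
proof (induction k)
  case (Suc k)
  then show ?case using linear_compose[OF Suc bounded_linear.linear[OF A]] by (simp add: o_def)
qed (simp add: linear_id[unfolded id_def] id_def)

lemma flow_add: "flow A t (z + w) = flow A t z + flow A t w"
proof -
  have "(\<lambda>k. (t ^ k / fact k) *\<^sub>R (A ^^ k) (z + w)) sums (flow A t z + flow A t w)"
    using sums_add[OF flow_sums[of t z] flow_sums[of t w]] by (simp add: linear_add[OF funpow_linear] scaleR_add_right)
  from sums_unique2[OF flow_sums this] show ?thesis .
qed

lemma flow_scaleR: "flow A t (r *\<^sub>R z) = r *\<^sub>R flow A t z"
proof -
  have "(\<lambda>k. (t ^ k / fact k) *\<^sub>R (A ^^ k) (r *\<^sub>R z)) sums (r *\<^sub>R flow A t z)"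
    using sums_scaleR_right[OF flow_sums[of t z], of r] by (simp add: linear_scale[OF funpow_linear] mult.commute)
  from sums_unique2[OF flow_sums this] show ?thesis .
qed

text \<open>In each coordinate the flow is an everywhere convergent scalar power series, which may
  be differentiated termwise.\<close>

lemma flow_has_vector_derivative: "((\<lambda>t. flow A t z) has_vector_derivative A (flow A t z)) (at t within S)"
  unfolding has_vector_derivative_def
proof (subst has_derivative_componentwise_within, intro ballI)
  fix i :: 'a assume i: "i \<in> Basis"
  define c where "c k = ((A ^^ k) z \<bullet> i) / fact k" for k
  have cs: "(\<lambda>k. c k * s ^ k) sums (flow A s z \<bullet> i)" for s
    using bounded_linear.sums[OF bounded_linear_inner_left flow_sums[of s z], of i]
    by (simp add: c_def mult.commute)
  have d: "diffs c k = ((A ^^ Suc k) z \<bullet> i) / fact k" for k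
  proof -
    have "real (Suc k) / fact (Suc k) = 1 / fact k" by (simp add: field_simps del: of_nat_Suc)
    then show ?thesis by (simp add: diffs_def c_def field_simps del: of_nat_Suc fact_Suc)
  qed
  have "(\<lambda>k. diffs c k * t ^ k) sums (A (flow A t z) \<bullet> i)"
  proof -
    have "(\<lambda>k. A ((t ^ k / fact k) *\<^sub>R (A ^^ k) z) \<bullet> i) sums (A (flow A t z) \<bullet> i)"
      by (intro bounded_linear.sums[OF bounded_linear_inner_left] bounded_linear.sums[OF A] flow_sums)
    then show ?thesis by (simp add: d linear_scale[OF bounded_linear.linear[OF A]] mult.commute)
  qed
  then have "(\<Sum>k. diffs c k * t ^ k) = A (flow A t z) \<bullet> i" by (rule sums_unique[symmetric])
  moreover have "(\<lambda>s. \<Sum>k. c k * s ^ k) = (\<lambda>s. flow A s z \<bullet> i)" by (rule ext) (rule sums_unique[OF cs, symmetric])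
  moreover have "((\<lambda>s. \<Sum>k. c k * s ^ k) has_field_derivative (\<Sum>k. diffs c k * t ^ k)) (at t)"
    by (rule termdiffs_strong_converges_everywhere) (rule sums_summable[OF cs])
  ultimately have "((\<lambda>s. flow A s z \<bullet> i) has_field_derivative A (flow A t z) \<bullet> i) (at t within S)"
    by (simp add: has_field_derivative_at_within)
  then show "((\<lambda>s. flow A s z \<bullet> i) has_derivative (\<lambda>s. (s *\<^sub>R A (flow A t z)) \<bullet> i)) (at t within S)"
    by (simp add: has_field_derivative_def mult_commute_abs)
qed

lemma flow_continuous: "continuous_on S (\<lambda>t. flow A t z)"
  unfolding continuous_on_eq_continuous_within
  using has_vector_derivative_continuous[OF flow_has_vector_derivative] by blast

end

section \<open>Drift and accumulated noise\<close>

lemma drift_linear: "linear (drift \<Omega> \<kappa> U V)"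
proof (rule linearI)
  have cv: "cnj_vec (z + w) = cnj_vec z + cnj_vec w" "cnj_vec (r *\<^sub>R z) = r *\<^sub>R cnj_vec z" for z w :: "complex^'a" and r
    by (simp_all add: cnj_vec_def vec_eq_iff)
  have mr: "M *v (r *\<^sub>R x) = r *\<^sub>R (M *v x)" for M :: "complex^'a^'a" and r x
    by (simp add: vec_eq_iff matrix_vector_mult_def scaleR_sum_right)
  fix z w :: "complex^'a" and r :: real
  show "drift \<Omega> \<kappa> U V (z + w) = drift \<Omega> \<kappa> U V z + drift \<Omega> \<kappa> U V w"
    by (simp add: drift_def cv matrix_vector_right_distrib)
  show "drift \<Omega> \<kappa> U V (r *\<^sub>R z) = r *\<^sub>R drift \<Omega> \<kappa> U V z"
    by (simp add: drift_def cv mr scaleR_add_right)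
qed

lemma drift_bounded_linear: "bounded_linear (drift \<Omega> \<kappa> U V)"
  using drift_linear linear_conv_bounded_linear by blast

lemma lam_add: "lam U V l (z + w) = lam U V l z + lam U V l w"
  and lam_scaleR: "lam U V l (r *\<^sub>R z) = r * lam U V l z"
  by (simp_all add: lam_def sum.distrib[symmetric] sum_distrib_left algebra_simps scaleR_conv_of_real[where 'a = complex])

lemma bounded_linear_lam: "bounded_linear (lam U V l)"
  by (rule linear_conv_bounded_linear[THEN iffD1], rule linearI)
    (simp_all add: lam_add lam_scaleR scaleR_conv_of_real[where 'a = complex])

lemma diffu_add_left: "diffu U V (z + z') w = diffu U V z w + diffu U V z' w"
  and diffu_add_right: "diffu U V w (z + z') = diffu U V w z + diffu U V w z'"
  and diffu_scaleR_left: "diffu U V (r *\<^sub>R z) w = r * diffu U V z w"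
  and diffu_scaleR_right: "diffu U V w (r *\<^sub>R z) = r * diffu U V w z"
  by (simp_all add: diffu_def lam_add lam_scaleR sum.distrib[symmetric] sum_distrib_left algebra_simps)

lemma diffu_commute: "diffu U V z w = diffu U V w z"
  unfolding diffu_def by (rule sum.cong) (auto simp: algebra_simps)

lemma diffu_nonneg: "diffu U V z z \<ge> 0"
  unfolding diffu_def by (rule sum_nonneg) (simp add: power2_eq_square[symmetric])

lemma continuous_on_diffu [continuous_intros]:
  "continuous_on S f \<Longrightarrow> continuous_on S g \<Longrightarrow> continuous_on S (\<lambda>s. diffu U V (f s) (g s))"
  unfolding diffu_def by (intro continuous_intros bounded_linear.continuous_on[OF bounded_linear_lam])

text \<open>The polarised form of the integral in the exponent of the Weyl formula; two arguments
  are kept because it becomes the real part of a Gram matrix.\<close>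

definition noise :: "complex^'d^'d \<Rightarrow> complex^'d^'d \<Rightarrow> complex^'d^'m::finite \<Rightarrow> complex^'d^'m \<Rightarrow> real \<Rightarrow> complex^'d \<Rightarrow> complex^'d::finite \<Rightarrow> real"
  where "noise \<Omega> \<kappa> U V t z w =
    integral {0..t} (\<lambda>s. diffu U V (flow (drift \<Omega> \<kappa> U V) s z) (flow (drift \<Omega> \<kappa> U V) s w))"

lemma noise_continuous: "continuous_on S (\<lambda>s. diffu U V (flow (drift \<Omega> \<kappa> U V) s z) (flow (drift \<Omega> \<kappa> U V) s w))"
  by (intro continuous_intros flow_continuous drift_bounded_linear)

lemma noise_integrable: "(\<lambda>s. diffu U V (flow (drift \<Omega> \<kappa> U V) s z) (flow (drift \<Omega> \<kappa> U V) s w)) integrable_on {a..b}"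
  by (intro integrable_continuous_real noise_continuous)

lemma noise_0 [simp]: "noise \<Omega> \<kappa> U V 0 z w = 0"
  by (simp add: noise_def)

lemma noise_has_derivative:
  assumes "t \<ge> 0"
  shows "((\<lambda>t. noise \<Omega> \<kappa> U V t z w) has_real_derivative
    diffu U V (flow (drift \<Omega> \<kappa> U V) t z) (flow (drift \<Omega> \<kappa> U V) t w)) (at t within {0..})"
proof -
  let ?f = "\<lambda>s. diffu U V (flow (drift \<Omega> \<kappa> U V) s z) (flow (drift \<Omega> \<kappa> U V) s w)"
  have "((\<lambda>t. noise \<Omega> \<kappa> U V t z w) has_real_derivative ?f t) (at t within {0..t+1})"
    unfolding noise_def by (rule integral_has_real_derivative[OF noise_continuous]) (use assms in auto)
  moreover have "at t within {0..t+1} = at t within {0..}"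
    by (rule at_within_nhd[of _ "{..<t+1}"]) (use assms in auto)
  ultimately show ?thesis by simp
qed

lemma noise_mono:
  assumes "0 \<le> s" "s \<le> t"
  shows "noise \<Omega> \<kappa> U V s z z \<le> noise \<Omega> \<kappa> U V t z z"
  unfolding noise_def by (rule integral_subset_le) (use assms in \<open>auto intro: noise_integrable diffu_nonneg\<close>)

lemma noise_nonneg: "t \<ge> 0 \<Longrightarrow> noise \<Omega> \<kappa> U V t z z \<ge> 0"
  using noise_mono[of 0 t] by simp

lemma noise_add_left: "noise \<Omega> \<kappa> U V t (z + z') w = noise \<Omega> \<kappa> U V t z w + noise \<Omega> \<kappa> U V t z' w"
  by (simp add: noise_def flow_add[OF drift_bounded_linear] diffu_add_left integral_add noise_integrable)

lemma noise_scaleR_left: "noise \<Omega> \<kappa> U V t (r *\<^sub>R z) w = r * noise \<Omega> \<kappa> U V t z w"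
  by (simp add: noise_def flow_scaleR[OF drift_bounded_linear] diffu_scaleR_left)

lemma noise_commute: "noise \<Omega> \<kappa> U V t z w = noise \<Omega> \<kappa> U V t w z"
  unfolding noise_def by (simp add: diffu_commute)

section \<open>Evolution of Weyl operators\<close>

text \<open>The 2 by 2 operator matrix with 1 on the diagonal and W(z), W(-z) off it is positive,
  since its form is the squared norm of \<xi>_0 + W(z) \<xi>_1. Its image under \<Phi> being
  positive forces the bound. This supplies the uniform M in \<open>master_unique\<close>.\<close>

lemma cp_unital_contraction:
  fixes \<Phi> :: "'d::finite op \<Rightarrow> 'd op"
  assumes cp: "completely_positive \<Phi>" and un: "\<Phi> id_blinfun = id_blinfun" and lin: "linear_on_ops BH \<Phi>"
  shows "norm (\<Phi> (weyl z)) \<le> 1"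
proof -
  define X :: "nat \<Rightarrow> nat \<Rightarrow> 'd op" where "X i j = (if i = j then id_blinfun else if i < j then weyl z else weyl (- z))" for i j
  have two: "{..<2::nat} = {0, 1}" by auto
  have "positive_matrix 2 X"
    unfolding positive_matrix_def
  proof (intro conjI allI impI)
    fix \<xi> :: "nat \<Rightarrow> 'd fock"
    have "(\<Sum>i<2. \<Sum>j<2. cinner (\<xi> i) (X i j (\<xi> j))) = cinner (\<xi> 0 + weyl z (\<xi> 1)) (\<xi> 0 + weyl z (\<xi> 1))"
      by (simp add: two X_def cinner_add_left cinner_add_right cinner_weyl_left weyl_inverse del: One_nat_def)
    then show "(\<Sum>i<2. \<Sum>j<2. cinner (\<xi> i) (X i j (\<xi> j))) \<in> \<real>\<^sub>\<ge>\<^sub>0"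
      by (simp add: cinner_self complex_nonneg_Reals_iff del: of_real_power)
  qed (simp add: X_def)
  then have pm: "positive_matrix 2 (\<lambda>i j. \<Phi> (X i j))" using cp by (simp add: completely_positive_def)
  let ?A = "\<Phi> (weyl z)" and ?B = "\<Phi> (weyl (- z))"
  have AB: "?A \<in> BH" "?B \<in> BH" using lin by (auto simp: linear_on_ops_def image_subset_iff)
  have pos: "cinner u u + cinner u (?A v) + (cinner v (?B u) + cinner v v) \<in> \<real>\<^sub>\<ge>\<^sub>0" for u v
    using pm[unfolded positive_matrix_def, THEN conjunct2, rule_format, of "\<lambda>i. if i = 0 then u else v"]
    by (simp add: two X_def un del: One_nat_def)
  have Im0: "Im (cinner u (?A v)) + Im (cinner v (?B u)) = 0"
    and Re0: "(norm u)\<^sup>2 + (norm v)\<^sup>2 + Re (cinner u (?A v)) + Re (cinner v (?B u)) \<ge> 0" for u v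
    using pos[of u v] by (auto simp: complex_nonneg_Reals_iff cinner_self simp del: of_real_power)
  have ReAB: "Re (cinner u (?A v)) = Re (cinner v (?B u))" for u v
    using Im0[of u "\<i> *\<^sub>C v"] by (simp add: BH_scaleC[OF AB(1)])
  show ?thesis
  proof (rule norm_blinfun_bound)
    fix v
    \<comment> \<open>Positivity is tested at u = - \<Phi>(W(z)) v, the choice that gives the sharp
      bound.\<close>
    have "(norm (?A v))\<^sup>2 + (norm v)\<^sup>2 - 2 * (norm (?A v))\<^sup>2 \<ge> 0"
      using Re0[of "- ?A v" v] ReAB[of "- ?A v" v] by (simp add: cinner_self del: of_real_power)
    then have "(norm (?A v))\<^sup>2 \<le> (norm v)\<^sup>2" by simp
    then show "norm (?A v) \<le> 1 * norm v" by (simp add: power2_le_iff_abs_le)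
  qed simp
qed

text \<open>Both sides are bounded in norm by 1, solve the same weak master equation on
  \<open>fock_D\<close> and agree at t = 0, so \<open>master_unique\<close> applies to their
  difference.\<close>

lemma gaussian_qms_weyl:
  fixes U V :: "complex^'d::finite^'m::finite"
  assumes \<Omega>: "adj_mat \<Omega> = \<Omega>" and \<kappa>: "transpose \<kappa> = \<kappa>" and T: "gaussian_qms \<Omega> \<kappa> U V 0 T" and t: "t \<ge> 0"
  shows "T t (weyl z) = scaleC_op (exp (- noise \<Omega> \<kappa> U V t z z / 2)) (weyl (flow (drift \<Omega> \<kappa> U V) t z))"
proof -
  let ?Z = "drift \<Omega> \<kappa> U V"
  let ?g = "generator_form \<Omega> \<kappa> U V 0"
  define \<phi> where "\<phi> t = exp (- noise \<Omega> \<kappa> U V t z z / 2)" for t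
  define x where "x t = scaleC_op (\<phi> t) (weyl (flow ?Z t z))" for t
  define y where "y t = T t (weyl z) - x t" for t
  have qms: "quantum_markov_semigroup T" using T by (simp add: gaussian_qms_def)
  have TB: "T t (weyl z) \<in> BH" if "t \<ge> 0" for t
    using qms that by (auto simp: quantum_markov_semigroup_def linear_on_ops_def image_subset_iff)
  have Tn: "norm (T t (weyl z)) \<le> 1" if "t \<ge> 0" for t
    by (rule cp_unital_contraction) (use qms that in \<open>auto simp: quantum_markov_semigroup_def\<close>)
  have \<phi>1: "\<bar>\<phi> t\<bar> \<le> 1" if "t \<ge> 0" for t
    using noise_nonneg[OF that, of \<Omega> \<kappa> U V z] by (simp add: \<phi>_def)
  have xn: "norm (x t) \<le> 1" if "t \<ge> 0" for t
    by (rule norm_blinfun_bound) (use \<phi>1[OF that] in \<open>auto simp: x_def intro: mult_left_le_one_le\<close>)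
  have "y t = 0"
  proof (rule master_unique[OF \<Omega>, where M = 2 and \<tau> = t and \<kappa> = \<kappa> and U = U and V = V])
    fix t :: real assume t: "t \<ge> 0"
    show "y t \<in> BH" using TB[OF t] by (simp add: y_def x_def)
    show "norm (y t) \<le> 2"
      unfolding y_def by (rule order_trans[OF norm_triangle_ineq4]) (use Tn[OF t] xn[OF t] in linarith)
    fix u v :: "'d fock" assume u: "u \<in> fock_D" and v: "v \<in> fock_D"
    let ?W = "weyl (flow ?Z t z)"
    have 1: "((\<lambda>s. cinner u (T s (weyl z) v)) has_vector_derivative ?g (T t (weyl z)) u v) (at t within {0..})"
      using T u v t by (simp add: gaussian_qms_def)
    have d\<phi>: "(\<phi> has_real_derivative - (diffu U V (flow ?Z t z) (flow ?Z t z) / 2) * \<phi> t) (at t within {0..})"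
      unfolding \<phi>_def by (auto intro!: derivative_eq_intros noise_has_derivative t)
    have d\<phi>': "((\<lambda>s. complex_of_real (\<phi> s)) has_vector_derivative complex_of_real (- (diffu U V (flow ?Z t z) (flow ?Z t z) / 2) * \<phi> t)) (at t within {0..})"
      using bounded_linear.has_vector_derivative[OF bounded_linear_of_real d\<phi>[unfolded has_real_derivative_iff_has_vector_derivative]] .
    have gx: "?g (x t) u v = \<phi> t * ?g ?W u v"
      using u v by (simp add: generator_form_gdrift x_def sum_distrib_left algebra_simps)
    have "((\<lambda>s. complex_of_real (\<phi> s) * cinner u (weyl (flow ?Z s z) v)) has_vector_derivative
        complex_of_real (\<phi> t) * (cinner u (?W (fieldop (?Z (flow ?Z t z)) v)) + \<i> * Im (hip (flow ?Z t z) (?Z (flow ?Z t z))) * cinner u (?W v))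
        + complex_of_real (- (diffu U V (flow ?Z t z) (flow ?Z t z) / 2) * \<phi> t) * cinner u (?W v)) (at t within {0..})"
      by (rule has_vector_derivative_mult[OF d\<phi>' weyl_has_vector_derivative[OF u v flow_has_vector_derivative[OF drift_bounded_linear]]])
    moreover have cx: "cinner u (x s v) = complex_of_real (\<phi> s) * cinner u (weyl (flow ?Z s z) v)" for s
      by (simp add: x_def)
    ultimately have 2: "((\<lambda>s. cinner u (x s v)) has_vector_derivative ?g (x t) u v) (at t within {0..})"
      unfolding cx gx generator_form_weyl[OF u v \<Omega> \<kappa>] by (simp add: algebra_simps)
    have "?g (y t) u v = ?g (T t (weyl z)) u v - ?g (x t) u v"
      using u v TB[OF t] by (simp add: y_def generator_form_gdrift minus_blinfun.rep_eq cinner_diff_right x_def sum_subtractf)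
    then show "((\<lambda>s. cinner u (y s v)) has_vector_derivative ?g (y t) u v) (at t within {0..})"
      using has_vector_derivative_diff[OF 1 2] by (simp add: y_def minus_blinfun.rep_eq cinner_diff_right)
  next
    have "T 0 (weyl z) = weyl z" using qms by (simp add: quantum_markov_semigroup_def weak_star_semigroup_def)
    then show "y 0 = 0"
      by (intro blinfun_eqI) (simp add: y_def x_def \<phi>_def minus_blinfun.rep_eq flow_0[OF drift_bounded_linear])
  qed (rule t)
  then show ?thesis by (simp add: y_def x_def \<phi>_def)
qed

subsection \<open>Square roots of positive operators\<close>

lemma positive_op_BH: "positive_op x \<Longrightarrow> x \<in> BH"
  by (simp add: positive_op_def)

lemma positive_op_nonneg:
  assumes "positive_op x"
  shows "Re (cinner \<xi> (x \<xi>)) \<ge> 0" "Im (cinner \<xi> (x \<xi>)) = 0"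
  using assms by (auto simp: positive_op_def complex_nonneg_Reals_iff)

lemma positive_opI:
  assumes "x \<in> BH" "\<And>\<xi>. Re (cinner \<xi> (blinfun_apply x \<xi>)) \<ge> 0" "\<And>\<xi>. Im (cinner \<xi> (blinfun_apply x \<xi>)) = 0"
  shows "positive_op x"
  using assms by (simp add: positive_op_def complex_nonneg_Reals_iff)

lemma positive_op_commute:
  assumes x: "positive_op x"
  shows "cinner \<eta> (x \<xi>) = cnj (cinner \<xi> (x \<eta>))"
proof -
  note B = positive_op_BH[OF x]
  have 1: "Im (cinner \<xi> (x \<eta>)) + Im (cinner \<eta> (x \<xi>)) = 0"
    using positive_op_nonneg(2)[OF x, of "\<xi> + \<eta>"] positive_op_nonneg(2)[OF x, of \<xi>] positive_op_nonneg(2)[OF x, of \<eta>]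
    by (simp add: cinner_add_left cinner_add_right blinfun.add_right)
  have 2: "Re (cinner \<xi> (x \<eta>)) = Re (cinner \<eta> (x \<xi>))"
    using positive_op_nonneg(2)[OF x, of "\<xi> + \<i> *\<^sub>C \<eta>"] positive_op_nonneg(2)[OF x, of \<xi>] positive_op_nonneg(2)[OF x, of \<eta>]
    by (simp add: cinner_add_left cinner_add_right blinfun.add_right BH_scaleC[OF B])
  show ?thesis using 1 2 by (simp add: complex_eq_iff)
qed

lemma positive_op_hermitian: "positive_op x \<Longrightarrow> cinner (x \<xi>) \<eta> = cinner \<xi> (x \<eta>)"
  using positive_op_commute[of x \<xi> \<eta>] cinner_commute[of "x \<xi>" \<eta>] by simp

lemma positive_op_Cauchy_Schwarz:
  assumes x: "positive_op x"
  shows "(cmod (cinner \<xi> (x \<eta>)))\<^sup>2 \<le> Re (cinner \<xi> (x \<xi>)) * Re (cinner \<eta> (x \<eta>))"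
proof (rule quadratic_nonneg_discriminant)
  note B = positive_op_BH[OF x]
  fix r :: real
  define s where "s = cinner \<xi> (x \<eta>)"
  define c where "c = (if s = 0 then 1 else cnj s / cmod s)"
  have cs: "c * s = cmod s" using complex_norm_square[of s] by (simp add: c_def field_simps power2_eq_square)
  have "cmod c = 1" by (simp add: c_def norm_divide)
  then have cc: "cnj c * c = 1" by (simp add: cnj_mult_self)
  have "cinner \<eta> (x \<xi>) = cnj s" unfolding s_def by (rule positive_op_commute[OF x])
  then have "cinner (\<xi> + (complex_of_real r * c) *\<^sub>C \<eta>) (x (\<xi> + (complex_of_real r * c) *\<^sub>C \<eta>)) =
    cinner \<xi> (x \<xi>) + complex_of_real r * (c * s) + complex_of_real r * cnj (c * s) + (complex_of_real (r\<^sup>2) * (cnj c * c)) * cinner \<eta> (x \<eta>)"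
    by (simp add: cinner_add_left cinner_add_right blinfun.add_right BH_scaleC[OF B] s_def power2_eq_square algebra_simps)
  then have "Re (cinner (\<xi> + (complex_of_real r * c) *\<^sub>C \<eta>) (x (\<xi> + (complex_of_real r * c) *\<^sub>C \<eta>))) =
    Re (cinner \<xi> (x \<xi>)) + 2 * r * cmod s + r\<^sup>2 * Re (cinner \<eta> (x \<eta>))"
    unfolding cs cc by simp
  then show "0 \<le> Re (cinner \<xi> (x \<xi>)) + 2 * r * cmod (cinner \<xi> (x \<eta>)) + r\<^sup>2 * Re (cinner \<eta> (x \<eta>))"
    using positive_op_nonneg(1)[OF x, of "\<xi> + (complex_of_real r * c) *\<^sub>C \<eta>"] by (simp add: s_def)
qed (rule positive_op_nonneg(1)[OF x])

lemma positive_op_eq_0: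
  assumes x: "positive_op x" and "Re (cinner \<eta> (x \<eta>)) = 0"
  shows "x \<eta> = 0"
proof -
  have "(cmod (cinner (x \<eta>) (x \<eta>)))\<^sup>2 \<le> 0"
    using positive_op_Cauchy_Schwarz[OF x, of "x \<eta>" \<eta>] assms(2) by simp
  then show ?thesis by (simp add: cinner_self norm_power del: of_real_power)
qed

text \<open>Taylor coefficients of (1 - sqrt (1 - x)) / x, that is, Catalan numbers divided by
  2^{2n+1}.\<close>

fun sqrt_coeff :: "nat \<Rightarrow> real" where
  "sqrt_coeff 0 = 1/2"
| "sqrt_coeff (Suc n) = (\<Sum>i\<le>n. sqrt_coeff i * sqrt_coeff (n - i)) / 2"

lemma sqrt_coeff_nonneg: "sqrt_coeff n \<ge> 0"
  by (induction n rule: sqrt_coeff.induct) (auto intro!: sum_nonneg mult_nonneg_nonneg)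

text \<open>Bounding the triangle of index pairs by the full square gives s_{N+1} <= (1 + s_N^2) /
  2, and this map preserves the bound 1.\<close>

lemma sum_sqrt_coeff_le: "(\<Sum>n<N. sqrt_coeff n) \<le> 1"
proof (induction N)
  case (Suc N)
  have "(\<Sum>n<Suc N. sqrt_coeff n) = 1/2 + (\<Sum>n<N. \<Sum>i\<le>n. sqrt_coeff i * sqrt_coeff (n - i)) / 2"
    by (subst sum.lessThan_Suc_shift) (simp add: sum_divide_distrib)
  also have "(\<Sum>n<N. \<Sum>i\<le>n. sqrt_coeff i * sqrt_coeff (n - i)) = (\<Sum>(i,j)\<in>{(i, j). i + j < N}. sqrt_coeff i * sqrt_coeff j)"
    by (rule sum.triangle_reindex[symmetric])
  also have "\<dots> \<le> (\<Sum>(i,j)\<in>{..<N} \<times> {..<N}. sqrt_coeff i * sqrt_coeff j)"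
    by (rule sum_mono2) (auto simp: sqrt_coeff_nonneg)
  also have "\<dots> = (\<Sum>n<N. sqrt_coeff n) * (\<Sum>n<N. sqrt_coeff n)"
    by (simp add: sum_product sum.cartesian_product)
  also have "\<dots> \<le> 1 * 1"
    using Suc by (intro mult_mono) (auto simp: sqrt_coeff_nonneg sum_nonneg)
  finally show ?case by simp
qed simp

lemma summable_sqrt_coeff: "summable sqrt_coeff"
  using sum_sqrt_coeff_le sqrt_coeff_nonneg by (intro summableI_nonneg_bounded[of _ 1]) auto

text \<open>
  With \<open>P = 1 - x\<close> and \<open>Y = \<Sum>\<^sub>n d\<^sub>n P\<^sup>n\<close>, the recursion for \<open>d\<^sub>n\<close> says \<open>2 Y = 1 + P Y\<^sup>2\<close>, so that
  \<open>(1 - P Y)\<^sup>2 = 1 - P\<close>.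
\<close>

lemma ex_sqrt_contraction:
  fixes x :: "'d::finite op"
  assumes x: "positive_op x" and le1: "\<And>\<xi>. Re (cinner \<xi> (x \<xi>)) \<le> (norm \<xi>)\<^sup>2"
  shows "\<exists>b. positive_op b \<and> b o\<^sub>L b = x \<and> (\<forall>w. w o\<^sub>L x = x o\<^sub>L w \<longrightarrow> w o\<^sub>L b = b o\<^sub>L w)"
proof -
  define P where "P = id_blinfun - x"
  have PB: "P \<in> BH" using positive_op_BH[OF x] by (simp add: P_def)
  have Pap: "P \<xi> = \<xi> - x \<xi>" for \<xi> by (simp add: P_def minus_blinfun.rep_eq)
  have Ppos: "positive_op P"
    by (rule positive_opI[OF PB])
      (use le1 positive_op_nonneg(2)[OF x] in \<open>simp_all add: Pap cinner_diff_right cinner_self del: of_real_power\<close>)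
  have Ple: "Re (cinner \<xi> (P \<xi>)) \<le> (norm \<xi>)\<^sup>2" for \<xi>
    using positive_op_nonneg(1)[OF x, of \<xi>] by (simp add: Pap cinner_diff_right cinner_self del: of_real_power)
  \<comment> \<open>The operator norm bound follows from 0 <= P <= 1 as forms, by Cauchy-Schwarz for
    the form of P at \<xi> and P \<xi>.\<close>
  have nP: "norm (P \<xi>) \<le> norm \<xi>" for \<xi>
  proof (cases "P \<xi> = 0")
    case False
    have "cinner \<xi> (P (P \<xi>)) = cinner (P \<xi>) (P \<xi>)" by (rule positive_op_hermitian[OF Ppos, symmetric])
    then have "((norm (P \<xi>))\<^sup>2)\<^sup>2 = (cmod (cinner \<xi> (P (P \<xi>))))\<^sup>2"
      by (simp add: cinner_self norm_power)
    also have "\<dots> \<le> Re (cinner \<xi> (P \<xi>)) * Re (cinner (P \<xi>) (P (P \<xi>)))" by (rule positive_op_Cauchy_Schwarz[OF Ppos])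
    also have "\<dots> \<le> (norm \<xi>)\<^sup>2 * (norm (P \<xi>))\<^sup>2"
      by (intro mult_mono Ple positive_op_nonneg(1)[OF Ppos]) auto
    finally have "(norm (P \<xi>))\<^sup>2 \<le> (norm \<xi>)\<^sup>2" using False by (simp add: power2_eq_square)
    then show ?thesis by (rule power2_le_imp_le) simp
  qed simp
  let ?d = sqrt_coeff
  define p where "p n \<xi> = (blinfun_apply P ^^ n) \<xi>" for n \<xi>
  have pS: "p (Suc n) \<xi> = P (p n \<xi>)" and pS': "p (Suc n) \<xi> = p n (P \<xi>)" for n \<xi>
    by (simp_all add: p_def funpow_swap1)
  have p0: "p 0 \<xi> = \<xi>" for \<xi> by (simp add: p_def)
  have np: "norm (p n \<xi>) \<le> norm \<xi>" for n \<xi>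
    by (induction n) (auto simp: p0 pS intro: order_trans[OF nP])
  have padd: "p n (\<xi> + \<eta>) = p n \<xi> + p n \<eta>" for n \<xi> \<eta>
    by (induction n) (auto simp: p0 pS blinfun.add_right)
  have psc: "p n (c *\<^sub>C \<xi>) = c *\<^sub>C p n \<xi>" for n \<xi> c
    by (induction n) (auto simp: p0 pS BH_scaleC[OF PB])
  have pherm: "cinner (p i u) (p j v) = cinner u (p (i + j) v)" for i j u v
  proof (induction i arbitrary: u)
    case (Suc i)
    have "cinner (p (Suc i) u) (p j v) = cinner (P u) (p (i + j) v)" unfolding pS' by (rule Suc)
    also have "\<dots> = cinner u (P (p (i + j) v))" by (rule positive_op_hermitian[OF Ppos])
    finally show ?case by (simp add: pS)
  qed (simp add: p0)
  have sn: "summable (\<lambda>n. norm (?d n *\<^sub>R p n \<xi>))" for \<xi>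
    by (rule summable_comparison_test[OF _ summable_mult2[OF summable_sqrt_coeff, of "norm \<xi>"]], intro exI[of _ 0])
      (auto simp: sqrt_coeff_nonneg intro!: mult_left_mono np)
  define Yf where "Yf \<xi> = (\<Sum>n. ?d n *\<^sub>R p n \<xi>)" for \<xi>
  have Ys: "(\<lambda>n. ?d n *\<^sub>R p n \<xi>) sums Yf \<xi>" for \<xi>
    unfolding Yf_def by (rule summable_sums[OF summable_norm_cancel[OF sn]])
  have Yadd: "Yf (\<xi> + \<eta>) = Yf \<xi> + Yf \<eta>" for \<xi> \<eta>
    using sums_unique2[OF Ys[of "\<xi> + \<eta>"]] sums_add[OF Ys[of \<xi>] Ys[of \<eta>]] by (simp add: padd scaleR_add_right)
  have Ysc: "Yf (c *\<^sub>C \<xi>) = c *\<^sub>C Yf \<xi>" for \<xi> c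
    using sums_unique2[OF Ys[of "c *\<^sub>C \<xi>"]] bounded_linear.sums[OF bounded_linear_scaleC[of c] Ys[of \<xi>]]
    by (simp add: psc scaleR_scaleC_commute)
  have nY: "norm (Yf \<xi>) \<le> norm \<xi>" for \<xi>
  proof -
    have "norm (Yf \<xi>) \<le> (\<Sum>n. ?d n * norm \<xi>)"
      unfolding Yf_def by (rule norm_suminf_le[OF _ summable_mult2[OF summable_sqrt_coeff]])
        (auto simp: sqrt_coeff_nonneg intro!: mult_left_mono np)
    also have "\<dots> = (\<Sum>n. ?d n) * norm \<xi>" by (rule suminf_mult2[symmetric, OF summable_sqrt_coeff])
    also have "\<dots> \<le> 1 * norm \<xi>"
      by (intro mult_right_mono suminf_le_const[OF summable_sqrt_coeff] sum_sqrt_coeff_le) auto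
    finally show ?thesis by simp
  qed
  have blY: "bounded_linear Yf"
    by (rule bounded_linear_intro[where K = 1]) (use Yadd nY in \<open>auto simp: scaleR_scaleC Ysc\<close>)
  define Y where "Y = Blinfun Yf"
  have Yap: "blinfun_apply Y = Yf" unfolding Y_def by (rule bounded_linear_Blinfun_apply[OF blY])
  have YB: "Y \<in> BH" by (simp add: BH_def Yap Ysc)
  have Yw: "(\<lambda>n. complex_of_real (?d n) * cinner u (p n v)) sums cinner u (Y v)" for u v
    using bounded_linear.sums[OF bounded_bilinear.bounded_linear_right[OF bounded_bilinear_cinner] Ys[of v], of u]
    by (simp add: Yap)
  have Yherm: "cinner (Y u) v = cinner u (Y v)" for u v
  proof -
    have "(\<lambda>n. complex_of_real (?d n) * cinner (p n u) v) sums cinner (Y u) v"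
      using bounded_linear.sums[OF bounded_bilinear.bounded_linear_left[OF bounded_bilinear_cinner] Ys[of u], of v]
      by (simp add: Yap)
    moreover have "cinner (p n u) v = cinner u (p n v)" for n using pherm[of n u 0 v] by (simp add: p0)
    ultimately show ?thesis using Yw[of u v] sums_unique2 by simp
  qed
  \<comment> \<open>Whatever commutes with x commutes with every term of the series, hence with Y.
    Uniqueness of the root relies on this.\<close>
  have Ycomm: "w (Y \<xi>) = Y (w \<xi>)" if w: "w o\<^sub>L x = x o\<^sub>L w" for w :: "'d op" and \<xi>
  proof -
    have wx: "w (x \<eta>) = x (w \<eta>)" for \<eta> using w by (metis blinfun_apply_blinfun_compose)
    have "w (p n \<eta>) = p n (w \<eta>)" for n \<eta>
      by (induction n) (auto simp: p0 pS Pap blinfun.diff_right wx)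
    then have "(\<lambda>n. ?d n *\<^sub>R p n (w \<xi>)) sums w (Y \<xi>)"
      using bounded_linear.sums[OF blinfun.bounded_linear_right Ys[of \<xi>], of w] by (simp add: Yap blinfun.scaleR_right)
    from sums_unique2[OF this Ys] show ?thesis by (simp add: Yap)
  qed
  have PY: "P (Y \<xi>) = Y (P \<xi>)" for \<xi>
    by (rule Ycomm) (auto intro!: blinfun_eqI simp: Pap blinfun.diff_right)
  have Yeq: "2 * cinner u (Y v) = cinner u v + cinner u (P (Y (Y v)))" for u v
  proof -
    have Y2: "(\<lambda>n. complex_of_real (\<Sum>i\<le>n. ?d i * ?d (n - i)) * cinner u (p n v)) sums cinner u (Y (Y v))" for u
    proof -
      have "(\<lambda>n. \<Sum>i\<le>n. cinner (?d i *\<^sub>R p i u) (?d (n - i) *\<^sub>R p (n - i) v)) sums cinner (Y u) (Y v)"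
        unfolding Yap Yf_def by (rule cinner_suminf_Cauchy[OF sn sn])
      then show ?thesis unfolding Yherm by (simp add: pherm sum_distrib_left sum_distrib_right mult_ac)
    qed
    have "(\<lambda>n. complex_of_real (?d (Suc n)) * cinner u (p (Suc n) v)) sums (cinner u (Y v) - complex_of_real (?d 0) * cinner u (p 0 v))"
      using Yw[of u v] by (subst sums_Suc_iff) simp
    then have s2: "(\<lambda>n. 2 * (complex_of_real (?d (Suc n)) * cinner u (p (Suc n) v))) sums (2 * (cinner u (Y v) - complex_of_real (?d 0) * cinner u (p 0 v)))"
      by (rule sums_mult)
    have e: "2 * (complex_of_real (?d (Suc n)) * cinner u (p (Suc n) v)) = complex_of_real (\<Sum>i\<le>n. ?d i * ?d (n - i)) * cinner (P u) (p n v)" for n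
      by (simp add: pS positive_op_hermitian[OF Ppos])
    have "2 * (cinner u (Y v) - complex_of_real (?d 0) * cinner u (p 0 v)) = cinner (P u) (Y (Y v))"
      by (rule sums_unique2[OF s2[unfolded e] Y2])
    then show ?thesis by (simp add: p0 positive_op_hermitian[OF Ppos] algebra_simps)
  qed
  define b where "b = id_blinfun - (P o\<^sub>L Y)"
  have bap: "b \<xi> = \<xi> - P (Y \<xi>)" for \<xi> by (simp add: b_def minus_blinfun.rep_eq)
  have bB: "b \<in> BH" by (simp add: b_def PB YB)
  have bpos: "positive_op b"
  proof (rule positive_opI[OF bB])
    fix \<xi>
    have "Re (cinner \<xi> (P (Y \<xi>))) \<le> norm \<xi> * norm (P (Y \<xi>))" by (rule order_trans[OF complex_Re_le_cmod cmod_cinner_le])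
    also have "\<dots> \<le> norm \<xi> * norm \<xi>"
      using nP[of "Y \<xi>"] nY[of \<xi>] by (intro mult_left_mono) (auto simp: Yap)
    finally show "Re (cinner \<xi> (b \<xi>)) \<ge> 0"
      by (simp add: bap cinner_diff_right cinner_self power2_eq_square)
    have "cinner \<xi> (P (Y \<xi>)) = cnj (cinner \<xi> (P (Y \<xi>)))"
      using cinner_commute[of \<xi> "P (Y \<xi>)"] by (simp add: positive_op_hermitian[OF Ppos] Yherm PY)
    then have "Im (cinner \<xi> (P (Y \<xi>))) = - Im (cinner \<xi> (P (Y \<xi>)))" by (metis cnj.sel(2))
    then show "Im (cinner \<xi> (b \<xi>)) = 0" by (simp add: bap cinner_diff_right cinner_self)
  qed
  have "b o\<^sub>L b = x"
  proof (rule blinfun_eqI_D)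
    fix u v
    have "cinner u (b (b v)) = cinner u v - (2 * cinner u (P (Y v)) - cinner u (P (Y (P (Y v)))))"
      by (simp add: bap cinner_diff_right cinner_add_right blinfun.diff_right algebra_simps)
    also have "2 * cinner u (P (Y v)) = 2 * cinner (P u) (Y v)" by (simp add: positive_op_hermitian[OF Ppos])
    also have "\<dots> = cinner u (P v) + cinner u (P (P (Y (Y v))))" using Yeq[of "P u" v] by (simp only: positive_op_hermitian[OF Ppos])
    finally show "cinner u ((b o\<^sub>L b) v) = cinner u (x v)"
      unfolding PY[of "Y v", symmetric] by (simp add: Pap[of v] cinner_diff_right)
  qed
  moreover have "w o\<^sub>L b = b o\<^sub>L w" if w: "w o\<^sub>L x = x o\<^sub>L w" for w
  proof (rule blinfun_eqI)
    fix \<xi>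
    have wx: "w (x \<eta>) = x (w \<eta>)" for \<eta> using w by (metis blinfun_apply_blinfun_compose)
    show "(w o\<^sub>L b) \<xi> = (b o\<^sub>L w) \<xi>" by (simp add: bap Pap blinfun.diff_right wx Ycomm[OF w])
  qed
  ultimately show ?thesis using bpos by blast
qed

text \<open>With \<eta> = (b - c) \<xi>, the identity (b + c)(b - c) = 0 makes the nonnegative forms
  of b and c vanish at \<eta>. So b \<eta> = c \<eta> = 0, and the squared norm of \<eta> is <(b -
  c) \<eta>, \<xi>> = 0.\<close>

lemma positive_sqrt_unique_commuting:
  assumes b: "positive_op b" and c: "positive_op c" and eq: "b o\<^sub>L b = c o\<^sub>L c" and comm: "c o\<^sub>L b = b o\<^sub>L c"
  shows "b = c"
proof (rule blinfun_eqI)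
  fix \<xi>
  define \<eta> where "\<eta> = b \<xi> - c \<xi>"
  have bb: "b (b \<xi>) = c (c \<xi>)" "c (b \<xi>) = b (c \<xi>)"
    using arg_cong[OF eq, of "\<lambda>x. blinfun_apply x \<xi>"] arg_cong[OF comm, of "\<lambda>x. blinfun_apply x \<xi>"] by simp_all
  have "b \<eta> + c \<eta> = 0" by (simp add: \<eta>_def blinfun.diff_right bb)
  then have "Re (cinner \<eta> (b \<eta>)) + Re (cinner \<eta> (c \<eta>)) = 0"
    by (metis cinner_add_right cinner_zero(2) plus_complex.sel(1) zero_complex.sel(1))
  then have "Re (cinner \<eta> (b \<eta>)) = 0" "Re (cinner \<eta> (c \<eta>)) = 0"
    using positive_op_nonneg(1)[OF b, of \<eta>] positive_op_nonneg(1)[OF c, of \<eta>] by linarith+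
  then have z: "b \<eta> = 0" "c \<eta> = 0" using positive_op_eq_0 b c by blast+
  have "cinner \<eta> \<eta> = cinner (b \<eta>) \<xi> - cinner (c \<eta>) \<xi>"
    unfolding positive_op_hermitian[OF b] positive_op_hermitian[OF c] by (simp add: \<eta>_def cinner_diff_right)
  then have "\<eta> = 0" using z by (simp add: cinner_self)
  then show "b \<xi> = c \<xi>" by (simp add: \<eta>_def)
qed

lemma positive_op_scaleR:
  assumes "positive_op x" "r \<ge> 0"
  shows "positive_op (r *\<^sub>R x)"
  using assms positive_op_BH[OF assms(1)]
  by (intro positive_opI) (auto simp: BH_def scaleR_blinfun.rep_eq scaleR_scaleC_commute positive_op_nonneg)

text \<open>The power series root is applied to x / K, which is at most 1. Any other positive root c
  commutes with x = c c, hence with the constructed root, and commuting positive roots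
  coincide.\<close>

lemma sqrt_op:
  fixes x :: "'d::finite op"
  assumes x: "positive_op x"
  shows "positive_op (sqrt_op x)" "sqrt_op x o\<^sub>L sqrt_op x = x"
proof -
  define K where "K = norm x + 1"
  have K: "K > 0" by (simp add: K_def add_nonneg_pos)
  define a where "a = (1 / K) *\<^sub>R x"
  have xa: "x = K *\<^sub>R a" using K by (simp add: a_def)
  have apos: "positive_op a" unfolding a_def using x K by (intro positive_op_scaleR) auto
  have ale: "Re (cinner \<xi> (a \<xi>)) \<le> (norm \<xi>)\<^sup>2" for \<xi>
  proof -
    have "Re (cinner \<xi> (x \<xi>)) \<le> norm \<xi> * (norm x * norm \<xi>)"
      by (rule order_trans[OF complex_Re_le_cmod order_trans[OF cmod_cinner_le mult_left_mono[OF norm_blinfun]]]) simp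
    also have "\<dots> \<le> norm \<xi> * (K * norm \<xi>)" by (intro mult_left_mono mult_right_mono) (auto simp: K_def)
    finally show ?thesis using K by (simp add: a_def scaleR_blinfun.rep_eq field_simps power2_eq_square)
  qed
  obtain b where b: "positive_op b" "b o\<^sub>L b = a" "\<And>w. w o\<^sub>L a = a o\<^sub>L w \<Longrightarrow> w o\<^sub>L b = b o\<^sub>L w"
    using ex_sqrt_contraction[OF apos ale] by blast
  have sc: "(r *\<^sub>R p) o\<^sub>L (s *\<^sub>R q) = (r * s) *\<^sub>R (p o\<^sub>L q)" for r s and p q :: "'d op"
    by (rule blinfun_eqI) (simp add: scaleR_blinfun.rep_eq blinfun.scaleR_right)
  define y where "y = sqrt K *\<^sub>R b"
  have y: "positive_op y" "y o\<^sub>L y = x" unfolding y_def using b(1,2) K by (simp_all add: positive_op_scaleR sc xa)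
  have "sqrt_op x = y"
    unfolding sqrt_op_def
  proof (rule the_equality)
    fix c assume c: "positive_op c \<and> c o\<^sub>L c = x"
    then have xc: "x = c o\<^sub>L c" by simp
    have "c o\<^sub>L x = x o\<^sub>L c" unfolding xc by (rule blinfun_eqI) simp
    then have "c o\<^sub>L a = a o\<^sub>L c" using sc[of 1 c "1/K" x] sc[of "1/K" x 1 c] by (simp add: a_def)
    then have "c o\<^sub>L b = b o\<^sub>L c" by (rule b(3))
    then have "c o\<^sub>L y = y o\<^sub>L c" using sc[of 1 c "sqrt K" b] sc[of "sqrt K" b 1 c] by (simp add: y_def)
    then show "c = y" using positive_sqrt_unique_commuting[of y c] y c by simp
  qed (use y in simp)
  then show "positive_op (sqrt_op x)" "sqrt_op x o\<^sub>L sqrt_op x = x" using y by auto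
qed

subsection \<open>The GNS form\<close>

lemma faithful_state_sqrt:
  fixes \<rho> :: "'d::finite op"
  assumes st: "state \<rho>" and f: "faithful \<rho>"
  defines "R \<equiv> sqrt_op \<rho>"
  shows "positive_op R" "\<And>\<xi>. R \<xi> = 0 \<Longrightarrow> \<xi> = 0" "((\<lambda>n. (norm (R (fock_e n)))\<^sup>2) has_sum 1) UNIV"
proof -
  have \<rho>: "positive_op \<rho>" "tr \<rho> = 1" using st by (auto simp: state_def)
  show R: "positive_op R" unfolding R_def by (rule sqrt_op(1)[OF \<rho>(1)])
  have RR: "R (R \<xi>) = \<rho> \<xi>" for \<xi>
    using arg_cong[OF sqrt_op(2)[OF \<rho>(1)], of "\<lambda>x. blinfun_apply x \<xi>"] by (simp add: R_def)
  show "\<xi> = 0" if "R \<xi> = 0" for \<xi>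
    using f RR[of \<xi>] that by (simp add: faithful_def)
  let ?f = "\<lambda>n. (norm (R (fock_e n)))\<^sup>2"
  have t: "(\<Sum>\<^sub>\<infinity>n. complex_of_real (?f n)) = 1"
  proof -
    have "cinner (fock_e n) (\<rho> (fock_e n)) = complex_of_real (?f n)" for n
      unfolding RR[symmetric] cinner_self[symmetric] by (rule positive_op_hermitian[OF R, symmetric])
    then show ?thesis using \<rho>(2) unfolding tr_def by simp
  qed
  \<comment> \<open>A family that is not summable has sum 0 by convention, so trace one entails
    summability.\<close>
  have "(\<lambda>n. complex_of_real (?f n)) summable_on UNIV"
    using infsum_not_exists[of "\<lambda>n. complex_of_real (?f n)" UNIV] t by fastforce
  then have "((\<lambda>n. complex_of_real (?f n)) has_sum 1) UNIV" using t by (simp add: has_sum_iff)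
  from has_sum_Re[OF this] show "(?f has_sum 1) UNIV" by simp
qed

lemma hs_inner_infsum:
  "x \<in> BH \<Longrightarrow> hs_inner x y = (\<Sum>\<^sub>\<infinity>n. cinner (x (fock_e n)) (y (fock_e n)))"
  unfolding hs_inner_def tr_def blinfun_apply_blinfun_compose by (simp only: adj_exists_right)

text \<open>With R the square root of \<rho>, this is the Hilbert-Schmidt product of x R and y R,
  the GNS form of \<rho>; pairing with the identity gives the mean of an operator.\<close>

definition gns :: "'d::finite op \<Rightarrow> 'd op \<Rightarrow> 'd op \<Rightarrow> complex"
  where "gns R x y = (\<Sum>\<^sub>\<infinity>n. cinner (x (R (fock_e n))) (y (R (fock_e n))))"

context
  fixes R :: "'d::finite op"
  assumes R: "((\<lambda>n. (norm (R (fock_e n)))\<^sup>2) has_sum 1) UNIV"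
begin

lemma gns_summable: "(\<lambda>n. cinner (blinfun_apply x (R (fock_e n))) (blinfun_apply y (R (fock_e n)))) summable_on UNIV"
proof (rule abs_summable_summable, rule summable_on_comparison_test)
  show "(\<lambda>n. norm x * norm y * (norm (R (fock_e n)))\<^sup>2) summable_on UNIV"
    by (rule summable_on_cmult_right[OF has_sum_imp_summable[OF R]])
  fix n
  have "cmod (cinner (x (R (fock_e n))) (y (R (fock_e n)))) \<le> norm (x (R (fock_e n))) * norm (y (R (fock_e n)))"
    by (rule cmod_cinner_le)
  also have "\<dots> \<le> (norm x * norm (R (fock_e n))) * (norm y * norm (R (fock_e n)))"
    by (intro mult_mono norm_blinfun) auto
  finally show "norm (cinner (x (R (fock_e n))) (y (R (fock_e n)))) \<le> norm x * norm y * (norm (R (fock_e n)))\<^sup>2"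
    by (simp add: power2_eq_square mult_ac)
qed auto

lemma gns_add_left: "gns R (x + x') y = gns R x y + gns R x' y"
  and gns_add_right: "gns R y (x + x') = gns R y x + gns R y x'"
  and gns_diff_left: "gns R (x - x') y = gns R x y - gns R x' y"
  and gns_diff_right: "gns R y (x - x') = gns R y x - gns R y x'"
proof -
  show "gns R (x + x') y = gns R x y + gns R x' y" "gns R y (x + x') = gns R y x + gns R y x'"
    unfolding gns_def plus_blinfun.rep_eq cinner_add_left cinner_add_right by (intro infsum_add gns_summable)+
  have d: "infsum (\<lambda>n. f n - g n) UNIV = infsum f UNIV - infsum g UNIV"
    if "f summable_on UNIV" "g summable_on UNIV" for f g :: "('d \<Rightarrow> nat) \<Rightarrow> complex"
    using infsum_add[OF that(1) summable_on_uminus[THEN iffD2, OF that(2)]] infsum_uminus[of g UNIV] by simp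
  show "gns R (x - x') y = gns R x y - gns R x' y" "gns R y (x - x') = gns R y x - gns R y x'"
    unfolding gns_def minus_blinfun.rep_eq cinner_diff_left cinner_diff_right by (intro d gns_summable)+
qed

lemma gns_scaleC_left: "gns R (scaleC_op c x) y = cnj c * gns R x y"
  and gns_scaleC_right: "gns R x (scaleC_op c y) = c * gns R x y"
  by (simp_all add: gns_def infsum_cmult_right')

lemma gns_0 [simp]: "gns R 0 y = 0" "gns R x 0 = 0"
  by (simp_all add: gns_def)

lemma gns_sum_left: "gns R (sum f A) y = (\<Sum>a\<in>A. gns R (f a) y)"
  by (induction A rule: infinite_finite_induct) (auto simp: gns_add_left)

lemma gns_sum_right: "gns R x (sum f A) = (\<Sum>a\<in>A. gns R x (f a))"
  by (induction A rule: infinite_finite_induct) (auto simp: gns_add_right)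

lemma gns_commute: "gns R x y = cnj (gns R y x)"
  unfolding gns_def infsum_cnj[symmetric] by (intro infsum_cong cinner_commute)

lemma gns_id [simp]: "gns R id_blinfun id_blinfun = 1"
proof -
  have "((\<lambda>n. complex_of_real ((norm (R (fock_e n)))\<^sup>2)) has_sum complex_of_real 1) UNIV"
    by (rule has_sum_of_real[OF R])
  then show ?thesis unfolding gns_def id_blinfun.rep_eq cinner_self by (simp add: has_sum_iff)
qed

lemma gns_self_summable: "(\<lambda>n. (norm (blinfun_apply (x :: 'd op) (R (fock_e n))))\<^sup>2) summable_on UNIV"
  using summable_on_Re[OF gns_summable[of x x]] by (simp add: cinner_self del: of_real_power)

lemma gns_self_infsum: "Re (gns R x x) = (\<Sum>\<^sub>\<infinity>n. (norm (blinfun_apply (x :: 'd op) (R (fock_e n))))\<^sup>2)"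
  unfolding gns_def infsum_Re[OF gns_summable, symmetric] by (simp add: cinner_self del: of_real_power)

lemma gns_self_nonneg: "Re (gns R x x) \<ge> 0" "Im (gns R x x) = 0"
proof -
  show "Re (gns R x x) \<ge> 0" unfolding gns_self_infsum by (rule infsum_nonneg) simp
  show "Im (gns R x x) = 0" using arg_cong[OF gns_commute[of x x], of Im] by simp
qed

lemma gns_self_ge: "(norm (blinfun_apply (x :: 'd op) (R (fock_e n))))\<^sup>2 \<le> Re (gns R x x)"
  unfolding gns_self_infsum using finite_sum_le_infsum[OF gns_self_summable, of "{n}"] by simp

text \<open>Variance equals second moment minus squared modulus of the mean.\<close>

lemma gns_centred:
  defines "b x \<equiv> gns R id_blinfun x"
  shows "Re (gns R (x - scaleC_op (b x) id_blinfun) (x - scaleC_op (b x) id_blinfun)) = Re (gns R x x) - (cmod (b x))\<^sup>2"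
proof -
  have "gns R (x - scaleC_op (b x) id_blinfun) (x - scaleC_op (b x) id_blinfun)
    = gns R x x - b x * cnj (b x)"
    unfolding gns_diff_left gns_diff_right gns_scaleC_left gns_scaleC_right
    using gns_commute[of x id_blinfun] by (simp add: b_def mult.commute)
  then show ?thesis by (simp add: cnj_mult_self)
qed

lemma gns_mean_le: "(cmod (gns R id_blinfun x))\<^sup>2 \<le> Re (gns R x x)"
  using gns_centred[of x] gns_self_nonneg(1)[of "x - scaleC_op (gns R id_blinfun x) id_blinfun"] by linarith

end

lemma gns_gap:
  fixes \<rho> :: "'d::finite op"
  assumes st: "state \<rho>" and f: "faithful \<rho>" and qms: "quantum_markov_semigroup T"
    and S: "gns_semigroup T \<rho> S" and gap: "gap_inequality \<rho> S g" and t: "t > 0" and Y: "Y \<in> BH"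
  defines "R \<equiv> sqrt_op \<rho>"
  shows "Re (gns R (T t Y - scaleC_op (gns R id_blinfun Y) id_blinfun) (T t Y - scaleC_op (gns R id_blinfun Y) id_blinfun))
    \<le> exp (- 2 * g * t) * Re (gns R (Y - scaleC_op (gns R id_blinfun Y) id_blinfun) (Y - scaleC_op (gns R id_blinfun Y) id_blinfun))"
proof -
  note Rp = faithful_state_sqrt[OF st f, folded R_def]
  note RB = positive_op_BH[OF Rp(1)]
  let ?b = "gns R id_blinfun Y"
  have TB: "T t Y \<in> BH" using qms t Y by (auto simp: quantum_markov_semigroup_def linear_on_ops_def image_subset_iff)
  have hs: "Y o\<^sub>L R \<in> hilbert_schmidt"
    using gns_self_summable[OF Rp(3), of Y] by (simp add: hilbert_schmidt_def Y RB)
  have b: "hs_inner (sqrt_op \<rho>) (Y o\<^sub>L R) = ?b"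
    unfolding R_def[symmetric] hs_inner_infsum[OF RB] gns_def by simp
  have St: "S t (Y o\<^sub>L R) = T t Y o\<^sub>L R" using S t Y by (simp add: gns_semigroup_def R_def)
  have e: "hs_norm ((X o\<^sub>L R) - scaleC_op c R) = sqrt (Re (gns R (X - scaleC_op c id_blinfun) (X - scaleC_op c id_blinfun)))"
    if "X \<in> BH" for X c
  proof -
    have "(X o\<^sub>L R) - scaleC_op c R = (X - scaleC_op c id_blinfun) o\<^sub>L R"
      by (rule blinfun_eqI) (simp add: minus_blinfun.rep_eq)
    moreover have "(X - scaleC_op c id_blinfun) o\<^sub>L R \<in> BH" using that RB by simp
    ultimately show ?thesis by (simp add: hs_norm_def hs_inner_infsum gns_def)
  qed
  have "hs_norm (S t (Y o\<^sub>L R) - scaleC_op ?b R) \<le> exp (- g * t) * hs_norm ((Y o\<^sub>L R) - scaleC_op ?b R)"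
    using gap hs t b unfolding gap_inequality_def R_def[symmetric] by metis
  then have "(sqrt (Re (gns R (T t Y - scaleC_op ?b id_blinfun) (T t Y - scaleC_op ?b id_blinfun))))\<^sup>2
    \<le> (exp (- g * t) * sqrt (Re (gns R (Y - scaleC_op ?b id_blinfun) (Y - scaleC_op ?b id_blinfun))))\<^sup>2"
    unfolding St e[OF TB] e[OF Y] by (intro power_mono) (auto simp: gns_self_nonneg[OF Rp(3)])
  moreover have "(exp (- g * t))\<^sup>2 = exp (- 2 * g * t)" by (simp add: power2_eq_square exp_add[symmetric])
  ultimately show ?thesis
    by (simp add: power_mult_distrib gns_self_nonneg[OF Rp(3)])
qed

text \<open>By the gap the mean of T_{k+r} X tends to the mean of X as k grows. For X = Y, r = s and
  for X = T_s Y, r = 0 the sequences are the same, so the two limits agree.\<close>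

lemma gns_invariant:
  fixes \<rho> :: "'d::finite op"
  assumes st: "state \<rho>" and f: "faithful \<rho>" and qms: "quantum_markov_semigroup T"
    and S: "gns_semigroup T \<rho> S" and gap: "gap_inequality \<rho> S g" and g: "g > 0" and s: "s \<ge> 0" and Y: "Y \<in> BH"
  defines "R \<equiv> sqrt_op \<rho>"
  shows "gns R id_blinfun (T s Y) = gns R id_blinfun Y"
proof -
  note Rp = faithful_state_sqrt[OF st f, folded R_def]
  let ?m = "gns R id_blinfun"
  have TB: "T t X \<in> BH" if "t \<ge> 0" "X \<in> BH" for t X
    using qms that by (auto simp: quantum_markov_semigroup_def linear_on_ops_def image_subset_iff)
  have lim: "(\<lambda>k. ?m (T (real k + r) X)) \<longlonglongrightarrow> ?m X" if r: "r \<ge> 0" and X: "X \<in> BH" for r X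
  proof (rule LIM_zero_cancel, rule Lim_null_comparison)
    let ?C = "Re (gns R (X - scaleC_op (?m X) id_blinfun) (X - scaleC_op (?m X) id_blinfun))"
    have C0: "?C \<ge> 0" by (rule gns_self_nonneg[OF Rp(3)])
    show "\<forall>\<^sub>F k in sequentially. norm (?m (T (real k + r) X) - ?m X) \<le> exp (- g * real k) * sqrt ?C"
      unfolding eventually_sequentially
    \<comment> \<open>The gap inequality speaks about strictly positive times, so k = 0 is left
      out.\<close>
    proof (intro exI[of _ 1] allI impI)
      fix k :: nat assume k: "1 \<le> k"
      have "(cmod (?m (T (real k + r) X - scaleC_op (?m X) id_blinfun)))\<^sup>2 \<le> exp (- 2 * g * (real k + r)) * ?C"
        using order_trans[OF gns_mean_le[OF Rp(3)] gns_gap[OF st f qms S gap _ X, of "real k + r", folded R_def]] k r by simp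
      also have "\<dots> \<le> exp (- 2 * g * real k) * ?C"
        using g r by (intro mult_right_mono C0) (simp add: algebra_simps)
      also have "\<dots> = (exp (- g * real k) * sqrt ?C)\<^sup>2"
        using C0 by (simp add: power_mult_distrib) (simp add: power2_eq_square exp_add[symmetric])
      finally have "cmod (?m (T (real k + r) X - scaleC_op (?m X) id_blinfun)) \<le> exp (- g * real k) * sqrt ?C"
        by (rule power2_le_imp_le) (simp add: C0)
      then show "norm (?m (T (real k + r) X) - ?m X) \<le> exp (- g * real k) * sqrt ?C"
        by (simp add: gns_diff_right[OF Rp(3)] gns_scaleC_right[OF Rp(3)] gns_id[OF Rp(3)])
    qed
    have "(\<lambda>k. exp (- g) ^ k * sqrt ?C) \<longlonglongrightarrow> 0"
      by (intro tendsto_mult_left_zero LIMSEQ_realpow_zero) (use g in auto)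
    then show "(\<lambda>k. exp (- g * real k) * sqrt ?C) \<longlonglongrightarrow> 0"
      by (simp add: exp_of_nat_mult[symmetric] mult.commute)
  qed
  have "T (real k) (T s Y) = T (real k + s) Y" for k
    using qms s Y by (simp add: quantum_markov_semigroup_def weak_star_semigroup_def)
  then have "(\<lambda>k. ?m (T (real k) (T s Y))) \<longlonglongrightarrow> ?m Y" using lim[OF s Y] by simp
  moreover have "(\<lambda>k. ?m (T (real k) (T s Y))) \<longlonglongrightarrow> ?m (T s Y)"
    using lim[OF order_refl TB[OF s Y]] by simp
  ultimately have "?m Y = ?m (T s Y)" by (rule LIMSEQ_unique)
  then show ?thesis by (rule sym)
qed

subsection \<open>The characteristic function of the invariant state\<close>

text \<open>A three-epsilon argument: continuity is known on truncations, and W(h) is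
  isometric.\<close>

lemma weyl_strongly_continuous: "((\<lambda>h. weyl h \<xi>) \<longlongrightarrow> \<xi>) (at 0)"
proof (rule tendstoI)
  fix e :: real assume e: "0 < e"
  obtain K where K: "norm (trunc K \<xi> - \<xi>) < e/3"
    using metric_LIMSEQ_D[OF trunc_tendsto, of "e/3" \<xi>] e by (auto simp: dist_norm)
  have "((\<lambda>h. weyl h (trunc K \<xi>)) \<longlongrightarrow> weyl 0 (trunc K \<xi>)) (at 0)"
    using has_derivative_continuous[OF weyl_has_derivative_0[OF trunc_in_D]] by (simp add: continuous_within)
  then have "\<forall>\<^sub>F h in at 0. dist (weyl h (trunc K \<xi>)) (trunc K \<xi>) < e/3"
    by (intro tendstoD) (use e in auto)
  then show "\<forall>\<^sub>F h in at 0. dist (weyl h \<xi>) \<xi> < e"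
  proof (rule eventually_mono)
    fix h :: "complex^'a" assume h: "dist (weyl h (trunc K \<xi>)) (trunc K \<xi>) < e/3"
    have "weyl h \<xi> - \<xi> = (weyl h (trunc K \<xi>) - trunc K \<xi>) - weyl h (trunc K \<xi> - \<xi>) + (trunc K \<xi> - \<xi>)"
      by (simp add: blinfun.diff_right)
    also have "norm \<dots> \<le> norm (weyl h (trunc K \<xi>) - trunc K \<xi>) + norm (weyl h (trunc K \<xi> - \<xi>)) + norm (trunc K \<xi> - \<xi>)"
      by (rule norm_triangle_le[OF add_right_mono[OF norm_triangle_ineq4]])
    finally show "dist (weyl h \<xi>) \<xi> < e" using h K by (simp add: dist_norm)
  qed
qed

definition iunit :: "complex^'d \<Rightarrow> complex^'d"
  where "iunit z = (\<chi> j. \<i> * z $ j)"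

lemma hip_iunit_pos: "z \<noteq> 0 \<Longrightarrow> \<exists>r>0. hip z (iunit z) = \<i> * complex_of_real r"
proof -
  assume "z \<noteq> 0"
  then obtain j where j: "z $ j \<noteq> 0" by (auto simp: vec_eq_iff)
  let ?r = "\<Sum>j\<in>UNIV. (cmod (z $ j))\<^sup>2"
  have "hip z (iunit z) = \<i> * complex_of_real ?r"
    unfolding hip_def iunit_def of_real_sum sum_distrib_left
    by (rule sum.cong) (simp_all add: cnj_mult_self[symmetric] del: of_real_power)
  moreover have "?r > 0" by (rule sum_pos2[of _ j]) (use j in auto)
  ultimately show ?thesis by blast
qed

text \<open>For nonzero z a suitable multiple w of i z has Im <z, w> = pi/2; then W(z) and W(w)
  anticommute, which is impossible for a nonzero scalar W(z).\<close>

lemma weyl_scalar_imp_0: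
  assumes "\<And>u. weyl z u = c *\<^sub>C (u :: 'd::finite fock)"
  shows "z = 0"
proof (rule ccontr)
  assume "z \<noteq> 0"
  then obtain r where r: "r > 0" "hip z (iunit z) = \<i> * complex_of_real r" using hip_iunit_pos by blast
  define w where "w = (pi / (2 * r)) *\<^sub>R iunit z"
  have zw: "Im (hip z w) = pi / 2" using r by (simp add: w_def)
  have wz: "Im (hip w z) = - (pi / 2)" using hip_commute[of w z] zw by simp
  let ?e = "fock_e (\<lambda>_. 0) :: 'd fock"
  have "weyl z (weyl w ?e) = weyl w (weyl z ?e)" by (simp add: assms weyl_scaleC)
  then have "exp (- \<i> * Im (hip z w)) *\<^sub>C weyl (z + w) ?e = exp (- \<i> * Im (hip w z)) *\<^sub>C weyl (z + w) ?e"
    by (simp only: weyl_weyl add.commute)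
  then have "(exp (- \<i> * Im (hip z w)) - exp (- \<i> * Im (hip w z))) *\<^sub>C weyl (z + w) ?e = 0"
    by (simp add: scaleC_diff_left)
  then have "norm ((exp (- \<i> * Im (hip z w)) - exp (- \<i> * Im (hip w z))) *\<^sub>C weyl (z + w) ?e) = 0" by simp
  then have "exp (- \<i> * Im (hip z w)) = exp (- \<i> * Im (hip w z))" by simp
  then have "exp (- (\<i> * complex_of_real (pi/2))) = exp (\<i> * complex_of_real (pi/2))" by (simp add: zw wz)
  moreover have "exp (\<i> * complex_of_real (pi/2)) = \<i>" using cis_pi_half by (simp add: cis_conv_exp)
  moreover have "exp (- (\<i> * complex_of_real (pi/2))) = - \<i>" using \<open>exp (\<i> * complex_of_real (pi/2)) = \<i>\<close> by (simp add: exp_minus)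
  ultimately show False by (simp add: complex_eq_iff)
qed

text \<open>The characteristic function of \<rho> in the symmetric form tr (R W(z) R), with R the
  square root of \<rho>.\<close>

definition charf :: "'d::finite op \<Rightarrow> complex^'d \<Rightarrow> complex"
  where "charf R z = gns R id_blinfun (weyl z)"

lemma gns_weyl: "gns R (weyl z) (weyl w) = exp (\<i> * Im (hip z w)) * charf R (w - z)"
proof -
  have "cinner (weyl z u) (weyl w u) = exp (\<i> * Im (hip z w)) * cinner u (weyl (w - z) u)" for u
    unfolding cinner_weyl_left by (simp add: weyl_weyl)
  then show ?thesis by (simp add: charf_def gns_def infsum_cmult_right')
qed

lemma weyl_0_id: "weyl 0 = id_blinfun"
  by (rule blinfun_eqI) simp

context
  fixes R :: "'d::finite op"
  assumes R: "((\<lambda>n. (norm (R (fock_e n)))\<^sup>2) has_sum 1) UNIV"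
begin

lemma charf_0 [simp]: "charf R 0 = 1"
  by (simp add: charf_def weyl_0_id gns_id[OF R])

lemma cmod_charf_le: "cmod (charf R z) \<le> 1"
proof -
  have "(cmod (charf R z))\<^sup>2 \<le> Re (gns R (weyl z) (weyl z))" unfolding charf_def by (rule gns_mean_le[OF R])
  then have "(cmod (charf R z))\<^sup>2 \<le> 1\<^sup>2" by (simp add: gns_weyl)
  then show ?thesis by (rule power2_le_imp_le) simp
qed

lemma charf_continuous_0: "(charf R \<longlongrightarrow> 1) (at 0)"
proof (rule tendstoI)
  fix e :: real assume e: "0 < e"
  let ?r = "\<lambda>n. (norm (R (fock_e n)))\<^sup>2"
  \<comment> \<open>Dominated convergence by hand: off F each term is at most twice the summand of
    the trace, so the tail contributes at most 2 (e/8), and on the finite F strong continuity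
    suffices.\<close>
  obtain F where F: "finite F" "dist (sum ?r F) 1 \<le> e/8"
    using has_sum_finite_approximation[OF R, of "e/8"] e by auto
  have Rs: "?r summable_on UNIV" by (rule has_sum_imp_summable[OF R])
  have Fc: "infsum ?r (- F) \<le> e/8"
  proof -
    have "infsum ?r UNIV = sum ?r F + infsum ?r (- F)"
      using infsum_Un_disjoint[of ?r F "- F"] F(1) summable_on_subset_banach[OF Rs, of "- F"] by (simp add: Compl_partition)
    moreover have "infsum ?r UNIV = 1" using R by (simp add: has_sum_iff)
    ultimately show ?thesis using F(2) unfolding dist_real_def by linarith
  qed
  define a where "a z n = cinner (R (fock_e n)) (weyl z (R (fock_e n)) - R (fock_e n))" for z n
  have an: "cmod (a z n) \<le> 2 * ?r n" for z n
  proof -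
    have "cmod (a z n) \<le> norm (R (fock_e n)) * norm (weyl z (R (fock_e n)) - R (fock_e n))"
      unfolding a_def by (rule cmod_cinner_le)
    also have "\<dots> \<le> norm (R (fock_e n)) * (norm (R (fock_e n)) + norm (R (fock_e n)))"
      using norm_triangle_ineq4[of "weyl z (R (fock_e n))" "R (fock_e n)"] by (intro mult_left_mono) auto
    finally show ?thesis by (simp add: power2_eq_square)
  qed
  have as: "(\<lambda>n. cmod (a z n)) summable_on A" for z A
    by (rule summable_on_comparison_test[OF summable_on_cmult_right[OF summable_on_subset_banach[OF Rs, of A], of 2]]) (use an in auto)
  have sub: "charf R z - 1 = infsum (a z) UNIV" for z
  proof -
    have "charf R z - 1 = gns R id_blinfun (weyl z - id_blinfun)"
      by (simp add: charf_def gns_diff_right[OF R] gns_id[OF R])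
    then show ?thesis by (simp add: gns_def a_def[abs_def] minus_blinfun.rep_eq)
  qed
  have bd: "cmod (charf R z - 1) \<le> (\<Sum>n\<in>F. cmod (a z n)) + 2 * (e/8)" for z
  proof -
    have "cmod (charf R z - 1) \<le> infsum (\<lambda>n. cmod (a z n)) UNIV"
      unfolding sub by (rule norm_infsum_bound[OF as])
    also have "\<dots> = (\<Sum>n\<in>F. cmod (a z n)) + infsum (\<lambda>n. cmod (a z n)) (- F)"
      using infsum_Un_disjoint[of "\<lambda>n. cmod (a z n)" F "- F"] F(1) as by (simp add: Compl_partition)
    also have "infsum (\<lambda>n. cmod (a z n)) (- F) \<le> infsum (\<lambda>n. 2 * ?r n) (- F)"
      by (intro infsum_mono as summable_on_cmult_right summable_on_subset_banach[OF Rs] an) auto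
    also have "infsum (\<lambda>n. 2 * ?r n) (- F) = 2 * infsum ?r (- F)" by (rule infsum_cmult_right')
    finally show ?thesis using Fc by simp
  qed
  have "((\<lambda>z. (\<Sum>n\<in>F. cmod (a z n)) + 2 * (e/8)) \<longlongrightarrow> (\<Sum>n\<in>F. cmod (cinner (R (fock_e n)) (R (fock_e n) - R (fock_e n)))) + 2 * (e/8)) (at 0)"
    unfolding a_def by (intro tendsto_intros weyl_strongly_continuous)
  then have "\<forall>\<^sub>F z in at 0. (\<Sum>n\<in>F. cmod (a z n)) + 2 * (e/8) < e"
    by (rule order_tendstoD) (use e in simp)
  then show "\<forall>\<^sub>F z in at 0. dist (charf R z) 1 < e"
    by (rule eventually_mono) (use bd in \<open>auto simp: dist_norm intro: le_less_trans\<close>)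
qed

end

lemma bounded_bilinear_min:
  fixes Q :: "'a::euclidean_space \<Rightarrow> 'a \<Rightarrow> real"
  assumes Q: "bilinear Q" and pos: "\<And>z. z \<noteq> 0 \<Longrightarrow> Q z z > 0"
  shows "\<exists>m>0. \<forall>z. m * (norm z)\<^sup>2 \<le> Q z z"
proof (cases "\<exists>z::'a. z \<noteq> 0")
  case True
  then obtain z0 :: 'a where z0: "z0 \<noteq> 0" by blast
  have bb: "bounded_bilinear Q" using Q bilinear_conv_bounded_bilinear by blast
  have "sphere (0::'a) 1 \<noteq> {}" using z0 by (auto intro!: exI[of _ "z0 /\<^sub>R norm z0"])
  moreover have "continuous_on (sphere (0::'a) 1) (\<lambda>z. Q z z)"
    by (intro bounded_bilinear.continuous_on[OF bb] continuous_intros)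
  ultimately obtain x where x: "x \<in> sphere 0 1" "\<forall>y\<in>sphere 0 1. Q x x \<le> Q y y"
    using continuous_attains_inf[of "sphere (0::'a) 1" "\<lambda>z. Q z z"] by auto
  show ?thesis
  proof (intro exI[of _ "Q x x"] conjI allI)
    show "Q x x > 0" using x(1) by (intro pos) auto
    fix z :: 'a
    show "Q x x * (norm z)\<^sup>2 \<le> Q z z"
    proof (cases "z = 0")
      case True
      then show ?thesis using bilinear_lzero[OF Q, of 0] by simp
    next
      case False
      have "Q x x \<le> Q ((1 / norm z) *\<^sub>R z) ((1 / norm z) *\<^sub>R z)" using x(2) False by auto
      then show ?thesis using False
        by (simp add: bilinear_lmul[OF Q] bilinear_rmul[OF Q] field_simps power2_eq_square)
    qed
  qed
qed (auto intro!: exI[of _ 1] simp: bilinear_lzero[OF Q])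

section \<open>The limiting quadratic form Q\<close>

locale gaussian_gap =
  fixes \<Omega> \<kappa> :: "complex^'d::finite^'d" and U V :: "complex^'d^'m::finite"
    and T :: "real \<Rightarrow> 'd op \<Rightarrow> 'd op" and \<rho> :: "'d op" and S :: "real \<Rightarrow> 'd op \<Rightarrow> 'd op" and g :: real
  assumes \<Omega>: "adj_mat \<Omega> = \<Omega>" and \<kappa>: "transpose \<kappa> = \<kappa>" and T: "gaussian_qms \<Omega> \<kappa> U V 0 T"
    and st: "state \<rho>" and fa: "faithful \<rho>" and S: "gns_semigroup T \<rho> S" and gap: "gap_inequality \<rho> S g"
    and g: "g > 0"
begin

abbreviation "Z \<equiv> drift \<Omega> \<kappa> U V"
abbreviation "E t z \<equiv> flow Z t z"
abbreviation "I t z w \<equiv> noise \<Omega> \<kappa> U V t z w"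
abbreviation "R \<equiv> sqrt_op \<rho>"
abbreviation "chi \<equiv> charf R"

lemma qms: "quantum_markov_semigroup T"
  using T by (simp add: gaussian_qms_def)

lemmas Rpos = faithful_state_sqrt(1)[OF st fa]
lemmas Rinj = faithful_state_sqrt(2)[OF st fa]
lemmas R1 = faithful_state_sqrt(3)[OF st fa]
lemmas T_weyl = gaussian_qms_weyl[OF \<Omega> \<kappa> T]

text \<open>T_t preserves the mean, so the gap inequality becomes exponential decay of the
  variance.\<close>

lemma gap_centred:
  assumes t: "t > 0" and Y: "Y \<in> BH"
  shows "Re (gns R (T t Y) (T t Y)) - (cmod (gns R id_blinfun Y))\<^sup>2
    \<le> exp (- 2 * g * t) * (Re (gns R Y Y) - (cmod (gns R id_blinfun Y))\<^sup>2)"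
proof -
  have "gns R id_blinfun (T t Y) = gns R id_blinfun Y"
    by (rule gns_invariant[OF st fa qms S gap g _ Y]) (use t in simp)
  then show ?thesis
    using gns_gap[OF st fa qms S gap t Y] gns_centred[OF R1, of Y] gns_centred[OF R1, of "T t Y"] by simp
qed

lemma chi_flow:
  assumes "t \<ge> 0"
  shows "chi z = exp (- I t z z / 2) * chi (E t z)"
  using gns_invariant[OF st fa qms S gap g assms weyl_BH, of z]
  by (simp add: T_weyl[OF assms] gns_scaleC_right[OF R1] charf_def)

lemma cmod_chi_flow: "t \<ge> 0 \<Longrightarrow> cmod (chi z) = exp (- I t z z / 2) * cmod (chi (E t z))"
  unfolding chi_flow[of t z] norm_mult by simp

lemma chi_scaled_tendsto: "((\<lambda>r. chi (r *\<^sub>R z)) \<longlongrightarrow> 1) (at (0::real))"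
proof (cases "z = 0")
  case True then show ?thesis by (simp add: charf_0[OF R1])
next
  case False
  have "filterlim (\<lambda>r. r *\<^sub>R z) (at 0) (at (0::real))"
    unfolding filterlim_at using False by (auto intro!: tendsto_eq_intros simp: eventually_at_filter)
  then show ?thesis by (rule filterlim_compose[OF charf_continuous_0[OF R1]])
qed

lemma noise_scaleR2: "I t (r *\<^sub>R z) (r *\<^sub>R z) = r\<^sup>2 * I t z z"
  using noise_commute[of \<Omega> \<kappa> U V t z "r *\<^sub>R z"] by (simp add: noise_scaleR_left power2_eq_square)

text \<open>Near the origin chi is close to 1, so at a small multiple r z its modulus is at least
  1/2; as exp (-I_t / 2) dominates that modulus for every t, the accumulated noise cannot grow
  beyond 2 ln 2 / r^2.\<close>

lemma noise_bounded: "\<exists>B. \<forall>t\<ge>0. I t z z \<le> B"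
proof -
  have "\<forall>\<^sub>F r in at (0::real). dist (chi (r *\<^sub>R z)) 1 < 1/2" by (rule tendstoD[OF chi_scaled_tendsto]) simp
  then obtain d where d: "d > 0" "\<And>r. r \<noteq> 0 \<Longrightarrow> dist r 0 < d \<Longrightarrow> dist (chi (r *\<^sub>R z)) 1 < 1/2"
    unfolding eventually_at by blast
  define r where "r = d / 2"
  have r: "r > 0" "dist (chi (r *\<^sub>R z)) 1 < 1/2" using d by (auto simp: r_def)
  have h: "cmod (chi (r *\<^sub>R z)) \<ge> 1/2"
    using r(2) norm_triangle_ineq2[of 1 "1 - chi (r *\<^sub>R z)"] by (simp add: dist_norm norm_minus_commute)
  have "I t z z \<le> 2 * ln 2 / r\<^sup>2" if t: "t \<ge> 0" for t
  proof -
    have "1/2 \<le> exp (- I t (r *\<^sub>R z) (r *\<^sub>R z) / 2) * cmod (chi (E t (r *\<^sub>R z)))"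
      using h cmod_chi_flow[OF t, of "r *\<^sub>R z"] by simp
    also have "\<dots> \<le> exp (- I t (r *\<^sub>R z) (r *\<^sub>R z) / 2) * 1"
      by (intro mult_left_mono cmod_charf_le[OF R1]) simp
    finally have "ln (1/2) \<le> ln (exp (- I t (r *\<^sub>R z) (r *\<^sub>R z) / 2))"
      by (subst ln_le_cancel_iff) simp_all
    then have "r\<^sup>2 * I t z z \<le> 2 * ln 2" by (simp add: noise_scaleR2 ln_div)
    then show ?thesis using r(1) by (simp add: pos_le_divide_eq mult.commute)
  qed
  then show ?thesis by blast
qed

text \<open>Integer times suffice: on the diagonal I_t is increasing in t and bounded.\<close>

definition Q :: "complex^'d \<Rightarrow> complex^'d \<Rightarrow> real"
  where "Q z w = lim (\<lambda>k. I (real k) z w)"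

lemma noise_add_right: "I t w (z + z') = I t w z + I t w z'"
  using noise_add_left[of \<Omega> \<kappa> U V t z z' w] by (simp add: noise_commute[of \<Omega> \<kappa> U V t _ w])

lemma Q_tendsto: "(\<lambda>k. I (real k) z w) \<longlonglongrightarrow> Q z w"
proof -
  have d: "convergent (\<lambda>k. I (real k) z z)" for z
  proof -
    obtain B where "\<forall>t\<ge>0. I t z z \<le> B" using noise_bounded by blast
    then have "\<And>k. I (real k) z z \<le> B" by simp
    moreover have "incseq (\<lambda>k. I (real k) z z)" by (intro incseq_SucI noise_mono) auto
    ultimately show ?thesis by (metis convergentI incseq_convergent)
  qed
  \<comment> \<open>Polarisation: only diagonal values are monotone in t.\<close>
  have eq: "I t z w = (I t (z + w) (z + w) - I t z z - I t w w) / 2" for t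
    using noise_commute[of \<Omega> \<kappa> U V t w z] by (simp add: noise_add_left noise_add_right)
  have "convergent (\<lambda>k. (I (real k) (z + w) (z + w) - I (real k) z z - I (real k) w w) / 2)"
  proof -
    obtain a b c where "(\<lambda>k. I (real k) (z + w) (z + w)) \<longlonglongrightarrow> a" "(\<lambda>k. I (real k) z z) \<longlonglongrightarrow> b"
      "(\<lambda>k. I (real k) w w) \<longlonglongrightarrow> c" using d unfolding convergent_def by metis
    then have "(\<lambda>k. (I (real k) (z + w) (z + w) - I (real k) z z - I (real k) w w) / 2) \<longlonglongrightarrow> (a - b - c) / 2"
      by (intro tendsto_intros) auto
    then show ?thesis by (rule convergentI)
  qed
  then have "convergent (\<lambda>k. I (real k) z w)" unfolding eq[symmetric] .
  then show ?thesis unfolding Q_def convergent_LIMSEQ_iff .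
qed

lemma Q_commute: "Q z w = Q w z"
  unfolding Q_def using noise_commute by metis

lemma Q_bilinear: "bilinear Q"
proof -
  have a: "Q (z + z') w = Q z w + Q z' w" for z z' w
    using LIMSEQ_unique[OF Q_tendsto[of "z + z'" w]] tendsto_add[OF Q_tendsto[of z w] Q_tendsto[of z' w]]
    by (simp add: noise_add_left)
  have s: "Q (r *\<^sub>R z) w = r *\<^sub>R Q z w" for r z w
    using LIMSEQ_unique[OF Q_tendsto[of "r *\<^sub>R z" w]] tendsto_mult_left[OF Q_tendsto[of z w], of r]
    by (simp add: noise_scaleR_left)
  show ?thesis
    unfolding bilinear_def
    using a s Q_commute by (auto intro!: linearI)
qed

lemmas Q_simps = bilinear_ladd[OF Q_bilinear] bilinear_radd[OF Q_bilinear] bilinear_lmul[OF Q_bilinear]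
  bilinear_rmul[OF Q_bilinear] bilinear_lsub[OF Q_bilinear] bilinear_rsub[OF Q_bilinear]

lemma exp_m2g: "(\<lambda>k. exp (- 2 * g * real k)) \<longlonglongrightarrow> 0"
proof -
  have "(\<lambda>k. exp (- 2 * g) ^ k) \<longlonglongrightarrow> 0" by (intro LIMSEQ_realpow_zero) (use g in auto)
  then show ?thesis by (simp add: exp_of_nat_mult[symmetric] mult.commute)
qed

text \<open>From chi(z) = exp (-I_k / 2) chi(e^{kZ} z) and modulus at most 1 comes the upper bound.
  For the lower one, the second moment exp (-I_k) of T_k W(z) must approach the squared modulus of
  its mean because of the gap.\<close>

lemma cmod_chi: "(cmod (chi z))\<^sup>2 = exp (- Q z z)"
proof (rule antisym)
  have l: "(\<lambda>k. exp (- I (real k) z z)) \<longlonglongrightarrow> exp (- Q z z)"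
    by (intro tendsto_intros Q_tendsto)
  have e2: "(exp (- x / 2))\<^sup>2 = exp (- x)" for x :: real by (simp add: power2_eq_square exp_add[symmetric])
  show "(cmod (chi z))\<^sup>2 \<le> exp (- Q z z)"
  proof (rule LIMSEQ_le_const[OF l], intro exI allI impI)
    fix k :: nat
    have "cmod (chi z) \<le> exp (- I (real k) z z / 2) * 1"
      unfolding cmod_chi_flow[OF of_nat_0_le_iff, of z k] by (intro mult_left_mono cmod_charf_le[OF R1]) simp
    then have "(cmod (chi z))\<^sup>2 \<le> (exp (- I (real k) z z / 2))\<^sup>2" by (intro power_mono) auto
    then show "(cmod (chi z))\<^sup>2 \<le> exp (- I (real k) z z)" unfolding e2 .
  qed
  show "exp (- Q z z) \<le> (cmod (chi z))\<^sup>2"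
  proof (rule LIMSEQ_le[OF l])
    have "(\<lambda>k. (cmod (chi z))\<^sup>2 + exp (- 2 * g * real k) * (1 - (cmod (chi z))\<^sup>2)) \<longlonglongrightarrow> (cmod (chi z))\<^sup>2 + 0 * (1 - (cmod (chi z))\<^sup>2)"
      by (intro tendsto_intros exp_m2g)
    then show "(\<lambda>k. (cmod (chi z))\<^sup>2 + exp (- 2 * g * real k) * (1 - (cmod (chi z))\<^sup>2)) \<longlonglongrightarrow> (cmod (chi z))\<^sup>2" by simp
    show "\<exists>N. \<forall>k\<ge>N. exp (- I (real k) z z) \<le> (cmod (chi z))\<^sup>2 + exp (- 2 * g * real k) * (1 - (cmod (chi z))\<^sup>2)"
    proof (intro exI[of _ 1] allI impI)
      fix k :: nat assume k: "1 \<le> k"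
      have w: "gns R (weyl w) (weyl w) = 1" for w by (simp add: gns_weyl charf_0[OF R1])
      have "gns R (T (real k) (weyl z)) (T (real k) (weyl z)) = complex_of_real ((exp (- I (real k) z z / 2))\<^sup>2)"
        unfolding T_weyl[OF of_nat_0_le_iff] gns_scaleC_left[OF R1] gns_scaleC_right[OF R1] w by (simp add: power2_eq_square)
      then have "gns R (T (real k) (weyl z)) (T (real k) (weyl z)) = complex_of_real (exp (- I (real k) z z))"
        unfolding e2 .
      then show "exp (- I (real k) z z) \<le> (cmod (chi z))\<^sup>2 + exp (- 2 * g * real k) * (1 - (cmod (chi z))\<^sup>2)"
        using gap_centred[of "real k" "weyl z"] k by (simp add: w charf_def[symmetric])
    qed
  qed
qed

lemma Q_flow: assumes t: "t \<ge> 0" shows "Q (E t z) (E t w) = Q z w - I t z w"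
proof -
  have d: "Q (E t z) (E t z) = Q z z - I t z z" for z
  proof -
    have "exp (- Q z z) = exp (- I t z z) * exp (- Q (E t z) (E t z))"
      unfolding cmod_chi[symmetric] using cmod_chi_flow[OF t, of z]
      by (simp add: power_mult_distrib) (simp add: power2_eq_square exp_add[symmetric])
    then have "exp (- Q z z) = exp (- I t z z - Q (E t z) (E t z))" by (simp add: exp_diff exp_minus field_simps)
    then show ?thesis by simp
  qed
  have "Q (E t (z + w)) (E t (z + w)) = Q (z + w) (z + w) - I t (z + w) (z + w)" by (rule d)
  then show ?thesis
    using d[of z] d[of w] Q_commute[of w z] Q_commute[of "E t w" "E t z"] noise_commute[of \<Omega> \<kappa> U V t w z]
    by (simp add: flow_add[OF drift_bounded_linear] Q_simps noise_add_left noise_add_right)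
qed

text \<open>If Q(z, z) = 0, then chi has modulus 1 at z and W(z) has variance zero, so W(z) acts as
  the scalar chi(z) on the range of R. Faithfulness makes this range dense, so W(-z) is scalar and z
  = 0.\<close>

lemma Q_pos: assumes "z \<noteq> 0" shows "Q z z > 0"
proof (rule ccontr)
  assume neg: "\<not> Q z z > 0"
  have "(cmod (chi z))\<^sup>2 \<le> 1\<^sup>2" by (intro power_mono cmod_charf_le[OF R1]) simp
  then have "Q z z \<ge> 0" unfolding cmod_chi by simp
  then have "Q z z = 0" using neg by simp
  then have c1: "(cmod (chi z))\<^sup>2 = 1" using cmod_chi[of z] by simp
  let ?X = "weyl z - scaleC_op (chi z) id_blinfun"
  have "Re (gns R ?X ?X) = 0"
    using gns_centred[OF R1, of "weyl z"] c1 by (simp add: charf_def gns_weyl[of R z z] charf_0[OF R1, unfolded charf_def])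
  then have "(norm (?X (R (fock_e n))))\<^sup>2 \<le> 0" for n using gns_self_ge[OF R1, of ?X n] by simp
  then have X0: "weyl z (R (fock_e n)) = chi z *\<^sub>C R (fock_e n)" for n by (simp add: minus_blinfun.rep_eq)
  \<comment> \<open>Density of the range of R is used in dual form: R annihilates the difference of
    both sides, and R is injective.\<close>
  have "weyl (- z) u = cnj (chi z) *\<^sub>C u" for u
  proof -
    have "R (weyl (- z) u - cnj (chi z) *\<^sub>C u) = 0"
    proof (rule fock_eqI)
      fix n
      have "fock_coeff (R (weyl (- z) u - cnj (chi z) *\<^sub>C u)) n = cinner (R (fock_e n)) (weyl (- z) u) - cnj (chi z) * cinner (R (fock_e n)) u"
        unfolding cinner_fock_e[symmetric] positive_op_hermitian[OF Rpos, symmetric] by (simp add: cinner_diff_right)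
      also have "cinner (R (fock_e n)) (weyl (- z) u) = cnj (chi z) * cinner (R (fock_e n)) u"
        unfolding cinner_weyl_left[symmetric] X0 by simp
      finally show "fock_coeff (R (weyl (- z) u - cnj (chi z) *\<^sub>C u)) n = fock_coeff 0 n" by simp
    qed
    from Rinj[OF this] show ?thesis by simp
  qed
  then have "- z = 0" by (rule weyl_scalar_imp_0)
  then show False using assms by simp
qed

text \<open>Q is comparable to the squared norm, and its value along the flow is Q - I_k, which
  tends to 0 by the definition of Q.\<close>

lemma flow_tendsto_0: "(\<lambda>k. E (real k) z) \<longlonglongrightarrow> 0"
proof -
  obtain m where m: "m > 0" "\<And>z. m * (norm z)\<^sup>2 \<le> Q z z"
    using bounded_bilinear_min[OF Q_bilinear Q_pos] by blast
  have "(\<lambda>k. Q z z - I (real k) z z) \<longlonglongrightarrow> Q z z - Q z z" by (intro tendsto_intros Q_tendsto)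
  then have l: "(\<lambda>k. Q (E (real k) z) (E (real k) z) / m) \<longlonglongrightarrow> 0"
    using tendsto_divide[of _ "0::real" sequentially "\<lambda>_. m" m] m(1) by (simp add: Q_flow)
  have "(\<lambda>k. (norm (E (real k) z))\<^sup>2) \<longlonglongrightarrow> 0"
    by (rule tendsto_sandwich[OF _ _ tendsto_const l]) (use m in \<open>auto simp: pos_le_divide_eq mult.commute\<close>)
  then have "(\<lambda>k. sqrt ((norm (E (real k) z))\<^sup>2)) \<longlonglongrightarrow> sqrt 0" by (intro tendsto_intros)
  then show ?thesis by (simp add: tendsto_norm_zero_iff)
qed

text \<open>The modulus leaves the phase open; letting k tend to infinity in chi(z) = exp (-I_k / 2)
  chi(e^{kZ} z) fixes it, since chi tends to 1 at the origin.\<close>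

lemma chi_eq: "chi z = exp (- Q z z / 2)"
proof -
  have c: "isCont chi 0" using charf_continuous_0[OF R1] by (simp add: isCont_def charf_0[OF R1])
  have "(\<lambda>k. chi (E (real k) z)) \<longlonglongrightarrow> 1"
    using isCont_tendsto_compose[OF c flow_tendsto_0] by (simp add: charf_0[OF R1])
  moreover have "(\<lambda>k. complex_of_real (exp (- I (real k) z z / 2))) \<longlonglongrightarrow> complex_of_real (exp (- Q z z / 2))"
    by (intro tendsto_intros Q_tendsto) simp
  ultimately have "(\<lambda>k. complex_of_real (exp (- I (real k) z z / 2)) * chi (E (real k) z)) \<longlonglongrightarrow> complex_of_real (exp (- Q z z / 2)) * 1"
    by (intro tendsto_mult)
  then have "(\<lambda>k::nat. chi z) \<longlonglongrightarrow> complex_of_real (exp (- Q z z / 2))"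
    using chi_flow[of "real _" z] by simp
  then show ?thesis by (simp add: LIMSEQ_const_iff)
qed

section \<open>Normalised Weyl operators and their Gram matrix\<close>

text \<open>W(z) / chi(z). All of them have mean 1, and the semigroup permutes them without scalar
  factors.\<close>

definition What :: "complex^'d \<Rightarrow> 'd op"
  where "What z = scaleC_op (exp (Q z z / 2)) (weyl z)"

lemma What_BH [simp]: "What z \<in> BH"
  by (simp add: What_def)

text \<open>Real bilinear with complex values; its matrix in a real basis is the hermitian matrix of
  S on C^{2d}.\<close>

definition sform :: "complex^'d \<Rightarrow> complex^'d \<Rightarrow> complex"
  where "sform z w = Q z w + \<i> * Im (hip z w)"

lemma gns_What: "gns R (What z) (What w) = exp (sform z w)"
proof -
  have "gns R (What z) (What w) = exp (complex_of_real (Q z z / 2)) * exp (complex_of_real (Q w w / 2)) * exp (\<i> * Im (hip z w)) * exp (complex_of_real (- Q (w - z) (w - z) / 2))"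
    unfolding What_def gns_scaleC_left[OF R1] gns_scaleC_right[OF R1] gns_weyl chi_eq exp_of_real complex_cnj_complex_of_real
    by (simp only: mult_ac)
  also have "\<dots> = exp (complex_of_real (Q z z / 2) + complex_of_real (Q w w / 2) + \<i> * Im (hip z w) + complex_of_real (- Q (w - z) (w - z) / 2))"
    by (simp only: exp_add)
  also have "complex_of_real (Q z z / 2) + complex_of_real (Q w w / 2) + \<i> * Im (hip z w) + complex_of_real (- Q (w - z) (w - z) / 2) = sform z w"
    by (simp add: sform_def Q_simps Q_commute[of w z] complex_eq_iff field_simps)
  finally show ?thesis .
qed

lemma gns_id_What: "gns R id_blinfun (What z) = 1"
  by (simp add: What_def gns_scaleC_right[OF R1] charf_def[symmetric] chi_eq exp_of_real[symmetric] exp_minus flip: of_real_mult)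

lemma T_What:
  assumes t: "t \<ge> 0" shows "T t (What z) = What (E t z)"
proof -
  have lin: "T t (scaleC_op c x) = scaleC_op c (T t x)" if "x \<in> BH" for c x
    using qms t that by (simp add: quantum_markov_semigroup_def linear_on_ops_def)
  have "exp (Q z z / 2) * exp (- I t z z / 2) = exp (Q (E t z) (E t z) / 2)"
    unfolding Q_flow[OF t] by (simp add: exp_add[symmetric] diff_divide_distrib)
  then have "complex_of_real (exp (Q z z / 2)) * complex_of_real (exp (- I t z z / 2)) = complex_of_real (exp (Q (E t z) (E t z) / 2))"
    by (metis of_real_mult)
  then show ?thesis
    unfolding What_def lin[OF weyl_BH] T_weyl[OF t]
    by (intro blinfun_eqI) simp
qed

end

subsection \<open>Real coordinates\<close>

lemma sum_UNIV_Plus: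
  fixes f :: "'a::finite + 'b::finite \<Rightarrow> 'c::comm_monoid_add"
  shows "(\<Sum>k\<in>UNIV. f k) = (\<Sum>j\<in>UNIV. f (Inl j)) + (\<Sum>j\<in>UNIV. f (Inr j))"
  by (subst UNIV_Plus_UNIV[symmetric], subst sum.Plus) simp_all

text \<open>The real basis e_j, i e_j of C^d, indexed to match the real and imaginary blocks of
  \<open>complexification\<close>.\<close>

definition bvec :: "'d + 'd \<Rightarrow> complex^'d::finite"
  where "bvec k = (case k of Inl j \<Rightarrow> axis j 1 | Inr j \<Rightarrow> axis j \<i>)"

lemma bvec_simps [simp]: "bvec (Inl j) = axis j 1" "bvec (Inr j) = axis j \<i>"
  by (simp_all add: bvec_def)

lemma sum_bvec_nth:
  "(\<Sum>k\<in>UNIV. r k *\<^sub>R bvec k) $ p = complex_of_real (r (Inl p)) + \<i> * complex_of_real (r (Inr p))"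
proof -
  have 1: "(\<Sum>j\<in>UNIV. (r (Inl j) *\<^sub>R axis j (1::complex)) $ p) = complex_of_real (r (Inl p))"
    by (subst sum.remove[of _ p]) (auto simp: axis_def scaleR_conv_of_real[where 'a = complex] intro!: sum.neutral)
  have 2: "(\<Sum>j\<in>UNIV. (r (Inr j) *\<^sub>R axis j \<i>) $ p) = \<i> * complex_of_real (r (Inr p))"
    by (subst sum.remove[of _ p]) (auto simp: axis_def scaleR_conv_of_real[where 'a = complex] intro!: sum.neutral)
  show ?thesis unfolding sum_UNIV_Plus by (simp only: vector_add_component sum_component bvec_simps 1 2)
qed

lemma matrix_axis:
  fixes A1 A2 :: "complex^'d::finite^'d"
  shows "(A1 *v axis q c + A2 *v cnj_vec (axis q c)) $ p = A1 $ p $ q * c + A2 $ p $ q * cnj c"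
proof -
  have "(\<Sum>j\<in>UNIV. A1 $ p $ j * axis q c $ j) = A1 $ p $ q * c"
    by (subst sum.remove[of _ q]) (auto simp: axis_def intro!: sum.neutral)
  moreover have "(\<Sum>j\<in>UNIV. A2 $ p $ j * cnj (axis q c $ j)) = A2 $ p $ q * cnj c"
    by (subst sum.remove[of _ q]) (auto simp: axis_def intro!: sum.neutral)
  ultimately show ?thesis by (simp add: matrix_vector_mult_def cnj_vec_def)
qed

lemma complexification_real:
  "complexification A1 A2 $ k $ l = complex_of_real (Re (complexification A1 A2 $ k $ l))"
  by (cases k; cases l) (simp_all add: complexification_def block_mat_def map_matrix_def)

text \<open>The columns of the complexified matrix are the real coordinates of the images of the
  real basis vectors.\<close>

lemma complexification_bvec:
  fixes A1 A2 :: "complex^'d::finite^'d"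
  shows "A1 *v bvec l + A2 *v cnj_vec (bvec l) = (\<Sum>k\<in>UNIV. Re (complexification A1 A2 $ k $ l) *\<^sub>R bvec k)"
proof (rule vec_eq_iff[THEN iffD2], rule allI)
  fix p
  show "(A1 *v bvec l + A2 *v cnj_vec (bvec l)) $ p = (\<Sum>k\<in>UNIV. Re (complexification A1 A2 $ k $ l) *\<^sub>R bvec k) $ p"
    unfolding sum_bvec_nth
    by (cases l) (simp_all only: bvec_simps matrix_axis, simp_all add: complexification_def block_mat_def map_matrix_def complex_eq_iff)
qed

lemma hip_axis_axis: "hip (axis j c) (axis k d) = (if j = k then cnj c * d else 0)"
  unfolding hip_axis by (simp add: axis_def)

lemma Re_hip_bvec: "Re (hip (bvec k) (bvec l)) = (if k = l then 1 else 0)"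
  by (cases k; cases l) (simp_all add: hip_axis_axis)

lemma Im_hip_bvec: "complex_of_real (Im (hip (bvec k) (bvec l))) = J_mat $ k $ l"
  by (cases k; cases l) (simp_all add: hip_axis_axis J_mat_def block_mat_def mat_def)

lemma hip_sum_right: "hip z (sum f A) = (\<Sum>a\<in>A. hip z (f a))"
  by (induction A rule: infinite_finite_induct) (auto simp: hip_add_right)

lemma hip_sum_left: "hip (sum f A) z = (\<Sum>a\<in>A. hip (f a) z)"
  by (induction A rule: infinite_finite_induct) (auto simp: hip_add_left)

lemma diffu_hip:
  fixes U V :: "complex^'d::finite^'m::finite"
  shows "diffu U V z w = Re (hip z (C1 U V *v w + C2 U V *v cnj_vec w))"
proof -
  define a where "a l z = (\<Sum>k\<in>UNIV. cnj (V $ l $ k) * z $ k)" for l and z :: "complex^'d"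
  define b where "b l z = (\<Sum>k\<in>UNIV. U $ l $ k * cnj (z $ k))" for l and z :: "complex^'d"
  have l: "lam U V l z = a l z + b l z" for l z by (simp add: lam_def a_def b_def sum.distrib)
  have ha: "hip z (transpose A *v x) = (\<Sum>l\<in>UNIV. (\<Sum>k\<in>UNIV. A $ l $ k * cnj (z $ k)) * x $ l)" for A :: "complex^'d^'m" and x
  proof -
    have "hip z (transpose A *v x) = (\<Sum>k\<in>UNIV. \<Sum>l\<in>UNIV. cnj (z $ k) * (A $ l $ k * x $ l))"
      by (simp add: hip_def matrix_vector_mult_def transpose_def sum_distrib_left)
    also have "\<dots> = (\<Sum>l\<in>UNIV. \<Sum>k\<in>UNIV. cnj (z $ k) * (A $ l $ k * x $ l))" by (rule sum.swap)
    finally show ?thesis by (simp add: sum_distrib_right sum_distrib_left mult_ac)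
  qed
  have cV: "(\<Sum>k\<in>UNIV. V $ l $ k * cnj (z $ k)) = cnj (a l z)" for l by (simp add: a_def)
  have e: "(cnj_mat U *v w) $ l = cnj (b l w)" "(cnj_mat V *v w) $ l = a l w"
    "(V *v cnj_vec w) $ l = cnj (a l w)" "(U *v cnj_vec w) $ l = b l w" for l
    by (simp_all add: matrix_vector_mult_def map_matrix_def cnj_vec_def a_def b_def)
  have "hip z (C1 U V *v w + C2 U V *v cnj_vec w) = hip z (transpose U *v (cnj_mat U *v w)) + hip z (transpose V *v (cnj_mat V *v w))
    + hip z (transpose U *v (V *v cnj_vec w)) + hip z (transpose V *v (U *v cnj_vec w))"
    by (simp add: C1_def C2_def matrix_vector_mult_add_rdistrib matrix_vector_mul_assoc hip_add_right)
  also have "\<dots> = (\<Sum>l\<in>UNIV. b l z * cnj (b l w) + cnj (a l z) * a l w + b l z * cnj (a l w) + cnj (a l z) * b l w)"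
    unfolding ha e cV b_def[symmetric] by (simp add: sum.distrib)
  finally have "Re (hip z (C1 U V *v w + C2 U V *v cnj_vec w)) = (\<Sum>l\<in>UNIV. Re (b l z * cnj (b l w) + cnj (a l z) * a l w + b l z * cnj (a l w) + cnj (a l z) * b l w))"
    by simp
  also have "\<dots> = diffu U V z w"
    unfolding diffu_def l by (rule sum.cong) (auto simp: algebra_simps)
  finally show ?thesis by simp
qed

lemma diffu_bvec:
  "complex_of_real (diffu U V (bvec k) (bvec l)) = C_mat U V $ k $ l"
proof -
  have "diffu U V (bvec k) (bvec l) = (\<Sum>m\<in>UNIV. Re (C_mat U V $ m $ l) * Re (hip (bvec k) (bvec m)))"
    unfolding diffu_hip complexification_bvec hip_sum_right by simp
  also have "\<dots> = Re (C_mat U V $ k $ l)"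
    unfolding Re_hip_bvec by (simp add: if_distrib[of "\<lambda>x. _ * x"] cong: if_cong)
  finally show ?thesis using complexification_real[of "C1 U V" "C2 U V" k l] by simp
qed

lemma drift_bvec:
  "drift \<Omega> \<kappa> U V (bvec l) = (\<Sum>k\<in>UNIV. Re (Z_mat \<Omega> \<kappa> U V $ k $ l) *\<^sub>R bvec k)"
  unfolding drift_def by (rule complexification_bvec)

text \<open>Z has real entries, so its adjoint is its transpose; the entries of J are the values of
  Im <.,.> on the real basis, and those of C are the values of \<open>diffu\<close>.\<close>

lemma CZ_mat_nth:
  fixes U V :: "complex^'d::finite^'m::finite"
  shows "CZ_mat \<Omega> \<kappa> U V $ k $ l = complex_of_real (diffu U V (bvec k) (bvec l))
    - \<i> * complex_of_real (Im (hip (drift \<Omega> \<kappa> U V (bvec k)) (bvec l)) + Im (hip (bvec k) (drift \<Omega> \<kappa> U V (bvec l))))"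
proof -
  let ?Z = "Z_mat \<Omega> \<kappa> U V"
  have Zr: "?Z $ m $ k = complex_of_real (Re (?Z $ m $ k))" for m k by (rule complexification_real)
  have cZ: "cnj (?Z $ m $ k) = complex_of_real (Re (?Z $ m $ k))" for m k by (subst Zr) simp
  have 1: "complex_of_real (Im (hip (drift \<Omega> \<kappa> U V (bvec k)) (bvec l))) = (\<Sum>m\<in>UNIV. cnj (?Z $ m $ k) * J_mat $ m $ l)"
    unfolding drift_bvec hip_sum_left Im_hip_bvec[symmetric] cZ by simp
  have 2: "complex_of_real (Im (hip (bvec k) (drift \<Omega> \<kappa> U V (bvec l)))) = (\<Sum>m\<in>UNIV. J_mat $ k $ m * ?Z $ m $ l)"
    unfolding drift_bvec hip_sum_right Im_hip_bvec[symmetric]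
    by (subst (2) Zr) (simp add: mult.commute)
  show ?thesis
    unfolding CZ_mat_def diffu_bvec of_real_add 1 2
    by (simp add: scale_mat_def adj_mat_def map_matrix_def transpose_def matrix_matrix_mult_def)
qed

context gaussian_gap
begin

subsection \<open>The gap inequality for quadratic forms\<close>

text \<open>The variance of the combination with coefficients c_i: the -1 subtracts the product of
  means, as each summand has mean c_i.\<close>

definition expform :: "('i::finite \<Rightarrow> complex) \<Rightarrow> ('i \<Rightarrow> complex^'d) \<Rightarrow> real"
  where "expform c z = Re (\<Sum>i\<in>UNIV. \<Sum>j\<in>UNIV. cnj (c i) * c j * (exp (sform (z i) (z j)) - 1))"

definition combo :: "('i::finite \<Rightarrow> complex) \<Rightarrow> ('i \<Rightarrow> complex^'d) \<Rightarrow> 'd op"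
  where "combo c z = (\<Sum>i\<in>UNIV. scaleC_op (c i) (What (z i)))"

lemma combo_BH [simp]: "combo c z \<in> BH"
  by (simp add: combo_def)

lemma gns_combo:
  "gns R id_blinfun (combo c z) = (\<Sum>i\<in>UNIV. c i)"
  "expform c z = Re (gns R (combo c z) (combo c z)) - (cmod (gns R id_blinfun (combo c z)))\<^sup>2"
proof -
  show m: "gns R id_blinfun (combo c z) = (\<Sum>i\<in>UNIV. c i)"
    by (simp add: combo_def gns_sum_right[OF R1] gns_scaleC_right[OF R1] gns_id_What)
  have "gns R (combo c z) (combo c z) = (\<Sum>i\<in>UNIV. \<Sum>j\<in>UNIV. cnj (c i) * c j * exp (sform (z i) (z j)))"
    by (subst sum.swap) (simp add: combo_def gns_sum_left[OF R1] gns_sum_right[OF R1] gns_scaleC_left[OF R1] gns_scaleC_right[OF R1] gns_What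
      sum_distrib_left mult_ac)
  moreover have "complex_of_real ((cmod (\<Sum>i\<in>UNIV. c i))\<^sup>2) = (\<Sum>i\<in>UNIV. \<Sum>j\<in>UNIV. cnj (c i) * c j)"
    unfolding cnj_mult_self[symmetric] by (simp add: sum_product)
  then have "(cmod (\<Sum>i\<in>UNIV. c i))\<^sup>2 = Re (\<Sum>i\<in>UNIV. \<Sum>j\<in>UNIV. cnj (c i) * c j)"
    by (metis Re_complex_of_real)
  ultimately show "expform c z = Re (gns R (combo c z) (combo c z)) - (cmod (gns R id_blinfun (combo c z)))\<^sup>2"
    unfolding m expform_def by (simp only: right_diff_distrib sum_subtractf minus_complex.sel mult_1_right)
qed

lemma T_combo:
  assumes t: "t \<ge> 0" shows "T t (combo c z) = combo c (\<lambda>i. E t (z i))"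
proof -
  have lin: "linear_on_ops BH (T t)" using qms t by (simp add: quantum_markov_semigroup_def)
  have T0: "T t 0 = 0"
  proof -
    have "T t (scaleC_op 0 0) = scaleC_op 0 (T t 0)" using lin BH_0 unfolding linear_on_ops_def by blast
    moreover have "scaleC_op 0 x = 0" for x :: "'d op" by (rule blinfun_eqI) simp
    ultimately show ?thesis by simp
  qed
  have "T t (\<Sum>i\<in>A. scaleC_op (c i) (What (z i))) = (\<Sum>i\<in>A. scaleC_op (c i) (What (E t (z i))))" if "finite A" for A
    using that
  proof (induction A rule: finite_induct)
    case (insert i A)
    have "T t (scaleC_op (c i) (What (z i)) + (\<Sum>i\<in>A. scaleC_op (c i) (What (z i))))
      = T t (scaleC_op (c i) (What (z i))) + T t (\<Sum>i\<in>A. scaleC_op (c i) (What (z i)))"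
      using lin unfolding linear_on_ops_def by simp
    moreover have "T t (scaleC_op (c i) (What (z i))) = scaleC_op (c i) (What (E t (z i)))"
      using lin T_What[OF t] unfolding linear_on_ops_def by simp
    ultimately show ?case using insert by simp
  qed (simp add: T0)
  then show ?thesis by (simp add: combo_def)
qed

lemma expform_gap: "t > 0 \<Longrightarrow> expform c (\<lambda>i. E t (z i)) \<le> exp (- 2 * g * t) * expform c z"
  using gap_centred[of t "combo c z"] unfolding gns_combo(2) by (simp add: T_combo gns_combo(1))

lemma expform_nonneg: "expform c z \<ge> 0"
  unfolding gns_combo(2) gns_centred[OF R1, symmetric] by (rule gns_self_nonneg(1)[OF R1])

text \<open>The variance dominates each single term of the GNS sum, so vanishing variance can be
  tested on matrix elements.\<close>

lemma expform_ge:
  "(cmod (cinner u (combo c z (R (fock_e n)) - (\<Sum>i\<in>UNIV. c i) *\<^sub>C R (fock_e n))))\<^sup>2 \<le> (norm u)\<^sup>2 * expform c z"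
proof -
  let ?X = "combo c z - scaleC_op (gns R id_blinfun (combo c z)) id_blinfun"
  have "(cmod (cinner u (?X (R (fock_e n)))))\<^sup>2 \<le> (norm u * norm (?X (R (fock_e n))))\<^sup>2"
    by (intro power_mono cmod_cinner_le) simp
  also have "\<dots> = (norm u)\<^sup>2 * (norm (?X (R (fock_e n))))\<^sup>2" by (rule power_mult_distrib)
  also have "\<dots> \<le> (norm u)\<^sup>2 * expform c z"
    unfolding gns_combo(2) gns_centred[OF R1, symmetric] by (intro mult_left_mono gns_self_ge[OF R1]) simp
  finally show ?thesis by (simp add: minus_blinfun.rep_eq gns_combo(1))
qed

definition qform :: "('i::finite \<Rightarrow> complex) \<Rightarrow> ('i \<Rightarrow> complex^'d) \<Rightarrow> real"
  where "qform c z = Re (\<Sum>i\<in>UNIV. \<Sum>j\<in>UNIV. cnj (c i) * c j * sform (z i) (z j))"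

lemma sform_bilinear: "bilinear sform"
  unfolding bilinear_def sform_def
  by (auto intro!: linearI simp: Q_simps hip_add_left hip_add_right algebra_simps scaleR_conv_of_real[where 'a = complex])

lemmas sform_simps = bilinear_lmul[OF sform_bilinear] bilinear_rmul[OF sform_bilinear]
  bilinear_ladd[OF sform_bilinear] bilinear_radd[OF sform_bilinear]

text \<open>S is real bilinear, so scaling by r gives exp (r^2 S) - 1: the order r is absent and r^2
  is the leading order.\<close>

lemma expform_tendsto:
  "((\<lambda>r. expform c (\<lambda>i. r *\<^sub>R z i) / r\<^sup>2) \<longlongrightarrow> qform c z) (at_right 0)"
proof -
  have e: "((\<lambda>r. (exp (of_real (r\<^sup>2) * s) - 1) / of_real (r\<^sup>2)) \<longlongrightarrow> s) (at_right (0::real))" for s :: complex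
  proof -
    have "((\<lambda>w. exp (w * s)) has_field_derivative exp (0 * s) * s) (at 0)"
      by (auto intro!: derivative_eq_intros)
    then have "((\<lambda>w. (exp (w * s) - 1) / w) \<longlongrightarrow> s) (at 0)" by (simp add: has_field_derivative_iff)
    moreover have "filterlim (\<lambda>r::real. complex_of_real (r\<^sup>2)) (at 0) (at_right 0)"
      unfolding filterlim_at by (auto intro!: tendsto_eq_intros simp: eventually_at_filter)
    ultimately show ?thesis by (rule filterlim_compose)
  qed
  have "expform c (\<lambda>i. r *\<^sub>R z i) / r\<^sup>2 = Re (\<Sum>i\<in>UNIV. \<Sum>j\<in>UNIV. cnj (c i) * c j * ((exp (of_real (r\<^sup>2) * sform (z i) (z j)) - 1) / of_real (r\<^sup>2)))" for r
  proof -
    have s: "sform (r *\<^sub>R z i) (r *\<^sub>R z j) = of_real (r\<^sup>2) * sform (z i) (z j)" for i j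
      by (simp add: sform_simps scaleR_conv_of_real[where 'a = complex] power2_eq_square)
    have "Re x / r\<^sup>2 = Re (x / of_real (r\<^sup>2))" for x by (simp del: of_real_power)
    then show ?thesis unfolding expform_def s by (simp add: sum_divide_distrib del: of_real_power)
  qed
  then show ?thesis unfolding qform_def by (simp only:) (intro tendsto_intros e)
qed

lemma qform_nonneg: "qform c z \<ge> 0"
  by (rule tendsto_lowerbound[OF expform_tendsto]) (simp_all add: expform_nonneg)

lemma qform_gap:
  assumes t: "t > 0" shows "qform c (\<lambda>i. E t (z i)) \<le> exp (- 2 * g * t) * qform c z"
proof (rule tendsto_le[of "at_right (0::real)"])
  show "((\<lambda>r. exp (- 2 * g * t) * (expform c (\<lambda>i. r *\<^sub>R z i) / r\<^sup>2)) \<longlongrightarrow> exp (- 2 * g * t) * qform c z) (at_right 0)"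
    by (intro tendsto_intros expform_tendsto)
  show "((\<lambda>r. expform c (\<lambda>i. r *\<^sub>R E t (z i)) / r\<^sup>2) \<longlongrightarrow> qform c (\<lambda>i. E t (z i))) (at_right 0)"
    by (rule expform_tendsto)
  have "expform c (\<lambda>i. r *\<^sub>R E t (z i)) / r\<^sup>2 \<le> exp (- 2 * g * t) * (expform c (\<lambda>i. r *\<^sub>R z i) / r\<^sup>2)" for r
    using divide_right_mono[OF expform_gap[OF t, of c "\<lambda>i. r *\<^sub>R z i"], of "r\<^sup>2"]
    by (simp add: flow_scaleR[OF drift_bounded_linear])
  then show "\<forall>\<^sub>F r in at_right 0. expform c (\<lambda>i. r *\<^sub>R E t (z i)) / r\<^sup>2 \<le> exp (- 2 * g * t) * (expform c (\<lambda>i. r *\<^sub>R z i) / r\<^sup>2)"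
    by simp
qed simp

text \<open>
  If \<open>qform c z = 0\<close>, the derivative \<open>\<Sum>\<^sub>i c\<^sub>i B(z\<^sub>i)\<close> of \<open>\<Sum>\<^sub>i c\<^sub>i W(r z\<^sub>i)\<close> at \<open>r = 0\<close> vanishes on the
  range of \<open>\<rho>\<^sup>1\<^sup>/\<^sup>2\<close>, which is dense.
\<close>

lemma qform_eq_0:
  assumes q: "qform c z = 0" and u: "u \<in> fock_D"
  shows "(\<Sum>i\<in>UNIV. cnj (c i) *\<^sub>C fieldop (z i) u) = 0"
proof (rule Rinj, rule fock_eqI)
  fix n
  let ?x = "R (fock_e n)"
  define f where "f r = cinner u (combo c (\<lambda>i. r *\<^sub>R z i) ?x - (\<Sum>i\<in>UNIV. c i) *\<^sub>C ?x)" for r :: real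
  have f_eq: "f r = (\<Sum>i\<in>UNIV. c i * (complex_of_real (exp (r\<^sup>2 * Q (z i) (z i) / 2)) * cinner (weyl (r *\<^sub>R (- z i)) u) ?x)) - (\<Sum>i\<in>UNIV. c i) * cinner u ?x" for r
    by (simp add: f_def combo_def What_def cinner_diff_right cinner_sum_right cinner_weyl_left Q_simps power2_eq_square mult.assoc)
  let ?D = "\<Sum>i\<in>UNIV. c i * - cinner (fieldop (z i) u) ?x"
  have dw: "((\<lambda>r. cinner (weyl (r *\<^sub>R (- z i)) u) ?x) has_vector_derivative - cinner (fieldop (z i) u) ?x) (at 0)" for i
  proof -
    have "((\<lambda>r. r *\<^sub>R (- z i)) has_vector_derivative - z i) (at (0::real))"
      by (auto intro!: derivative_eq_intros)
    from has_derivative_compose[OF this[unfolded has_vector_derivative_def], of "\<lambda>h. weyl h u" "\<lambda>h. fieldop h u"]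
    have "((\<lambda>r. weyl (r *\<^sub>R (- z i)) u) has_vector_derivative fieldop (- z i) u) (at 0)"
      using weyl_has_derivative_0[OF u] by (simp add: has_vector_derivative_def fieldop_scaleR fieldop_minus)
    from bounded_linear.has_vector_derivative[OF bounded_bilinear.bounded_linear_left[OF bounded_bilinear_cinner] this, of ?x]
    show ?thesis by (simp add: fieldop_minus)
  qed
  \<comment> \<open>The normalising factor is even in r and therefore does not contribute to the
    derivative at 0.\<close>
  have de: "((\<lambda>r. complex_of_real (exp (r\<^sup>2 * Q (z i) (z i) / 2))) has_vector_derivative 0) (at 0)" for i
  proof -
    have "((\<lambda>r. exp (r\<^sup>2 * Q (z i) (z i) / 2)) has_real_derivative 0) (at 0)"
      by (auto intro!: derivative_eq_intros)
    from bounded_linear.has_vector_derivative[OF bounded_linear_of_real this[unfolded has_real_derivative_iff_has_vector_derivative]]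
    show ?thesis by simp
  qed
  have "(f has_vector_derivative ?D) (at 0)"
  proof -
    have "((\<lambda>r. c i * (complex_of_real (exp (r\<^sup>2 * Q (z i) (z i) / 2)) * cinner (weyl (r *\<^sub>R (- z i)) u) ?x)) has_vector_derivative c i * - cinner (fieldop (z i) u) ?x) (at 0)" for i
      using has_vector_derivative_mult_right[OF has_vector_derivative_mult[OF de dw], of "c i"] by simp
    then have "((\<lambda>r. \<Sum>i\<in>UNIV. c i * (complex_of_real (exp (r\<^sup>2 * Q (z i) (z i) / 2)) * cinner (weyl (r *\<^sub>R (- z i)) u) ?x)) has_vector_derivative ?D) (at 0)"
      by (intro has_vector_derivative_sum)
    from has_vector_derivative_diff[OF this has_vector_derivative_const[of "(\<Sum>i\<in>UNIV. c i) * cinner u ?x"]]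
    show ?thesis unfolding f_eq[abs_def] by simp
  qed
  then have "((\<lambda>h. norm (f (0 + h) - f 0 - h *\<^sub>R ?D) / norm h) \<longlongrightarrow> 0) (at 0)"
    unfolding has_vector_derivative_def has_derivative_at by blast
  moreover have f0: "f 0 = 0"
    by (simp add: f_eq sum_distrib_right)
  have "norm (f (0 + h) - f 0 - h *\<^sub>R ?D) / norm h = norm (f h /\<^sub>R h - ?D)" if "h \<noteq> 0" for h
  proof -
    have "f h /\<^sub>R h - ?D = (f h - h *\<^sub>R ?D) /\<^sub>R h" using that by (simp add: scaleR_diff_right)
    then show ?thesis by (simp add: f0 divide_inverse mult.commute)
  qed
  then have "\<forall>\<^sub>F h in at 0. norm (f (0 + h) - f 0 - h *\<^sub>R ?D) / norm h = norm (f h /\<^sub>R h - ?D)"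
    by (auto simp: eventually_at_filter)
  ultimately have "((\<lambda>h. norm (f h /\<^sub>R h - ?D)) \<longlongrightarrow> 0) (at 0)"
    by (rule Lim_transform_eventually)
  then have "((\<lambda>h. f h /\<^sub>R h) \<longlongrightarrow> ?D) (at 0)"
    by (rule LIM_zero_cancel[OF tendsto_norm_zero_cancel])
  then have fd: "((\<lambda>h. f h /\<^sub>R h) \<longlongrightarrow> ?D) (at_right 0)"
    by (rule tendsto_within_subset) simp
  have "((\<lambda>r. norm (f r /\<^sub>R r)) \<longlongrightarrow> norm ?D) (at_right 0)"
    by (rule tendsto_norm[OF fd])
  \<comment> \<open>The centred matrix element f(r) is at most norm u times the standard deviation,
    which is o(r) because \<open>qform c z\<close> vanishes.\<close>
  moreover have "((\<lambda>r. norm (f r /\<^sub>R r)) \<longlongrightarrow> 0) (at_right 0)"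
  proof (rule tendsto_sandwich[OF _ _ tendsto_const])
    show "\<forall>\<^sub>F r in at_right 0. norm (f r /\<^sub>R r) \<le> norm u * sqrt (expform c (\<lambda>i. r *\<^sub>R z i) / r\<^sup>2)"
      unfolding eventually_at_right_field
    proof (intro exI[of _ 1] conjI allI impI)
      fix r :: real assume r: "0 < r" "r < 1"
      have "(norm (f r))\<^sup>2 \<le> (norm u)\<^sup>2 * expform c (\<lambda>i. r *\<^sub>R z i)"
        unfolding f_def by (rule expform_ge)
      then have "sqrt ((norm (f r))\<^sup>2) \<le> sqrt ((norm u)\<^sup>2 * expform c (\<lambda>i. r *\<^sub>R z i))" by (rule real_sqrt_le_mono)
      then have "norm (f r) \<le> norm u * sqrt (expform c (\<lambda>i. r *\<^sub>R z i))" by (simp add: real_sqrt_mult)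
      then show "norm (f r /\<^sub>R r) \<le> norm u * sqrt (expform c (\<lambda>i. r *\<^sub>R z i) / r\<^sup>2)"
        using r by (simp add: real_sqrt_divide field_simps)
    qed simp
    have "((\<lambda>r. norm u * sqrt (expform c (\<lambda>i. r *\<^sub>R z i) / r\<^sup>2)) \<longlongrightarrow> norm u * sqrt (qform c z)) (at_right 0)"
      by (intro tendsto_intros expform_tendsto)
    then show "((\<lambda>r. norm u * sqrt (expform c (\<lambda>i. r *\<^sub>R z i) / r\<^sup>2)) \<longlongrightarrow> 0) (at_right 0)" by (simp add: q)
  qed simp
  ultimately have "norm ?D = 0" by (rule tendsto_unique[OF trivial_limit_at_right_real])
  then have "(\<Sum>i\<in>UNIV. c i * cinner (fieldop (z i) u) ?x) = 0" by (simp add: sum_negf)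
  then have "cinner (\<Sum>i\<in>UNIV. cnj (c i) *\<^sub>C fieldop (z i) u) ?x = 0" by (simp add: cinner_sum_left)
  then have "cinner ?x (\<Sum>i\<in>UNIV. cnj (c i) *\<^sub>C fieldop (z i) u) = 0"
    using cinner_commute by (metis complex_cnj_zero)
  then show "fock_coeff (R (\<Sum>i\<in>UNIV. cnj (c i) *\<^sub>C fieldop (z i) u)) n = fock_coeff 0 n"
    unfolding positive_op_hermitian[OF Rpos] cinner_fock_e by simp
qed

text \<open>A null vector w makes a complex combination of field operators vanish on
  \<open>fock_D\<close>. The vacuum and the one-particle vectors separate its creation and
  annihilation coefficients, so all entries of w are 0.\<close>

lemma qform_bvec_pos:
  fixes w :: "complex^('d + 'd)"
  assumes "w \<noteq> 0" shows "qform (\<lambda>k. w $ k) bvec > 0"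
proof (rule ccontr)
  assume "\<not> ?thesis"
  then have q: "qform (\<lambda>k. w $ k) bvec = 0" using qform_nonneg[of "\<lambda>k. w $ k" bvec] by simp
  have x: "(\<Sum>j\<in>UNIV. (cnj (w $ Inl j) + \<i> * cnj (w $ Inr j)) * fock_coeff (creat j u) n
      + (- cnj (w $ Inl j) + \<i> * cnj (w $ Inr j)) * fock_coeff (annih j u) n) = 0" if u: "u \<in> fock_D" for u n
  proof -
    have "(\<Sum>k\<in>UNIV. cnj (w $ k) *\<^sub>C fieldop (bvec k) u) = 0" by (rule qform_eq_0[OF q u])
    then have "fock_coeff (\<Sum>k\<in>UNIV. cnj (w $ k) *\<^sub>C fieldop (bvec k) u) n = 0" by simp
    then show ?thesis by (simp add: sum_UNIV_Plus fieldop_axis sum.distrib[symmetric] algebra_simps)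
  qed
  define e0 :: "'d \<Rightarrow> nat" where "e0 = (\<lambda>_. 0)"
  have "w $ Inl j = 0 \<and> w $ Inr j = 0" for j
  proof -
    let ?e = "e0(j := 1)"
    have up: "(e0(i := Suc 0) = e0(j := Suc 0)) = (i = j)" for i by (auto simp: e0_def fun_eq_iff)
    have nz: "?e(i := m + 1) \<noteq> e0" for i m by (metis e0_def fun_upd_same Suc_eq_plus1 nat.distinct(1))
    have c1: "fock_coeff (creat i (fock_e e0)) ?e = (if i = j then 1 else 0)" for i
      by (auto simp: fock_coeff_creat e0_def fun_eq_iff)
    have a1: "fock_coeff (annih i (fock_e e0)) ?e = 0" for i
      using nz[of i] by (simp add: fock_coeff_annih)
    have c2: "fock_coeff (creat i (fock_e ?e)) e0 = 0" for i
      by (simp add: fock_coeff_creat e0_def)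
    have a2: "fock_coeff (annih i (fock_e ?e)) e0 = (if i = j then 1 else 0)" for i
      using up[of i] by (simp add: fock_coeff_annih) (simp add: e0_def)
    \<comment> \<open>The vacuum tested at the one-particle state of mode j isolates the coefficient
      of creation there; exchanging the two states isolates that of annihilation.\<close>
    have "cnj (w $ Inl j) + \<i> * cnj (w $ Inr j) = 0"
      using x[OF fock_D_e, of e0 ?e] unfolding c1 a1 by (simp add: if_distrib[of "\<lambda>x. _ * x"] cong: if_cong)
    moreover have "- cnj (w $ Inl j) + \<i> * cnj (w $ Inr j) = 0"
      using x[OF fock_D_e, of ?e e0] unfolding c2 a2 by (simp add: if_distrib[of "\<lambda>x. _ * x"] cong: if_cong)
    ultimately have "2 * (\<i> * cnj (w $ Inr j)) = 0" "cnj (w $ Inl j) = \<i> * cnj (w $ Inr j)" by (simp_all add: algebra_simps)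
    then show ?thesis by simp
  qed
  then have "w = 0"
    by (auto simp: vec_eq_iff) (metis sum.exhaust)
  then show False using assms by simp
qed

section \<open>The infinitesimal gap inequality\<close>

lemma right_derivative_nonneg:
  fixes f :: "real \<Rightarrow> real"
  assumes d: "(f has_real_derivative D) (at 0 within {0..})" and "f 0 = 0" "\<And>t. t > 0 \<Longrightarrow> f t \<ge> 0"
  shows "D \<ge> 0"
proof (rule tendsto_lowerbound)
  show "((\<lambda>t. (f t - f 0) / (t - 0)) \<longlongrightarrow> D) (at 0 within {0..})"
    using d by (simp add: has_field_derivative_iff)
  show "\<forall>\<^sub>F t in at 0 within {0..}. 0 \<le> (f t - f 0) / (t - 0)"
    using assms(2,3) by (auto simp: eventually_at_filter)
  show "at (0::real) within {0..} \<noteq> bot"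
    by (simp add: at_within_Ici_at_right)
qed

definition dsform :: "complex^'d \<Rightarrow> complex^'d \<Rightarrow> complex"
  where "dsform z w = sform (Z z) w + sform z (Z w)"

lemma flow_has_vector_derivative_0: "((\<lambda>t. E t z) has_vector_derivative Z z) (at 0 within {0..})"
  using flow_has_vector_derivative[OF drift_bounded_linear, of \<Omega> \<kappa> U V z 0 "{0..}"] by (simp add: flow_0[OF drift_bounded_linear])

text \<open>Derivative at t = 0 of Q along the flow, computed by the product rule and from Q -
  I_t.\<close>

lemma Lyapunov: "Q (Z z) w + Q z (Z w) = - diffu U V z w"
proof -
  have bb: "bounded_bilinear Q" using Q_bilinear bilinear_conv_bounded_bilinear by blast
  have "((\<lambda>t. Q (E t z) (E t w)) has_vector_derivative (Q (E 0 z) (Z w) + Q (Z z) (E 0 w))) (at 0 within {0..})"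
    by (rule bounded_bilinear.has_vector_derivative[OF bb flow_has_vector_derivative_0 flow_has_vector_derivative_0])
  then have 1: "((\<lambda>t. Q (E t z) (E t w)) has_vector_derivative (Q z (Z w) + Q (Z z) w)) (at 0 within {0..})"
    by (simp add: flow_0[OF drift_bounded_linear])
  have "((\<lambda>t. Q z w - I t z w) has_vector_derivative (0 - diffu U V (E 0 z) (E 0 w))) (at 0 within {0..})"
    using noise_has_derivative[of 0 \<Omega> \<kappa> U V z w]
    by (intro has_vector_derivative_diff has_vector_derivative_const) (simp add: has_real_derivative_iff_has_vector_derivative)
  then have "((\<lambda>t. Q (E t z) (E t w)) has_vector_derivative (0 - diffu U V (E 0 z) (E 0 w))) (at 0 within {0..})"
    by (rule has_vector_derivative_transform[rotated 2]) (simp_all add: Q_flow)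
  then have 2: "((\<lambda>t. Q (E t z) (E t w)) has_vector_derivative - diffu U V z w) (at 0 within {0..})"
    by (simp add: flow_0[OF drift_bounded_linear])
  have "at (0::real) within {0..} \<noteq> bot" by (simp add: at_within_Ici_at_right)
  from vector_derivative_unique_within[OF this 1 2] show ?thesis by simp
qed

text \<open>Both sides of \<open>qform_gap\<close> agree at t = 0, so the inequality passes to their
  right derivatives there.\<close>

lemma qform_derivative_le:
  "Re (\<Sum>i\<in>UNIV. \<Sum>j\<in>UNIV. cnj (c i) * c j * dsform (z i) (z j)) \<le> - 2 * g * qform c z"
proof -
  let ?D = "Re (\<Sum>i\<in>UNIV. \<Sum>j\<in>UNIV. cnj (c i) * c j * dsform (z i) (z j))"
  have bb: "bounded_bilinear sform" using sform_bilinear bilinear_conv_bounded_bilinear by blast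
  have s: "((\<lambda>t. cnj (c i) * c j * sform (E t (z i)) (E t (z j))) has_vector_derivative cnj (c i) * c j * dsform (z i) (z j)) (at 0 within {0..})" for i j
  proof -
    have "((\<lambda>t. sform (E t (z i)) (E t (z j))) has_vector_derivative (sform (E 0 (z i)) (Z (z j)) + sform (Z (z i)) (E 0 (z j)))) (at 0 within {0..})"
      by (rule bounded_bilinear.has_vector_derivative[OF bb flow_has_vector_derivative_0 flow_has_vector_derivative_0])
    then have "((\<lambda>t. sform (E t (z i)) (E t (z j))) has_vector_derivative dsform (z i) (z j)) (at 0 within {0..})"
      by (simp add: flow_0[OF drift_bounded_linear] dsform_def add.commute)
    then show ?thesis by (rule has_vector_derivative_mult_right)
  qed
  have "((\<lambda>t. \<Sum>i\<in>UNIV. \<Sum>j\<in>UNIV. cnj (c i) * c j * sform (E t (z i)) (E t (z j))) has_vector_derivative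
      (\<Sum>i\<in>UNIV. \<Sum>j\<in>UNIV. cnj (c i) * c j * dsform (z i) (z j))) (at 0 within {0..})"
    by (intro has_vector_derivative_sum s)
  from bounded_linear.has_vector_derivative[OF bounded_linear_Re this]
  have q: "((\<lambda>t. qform c (\<lambda>i. E t (z i))) has_real_derivative ?D) (at 0 within {0..})"
    by (simp add: qform_def has_real_derivative_iff_has_vector_derivative)
  have "((\<lambda>t. exp (- 2 * g * t) * qform c z - qform c (\<lambda>i. E t (z i))) has_real_derivative (- 2 * g * qform c z - ?D)) (at 0 within {0..})"
    by (rule DERIV_diff[OF _ q]) (auto intro!: derivative_eq_intros)
  then have "0 \<le> - 2 * g * qform c z - ?D"
    by (rule right_derivative_nonneg) (use qform_gap[of _ c z] in \<open>simp_all add: flow_0[OF drift_bounded_linear]\<close>)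
  then show ?thesis by simp
qed

text \<open>The Lyapunov equation turns C into the Q part of the derivative of S along the flow, up
  to sign; the term with J is the remaining part, as S = Q + i J.\<close>

lemma CZ_mat_dsform: "CZ_mat \<Omega> \<kappa> U V $ k $ l = - dsform (bvec k) (bvec l)"
  using Lyapunov[of "bvec k" "bvec l"]
  by (simp add: CZ_mat_nth dsform_def sform_def complex_eq_iff)

lemma CZ_positive_definite: "positive_definite (CZ_mat \<Omega> \<kappa> U V)"
  unfolding positive_definite_def
proof (intro conjI allI impI)
  have anti: "Im (hip x y) = - Im (hip y x)" for x y :: "complex^'d" using hip_commute[of x y] by simp
  show "adj_mat (CZ_mat \<Omega> \<kappa> U V) = CZ_mat \<Omega> \<kappa> U V"
  proof (rule vec_eq_iff[THEN iffD2], rule allI, rule vec_eq_iff[THEN iffD2], rule allI)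
    fix k l
    show "adj_mat (CZ_mat \<Omega> \<kappa> U V) $ k $ l = CZ_mat \<Omega> \<kappa> U V $ k $ l"
      using anti[of "Z (bvec l)" "bvec k"] anti[of "bvec l" "Z (bvec k)"] diffu_commute[of U V "bvec l" "bvec k"]
      by (simp add: adj_mat_def map_matrix_def transpose_def CZ_mat_nth complex_eq_iff)
  qed
  fix v :: "complex^('d + 'd)" assume v: "v \<noteq> 0"
  have "(\<Sum>i\<in>UNIV. cnj (v $ i) * (CZ_mat \<Omega> \<kappa> U V *v v) $ i) = - (\<Sum>i\<in>UNIV. \<Sum>j\<in>UNIV. cnj (v $ i) * v $ j * dsform (bvec i) (bvec j))"
    by (simp add: matrix_vector_mult_def CZ_mat_dsform sum_distrib_left sum_negf mult_ac)
  then have "Re (\<Sum>i\<in>UNIV. cnj (v $ i) * (CZ_mat \<Omega> \<kappa> U V *v v) $ i) \<ge> 2 * g * qform (\<lambda>k. v $ k) bvec"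
    using qform_derivative_le[of "\<lambda>k. v $ k" bvec] by (simp only: uminus_complex.sel)
  moreover have "2 * g * qform (\<lambda>k. v $ k) bvec > 0" using g qform_bvec_pos[OF v] by simp
  ultimately show "0 < Re (\<Sum>i\<in>UNIV. cnj (v $ i) * (CZ_mat \<Omega> \<kappa> U V *v v) $ i)" by linarith
qed

lemma sform_sum_left: "sform (sum f A) w = (\<Sum>a\<in>A. sform (f a) w)"
  and sform_sum_right: "sform w (sum f A) = (\<Sum>a\<in>A. sform w (f a))"
  by (induction A rule: infinite_finite_induct)
    (simp_all add: sform_simps bilinear_lzero[OF sform_bilinear] bilinear_rzero[OF sform_bilinear])

text \<open>On an eigenvector the derivative of S along the flow equals 2 Re \<mu> times the value
  of S. The gap bounds it by -2 g times that value, which is positive, so even Re \<mu> <=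
  -g.\<close>

lemma Z_stable: "stable_mat (Z_mat \<Omega> \<kappa> U V)"
  unfolding stable_mat_def eigenvalue_def
proof (intro allI impI, elim exE conjE)
  fix \<mu> and w :: "complex^('d + 'd)" assume w: "w \<noteq> 0" and ev: "Z_mat \<Omega> \<kappa> U V *v w = \<mu> *s w"
  let ?Z = "Z_mat \<Omega> \<kappa> U V"
  define M where "M k l = sform (bvec k) (bvec l)" for k l :: "'d + 'd"
  define h where "h = (\<Sum>k\<in>UNIV. \<Sum>l\<in>UNIV. cnj (w $ k) * w $ l * M k l)"
  have Zr: "complex_of_real (Re (?Z $ m $ k)) = ?Z $ m $ k" for m k by (rule complexification_real[symmetric])
  have cZ: "cnj (?Z $ m $ k) = ?Z $ m $ k" for m k using Zr[of m k] by (metis complex_cnj_complex_of_real)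
  have ev': "(\<Sum>l\<in>UNIV. ?Z $ m $ l * w $ l) = \<mu> * w $ m" for m
    using arg_cong[OF ev, of "\<lambda>x. x $ m"] by (simp add: matrix_vector_mult_def)
  have r: "sform (bvec k) (Z (bvec l)) = (\<Sum>m\<in>UNIV. ?Z $ m $ l * M k m)" for k l
    unfolding drift_bvec sform_sum_right by (simp add: sform_simps M_def Zr scaleR_conv_of_real[where 'a = complex])
  have l: "sform (Z (bvec k)) (bvec l) = (\<Sum>m\<in>UNIV. ?Z $ m $ k * M m l)" for k l
    unfolding drift_bvec sform_sum_left by (simp add: sform_simps M_def Zr scaleR_conv_of_real[where 'a = complex])
  have A: "(\<Sum>k\<in>UNIV. \<Sum>l\<in>UNIV. cnj (w $ k) * w $ l * sform (bvec k) (Z (bvec l))) = \<mu> * h"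
  proof -
    have "(\<Sum>l\<in>UNIV. cnj (w $ k) * w $ l * sform (bvec k) (Z (bvec l))) = (\<Sum>m\<in>UNIV. cnj (w $ k) * (\<mu> * w $ m) * M k m)" for k
    proof -
      have "(\<Sum>l\<in>UNIV. cnj (w $ k) * w $ l * sform (bvec k) (Z (bvec l))) = (\<Sum>l\<in>UNIV. \<Sum>m\<in>UNIV. cnj (w $ k) * (?Z $ m $ l * w $ l) * M k m)"
        unfolding r by (simp add: sum_distrib_left mult_ac)
      also have "\<dots> = (\<Sum>m\<in>UNIV. \<Sum>l\<in>UNIV. cnj (w $ k) * (?Z $ m $ l * w $ l) * M k m)" by (rule sum.swap)
      finally show ?thesis unfolding ev'[symmetric] by (simp add: sum_distrib_left sum_distrib_right)
    qed
    then show ?thesis by (simp add: h_def sum_distrib_left mult_ac)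
  qed
  \<comment> \<open>Z has real entries, so conjugating the eigenvalue equation brings out the
    conjugate of \<mu> on the left argument.\<close>
  have B: "(\<Sum>k\<in>UNIV. \<Sum>l\<in>UNIV. cnj (w $ k) * w $ l * sform (Z (bvec k)) (bvec l)) = cnj \<mu> * h"
  proof -
    have ev'': "(\<Sum>k\<in>UNIV. ?Z $ m $ k * cnj (w $ k)) = cnj \<mu> * cnj (w $ m)" for m
      using arg_cong[OF ev'[of m], of cnj] by (simp add: cZ)
    have "(\<Sum>k\<in>UNIV. cnj (w $ k) * w $ l * sform (Z (bvec k)) (bvec l)) = (\<Sum>m\<in>UNIV. (cnj \<mu> * cnj (w $ m)) * w $ l * M m l)" for l
    proof -
      have "(\<Sum>k\<in>UNIV. cnj (w $ k) * w $ l * sform (Z (bvec k)) (bvec l)) = (\<Sum>k\<in>UNIV. \<Sum>m\<in>UNIV. (?Z $ m $ k * cnj (w $ k)) * w $ l * M m l)"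
        unfolding l by (simp add: sum_distrib_left mult_ac)
      also have "\<dots> = (\<Sum>m\<in>UNIV. \<Sum>k\<in>UNIV. (?Z $ m $ k * cnj (w $ k)) * w $ l * M m l)" by (rule sum.swap)
      finally show ?thesis unfolding ev''[symmetric] by (simp add: sum_distrib_left sum_distrib_right)
    qed
    then have "(\<Sum>l\<in>UNIV. \<Sum>k\<in>UNIV. cnj (w $ k) * w $ l * sform (Z (bvec k)) (bvec l)) = (\<Sum>l\<in>UNIV. \<Sum>m\<in>UNIV. (cnj \<mu> * cnj (w $ m)) * w $ l * M m l)"
      by simp
    also have "\<dots> = (\<Sum>m\<in>UNIV. \<Sum>l\<in>UNIV. (cnj \<mu> * cnj (w $ m)) * w $ l * M m l)" by (rule sum.swap)
    also have "\<dots> = cnj \<mu> * h" by (simp add: h_def sum_distrib_left mult.assoc)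
    finally show ?thesis by (subst sum.swap)
  qed
  have "(\<Sum>i\<in>UNIV. \<Sum>j\<in>UNIV. cnj (w $ i) * w $ j * dsform (bvec i) (bvec j)) = cnj \<mu> * h + \<mu> * h"
    unfolding dsform_def A[symmetric] B[symmetric] sum.distrib[symmetric] by (simp add: distrib_left)
  moreover have h: "Re h = qform (\<lambda>k. w $ k) bvec" by (simp add: h_def M_def qform_def)
  ultimately have "2 * Re \<mu> * Re h \<le> - 2 * g * Re h"
    using qform_derivative_le[of "\<lambda>k. w $ k" bvec] by simp
  moreover have "Re h > 0" unfolding h by (rule qform_bvec_pos[OF w])
  ultimately have "2 * Re \<mu> \<le> - 2 * g" by (rule mult_right_le_imp_le)
  then show "Re \<mu> < 0" using g by simp
qed

end

theorem theorem19:
  fixes \<Omega> \<kappa> :: "complex^'d^'d"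
    and U V :: "complex^'d^'m"
    and T :: "real \<Rightarrow> 'd::finite op \<Rightarrow> 'd op"
    and \<rho> :: "'d op"
    and S :: "real \<Rightarrow> 'd op \<Rightarrow> 'd op"
  assumes "CARD('m) \<le> 2 * CARD('d)"
    and "adj_mat \<Omega> = \<Omega>"
    and "transpose \<kappa> = \<kappa>"
    and "{w. adj_mat V *v w = 0} \<inter> {w. transpose U *v w = 0} = {0}"
    and "gaussian_qms \<Omega> \<kappa> U V 0 T"
    and "invariant_state T \<rho>"
    and "faithful \<rho>"
    and "gns_semigroup T \<rho> S"
    and "has_spectral_gap \<rho> S"
  shows "stable_mat (Z_mat \<Omega> \<kappa> U V) \<and> positive_definite (CZ_mat \<Omega> \<kappa> U V)"
proof -
  obtain g where g: "g > 0" "gap_inequality \<rho> S g"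
    using assms(9) by (auto simp: has_spectral_gap_def)
  have "state \<rho>" using assms(6) by (simp add: invariant_state_def)
  then interpret gaussian_gap \<Omega> \<kappa> U V T \<rho> S g
    using assms g by unfold_locales
  show ?thesis using Z_stable CZ_positive_definite by blast
qed

end
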